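(* Let $(\Sigma,D,T)$ be an affine surface equipped with a parallel (nonzero) nilpotent $(1,1)$-tensor field $T$. Then: (i) $(T^*\Sigma,g_{D,\Phi,T})$ is never self-dual, for any deformation tensor field $\Phi$ (a symmetric $(0,2)$-tensor field on $\Sigma$). (ii) If $(T^*\Sigma,g_{D,\Phi,T})$ is anti-self-dual, then $D$ is either a flat connection or $(\Sigma,D)$ is recurrent with symmetric Ricci tensor of rank one. In the latter case there exist local coordinates $(u^1,u^2)$ where the only non-zero Christoffel symbol is ${}^u\Gamma_{11}{}^2$ and the tensor field $T$ is given by $T\partial_{u^1}=\partial_{u^2}$, $T\partial_{u^2}=0$. Moreover, $(T^*\Sigma,g_{D,\Phi,T})$ is anti-self-dual if and only if the symmetric $(0,2)$-tensor field $\Phi$ satisfies the equations (where $\partial_1=\partial_{u^1}$) $$\widehat{D\Phi}=-2\,\widehat{\omega}\otimes\rho^D,$$ $$0=\tfrac12\,\widehat\Phi\otimes\widehat\Phi(\partial_1,\partial_1,\partial_1,\partial_1)+2(\widehat\Phi\otimes\rho^D)(\partial_1,\partial_1,\partial_1,\partial_1)+D^2\Phi(\partial_1,\partial_1;T\partial_1,T\partial_1)+D^2\Phi(T\partial_1,T\partial_1;\partial_1,\partial_1)-2\,D^2\Phi(\partial_1,T\partial_1;T\partial_1,\partial_1),$$ where $\widehat{D\Phi}(X,Y,Z)=D\Phi(TX,TY;TZ)$, $\omega$ is the recurrence one-form given by $D\rho^D=\omega\otimes\rho^D$, and $\widehat\omega(X)=\omega(TX)$.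
   Context: An affine surface $(\Sigma,D)$ is a smooth surface $\Sigma$ with a torsion free affine connection $D$, with Christoffel symbols ${}^D\Gamma_{ij}{}^k$ (written ${}^u\Gamma_{ij}{}^k$ in coordinates $(u^1,u^2)$). Its Ricci tensor is $\rho^D(X,Y)=\operatorname{tr}\{Z\mapsto R^D(Z,X)Y\}$ with $R^D(X,Y)=[D_X,D_Y]-D_{[X,Y]}$. Here $(\Sigma,D)$ is recurrent if $D\rho^D=\omega\otimes\rho^D$ for some one-form $\omega$. $T$ parallel means $DT=0$; nilpotent means $T^2=0$. Notation: $\widehat\Phi(X,Y)=\Phi(TX,TY)$; $D\Phi(X,Y;Z)=(D_Z\Phi)(X,Y)$; $D^2\Phi(X,Y;Z,W)=(D_W(D\Phi))(X,Y;Z)$. Let $\pi\colon T^*\Sigma\to\Sigma$ be the cotangent bundle. Local coordinates $(x^i)$ on $\Sigma$ induce coordinates $(x^i,x_{i'})$ on $T^*\Sigma$ by writing a covector as $\sum x_{i'}dx^i$. For a vector field $X$ on $\Sigma$, $\iota X(p,\alpha)=\alpha(X_p)$, and the complete lift $X^C$ is determined by $X^C(\iota Z)=\iota[X,Z]$ for all $Z$; $\iota T$ is the one-form with $\iota T(X^C)=\iota(TX)$; $g_D$ is the metric with $g_D(X^C,Y^C)=-\iota(D_XY+D_YX)$. Then $g_{D,\Phi,T}=\iota T\circ\iota T+g_D+\pi^*\Phi$, where $\omega_1\circ\omega_2=\frac12(\omega_1\otimes\omega_2+\omega_2\otimes\omega_1)$; it has neutral signature. In induced coordinates, with $T\partial_i=T_i^k\partial_k$,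 $$g_{D,\Phi,T}=2\,dx^i\circ dx_{i'}+\{\tfrac12x_{r'}x_{s'}(T_i^rT_j^s+T_j^rT_i^s)-2x_{k'}{}^D\Gamma_{ij}{}^k+\Phi_{ij}\}\,dx^i\circ dx^j .$$ $T^*\Sigma$ carries the orientation for which, for any basis $u,v$ of the null distribution $\ker\pi_*$, the bivector $u\wedge v$ is self-dual. A metric is self-dual if the anti-self-dual Weyl curvature operator $W^-$ vanishes, and anti-self-dual if the self-dual Weyl curvature operator $W^+$ vanishes.
   Formalization: In (ii), "recurrent with symmetric Ricci tensor of rank one" is asserted on the open set where the curvature of D is nonzero, since it fails globally (e.g. only Γ₁₁²=u¹u², Φ=0); "nonzero" means T is not identically zero on any connected component. *)

theory Defs
  imports "HOL-Analysis.Analysis"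
begin

section \<open>Smooth functions on open sets\<close>

definition pd :: "'n::finite \<Rightarrow> (real^'n \<Rightarrow> real) \<Rightarrow> real^'n \<Rightarrow> real" where
  "pd i f x = frechet_derivative f (at x) (axis i 1)"

text \<open>Only meaningful for open \<open>S\<close>.\<close>
primrec Ck_on :: "nat \<Rightarrow> (real^'n::finite \<Rightarrow> real) \<Rightarrow> (real^'n) set \<Rightarrow> bool" where
  "Ck_on 0 f S \<longleftrightarrow> continuous_on S f"
| "Ck_on (Suc k) f S \<longleftrightarrow> f differentiable_on S \<and> (\<forall>i. Ck_on k (pd i f) S)"

definition smooth_fun_on :: "(real^'n::finite) set \<Rightarrow> (real^'n \<Rightarrow> real) \<Rightarrow> bool" where
  "smooth_fun_on S f \<longleftrightarrow> (\<forall>k. Ck_on k f S)"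

definition smooth_map_on :: "(real^'n::finite) set \<Rightarrow> (real^'n \<Rightarrow> real^'m::finite) \<Rightarrow> bool" where
  "smooth_map_on S f \<longleftrightarrow> (\<forall>a. smooth_fun_on S (\<lambda>x. f x $ a))"


lemma vector_4 [simp]:
  "(vector [a, b, c, d] :: 'a::zero^4) $ 1 = a"
  "(vector [a, b, c, d] :: 'a::zero^4) $ 2 = b"
  "(vector [a, b, c, d] :: 'a::zero^4) $ 3 = c"
  "(vector [a, b, c, d] :: 'a::zero^4) $ 4 = d"
  by (simp_all add: vector_def)


section \<open>Smooth surfaces\<close>

text \<open>A chart \<open>(U, u)\<close> consists of its domain and its coordinate map; the values of the
  coordinate map off the domain are irrelevant.\<close>

type_synonym 'a chart = "'a set \<times> ('a \<Rightarrow> real^2)"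

definition chart_image :: "'a chart \<Rightarrow> (real^2) set" where
  "chart_image c = snd c ` fst c"

definition overlap :: "'a chart \<Rightarrow> 'a chart \<Rightarrow> (real^2) set" where
  "overlap c d = snd c ` (fst c \<inter> fst d)"

definition transition :: "'a chart \<Rightarrow> 'a chart \<Rightarrow> real^2 \<Rightarrow> real^2" where
  "transition c d x = snd d (inv_into (fst c) (snd c) x)"

definition chart_of :: "'a topology \<Rightarrow> 'a chart \<Rightarrow> bool" where
  "chart_of X c \<longleftrightarrow> openin X (fst c) \<and> open (chart_image c) \<and>
     homeomorphic_map (subtopology X (fst c)) (top_of_set (chart_image c)) (snd c)"

definition compatible :: "'a chart \<Rightarrow> 'a chart \<Rightarrow> bool" where
  "compatible c d \<longleftrightarrow> smooth_map_on (overlap c d) (transition c d) \<and>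
     smooth_map_on (overlap d c) (transition d c)"

text \<open>The atlas is required to be maximal, so that its members are exactly the local coordinate
  systems of the surface.\<close>

definition smooth_surface :: "'a topology \<Rightarrow> 'a chart set \<Rightarrow> bool" where
  "smooth_surface X A \<longleftrightarrow> Hausdorff_space X \<and> second_countable X \<and>
     (\<forall>c\<in>A. chart_of X c) \<and> (\<Union>c\<in>A. fst c) = topspace X \<and>
     (\<forall>c\<in>A. \<forall>d\<in>A. compatible c d) \<and>
     (\<forall>c. chart_of X c \<longrightarrow> (\<forall>d\<in>A. compatible c d) \<longrightarrow> c \<in> A)"

text \<open>The maximal atlas of the open submanifold \<open>S\<close>.\<close>

definition atlas_on :: "'a chart set \<Rightarrow> 'a set \<Rightarrow> 'a chart set" where
  "atlas_on A S = {c\<in>A. fst c \<subseteq> S}"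

definition jacobian :: "'a chart \<Rightarrow> 'a chart \<Rightarrow> real^2 \<Rightarrow> 2 \<Rightarrow> 2 \<Rightarrow> real" where
  "jacobian c d x a i = pd i (\<lambda>y. transition c d y $ a) x"


section \<open>Tensor fields and connections\<close>

text \<open>A tensor field is given by its components in every chart of the maximal atlas, as functions
  on the image of the chart, subject to the transformation law. The component conventions are
  \<^item> \<open>\<omega> c x i = \<omega>(\<partial>\<^sub>i)\<close> and \<open>\<Phi> c x i j = \<Phi>(\<partial>\<^sub>i, \<partial>\<^sub>j)\<close>;
  \<^item> \<open>T c x i k\<close> is the \<open>\<partial>\<^sub>k\<close>-component of \<open>T \<partial>\<^sub>i\<close>;
  \<^item> \<open>\<Gamma> c x i j k\<close> is the \<open>\<partial>\<^sub>k\<close>-component of \<open>D\<close> applied to \<open>\<partial>\<^sub>j\<close> in the direction \<open>\<partial>\<^sub>i\<close>.\<close>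

type_synonym 'n form_comp = "real^'n \<Rightarrow> 'n \<Rightarrow> real"
type_synonym 'n tensor2_comp = "real^'n \<Rightarrow> 'n \<Rightarrow> 'n \<Rightarrow> real"
type_synonym 'n tensor3_comp = "real^'n \<Rightarrow> 'n \<Rightarrow> 'n \<Rightarrow> 'n \<Rightarrow> real"
type_synonym 'n tensor4_comp = "real^'n \<Rightarrow> 'n \<Rightarrow> 'n \<Rightarrow> 'n \<Rightarrow> 'n \<Rightarrow> real"

definition one_form :: "'a chart set \<Rightarrow> ('a chart \<Rightarrow> 2 form_comp) \<Rightarrow> bool" where
  "one_form A \<omega> \<longleftrightarrow>
     (\<forall>c\<in>A. \<forall>i. smooth_fun_on (chart_image c) (\<lambda>x. \<omega> c x i)) \<and>
     (\<forall>c\<in>A. \<forall>d\<in>A. \<forall>x\<in>overlap c d. \<forall>i.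
        \<omega> c x i = (\<Sum>a\<in>UNIV. jacobian c d x a i * \<omega> d (transition c d x) a))"

definition symmetric_02_tensor :: "'a chart set \<Rightarrow> ('a chart \<Rightarrow> 2 tensor2_comp) \<Rightarrow> bool" where
  "symmetric_02_tensor A \<Phi> \<longleftrightarrow>
     (\<forall>c\<in>A. \<forall>i j. smooth_fun_on (chart_image c) (\<lambda>x. \<Phi> c x i j)) \<and>
     (\<forall>c\<in>A. \<forall>d\<in>A. \<forall>x\<in>overlap c d. \<forall>i j.
        \<Phi> c x i j = (\<Sum>a\<in>UNIV. \<Sum>b\<in>UNIV.
          jacobian c d x a i * jacobian c d x b j * \<Phi> d (transition c d x) a b)) \<and>
     (\<forall>c\<in>A. \<forall>x\<in>chart_image c. \<forall>i j. \<Phi> c x i j = \<Phi> c x j i)"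

definition tensor_11 :: "'a chart set \<Rightarrow> ('a chart \<Rightarrow> 2 tensor2_comp) \<Rightarrow> bool" where
  "tensor_11 A T \<longleftrightarrow>
     (\<forall>c\<in>A. \<forall>i k. smooth_fun_on (chart_image c) (\<lambda>x. T c x i k)) \<and>
     (\<forall>c\<in>A. \<forall>d\<in>A. \<forall>x\<in>overlap c d. \<forall>i a.
        (\<Sum>k\<in>UNIV. T c x i k * jacobian c d x a k) =
        (\<Sum>b\<in>UNIV. jacobian c d x b i * T d (transition c d x) b a))"

definition affine_connection :: "'a chart set \<Rightarrow> ('a chart \<Rightarrow> 2 tensor3_comp) \<Rightarrow> bool" where
  "affine_connection A \<Gamma> \<longleftrightarrow>
     (\<forall>c\<in>A. \<forall>i j k. smooth_fun_on (chart_image c) (\<lambda>x. \<Gamma> c x i j k)) \<and>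
     (\<forall>c\<in>A. \<forall>d\<in>A. \<forall>x\<in>overlap c d. \<forall>i j a.
        (\<Sum>k\<in>UNIV. \<Gamma> c x i j k * jacobian c d x a k) =
        pd i (\<lambda>y. jacobian c d y a j) x +
        (\<Sum>b\<in>UNIV. \<Sum>e\<in>UNIV.
          jacobian c d x b i * jacobian c d x e j * \<Gamma> d (transition c d x) b e a))"

definition torsion_free :: "'a chart set \<Rightarrow> ('a chart \<Rightarrow> 2 tensor3_comp) \<Rightarrow> bool" where
  "torsion_free A \<Gamma> \<longleftrightarrow> (\<forall>c\<in>A. \<forall>x\<in>chart_image c. \<forall>i j k. \<Gamma> c x i j k = \<Gamma> c x j i k)"

definition affine_surface ::
    "'a topology \<Rightarrow> 'a chart set \<Rightarrow> ('a chart \<Rightarrow> 2 tensor3_comp) \<Rightarrow> bool" where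
  "affine_surface X A \<Gamma> \<longleftrightarrow> smooth_surface X A \<and> affine_connection A \<Gamma> \<and> torsion_free A \<Gamma>"


section \<open>Curvature and covariant derivatives in coordinates\<close>

text \<open>\<open>riemann \<Gamma> x i j k l\<close> is the \<open>\<partial>\<^sub>l\<close>-component of \<open>R(\<partial>\<^sub>i, \<partial>\<^sub>j)\<partial>\<^sub>k\<close>, where
  \<open>R(X,Y) = [D\<^sub>X, D\<^sub>Y] - D\<^bsub>[X,Y]\<^esub>\<close>.\<close>

definition riemann :: "('n::finite) tensor3_comp \<Rightarrow> 'n tensor4_comp" where
  "riemann \<Gamma> x i j k l =
     pd i (\<lambda>y. \<Gamma> y j k l) x - pd j (\<lambda>y. \<Gamma> y i k l) x
     + (\<Sum>m\<in>UNIV. \<Gamma> x j k m * \<Gamma> x i m l) - (\<Sum>m\<in>UNIV. \<Gamma> x i k m * \<Gamma> x j m l)"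

text \<open>\<open>\<rho>(X,Y) = tr {Z \<mapsto> R(Z,X)Y}\<close>.\<close>

definition ricci :: "('n::finite) tensor3_comp \<Rightarrow> 'n tensor2_comp" where
  "ricci \<Gamma> x j k = (\<Sum>i\<in>UNIV. riemann \<Gamma> x i j k i)"

text \<open>The differentiation index of a covariant derivative comes last:
  \<open>cov_deriv_02 \<Gamma> \<Phi> x i j k = D\<Phi>(\<partial>\<^sub>i, \<partial>\<^sub>j; \<partial>\<^sub>k)\<close>.\<close>

definition cov_deriv_02 :: "('n::finite) tensor3_comp \<Rightarrow> 'n tensor2_comp \<Rightarrow> 'n tensor3_comp" where
  "cov_deriv_02 \<Gamma> \<Phi> x i j k = pd k (\<lambda>y. \<Phi> y i j) x
     - (\<Sum>m\<in>UNIV. \<Gamma> x k i m * \<Phi> x m j) - (\<Sum>m\<in>UNIV. \<Gamma> x k j m * \<Phi> x i m)"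

definition cov_deriv_03 :: "('n::finite) tensor3_comp \<Rightarrow> 'n tensor3_comp \<Rightarrow> 'n tensor4_comp" where
  "cov_deriv_03 \<Gamma> \<Psi> x i j k l = pd l (\<lambda>y. \<Psi> y i j k) x
     - (\<Sum>m\<in>UNIV. \<Gamma> x l i m * \<Psi> x m j k) - (\<Sum>m\<in>UNIV. \<Gamma> x l j m * \<Psi> x i m k)
     - (\<Sum>m\<in>UNIV. \<Gamma> x l k m * \<Psi> x i j m)"

definition cov_deriv2_02 :: "('n::finite) tensor3_comp \<Rightarrow> 'n tensor2_comp \<Rightarrow> 'n tensor4_comp" where
  "cov_deriv2_02 \<Gamma> \<Phi> = cov_deriv_03 \<Gamma> (cov_deriv_02 \<Gamma> \<Phi>)"

text \<open>\<open>cov_deriv_11 \<Gamma> T x i k j\<close> is the \<open>\<partial>\<^sub>k\<close>-component of \<open>(D\<^sub>Z T)\<partial>\<^sub>i\<close> for \<open>Z = \<partial>\<^sub>j\<close>.\<close>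

definition cov_deriv_11 :: "('n::finite) tensor3_comp \<Rightarrow> 'n tensor2_comp \<Rightarrow> 'n tensor3_comp" where
  "cov_deriv_11 \<Gamma> T x i k j = pd j (\<lambda>y. T y i k) x
     + (\<Sum>m\<in>UNIV. \<Gamma> x j m k * T x i m) - (\<Sum>m\<in>UNIV. \<Gamma> x j i m * T x m k)"

definition parallel_11 ::
    "'a chart set \<Rightarrow> ('a chart \<Rightarrow> 2 tensor3_comp) \<Rightarrow> ('a chart \<Rightarrow> 2 tensor2_comp) \<Rightarrow> bool" where
  "parallel_11 A \<Gamma> T \<longleftrightarrow>
     (\<forall>c\<in>A. \<forall>x\<in>chart_image c. \<forall>i k j. cov_deriv_11 (\<Gamma> c) (T c) x i k j = 0)"

definition nilpotent_11 :: "'a chart set \<Rightarrow> ('a chart \<Rightarrow> 2 tensor2_comp) \<Rightarrow> bool" where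
  "nilpotent_11 A T \<longleftrightarrow>
     (\<forall>c\<in>A. \<forall>x\<in>chart_image c. \<forall>i l. (\<Sum>k\<in>UNIV. T c x i k * T c x k l) = 0)"

text \<open>Nonzero on every connected component: for connected \<open>X\<close> this says that \<open>T\<close> is not the zero
  tensor field.\<close>

definition nonzero_11 ::
    "'a topology \<Rightarrow> 'a chart set \<Rightarrow> ('a chart \<Rightarrow> 2 tensor2_comp) \<Rightarrow> bool" where
  "nonzero_11 X A T \<longleftrightarrow> (\<forall>C\<in>connected_components_of X.
     \<exists>c\<in>A. \<exists>p\<in>fst c \<inter> C. \<exists>i k. T c (snd c p) i k \<noteq> 0)"

definition flat :: "'a chart set \<Rightarrow> ('a chart \<Rightarrow> 2 tensor3_comp) \<Rightarrow> bool" where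
  "flat A \<Gamma> \<longleftrightarrow> (\<forall>c\<in>A. \<forall>x\<in>chart_image c. \<forall>i j k l. riemann (\<Gamma> c) x i j k l = 0)"

text \<open>The curvature may vanish at some points only, e.g. if the only non-zero Christoffel symbol is
  the one with indices \<open>1 1 2\<close>, equal to \<open>u\<^sup>1 u\<^sup>2\<close>; a rank one Ricci tensor can then be expected only
  on the following open set.\<close>

definition nonflat_locus :: "'a chart set \<Rightarrow> ('a chart \<Rightarrow> 2 tensor3_comp) \<Rightarrow> 'a set" where
  "nonflat_locus A \<Gamma> =
     {p. \<exists>c\<in>A. p \<in> fst c \<and> (\<exists>i j k l. riemann (\<Gamma> c) (snd c p) i j k l \<noteq> 0)}"

text \<open>\<open>D\<rho> = \<omega> \<otimes> \<rho>\<close>, that is \<open>D\<rho>(X,Y;Z) = \<omega>(Z) \<rho>(X,Y)\<close>.\<close>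

definition recurrence_form ::
    "'a chart set \<Rightarrow> ('a chart \<Rightarrow> 2 tensor3_comp) \<Rightarrow> ('a chart \<Rightarrow> 2 form_comp) \<Rightarrow> bool" where
  "recurrence_form A \<Gamma> \<omega> \<longleftrightarrow> one_form A \<omega> \<and>
     (\<forall>c\<in>A. \<forall>x\<in>chart_image c. \<forall>i j k.
        cov_deriv_02 (\<Gamma> c) (ricci (\<Gamma> c)) x i j k = \<omega> c x k * ricci (\<Gamma> c) x i j)"

definition recurrent :: "'a chart set \<Rightarrow> ('a chart \<Rightarrow> 2 tensor3_comp) \<Rightarrow> bool" where
  "recurrent A \<Gamma> \<longleftrightarrow> (\<exists>\<omega>. recurrence_form A \<Gamma> \<omega>)"

definition symmetric_ricci :: "'a chart set \<Rightarrow> ('a chart \<Rightarrow> 2 tensor3_comp) \<Rightarrow> bool" where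
  "symmetric_ricci A \<Gamma> \<longleftrightarrow>
     (\<forall>c\<in>A. \<forall>x\<in>chart_image c. \<forall>i j. ricci (\<Gamma> c) x i j = ricci (\<Gamma> c) x j i)"

definition rank_one_ricci :: "'a chart set \<Rightarrow> ('a chart \<Rightarrow> 2 tensor3_comp) \<Rightarrow> bool" where
  "rank_one_ricci A \<Gamma> \<longleftrightarrow>
     (\<forall>c\<in>A. \<forall>x\<in>chart_image c. rank (\<chi> i j. ricci (\<Gamma> c) x i j) = 1)"


section \<open>Self-duality of four-dimensional metrics\<close>

type_synonym metric4 = "real^4 \<Rightarrow> real^4^4"

definition levi_civita :: "metric4 \<Rightarrow> 4 tensor3_comp" where
  "levi_civita g x i j k = (1/2) * (\<Sum>l\<in>UNIV. matrix_inv (g x) $ k $ l *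
     (pd i (\<lambda>y. g y $ j $ l) x + pd j (\<lambda>y. g y $ i $ l) x - pd l (\<lambda>y. g y $ i $ j) x))"

text \<open>\<open>R(X,Y,Z,V) = g(R(X,Y)Z, V)\<close>.\<close>

definition riemann_low :: "metric4 \<Rightarrow> 4 tensor4_comp" where
  "riemann_low g x i j k l = (\<Sum>m\<in>UNIV. riemann (levi_civita g) x i j k m * g x $ m $ l)"

definition scalar_curv :: "metric4 \<Rightarrow> real^4 \<Rightarrow> real" where
  "scalar_curv g x =
     (\<Sum>j\<in>UNIV. \<Sum>k\<in>UNIV. matrix_inv (g x) $ j $ k * ricci (levi_civita g) x j k)"

definition weyl :: "metric4 \<Rightarrow> 4 tensor4_comp" where
  "weyl g x i j k l = riemann_low g x i j k l
     - (1/2) * (ricci (levi_civita g) x j k * g x $ i $ l + ricci (levi_civita g) x i l * g x $ j $ k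
              - ricci (levi_civita g) x i k * g x $ j $ l - ricci (levi_civita g) x j l * g x $ i $ k)
     + scalar_curv g x / 6 * (g x $ j $ k * g x $ i $ l - g x $ i $ k * g x $ j $ l)"

text \<open>Bivectors are antisymmetric matrices of contravariant components.\<close>

definition bivector :: "real^4^4 \<Rightarrow> bool" where
  "bivector B \<longleftrightarrow> (\<forall>i j. B $ i $ j = - B $ j $ i)"

definition wedge :: "real^4 \<Rightarrow> real^4 \<Rightarrow> real^4^4" where
  "wedge u v = (\<chi> i j. u $ i * v $ j - u $ j * v $ i)"

definition raise2 :: "metric4 \<Rightarrow> real^4 \<Rightarrow> (4 \<Rightarrow> 4 \<Rightarrow> real) \<Rightarrow> real^4^4" where
  "raise2 g x L =
     (\<chi> i j. \<Sum>a\<in>UNIV. \<Sum>b\<in>UNIV. matrix_inv (g x) $ i $ a * matrix_inv (g x) $ j $ b * L a b)"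

text \<open>The Levi-Civita symbol, normalised by \<open>lc_symbol 1 2 3 4 = 1\<close>.\<close>

definition lc_symbol :: "4 \<Rightarrow> 4 \<Rightarrow> 4 \<Rightarrow> 4 \<Rightarrow> real" where
  "lc_symbol i j k l = det (vector [axis i 1, axis j 1, axis k 1, axis l 1] :: real^4^4)"

text \<open>The Hodge operator on bivectors for the volume form
  \<open>s \<bar>det g\<bar>\<^sup>1\<^sup>/\<^sup>2 dz\<^sup>1 \<and> dz\<^sup>2 \<and> dz\<^sup>3 \<and> dz\<^sup>4\<close>; the sign \<open>s\<close> encodes the orientation.\<close>

definition hodge :: "real \<Rightarrow> metric4 \<Rightarrow> real^4 \<Rightarrow> real^4^4 \<Rightarrow> real^4^4" where
  "hodge s g x B = raise2 g x (\<lambda>a b. (1/2) * (\<Sum>k\<in>UNIV. \<Sum>l\<in>UNIV.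
     s * sqrt \<bar>det (g x)\<bar> * lc_symbol a b k l * B $ k $ l))"

text \<open>The index order \<open>l k\<close> makes the corresponding operator of the full curvature tensor
  positive on round spheres.\<close>

definition weyl_operator :: "metric4 \<Rightarrow> real^4 \<Rightarrow> real^4^4 \<Rightarrow> real^4^4" where
  "weyl_operator g x B = raise2 g x (\<lambda>a b. (1/2) * (\<Sum>k\<in>UNIV. \<Sum>l\<in>UNIV.
     weyl g x a b l k * B $ k $ l))"

text \<open>\<open>W\<^sup>+\<close> and \<open>W\<^sup>-\<close> are the restrictions of the Weyl operator to the eigenspaces of the Hodge
  operator.\<close>

definition W_plus_vanishes :: "real \<Rightarrow> metric4 \<Rightarrow> real^4 \<Rightarrow> bool" where
  "W_plus_vanishes s g x \<longleftrightarrow>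
     (\<forall>B. bivector B \<longrightarrow> hodge s g x B = B \<longrightarrow> weyl_operator g x B = 0)"

definition W_minus_vanishes :: "real \<Rightarrow> metric4 \<Rightarrow> real^4 \<Rightarrow> bool" where
  "W_minus_vanishes s g x \<longleftrightarrow>
     (\<forall>B. bivector B \<longrightarrow> hodge s g x B = - B \<longrightarrow> weyl_operator g x B = 0)"


section \<open>The cotangent bundle and deformed Riemannian extensions\<close>

text \<open>A chart with coordinates \<open>(x\<^sup>1, x\<^sup>2)\<close> induces on the cotangent bundle the coordinates
  \<open>z = (x\<^sup>1, x\<^sup>2, x\<^bsub>1'\<^esub>, x\<^bsub>2'\<^esub>)\<close>, ranging over all \<open>z\<close> with \<open>base z\<close> in the image of the chart. Fields on
  the cotangent bundle are given by their components in the induced coordinates.\<close>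

definition base :: "real^4 \<Rightarrow> real^2" where
  "base z = vector [z $ 1, z $ 2]"

definition fibre :: "real^4 \<Rightarrow> real^2" where
  "fibre z = vector [z $ 3, z $ 4]"

definition apply_11 :: "2 tensor2_comp \<Rightarrow> real^2 \<Rightarrow> real^2 \<Rightarrow> real^2" where
  "apply_11 T x v = (\<chi> k. \<Sum>i\<in>UNIV. v $ i * T x i k)"

definition iota :: "(real^2 \<Rightarrow> real^2) \<Rightarrow> real^4 \<Rightarrow> real" where
  "iota X z = (\<Sum>k\<in>UNIV. fibre z $ k * X (base z) $ k)"

definition iota_11 :: "2 tensor2_comp \<Rightarrow> real^4 \<Rightarrow> real^4" where
  "iota_11 T z = vector [(\<Sum>k\<in>UNIV. fibre z $ k * T (base z) 1 k),
                         (\<Sum>k\<in>UNIV. fibre z $ k * T (base z) 2 k), 0, 0]"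

definition sym_prod :: "real^4 \<Rightarrow> real^4 \<Rightarrow> real^4^4" where
  "sym_prod a b = (\<chi> i j. (1/2) * (a $ i * b $ j + b $ i * a $ j))"

text \<open>The matrix of \<open>2 e dx\<^sup>i \<circ> dx\<^bsub>i'\<^esub> + P\<^sub>i\<^sub>j dx\<^sup>i \<circ> dx\<^sup>j\<close>.\<close>

definition block_form :: "(2 \<Rightarrow> 2 \<Rightarrow> real) \<Rightarrow> real \<Rightarrow> real^4^4" where
  "block_form P e = vector [vector [P 1 1, P 1 2, e, 0],
                            vector [P 2 1, P 2 2, 0, e],
                            vector [e, 0, 0, 0],
                            vector [0, e, 0, 0]]"

definition riemannian_extension :: "2 tensor3_comp \<Rightarrow> metric4" where
  "riemannian_extension \<Gamma> z =
     block_form (\<lambda>i j. - 2 * (\<Sum>k\<in>UNIV. fibre z $ k * \<Gamma> (base z) i j k)) 1"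

definition pullback_02 :: "2 tensor2_comp \<Rightarrow> metric4" where
  "pullback_02 \<Phi> z = block_form (\<Phi> (base z)) 0"

definition deformed_extension :: "2 tensor3_comp \<Rightarrow> 2 tensor2_comp \<Rightarrow> 2 tensor2_comp \<Rightarrow> metric4" where
  "deformed_extension \<Gamma> \<Phi> T z =
     sym_prod (iota_11 T z) (iota_11 T z) + riemannian_extension \<Gamma> z + pullback_02 \<Phi> z"

lemma deformed_extension_coordinates:
  "deformed_extension \<Gamma> \<Phi> T z = block_form (\<lambda>i j.
     (1/2) * (\<Sum>r\<in>UNIV. \<Sum>s\<in>UNIV. fibre z $ r * fibre z $ s *
        (T (base z) i r * T (base z) j s + T (base z) j r * T (base z) i s))
     - 2 * (\<Sum>k\<in>UNIV. fibre z $ k * \<Gamma> (base z) i j k) + \<Phi> (base z) i j) 1"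
  by (simp add: vec_eq_iff forall_4 deformed_extension_def riemannian_extension_def pullback_02_def
      sym_prod_def iota_11_def block_form_def sum_2 algebra_simps)

text \<open>The complete lift in induced coordinates, and the identities which characterise it,
  \<open>\<iota>T\<close> and the Riemannian extension.\<close>

definition complete_lift :: "(real^2 \<Rightarrow> real^2) \<Rightarrow> real^4 \<Rightarrow> real^4" where
  "complete_lift X z = vector [X (base z) $ 1, X (base z) $ 2,
     - (\<Sum>k\<in>UNIV. fibre z $ k * pd 1 (\<lambda>y. X y $ k) (base z)),
     - (\<Sum>k\<in>UNIV. fibre z $ k * pd 2 (\<lambda>y. X y $ k) (base z))]"

definition bracket :: "(real^2 \<Rightarrow> real^2) \<Rightarrow> (real^2 \<Rightarrow> real^2) \<Rightarrow> real^2 \<Rightarrow> real^2" where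
  "bracket X Y x = (\<chi> k. \<Sum>i\<in>UNIV. X x $ i * pd i (\<lambda>y. Y y $ k) x - Y x $ i * pd i (\<lambda>y. X y $ k) x)"

definition cov_deriv_vec ::
    "2 tensor3_comp \<Rightarrow> (real^2 \<Rightarrow> real^2) \<Rightarrow> (real^2 \<Rightarrow> real^2) \<Rightarrow> real^2 \<Rightarrow> real^2" where
  "cov_deriv_vec \<Gamma> X Y x = (\<chi> k. (\<Sum>i\<in>UNIV. X x $ i * pd i (\<lambda>y. Y y $ k) x)
     + (\<Sum>i\<in>UNIV. \<Sum>j\<in>UNIV. X x $ i * Y x $ j * \<Gamma> x i j k))"

lemma complete_lift_iota:
  assumes "Z differentiable at (base z)"
  shows "frechet_derivative (iota Z) (at z) (complete_lift X z) = iota (bracket X Z) z"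
proof -
  let ?D = "frechet_derivative Z (at (base z))"
  have Z: "(Z has_derivative ?D) (at (base z))"
    using assms frechet_derivative_works by blast
  have lin: "linear ?D"
    using Z has_derivative_linear by blast
  have pdZ: "pd i (\<lambda>y. Z y $ k) (base z) = ?D (axis i 1) $ k" for i k
  proof -
    have "((\<lambda>y. Z y $ k) has_derivative (\<lambda>h. ?D h $ k)) (at (base z))"
      using Z by (rule bounded_linear.has_derivative[OF bounded_linear_vec_nth])
    from frechet_derivative_at[OF this, symmetric] show ?thesis
      by (simp only: pd_def)
  qed
  have linb: "linear base"
    by (rule linearI) (simp_all add: base_def vec_eq_iff forall_2)
  have b: "(base has_derivative base) (at z)"
    using linb by (simp add: bounded_linear_imp_has_derivative linear_conv_bounded_linear)
  have Zb: "((\<lambda>z. Z (base z)) has_derivative (\<lambda>h. ?D (base h))) (at z)"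
    by (rule has_derivative_compose[OF b Z])
  have Zk: "((\<lambda>z. Z (base z) $ k) has_derivative (\<lambda>h. ?D (base h) $ k)) (at z)" for k
    using Zb by (rule bounded_linear.has_derivative[OF bounded_linear_vec_nth])
  have n: "((\<lambda>z. z $ i) has_derivative (\<lambda>h. h $ i)) (at z)" for i :: 4
    by (rule bounded_linear_imp_has_derivative[OF bounded_linear_vec_nth])
  have "((\<lambda>z. z $ 3 * Z (base z) $ 1 + z $ 4 * Z (base z) $ 2) has_derivative
      (\<lambda>h. (z $ 3 * ?D (base h) $ 1 + h $ 3 * Z (base z) $ 1)
         + (z $ 4 * ?D (base h) $ 2 + h $ 4 * Z (base z) $ 2))) (at z)"
    by (intro has_derivative_add has_derivative_mult n Zk)
  also have "(\<lambda>z. z $ 3 * Z (base z) $ 1 + z $ 4 * Z (base z) $ 2) = iota Z"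
    by (simp add: fun_eq_iff iota_def sum_2 fibre_def)
  finally have D: "frechet_derivative (iota Z) (at z) =
      (\<lambda>h. (z $ 3 * ?D (base h) $ 1 + h $ 3 * Z (base z) $ 1)
         + (z $ 4 * ?D (base h) $ 2 + h $ 4 * Z (base z) $ 2))"
    by (rule frechet_derivative_at[symmetric])
  have "base (complete_lift X z) = X (base z) $ 1 *\<^sub>R axis 1 1 + X (base z) $ 2 *\<^sub>R axis 2 1"
    by (simp add: vec_eq_iff forall_2 base_def complete_lift_def axis_def)
  then have "?D (base (complete_lift X z)) =
      X (base z) $ 1 *\<^sub>R ?D (axis 1 1) + X (base z) $ 2 *\<^sub>R ?D (axis 2 1)"
    by (simp add: linear_add[OF lin] linear_scale[OF lin])
  then show ?thesis
    unfolding D by (simp add: iota_def bracket_def pdZ sum_2 complete_lift_def fibre_def algebra_simps)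
qed

lemma iota_11_complete_lift:
  "iota_11 T z \<bullet> complete_lift X z = iota (\<lambda>x. apply_11 T x (X x)) z"
  by (simp add: inner_vec_def sum_4 sum_2 iota_11_def complete_lift_def iota_def apply_11_def
      algebra_simps)

lemma riemannian_extension_complete_lift:
  assumes "\<And>i j k. \<Gamma> (base z) i j k = \<Gamma> (base z) j i k"
  shows "complete_lift X z \<bullet> (riemannian_extension \<Gamma> z *v complete_lift Y z) =
    - iota (\<lambda>x. cov_deriv_vec \<Gamma> X Y x + cov_deriv_vec \<Gamma> Y X x) z"
  using assms[of 1 2 1] assms[of 1 2 2]
  by (simp add: inner_vec_def matrix_vector_mult_def sum_4 sum_2 riemannian_extension_def
      block_form_def complete_lift_def iota_def cov_deriv_vec_def fibre_def algebra_simps)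

text \<open>The sign of the orientation for which \<open>u \<and> v\<close> is self-dual for every basis \<open>u, v\<close> of the
  kernel of the differential of the projection.\<close>

definition vertical :: "(real^4) set" where
  "vertical = {v. v $ 1 = 0 \<and> v $ 2 = 0}"

definition fibre_orientation :: "metric4 \<Rightarrow> real^4 \<Rightarrow> real" where
  "fibre_orientation g z = (THE s. s \<in> {-1, 1} \<and>
     (\<forall>u\<in>vertical. \<forall>v\<in>vertical. u \<noteq> v \<longrightarrow> independent {u, v} \<longrightarrow>
        hodge s g z (wedge u v) = wedge u v))"

text \<open>The orientation is the same at all points and in all induced charts.\<close>

lemma lc_symbol_1234: "lc_symbol 1 2 3 4 = 1"
proof -
  have "(vector [axis 1 1, axis 2 1, axis 3 1, axis 4 1] :: real^4^4) = mat 1"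
    by (simp add: vec_eq_iff forall_4 mat_def axis_def)
  then show ?thesis by (simp add: lc_symbol_def)
qed

lemma lc_symbol_swap12: "lc_symbol j i k l = - lc_symbol i j k l"
proof (cases "i = j")
  case True
  have "row (1::4) (vector [axis j 1, axis j 1, axis k 1, axis l 1] :: real^4^4) =
        row (2::4) (vector [axis j 1, axis j 1, axis k 1, axis l 1])"
    by (simp add: row_def)
  then have "lc_symbol j j k l = 0"
    unfolding lc_symbol_def by (intro det_identical_rows[of "1::4" 2]) auto
  then show ?thesis using True by simp
next
  case False
  let ?M = "vector [axis i 1, axis j 1, axis k 1, axis l 1] :: real^4^4"
  have "(vector [axis j 1, axis i 1, axis k 1, axis l 1] :: real^4^4) =
      (\<chi> r. ?M $ Transposition.transpose 1 2 r)"
    by (simp add: vec_eq_iff forall_4 Transposition.transpose_def)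
  then show ?thesis
    using det_permute_rows[of "Transposition.transpose 1 2" ?M]
    by (simp add: lc_symbol_def permutes_swap_id sign_swap_id)
qed

lemma lc_symbol_swap34: "lc_symbol i j l k = - lc_symbol i j k l"
proof (cases "k = l")
  case True
  have "row (3::4) (vector [axis i 1, axis j 1, axis l 1, axis l 1] :: real^4^4) =
        row (4::4) (vector [axis i 1, axis j 1, axis l 1, axis l 1])"
    by (simp add: row_def)
  then have "lc_symbol i j l l = 0"
    unfolding lc_symbol_def by (intro det_identical_rows[of "3::4" 4]) auto
  then show ?thesis using True by simp
next
  case False
  let ?M = "vector [axis i 1, axis j 1, axis k 1, axis l 1] :: real^4^4"
  have "(vector [axis i 1, axis j 1, axis l 1, axis k 1] :: real^4^4) =
      (\<chi> r. ?M $ Transposition.transpose 3 4 r)"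
    by (simp add: vec_eq_iff forall_4 Transposition.transpose_def)
  then show ?thesis
    using det_permute_rows[of "Transposition.transpose 3 4" ?M]
    by (simp add: lc_symbol_def permutes_swap_id sign_swap_id)
qed

lemma matrix_inv_block_form:
  "matrix_inv (block_form P 1) = vector [vector [0, 0, 1, 0], vector [0, 0, 0, 1],
     vector [1, 0, - P 1 1, - P 1 2], vector [0, 1, - P 2 1, - P 2 2]]" (is "_ = ?B")
proof -
  have 1: "block_form P 1 ** ?B = mat 1"
    by (simp add: vec_eq_iff forall_4 matrix_matrix_mult_def sum_4 block_form_def mat_def)
  have 2: "?B ** block_form P 1 = mat 1"
    by (simp add: vec_eq_iff forall_4 matrix_matrix_mult_def sum_4 block_form_def mat_def)
  show ?thesis
    unfolding matrix_inv_def
  proof (rule some_equality)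
    fix C assume C: "block_form P 1 ** C = mat 1 \<and> C ** block_form P 1 = mat 1"
    have "C = C ** (block_form P 1 ** ?B)"
      unfolding 1 by (rule matrix_mul_rid[symmetric])
    also have "\<dots> = (C ** block_form P 1) ** ?B"
      by (rule matrix_mul_assoc)
    also have "\<dots> = mat 1 ** ?B"
      using C by (simp only:)
    also have "\<dots> = ?B"
      by (rule matrix_mul_lid)
    finally show "C = ?B" .
  qed (intro conjI 1 2)
qed

lemma abs_det_block_form: "\<bar>det (block_form P 1)\<bar> = 1"
proof -
  have sq: "\<bar>x\<bar> = 1" if "x * x = 1" for x :: real
    using that square_eq_1_iff[of x] by auto
  let ?S = "block_form (\<lambda>i j. 0) 1"
  let ?L = "vector [vector [1, 0, P 1 1, P 1 2], vector [0, 1, P 2 1, P 2 2],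
    vector [0, 0, 1, 0], vector [0, 0, 0, 1]] :: real^4^4"
  have "block_form P 1 = ?L ** ?S"
    by (simp add: vec_eq_iff forall_4 matrix_matrix_mult_def sum_4 block_form_def)
  then have 1: "det (block_form P 1) = det ?L * det ?S"
    by (simp add: det_mul)
  let ?E = "vector [vector [1, 0, 0, 0], vector [0, 1, 0, 0],
    vector [0, 0, -1, 0], vector [0, 0, 0, -1]] :: real^4^4"
  have "?E ** ?E = mat 1"
    by (simp add: vec_eq_iff forall_4 matrix_matrix_mult_def sum_4 mat_def)
  then have E: "det ?E * det ?E = 1"
    by (simp only: det_mul[symmetric] det_I)
  have "?L ** (?E ** (?L ** ?E)) = mat 1"
    by (simp add: vec_eq_iff forall_4 matrix_matrix_mult_def sum_4 mat_def)
  then have "det ?L * (det ?E * (det ?L * det ?E)) = 1"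
    by (simp only: det_mul[symmetric] det_I)
  moreover have "det ?L * (det ?E * (det ?L * det ?E)) = (det ?L * det ?L) * (det ?E * det ?E)"
    by (simp only: ac_simps)
  ultimately have "det ?L * det ?L = 1"
    by (simp only: E mult_1_right)
  then have 2: "\<bar>det ?L\<bar> = 1"
    by (rule sq)
  have "?S ** ?S = mat 1"
    by (simp add: vec_eq_iff forall_4 matrix_matrix_mult_def sum_4 block_form_def mat_def)
  then have "det ?S * det ?S = 1"
    by (simp only: det_mul[symmetric] det_I)
  then have "\<bar>det ?S\<bar> = 1"
    by (rule sq)
  then show ?thesis using 1 2 by (simp add: abs_mult)
qed

lemma hodge_vertical:
  assumes g: "g z = block_form P 1" and u: "u \<in> vertical" and v: "v \<in> vertical"
  shows "hodge s g z (wedge u v) = s *\<^sub>R wedge u v"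
proof -
  have same12: "lc_symbol i i k l = 0" for i k l
    using lc_symbol_swap12[of i i k l] by simp
  have rep: "lc_symbol a b 3 4 = 0" if "a = 3 \<or> a = 4 \<or> b = 3 \<or> b = 4" for a b
  proof -
    let ?M = "vector [axis a 1, axis b 1, axis 3 1, axis 4 1] :: real^4^4"
    have "row 1 ?M = row 3 ?M \<or> row 1 ?M = row 4 ?M \<or> row 2 ?M = row 3 ?M \<or> row 2 ?M = row 4 ?M"
      using that by (auto simp: row_def)
    then show ?thesis
      unfolding lc_symbol_def
      using det_identical_rows[of 1 3 ?M] det_identical_rows[of 1 4 ?M]
        det_identical_rows[of 2 3 ?M] det_identical_rows[of 2 4 ?M] by auto
  qed
  have L: "(\<Sum>k\<in>UNIV. \<Sum>l\<in>UNIV. s * sqrt \<bar>det (g z)\<bar> * lc_symbol a b k l * wedge u v $ k $ l)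
      = 2 * s * lc_symbol a b 3 4 * (u $ 3 * v $ 4 - u $ 4 * v $ 3)" for a b
    using u v lc_symbol_swap34[of a b 4 3]
    by (simp add: g abs_det_block_form sum_4 wedge_def vertical_def algebra_simps)
  show ?thesis
    unfolding hodge_def L
    using u v lc_symbol_swap12[of 2 1 3 4]
    by (simp add: vec_eq_iff forall_4 raise2_def g matrix_inv_block_form sum_4 same12 rep
        lc_symbol_1234 wedge_def vertical_def algebra_simps)
qed

lemma fibre_orientation_block_form:
  assumes g: "g z = block_form P 1"
  shows "fibre_orientation g z = 1"
  unfolding fibre_orientation_def
proof (rule the_equality)
  show "1 \<in> {-1, 1 :: real} \<and> (\<forall>u\<in>vertical. \<forall>v\<in>vertical. u \<noteq> v \<longrightarrow> independent {u, v} \<longrightarrow>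
      hodge 1 g z (wedge u v) = wedge u v)"
    by (simp add: hodge_vertical[of g z P, OF g])
next
  fix s :: real
  assume s: "s \<in> {-1, 1} \<and> (\<forall>u\<in>vertical. \<forall>v\<in>vertical. u \<noteq> v \<longrightarrow> independent {u, v} \<longrightarrow>
      hodge s g z (wedge u v) = wedge u v)"
  let ?u = "axis 3 1 :: real^4" and ?v = "axis 4 1 :: real^4"
  have uv: "?u \<in> vertical" "?v \<in> vertical" "?u \<noteq> ?v"
    by (simp_all add: vertical_def axis_def vec_eq_iff forall_4)
  moreover have "independent {?u, ?v}"
    by (rule independent_mono[OF independent_Basis]) (auto simp: axis_in_Basis_iff)
  ultimately have "s *\<^sub>R wedge ?u ?v = wedge ?u ?v"
    using s hodge_vertical[of g z P, OF g] by metis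
  then have "(s *\<^sub>R wedge ?u ?v) $ 3 $ 4 = wedge ?u ?v $ 3 $ 4"
    by simp
  then show "s = 1"
    by (simp add: wedge_def axis_def)
qed

lemma fibre_orientation_deformed_extension: "fibre_orientation (deformed_extension \<Gamma> \<Phi> T) z = 1"
  by (rule fibre_orientation_block_form, rule deformed_extension_coordinates)

definition self_dual :: "'a chart set \<Rightarrow> ('a chart \<Rightarrow> metric4) \<Rightarrow> bool" where
  "self_dual A g \<longleftrightarrow> (\<forall>c\<in>A. \<forall>z. base z \<in> chart_image c \<longrightarrow>
     W_minus_vanishes (fibre_orientation (g c) z) (g c) z)"

definition anti_self_dual :: "'a chart set \<Rightarrow> ('a chart \<Rightarrow> metric4) \<Rightarrow> bool" where
  "anti_self_dual A g \<longleftrightarrow> (\<forall>c\<in>A. \<forall>z. base z \<in> chart_image c \<longrightarrow>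
     W_plus_vanishes (fibre_orientation (g c) z) (g c) z)"


section \<open>The equations for the deformation tensor\<close>

definition eval1 :: "('n::finite \<Rightarrow> real) \<Rightarrow> real^'n \<Rightarrow> real" where
  "eval1 \<omega> X = (\<Sum>i\<in>UNIV. \<omega> i * X $ i)"

definition eval2 :: "('n::finite \<Rightarrow> 'n \<Rightarrow> real) \<Rightarrow> real^'n \<Rightarrow> real^'n \<Rightarrow> real" where
  "eval2 \<Phi> X Y = (\<Sum>i\<in>UNIV. \<Sum>j\<in>UNIV. \<Phi> i j * X $ i * Y $ j)"

definition eval3 :: "('n::finite \<Rightarrow> 'n \<Rightarrow> 'n \<Rightarrow> real) \<Rightarrow> real^'n \<Rightarrow> real^'n \<Rightarrow> real^'n \<Rightarrow> real" where
  "eval3 \<Psi> X Y Z = (\<Sum>i\<in>UNIV. \<Sum>j\<in>UNIV. \<Sum>k\<in>UNIV. \<Psi> i j k * X $ i * Y $ j * Z $ k)"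

definition eval4 ::
    "('n::finite \<Rightarrow> 'n \<Rightarrow> 'n \<Rightarrow> 'n \<Rightarrow> real) \<Rightarrow> real^'n \<Rightarrow> real^'n \<Rightarrow> real^'n \<Rightarrow> real^'n \<Rightarrow> real" where
  "eval4 \<Psi> X Y Z W = (\<Sum>i\<in>UNIV. \<Sum>j\<in>UNIV. \<Sum>k\<in>UNIV. \<Sum>l\<in>UNIV.
     \<Psi> i j k l * X $ i * Y $ j * Z $ k * W $ l)"

text \<open>As for recurrence, the one-form factor of \<open>\<omega> \<otimes> \<rho>\<close> takes the differentiation slot.\<close>

definition first_equation ::
    "'a chart set \<Rightarrow> ('a chart \<Rightarrow> 2 tensor3_comp) \<Rightarrow> ('a chart \<Rightarrow> 2 tensor2_comp) \<Rightarrow>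
     ('a chart \<Rightarrow> 2 form_comp) \<Rightarrow> ('a chart \<Rightarrow> 2 tensor2_comp) \<Rightarrow> bool" where
  "first_equation A \<Gamma> T \<omega> \<Phi> \<longleftrightarrow> (\<forall>c\<in>A. \<forall>x\<in>chart_image c. \<forall>X Y Z.
     eval3 (cov_deriv_02 (\<Gamma> c) (\<Phi> c) x)
       (apply_11 (T c) x X) (apply_11 (T c) x Y) (apply_11 (T c) x Z) =
     - 2 * (eval1 (\<omega> c x) (apply_11 (T c) x Z) * eval2 (ricci (\<Gamma> c) x) X Y))"

definition second_equation ::
    "('a chart \<Rightarrow> 2 tensor3_comp) \<Rightarrow> ('a chart \<Rightarrow> 2 tensor2_comp) \<Rightarrow>
     ('a chart \<Rightarrow> 2 tensor2_comp) \<Rightarrow> 'a chart \<Rightarrow> bool" where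
  "second_equation \<Gamma> T \<Phi> c \<longleftrightarrow> (\<forall>x\<in>chart_image c.
     let d1 = axis 1 1; Td1 = apply_11 (T c) x d1; D2\<Phi> = eval4 (cov_deriv2_02 (\<Gamma> c) (\<Phi> c) x)
     in 0 = (1/2) * (eval2 (\<Phi> c x) Td1 Td1 * eval2 (\<Phi> c x) Td1 Td1)
          + 2 * (eval2 (\<Phi> c x) Td1 Td1 * eval2 (ricci (\<Gamma> c) x) d1 d1)
          + D2\<Phi> d1 d1 Td1 Td1 + D2\<Phi> Td1 Td1 d1 d1 - 2 * D2\<Phi> d1 Td1 Td1 d1)"

text \<open>The Christoffel symbol with indices \<open>1 1 2\<close> is the only non-zero one, \<open>T \<partial>\<^sub>1 = \<partial>\<^sub>2\<close> and
  \<open>T \<partial>\<^sub>2 = 0\<close>.\<close>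

definition adapted_chart ::
    "('a chart \<Rightarrow> 2 tensor3_comp) \<Rightarrow> ('a chart \<Rightarrow> 2 tensor2_comp) \<Rightarrow> 'a chart \<Rightarrow> bool" where
  "adapted_chart \<Gamma> T c \<longleftrightarrow>
     (\<forall>x\<in>chart_image c. \<forall>i j k. (i, j, k) \<noteq> (1, 1, 2) \<longrightarrow> \<Gamma> c x i j k = 0) \<and>
     (\<exists>x\<in>chart_image c. \<Gamma> c x 1 1 2 \<noteq> 0) \<and>
     (\<forall>x\<in>chart_image c. apply_11 (T c) x (axis 1 1) = axis 2 1 \<and> apply_11 (T c) x (axis 2 1) = 0)"

end

theory Submission
  imports Defs
begin

text \<open>In induced coordinates \<open>g\<close> is a Walker metric, with coordinates \<open>1, 2\<close> on the surface and
  \<open>3, 4\<close> on the fibres. Its curvature operator \<open>W\<^sup>-\<close> involves only second fibre derivatives; one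
  component is \<open>- (T\<^sub>1\<^sup>2)\<^sup>2\<close>, another \<open>- (T\<^sub>2\<^sup>1)\<^sup>2\<close>, and a parallel nilpotent tensor field that is
  nonzero somewhere on each component has no zeros, so \<open>W\<^sup>-\<close> never vanishes. The operator \<open>W\<^sup>+\<close> is
  determined by three scalars. One of them restricts on the zero section to the trace of the curvature
  of \<open>D\<close>, so anti-self-duality makes the Ricci tensor symmetric.

  Once the trace of the curvature vanishes, the factors of \<open>T = \<theta> \<otimes> V\<close> can be rescaled to be
  parallel, and two quadratures yield coordinates in which \<open>T \<partial>\<^sub>1 = \<partial>\<^sub>2\<close>, \<open>T \<partial>\<^sub>2 = 0\<close> and
  \<open>\<Gamma>\<^sub>1\<^sub>1\<^sup>2\<close> is the only Christoffel symbol that may be non-zero. The Ricci tensor is then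
  \<open>\<partial>\<^sub>2 \<Gamma>\<^sub>1\<^sub>1\<^sup>2 du\<^sup>1 \<otimes> du\<^sup>1\<close>, whence recurrence and rank one. In these coordinates the only component of
  \<open>W\<^sup>+\<close> that does not vanish identically is affine along the fibres: its linear part is the first
  equation for \<open>\<Phi>\<close> and its constant part the second one. All other charts are reached by naturality
  of the Weyl tensor under cotangent lifts of coordinate changes.\<close>

subsection \<open>Partial derivatives and smooth functions\<close>

text \<open>Self-duality and anti-self-duality are required in every chart, while the second
  equation has a meaning only in adapted charts, and these exist only once the trace of the
  curvature is known to vanish. The general Walker formulas are therefore evaluated in an arbitrary
  chart in just two places: on the zero section for the trace, and at one point to refute
  self-duality. The equations for \<open>\<Phi>\<close> are computed in adapted charts; between
  charts the vanishing of W^+ is transported by isometries.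

  In general W^+ is a trace-free symmetric 3 by 3 matrix with five free entries. The fibres of the
  cotangent bundle are null and parallel, which kills two of them and leaves \<open>sc\<close>,
  \<open>W12\<close> and \<open>W22\<close>.

  The linear part of \<open>W22\<close> contains a second derivative of the Christoffel symbol with
  coefficient 1 and a derivative of \<open>\<Phi>\<close> with coefficient 1/2, whence the factor -2
  in the first equation; recurrence turns that second derivative into a product with the recurrence
  form.

  This form is given by an explicit quotient of components, so that its smoothness does not depend
  on a choice of adapted charts.\<close>

lemma pd_eqI: "(f has_derivative f') (at x) \<Longrightarrow> pd i f x = f' (axis i 1)"
  unfolding pd_def by (drule frechet_derivative_at) (simp add: fun_eq_iff)

lemma has_derivative_frechet: "f differentiable (at x) \<Longrightarrow> (f has_derivative frechet_derivative f (at x)) (at x)"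
  using frechet_derivative_works by blast

text \<open>No differentiability is assumed: near \<open>x\<close> both functions have the same
  derivative maps, so the choice hidden in \<open>frechet_derivative\<close> returns the same
  one.\<close>

lemma pd_cong_open:
  assumes "open S" "x \<in> S" "\<And>y. y \<in> S \<Longrightarrow> f y = g y"
  shows "pd i f x = pd i g x"
proof -
  have "(f has_derivative D) (at x) \<longleftrightarrow> (g has_derivative D) (at x)" for D
    using has_derivative_transform_within_open[of f D x UNIV S g]
      has_derivative_transform_within_open[of g D x UNIV S f] assms by auto
  then show ?thesis unfolding pd_def frechet_derivative_def by simp
qed

lemma pd_const [simp]: "pd i (\<lambda>x. c) x = 0"
  by (rule pd_eqI[THEN trans], rule has_derivative_const) simp

lemma pd_nth [simp]: "pd i (\<lambda>x. x $ j) x = (if i = j then 1 else 0)"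
  by (rule pd_eqI[THEN trans], rule bounded_linear_imp_has_derivative[OF bounded_linear_vec_nth])
    (simp add: axis_def)

lemma pd_add:
  assumes "f differentiable (at x)" "g differentiable (at x)"
  shows "pd i (\<lambda>x. f x + g x) x = pd i f x + pd i g x"
  by (rule pd_eqI[THEN trans],
      rule has_derivative_add[OF assms[THEN has_derivative_frechet]]) (simp add: pd_def)

lemma pd_diff:
  assumes "f differentiable (at x)" "g differentiable (at x)"
  shows "pd i (\<lambda>x. f x - g x) x = pd i f x - pd i g x"
  by (rule pd_eqI[THEN trans],
      rule has_derivative_diff[OF assms[THEN has_derivative_frechet]]) (simp add: pd_def)

lemma pd_minus:
  assumes "f differentiable (at x)"
  shows "pd i (\<lambda>x. - f x) x = - pd i f x"
  by (rule pd_eqI[THEN trans],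
      rule has_derivative_minus[OF assms[THEN has_derivative_frechet]]) (simp add: pd_def)

lemma pd_mult:
  assumes "f differentiable (at x)" "g differentiable (at x)"
  shows "pd i (\<lambda>x. f x * g x) x = f x * pd i g x + pd i f x * g x"
  by (rule pd_eqI[THEN trans],
      rule has_derivative_mult[OF assms[THEN has_derivative_frechet]]) (simp add: pd_def)

lemma pd_cmult:
  assumes "f differentiable (at x)"
  shows "pd i (\<lambda>x. c * f x) x = c * pd i f x"
  using pd_mult[of "\<lambda>_. c" x f i] assms by simp

lemma pd_divide_const:
  assumes "f differentiable (at x)"
  shows "pd i (\<lambda>x. f x / c) x = pd i f x / c"
  using pd_cmult[OF assms, of i "1/c"] by simp

lemma pd_inverse:
  assumes "f differentiable (at x)" "f x \<noteq> 0"
  shows "pd i (\<lambda>x. inverse (f x)) x = - (inverse (f x) * inverse (f x) * pd i f x)"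
  by (rule pd_eqI[THEN trans],
      rule Deriv.has_derivative_inverse[OF assms(2) assms(1)[THEN has_derivative_frechet]])
    (simp add: pd_def)

lemma pd_sum:
  assumes "\<And>a. a \<in> I \<Longrightarrow> f a differentiable (at x)"
  shows "pd i (\<lambda>x. \<Sum>a\<in>I. f a x) x = (\<Sum>a\<in>I. pd i (f a) x)"
  by (rule pd_eqI[THEN trans], rule has_derivative_sum, rule has_derivative_frechet, rule assms)
    (simp_all add: pd_def)

lemma frechet_derivative_pd:
  fixes f :: "real^'n::finite \<Rightarrow> real"
  assumes "f differentiable (at x)"
  shows "frechet_derivative f (at x) v = (\<Sum>i\<in>UNIV. pd i f x * v $ i)"
proof -
  let ?D = "frechet_derivative f (at x)"
  have lin: "linear ?D" using linear_frechet_derivative[OF assms] .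
  have "v = (\<Sum>i\<in>UNIV. v $ i *\<^sub>R axis i 1)"
    using basis_expansion[of v] by (simp add: scalar_mult_eq_scaleR)
  then have "?D v = ?D (\<Sum>i\<in>UNIV. v $ i *\<^sub>R axis i 1)" by simp
  also have "\<dots> = (\<Sum>i\<in>UNIV. v $ i * ?D (axis i 1))"
    by (simp add: linear_sum[OF lin] linear_cmul[OF lin])
  finally show ?thesis by (simp add: pd_def mult.commute)
qed

lemma differentiable_vecI:
  fixes F :: "'b::real_normed_vector \<Rightarrow> real^'m::finite"
  assumes "\<And>a. (\<lambda>x. F x $ a) differentiable (at x)"
  shows "(F has_derivative (\<lambda>v. \<chi> a. frechet_derivative (\<lambda>x. F x $ a) (at x) v)) (at x)"
proof (subst has_derivative_componentwise_within, intro ballI)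
  fix b :: "real^'m" assume "b \<in> Basis"
  then obtain a where "b = axis a 1" by (auto simp: Basis_vec_def)
  then show "((\<lambda>x. F x \<bullet> b) has_derivative
      (\<lambda>v. (\<chi> a. frechet_derivative (\<lambda>x. F x $ a) (at x) v) \<bullet> b)) (at x)"
    using has_derivative_frechet[OF assms[of a]] by (simp add: inner_axis)
qed

lemma pd_compose:
  fixes f :: "real^'m::finite \<Rightarrow> real" and F :: "real^'n::finite \<Rightarrow> real^'m"
  assumes F: "\<And>a. (\<lambda>x. F x $ a) differentiable (at x)" and f: "f differentiable (at (F x))"
  shows "pd i (\<lambda>x. f (F x)) x = (\<Sum>a\<in>UNIV. pd a f (F x) * pd i (\<lambda>x. F x $ a) x)"
    and "(\<lambda>x. f (F x)) differentiable (at x)"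
proof -
  have D: "((\<lambda>x. f (F x)) has_derivative
      (\<lambda>v. frechet_derivative f (at (F x)) (\<chi> a. frechet_derivative (\<lambda>x. F x $ a) (at x) v))) (at x)"
    by (rule has_derivative_compose[OF differentiable_vecI[OF F] has_derivative_frechet[OF f]])
  then show "(\<lambda>x. f (F x)) differentiable (at x)" by (rule differentiableI)
  show "pd i (\<lambda>x. f (F x)) x = (\<Sum>a\<in>UNIV. pd a f (F x) * pd i (\<lambda>x. F x $ a) x)"
    unfolding pd_eqI[OF D] by (simp add: frechet_derivative_pd[OF f]) (simp add: pd_def)
qed

text \<open>Restriction to a line: this is how the mean value theorem, the fundamental theorem of
  calculus and a differential inequality in one real variable enter below.\<close>

lemma has_real_derivative_pd:
  fixes f :: "real^'n::finite \<Rightarrow> real"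
  assumes "f differentiable (at (x + s *\<^sub>R v))"
  shows "((\<lambda>s. f (x + s *\<^sub>R v)) has_real_derivative (\<Sum>i\<in>UNIV. pd i f (x + s *\<^sub>R v) * v $ i)) (at s)"
proof -
  have "((\<lambda>s. x + s *\<^sub>R v) has_derivative (\<lambda>h. h *\<^sub>R v)) (at s)"
    by (auto intro!: derivative_eq_intros)
  from has_derivative_compose[OF this has_derivative_frechet[OF assms]]
  show ?thesis
    unfolding has_field_derivative_def
    by (rule has_derivative_eq_rhs) (simp add: fun_eq_iff frechet_derivative_pd[OF assms]
        sum_distrib_left mult_ac)
qed

section \<open>Closure properties of C^k functions\<close>

lemma Ck_on_differentiable:
  "Ck_on (Suc k) f S \<Longrightarrow> open S \<Longrightarrow> x \<in> S \<Longrightarrow> f differentiable (at x)"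
  by (auto simp: differentiable_on_eq_differentiable_at)

lemma Ck_on_Suc_I:
  assumes "open S" "\<And>x. x \<in> S \<Longrightarrow> f differentiable (at x)" "\<And>i. Ck_on k (pd i f) S"
  shows "Ck_on (Suc k) f S"
  using assms by (auto simp: differentiable_on_eq_differentiable_at)

lemma Ck_on_cong:
  assumes "open S" "\<And>x. x \<in> S \<Longrightarrow> f x = g x" "Ck_on k f S"
  shows "Ck_on k g S"
  using assms(2,3)
proof (induction k arbitrary: f g)
  case 0
  then show ?case unfolding Ck_on.simps using continuous_on_cong[OF refl, of S f g] by blast
next
  case (Suc k)
  show ?case
  proof (rule Ck_on_Suc_I[OF assms(1)])
    fix x assume x: "x \<in> S"
    have "f differentiable (at x)" using Suc.prems(2) assms(1) x by (rule Ck_on_differentiable)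
    then show "g differentiable (at x)"
      unfolding differentiable_def
      by (meson has_derivative_transform_within_open assms(1) x Suc.prems(1))
  next
    fix i
    show "Ck_on k (pd i g) S"
    proof (rule Suc.IH[of "pd i f"])
      show "Ck_on k (pd i f) S" using Suc.prems by simp
      show "pd i f x = pd i g x" if "x \<in> S" for x
        using pd_cong_open[OF assms(1) that Suc.prems(1)] .
    qed
  qed
qed

lemma Ck_on_subset:
  "Ck_on k f S \<Longrightarrow> T \<subseteq> S \<Longrightarrow> Ck_on k f T"
  by (induction k arbitrary: f) (auto intro: continuous_on_subset differentiable_on_subset)

text \<open>The recursion never states continuity of intermediate derivatives; at its bottom
  differentiability supplies it.\<close>

lemma Ck_on_pred: "Ck_on (Suc k) f S \<Longrightarrow> Ck_on k f S"
proof (induction k arbitrary: f)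
  case 0
  then show ?case by (simp add: differentiable_imp_continuous_on)
next
  case (Suc k)
  then show ?case by (metis Ck_on.simps(2))
qed

lemma Ck_on_const: "Ck_on k (\<lambda>x. c) S"
proof (induction k arbitrary: c)
  case (Suc k)
  have "pd i (\<lambda>x. c) = (\<lambda>x. 0)" for i :: 'a by (simp add: fun_eq_iff)
  then show ?case using Suc by simp
qed simp

lemma Ck_on_nth: "Ck_on k (\<lambda>x. x $ j) S"
proof (cases k)
  case (Suc l)
  have "pd i (\<lambda>x. x $ j) = (\<lambda>x. if i = j then 1 else 0)" for i :: 'a by (simp add: fun_eq_iff)
  then show ?thesis using Suc Ck_on_const[of l]
    by (auto simp: differentiable_on_def
        intro!: bounded_linear_imp_differentiable bounded_linear_vec_nth)
qed (auto intro!: continuous_intros)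

lemma Ck_on_add:
  assumes "open S" "Ck_on k f S" "Ck_on k g S"
  shows "Ck_on k (\<lambda>x. f x + g x) S"
  using assms(2,3)
proof (induction k arbitrary: f g)
  case (Suc k)
  have d: "f differentiable (at x)" "g differentiable (at x)" if "x \<in> S" for x
    by (rule Ck_on_differentiable[OF Suc.prems(1) assms(1) that] Ck_on_differentiable[OF Suc.prems(2) assms(1) that])+
  show ?case
  proof (rule Ck_on_Suc_I[OF assms(1)])
    fix i
    have "Ck_on k (\<lambda>x. pd i f x + pd i g x) S"
      using Suc.prems by (intro Suc.IH) simp_all
    then show "Ck_on k (pd i (\<lambda>x. f x + g x)) S"
      by (rule Ck_on_cong[OF assms(1), rotated]) (simp add: pd_add d)
  qed (simp add: d)
qed (simp add: continuous_on_add)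

lemma Ck_on_mult:
  assumes "open S" "Ck_on k f S" "Ck_on k g S"
  shows "Ck_on k (\<lambda>x. f x * g x) S"
  using assms(2,3)
proof (induction k arbitrary: f g)
  case (Suc k)
  have d: "f differentiable (at x)" "g differentiable (at x)" if "x \<in> S" for x
    by (rule Ck_on_differentiable[OF Suc.prems(1) assms(1) that] Ck_on_differentiable[OF Suc.prems(2) assms(1) that])+
  show ?case
  proof (rule Ck_on_Suc_I[OF assms(1)])
    fix i
    have "Ck_on k (\<lambda>x. f x * pd i g x) S"
      using Suc.prems Ck_on_pred by (intro Suc.IH) auto
    moreover have "Ck_on k (\<lambda>x. pd i f x * g x) S"
      using Suc.prems Ck_on_pred by (intro Suc.IH) auto
    ultimately have "Ck_on k (\<lambda>x. f x * pd i g x + pd i f x * g x) S"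
      using Ck_on_add assms(1) by blast
    then show "Ck_on k (pd i (\<lambda>x. f x * g x)) S"
      by (rule Ck_on_cong[OF assms(1), rotated]) (simp add: pd_mult d)
  qed (simp add: d)
qed (simp add: continuous_on_mult)

lemma Ck_on_inverse:
  assumes "open S" "Ck_on k f S" "\<And>x. x \<in> S \<Longrightarrow> f x \<noteq> 0"
  shows "Ck_on k (\<lambda>x. inverse (f x)) S"
  using assms(2)
proof (induction k)
  case (Suc k)
  have d: "f differentiable (at x)" if "x \<in> S" for x
    by (rule Ck_on_differentiable[OF Suc.prems assms(1) that])
  have IH: "Ck_on k (\<lambda>x. inverse (f x)) S" using Suc Ck_on_pred by blast
  show ?case
  proof (rule Ck_on_Suc_I[OF assms(1)])
    fix i
    have "Ck_on k (\<lambda>x. (- 1) * (inverse (f x) * inverse (f x) * pd i f x)) S"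
      using Suc.prems by (intro Ck_on_mult assms(1) IH Ck_on_const) auto
    then show "Ck_on k (pd i (\<lambda>x. inverse (f x))) S"
      by (rule Ck_on_cong[OF assms(1), rotated]) (simp add: pd_inverse d assms(3))
  qed (simp add: d assms(3))
qed (use assms(3) in \<open>simp add: continuous_on_inverse\<close>)

lemma Ck_on_sum:
  assumes "open S" "\<And>a. a \<in> I \<Longrightarrow> Ck_on k (f a) S"
  shows "Ck_on k (\<lambda>x. \<Sum>a\<in>I. f a x) S"
  using assms(2)
  by (induction I rule: infinite_finite_induct)
    (auto simp: Ck_on_const intro!: Ck_on_add[OF assms(1)])

text \<open>The chain rule makes each partial derivative a sum of products, and the induction
  hypothesis is applied to the partial derivatives of \<open>f\<close>; hence \<open>f\<close> is
  generalised while \<open>F\<close> stays fixed.\<close>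

lemma Ck_on_compose:
  fixes f :: "real^'m::finite \<Rightarrow> real" and F :: "real^'n::finite \<Rightarrow> real^'m"
  assumes S: "open S" and T: "open T" and FS: "F ` S \<subseteq> T"
    and "\<And>a. Ck_on k (\<lambda>x. F x $ a) S" "Ck_on k f T"
  shows "Ck_on k (\<lambda>x. f (F x)) S"
  using assms(4,5)
proof (induction k arbitrary: f)
  case 0
  then have "continuous_on S F" by (intro continuous_on_vec_lambda[of S "\<lambda>a x. F x $ a", simplified]) simp
  with 0 FS show ?case by (simp add: continuous_on_compose2)
next
  case (Suc k)
  have F: "(\<lambda>x. F x $ a) differentiable (at x)" if "x \<in> S" for x a
    by (rule Ck_on_differentiable[OF Suc.prems(1) S that])
  have f: "f differentiable (at (F x))" if "x \<in> S" for x
    using FS that by (intro Ck_on_differentiable[OF Suc.prems(2) T]) auto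
  show ?case
  proof (rule Ck_on_Suc_I[OF S])
    fix i
    have "Ck_on k (\<lambda>x. pd a f (F x)) S" for a
      by (rule Suc.IH[OF Ck_on_pred[OF Suc.prems(1)]]) (use Suc.prems(2) in simp)
    moreover have "Ck_on k (pd i (\<lambda>x. F x $ a)) S" for a
      using Suc.prems(1)[of a] by simp
    ultimately have "Ck_on k (\<lambda>x. \<Sum>a\<in>UNIV. pd a f (F x) * pd i (\<lambda>x. F x $ a) x) S"
      by (intro Ck_on_sum Ck_on_mult S)
    then show "Ck_on k (pd i (\<lambda>x. f (F x))) S"
      by (rule Ck_on_cong[OF S, rotated]) (simp add: pd_compose F f)
  next
    fix x assume "x \<in> S"
    then show "(\<lambda>x. f (F x)) differentiable (at x)" using pd_compose(2)[OF F f] by blast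
  qed
qed

section \<open>Smooth functions and smooth maps\<close>

named_theorems smooth_intros

lemma smooth_fun_on_const [smooth_intros]: "smooth_fun_on S (\<lambda>x. c)"
  and smooth_fun_on_nth [smooth_intros]: "smooth_fun_on S (\<lambda>x. x $ j)"
  by (simp_all add: smooth_fun_on_def Ck_on_const Ck_on_nth)

lemma smooth_fun_on_add [smooth_intros]:
    "open S \<Longrightarrow> smooth_fun_on S f \<Longrightarrow> smooth_fun_on S g \<Longrightarrow> smooth_fun_on S (\<lambda>x. f x + g x)"
  and smooth_fun_on_mult [smooth_intros]:
    "open S \<Longrightarrow> smooth_fun_on S f \<Longrightarrow> smooth_fun_on S g \<Longrightarrow> smooth_fun_on S (\<lambda>x. f x * g x)"
  and smooth_fun_on_inverse [smooth_intros]: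
    "open S \<Longrightarrow> smooth_fun_on S f \<Longrightarrow> (\<And>x. x \<in> S \<Longrightarrow> f x \<noteq> 0) \<Longrightarrow> smooth_fun_on S (\<lambda>x. inverse (f x))"
  and smooth_fun_on_sum [smooth_intros]:
    "open S \<Longrightarrow> (\<And>a. a \<in> I \<Longrightarrow> smooth_fun_on S (h a)) \<Longrightarrow> smooth_fun_on S (\<lambda>x. \<Sum>a\<in>I. h a x)"
  by (simp_all add: smooth_fun_on_def Ck_on_add Ck_on_mult Ck_on_inverse Ck_on_sum)

lemma smooth_fun_on_minus [smooth_intros]:
  "open S \<Longrightarrow> smooth_fun_on S f \<Longrightarrow> smooth_fun_on S (\<lambda>x. - f x)"
  using smooth_fun_on_mult[of S "\<lambda>_. -1" f] by (simp add: smooth_fun_on_const)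

lemma smooth_fun_on_diff [smooth_intros]:
  "open S \<Longrightarrow> smooth_fun_on S f \<Longrightarrow> smooth_fun_on S g \<Longrightarrow> smooth_fun_on S (\<lambda>x. f x - g x)"
  using smooth_fun_on_add[of S f "\<lambda>x. - g x"] by (simp add: smooth_fun_on_minus)

lemma smooth_fun_on_divide [smooth_intros]:
  "open S \<Longrightarrow> smooth_fun_on S f \<Longrightarrow> smooth_fun_on S g \<Longrightarrow> (\<And>x. x \<in> S \<Longrightarrow> g x \<noteq> 0) \<Longrightarrow>
   smooth_fun_on S (\<lambda>x. f x / g x)"
  by (simp add: divide_inverse smooth_fun_on_mult smooth_fun_on_inverse)

lemma smooth_fun_on_compose:
  fixes f :: "real^'m::finite \<Rightarrow> real" and F :: "real^'n::finite \<Rightarrow> real^'m"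
  assumes "open S" "open T" "F ` S \<subseteq> T" "smooth_map_on S F" "smooth_fun_on T f"
  shows "smooth_fun_on S (\<lambda>x. f (F x))"
  using assms by (auto simp: smooth_fun_on_def smooth_map_on_def intro: Ck_on_compose)

lemma smooth_fun_on_pd [smooth_intros]: "smooth_fun_on S f \<Longrightarrow> smooth_fun_on S (pd i f)"
  unfolding smooth_fun_on_def by (metis Ck_on.simps(2))

lemma smooth_fun_on_subset: "smooth_fun_on S f \<Longrightarrow> T \<subseteq> S \<Longrightarrow> smooth_fun_on T f"
  unfolding smooth_fun_on_def using Ck_on_subset by blast

lemma smooth_fun_on_cong:
  "open S \<Longrightarrow> (\<And>x. x \<in> S \<Longrightarrow> f x = g x) \<Longrightarrow> smooth_fun_on S f \<Longrightarrow> smooth_fun_on S g"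
  unfolding smooth_fun_on_def using Ck_on_cong by blast

lemma smooth_fun_on_differentiable:
  "smooth_fun_on S f \<Longrightarrow> open S \<Longrightarrow> x \<in> S \<Longrightarrow> f differentiable (at x)"
  unfolding smooth_fun_on_def using Ck_on_differentiable by blast

lemma smooth_fun_on_continuous: "smooth_fun_on S f \<Longrightarrow> continuous_on S f"
  unfolding smooth_fun_on_def by (metis Ck_on.simps(1))

lemma smooth_map_on_differentiable:
  "smooth_map_on S F \<Longrightarrow> open S \<Longrightarrow> x \<in> S \<Longrightarrow> (\<lambda>x. F x $ a) differentiable (at x)"
  unfolding smooth_map_on_def by (blast intro: smooth_fun_on_differentiable[of S "\<lambda>x. F x $ a"])

lemma smooth_map_on_continuous: "smooth_map_on S F \<Longrightarrow> continuous_on S F"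
  using continuous_on_vec_lambda[of S "\<lambda>a x. F x $ a"]
  by (simp add: smooth_map_on_def smooth_fun_on_continuous)

lemma smooth_map_on_compose:
  assumes "open S" "open T" "F ` S \<subseteq> T" "smooth_map_on S F" "smooth_map_on T G"
  shows "smooth_map_on S (\<lambda>x. G (F x))"
  using assms(5) unfolding smooth_map_on_def
  by (auto intro: smooth_fun_on_compose[OF assms(1-4)])

text \<open>Two applications of the mean value theorem, first along \<open>i\<close>, then along
  \<open>j\<close>. The alternating sum over the corners of the square is symmetric in the two
  directions while the right-hand side is not, which is what \<open>pd_commute\<close>
  exploits.\<close>

lemma mixed_difference_mean_value:
  fixes f :: "real^'n::finite \<Rightarrow> real"
  assumes f: "Ck_on 2 f S" and S: "open S" and h: "h > 0"
    and sq: "\<And>s t. \<bar>s\<bar> \<le> h \<Longrightarrow> \<bar>t\<bar> \<le> h \<Longrightarrow> x + s *\<^sub>R axis i 1 + t *\<^sub>R axis j 1 \<in> S"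
  obtains s t where "0 < s" "s < h" "0 < t" "t < h"
    "f (x + h *\<^sub>R axis i 1 + h *\<^sub>R axis j 1) - f (x + h *\<^sub>R axis i 1) - f (x + h *\<^sub>R axis j 1) + f x
     = h * h * pd j (pd i f) (x + s *\<^sub>R axis i 1 + t *\<^sub>R axis j 1)"
proof -
  let ?e = "axis i 1 :: real^'n" and ?d = "axis j 1 :: real^'n"
  have 1: "Ck_on 1 (pd i f) S" and 0: "Ck_on (Suc 1) f S"
    using f by (simp_all add: numeral_2_eq_2)
  have df: "f differentiable (at y)" if "y \<in> S" for y
    using 0 S that by (rule Ck_on_differentiable)
  have dp: "pd i f differentiable (at y)" if "y \<in> S" for y
    using 1 S that by (intro Ck_on_differentiable[of 0]) auto
  have ax: "(\<Sum>l\<in>UNIV. g l * (axis m 1 :: real^'n) $ l) = g m" for g :: "'n \<Rightarrow> real" and m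
    by (simp add: axis_def if_distrib cong: if_cong)
  have D1: "((\<lambda>s. f (x + s *\<^sub>R ?e + t *\<^sub>R ?d)) has_real_derivative pd i f (x + s *\<^sub>R ?e + t *\<^sub>R ?d)) (at s)"
    if "\<bar>s\<bar> \<le> h" "\<bar>t\<bar> \<le> h" for s t
    using has_real_derivative_pd[of f "x + t *\<^sub>R ?d" s ?e] df[OF sq[OF that]]
    by (simp add: ax add_ac)
  have D2: "((\<lambda>t. pd i f (x + s *\<^sub>R ?e + t *\<^sub>R ?d)) has_real_derivative
      pd j (pd i f) (x + s *\<^sub>R ?e + t *\<^sub>R ?d)) (at t)" if "\<bar>s\<bar> \<le> h" "\<bar>t\<bar> \<le> h" for s t
    using has_real_derivative_pd[of "pd i f" "x + s *\<^sub>R ?e" t ?d] dp[OF sq[OF that]]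
    by (simp add: ax)
  let ?\<phi> = "\<lambda>s. f (x + s *\<^sub>R ?e + h *\<^sub>R ?d) - f (x + s *\<^sub>R ?e + 0 *\<^sub>R ?d)"
  have "\<exists>s>0. s < h \<and> ?\<phi> h - ?\<phi> 0 =
      (h - 0) * (pd i f (x + s *\<^sub>R ?e + h *\<^sub>R ?d) - pd i f (x + s *\<^sub>R ?e + 0 *\<^sub>R ?d))"
    using h by (intro MVT2 DERIV_diff D1) auto
  then obtain s where s: "0 < s" "s < h" and e1: "?\<phi> h - ?\<phi> 0 =
      h * (pd i f (x + s *\<^sub>R ?e + h *\<^sub>R ?d) - pd i f (x + s *\<^sub>R ?e + 0 *\<^sub>R ?d))" by auto
  have "\<exists>t>0. t < h \<and> pd i f (x + s *\<^sub>R ?e + h *\<^sub>R ?d) - pd i f (x + s *\<^sub>R ?e + 0 *\<^sub>R ?d) =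
      (h - 0) * pd j (pd i f) (x + s *\<^sub>R ?e + t *\<^sub>R ?d)"
    using h s by (intro MVT2 D2) auto
  then obtain t where t: "0 < t" "t < h" and e2:
    "pd i f (x + s *\<^sub>R ?e + h *\<^sub>R ?d) - pd i f (x + s *\<^sub>R ?e + 0 *\<^sub>R ?d) =
      h * pd j (pd i f) (x + s *\<^sub>R ?e + t *\<^sub>R ?d)" by auto
  from s t e1[unfolded e2] show ?thesis by (intro that[of s t]) (auto simp: algebra_simps)
qed

lemma pd_commute:
  fixes f :: "real^'n::finite \<Rightarrow> real"
  assumes "smooth_fun_on S f" and S: "open S" and x: "x \<in> S"
  shows "pd j (pd i f) x = pd i (pd j f) x"
proof (rule ccontr)
  assume neq: "pd j (pd i f) x \<noteq> pd i (pd j f) x"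
  define e where "e = \<bar>pd j (pd i f) x - pd i (pd j f) x\<bar> / 2"
  have e: "e > 0" using neq by (simp add: e_def)
  have f: "Ck_on 2 f S" using assms(1) by (simp add: smooth_fun_on_def)
  have c: "continuous_on S (pd l (pd m f))" for l m
    using assms(1) by (intro smooth_fun_on_continuous smooth_fun_on_pd)
  obtain r where r: "r > 0" "ball x r \<subseteq> S" using S x open_contains_ball by blast
  from c[of j i] x S obtain d1 where d1: "d1 > 0"
    "\<And>y. y \<in> ball x d1 \<Longrightarrow> \<bar>pd j (pd i f) y - pd j (pd i f) x\<bar> < e"
    using e unfolding continuous_on_eq_continuous_at[OF S] continuous_at_eps_delta
    by (metis dist_commute dist_real_def mem_ball)
  from c[of i j] x S obtain d2 where d2: "d2 > 0"
    "\<And>y. y \<in> ball x d2 \<Longrightarrow> \<bar>pd i (pd j f) y - pd i (pd j f) x\<bar> < e"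
    using e unfolding continuous_on_eq_continuous_at[OF S] continuous_at_eps_delta
    by (metis dist_commute dist_real_def mem_ball)
  \<comment> \<open>Points of the square are at distance at most \<open>2 * h\<close> from
    \<open>x\<close>, so a third of the smallest radius keeps the square inside all three
    balls.\<close>
  define h where "h = min r (min d1 d2) / 3"
  have h: "h > 0" using r d1 d2 by (simp add: h_def)
  have near: "x + s *\<^sub>R axis k 1 + t *\<^sub>R axis l 1 \<in> ball x r \<inter> ball x d1 \<inter> ball x d2"
    if "\<bar>s\<bar> \<le> h" "\<bar>t\<bar> \<le> h" for s t and k l :: 'n
  proof -
    have "norm (s *\<^sub>R axis k 1 + t *\<^sub>R axis l 1 :: real^'n) \<le> \<bar>s\<bar> + \<bar>t\<bar>"
      by (rule order_trans[OF norm_triangle_ineq]) simp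
    also have "\<dots> < min r (min d1 d2)" using that h by (simp add: h_def)
    finally have "dist x (x + (s *\<^sub>R axis k 1 + t *\<^sub>R axis l 1)) < min r (min d1 d2)"
      by (metis add_diff_cancel_left' dist_commute dist_norm)
    then show ?thesis by (simp only: add.assoc Int_iff mem_ball) simp
  qed
  obtain s t where st: "0 < s" "s < h" "0 < t" "t < h"
    "f (x + h *\<^sub>R axis i 1 + h *\<^sub>R axis j 1) - f (x + h *\<^sub>R axis i 1) - f (x + h *\<^sub>R axis j 1) + f x
     = h * h * pd j (pd i f) (x + s *\<^sub>R axis i 1 + t *\<^sub>R axis j 1)"
    using near r by (rule_tac mixed_difference_mean_value[OF f S h, of x i j]) blast+
  obtain s' t' where st': "0 < s'" "s' < h" "0 < t'" "t' < h"
    "f (x + h *\<^sub>R axis j 1 + h *\<^sub>R axis i 1) - f (x + h *\<^sub>R axis j 1) - f (x + h *\<^sub>R axis i 1) + f x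
     = h * h * pd i (pd j f) (x + s' *\<^sub>R axis j 1 + t' *\<^sub>R axis i 1)"
    using near r by (rule_tac mixed_difference_mean_value[OF f S h, of x j i]) blast+
  have "h * h * pd j (pd i f) (x + s *\<^sub>R axis i 1 + t *\<^sub>R axis j 1) =
      h * h * pd i (pd j f) (x + s' *\<^sub>R axis j 1 + t' *\<^sub>R axis i 1)"
    unfolding st(5)[symmetric] st'(5)[symmetric] by (simp add: add_ac)
  then have "pd j (pd i f) (x + s *\<^sub>R axis i 1 + t *\<^sub>R axis j 1) =
      pd i (pd j f) (x + s' *\<^sub>R axis j 1 + t' *\<^sub>R axis i 1)" using h by simp
  moreover have "\<bar>pd j (pd i f) (x + s *\<^sub>R axis i 1 + t *\<^sub>R axis j 1) - pd j (pd i f) x\<bar> < e"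
    using near[of s t i j] st by (intro d1) auto
  moreover have "\<bar>pd i (pd j f) (x + s' *\<^sub>R axis j 1 + t' *\<^sub>R axis i 1) - pd i (pd j f) x\<bar> < e"
    using near[of s' t' j i] st' by (intro d2) auto
  ultimately show False unfolding e_def by argo
qed

subsection \<open>Inverse functions and primitives\<close>

lemma smooth_map_on_subset: "smooth_map_on S F \<Longrightarrow> T \<subseteq> S \<Longrightarrow> smooth_map_on T F"
  unfolding smooth_map_on_def by (simp add: smooth_fun_on_subset[of S])

definition jac :: "(real^'n \<Rightarrow> real^'n) \<Rightarrow> real^'n \<Rightarrow> 'n \<Rightarrow> 'n::finite \<Rightarrow> real" where
  "jac F x a i = pd i (\<lambda>y. F y $ a) x"

definition jac_det :: "(real^2 \<Rightarrow> real^2) \<Rightarrow> real^2 \<Rightarrow> real" where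
  "jac_det F x = jac F x 1 1 * jac F x 2 2 - jac F x 1 2 * jac F x 2 1"

text \<open>Cramer's rule for 2 by 2 matrices; on the index type \<open>2\<close> the term
  \<open>3 - i\<close> exchanges \<open>1\<close> and \<open>2\<close>.\<close>

definition jac_inv :: "(real^2 \<Rightarrow> real^2) \<Rightarrow> real^2 \<Rightarrow> 2 \<Rightarrow> 2 \<Rightarrow> real" where
  "jac_inv F x i a = (if i = a then jac F x (3 - i) (3 - i) else - jac F x i a) / jac_det F x"

lemma smooth_jac: "smooth_map_on S F \<Longrightarrow> smooth_fun_on S (\<lambda>x. jac F x a i)"
  unfolding jac_def smooth_map_on_def by (intro smooth_intros) simp

lemma smooth_jac_det: "open S \<Longrightarrow> smooth_map_on S F \<Longrightarrow> smooth_fun_on S (jac_det F)"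
  unfolding jac_det_def[abs_def] by (intro smooth_intros smooth_jac)

lemma smooth_jac_inv:
  assumes "open S" "smooth_map_on S F" "\<And>x. x \<in> S \<Longrightarrow> jac_det F x \<noteq> 0"
  shows "smooth_fun_on S (\<lambda>x. jac_inv F x i a)"
  using assms unfolding jac_inv_def
  by (cases "i = a") (auto intro!: smooth_intros smooth_jac smooth_jac_det simp flip: minus_divide_left)

lemma jac_inv_solve:
  assumes "jac_det F x \<noteq> 0" and "\<And>a. (\<Sum>b\<in>UNIV. jac F x a b * h b) = k a"
  shows "h b = (\<Sum>a\<in>UNIV. jac_inv F x b a * k a)"
proof -
  have "jac_det F x * h b = (\<Sum>a\<in>UNIV. jac_det F x * jac_inv F x b a * k a)"
  proof -
    have "jac_det F x * jac_inv F x b a = (if b = a then jac F x (3 - b) (3 - b) else - jac F x b a)" for a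
      using assms(1) by (simp add: jac_inv_def)
    then show ?thesis
      using exhaust_2[of b] by (auto simp: assms(2)[symmetric] sum_2 jac_det_def algebra_simps)
  qed
  also have "\<dots> = jac_det F x * (\<Sum>a\<in>UNIV. jac_inv F x b a * k a)"
    by (simp add: sum_distrib_left mult.assoc)
  finally show ?thesis using assms(1) by simp
qed

text \<open>Bootstrapping: differentiating \<open>F (G y) = y\<close> expresses the partial
  derivatives of \<open>G\<close> as \<open>jac_inv F\<close> composed with \<open>G\<close>, so
  each order of differentiability of \<open>G\<close> yields the next one.\<close>

lemma smooth_inverse_map:
  fixes F G :: "real^2 \<Rightarrow> real^2"
  assumes S: "open S" and V: "open V" and F: "smooth_map_on S F"
    and det: "\<And>x. x \<in> S \<Longrightarrow> jac_det F x \<noteq> 0"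
    and G: "\<And>y. y \<in> V \<Longrightarrow> G y \<in> S" "\<And>y. y \<in> V \<Longrightarrow> F (G y) = y"
    and Gd: "\<And>y a. y \<in> V \<Longrightarrow> (\<lambda>y. G y $ a) differentiable (at y)"
  shows "smooth_map_on V G"
proof -
  have pdG: "pd i (\<lambda>y. G y $ b) y = jac_inv F (G y) b i" if y: "y \<in> V" for y i b
  proof -
    have "(\<Sum>b\<in>UNIV. jac F (G y) a b * pd i (\<lambda>y. G y $ b) y) = (if a = i then 1 else 0)" for a
    proof -
      have "(\<Sum>b\<in>UNIV. jac F (G y) a b * pd i (\<lambda>y. G y $ b) y) = pd i (\<lambda>y. F (G y) $ a) y"
        unfolding jac_def
        by (rule pd_compose(1)[OF Gd[OF y] smooth_map_on_differentiable[OF F S G(1)[OF y]], symmetric])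
      also have "\<dots> = pd i (\<lambda>y. y $ a) y"
        using G(2) by (intro pd_cong_open[OF V y]) simp
      finally show ?thesis by auto
    qed
    from jac_inv_solve[OF det[OF G(1)[OF y]] this] show ?thesis
      by (simp add: if_distrib cong: if_cong)
  qed
  have "Ck_on k (\<lambda>y. G y $ a) V" for k a
  proof (induction k arbitrary: a)
    case 0
    have "\<And>y. y \<in> V \<Longrightarrow> isCont (\<lambda>y. G y $ a) y"
      using Gd differentiable_imp_continuous_within by blast
    then show ?case using V by (simp add: continuous_on_eq_continuous_at)
  next
    case (Suc k)
    show ?case
    proof (rule Ck_on_Suc_I[OF V])
      fix i
      have "Ck_on k (\<lambda>y. jac_inv F (G y) a i) V"
        using G(1) smooth_jac_inv[OF S F det, of a i]
        by (intro Ck_on_compose[OF V S _ Suc, of "\<lambda>x. jac_inv F x a i"])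
          (simp_all add: smooth_fun_on_def image_subset_iff)
      then show "Ck_on k (pd i (\<lambda>y. G y $ a)) V"
        by (rule Ck_on_cong[OF V, rotated]) (simp add: pdG)
    qed (rule Gd)
  qed
  then show ?thesis by (simp add: smooth_map_on_def smooth_fun_on_def)
qed

lemma bounded_linear_elementary: "bounded_linear (\<lambda>v :: real^2. v $ b *\<^sub>R (axis a 1 :: real^2))"
  by (rule bounded_linear_compose[OF bounded_linear_scaleR_left bounded_linear_vec_nth])

lemma local_diffeomorphism:
  fixes F :: "real^2 \<Rightarrow> real^2"
  assumes S: "open S" and F: "smooth_map_on S F" and x0: "x0 \<in> S" and det: "jac_det F x0 \<noteq> 0"
  obtains U V G where "open U" "U \<subseteq> S" "x0 \<in> U" "open V" "homeomorphism U V F G" "smooth_map_on V G"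
proof -
  \<comment> \<open>The inverse function theorem is applied on this set, so that the Jacobian
    determinant is nonzero on the whole neighbourhood that it returns.\<close>
  define S' where "S' = {x \<in> S. jac_det F x \<noteq> 0}"
  have "continuous_on S (jac_det F)" by (intro smooth_fun_on_continuous smooth_jac_det S F)
  then have S': "open S'"
    using continuous_open_preimage[OF _ S open_Compl[OF closed_singleton], of "jac_det F" 0]
    by (simp add: S'_def vimage_def Int_def conj_commute)
  have F': "smooth_map_on S' F"
    using F by (rule smooth_map_on_subset) (auto simp: S'_def)
  have det': "jac_det F x \<noteq> 0" if "x \<in> S'" for x using that by (simp add: S'_def)
  have x0': "x0 \<in> S'" using x0 det by (simp add: S'_def)
  \<comment> \<open>Elementary matrices as bounded operators: continuity of the derivative in the
    operator norm reduces to continuity of the Jacobian entries.\<close>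
  define E :: "2 \<Rightarrow> 2 \<Rightarrow> (real^2) \<Rightarrow>\<^sub>L (real^2)"
    where "E a b = Blinfun (\<lambda>v. v $ b *\<^sub>R axis a 1)" for a b
  have E: "blinfun_apply (E a b) v = v $ b *\<^sub>R axis a 1" for a b v
    unfolding E_def by (simp add: bounded_linear_Blinfun_apply[OF bounded_linear_elementary])
  define f' where "f' x = (\<Sum>a\<in>UNIV. \<Sum>b\<in>UNIV. jac F x a b *\<^sub>R E a b)" for x
  have f': "blinfun_apply (f' x) v $ a = (\<Sum>b\<in>UNIV. jac F x a b * v $ b)" for x v a
    using exhaust_2[of a]
    by (auto simp: f'_def sum_2 blinfun.add_left blinfun.scaleR_left E axis_def)
  have der: "(F has_derivative blinfun_apply (f' x)) (at x)" if "x \<in> S'" for x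
  proof -
    have d: "(\<lambda>x. F x $ a) differentiable (at x)" for a
      using smooth_map_on_differentiable[OF F' S' that] .
    show ?thesis
      by (rule has_derivative_eq_rhs[OF differentiable_vecI[OF d]])
        (simp add: fun_eq_iff vec_eq_iff f' frechet_derivative_pd[OF d] jac_def)
  qed
  have cont: "continuous_on S' f'"
    unfolding f'_def
    by (intro continuous_intros smooth_fun_on_continuous smooth_jac F')
  define K where "K = (\<Sum>a\<in>UNIV. \<Sum>b\<in>UNIV. jac_inv F x0 a b *\<^sub>R E a b)"
  have K: "blinfun_apply K v $ a = (\<Sum>b\<in>UNIV. jac_inv F x0 a b * v $ b)" for v a
    using exhaust_2[of a]
    by (auto simp: K_def sum_2 blinfun.add_left blinfun.scaleR_left E axis_def)
  have inv: "K o\<^sub>L f' x0 = id_blinfun"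
  proof (rule blinfun_eqI)
    fix v
    show "blinfun_apply (K o\<^sub>L f' x0) v = blinfun_apply id_blinfun v"
      using jac_inv_solve[OF det f'[symmetric, of x0], of v]
      by (simp add: vec_eq_iff K)
  qed
  obtain U V G g' where UV: "open U" "U \<subseteq> S'" "x0 \<in> U" "open V" "F x0 \<in> V" "homeomorphism U V F G"
    and g': "\<And>y. y \<in> V \<Longrightarrow> (G has_derivative (g' y)) (at y)"
    using inverse_function_theorem[OF S' der cont x0' inv] by metis
  have GV: "G y \<in> U" "F (G y) = y" if "y \<in> V" for y
    using UV(6) that by (auto simp: homeomorphism_def)
  have "smooth_map_on V G"
  proof (rule smooth_inverse_map[OF S' UV(4) F' det'])
    fix y a assume "y \<in> V"
    then show "(\<lambda>y. G y $ a) differentiable (at y)"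
      by (intro differentiableI[OF bounded_linear.has_derivative[OF bounded_linear_vec_nth g']])
  qed (use GV UV in auto)
  with UV show ?thesis by (intro that[of U V G]) (auto simp: S'_def)
qed

text \<open>Parameter \<open>1\<close> gives the identity, parameter \<open>0\<close> moves the
  coordinates in \<open>M\<close> to those of \<open>b\<close>; the other coordinates act as
  parameters.\<close>

definition contraction :: "'n set \<Rightarrow> real^'n \<Rightarrow> real \<Rightarrow> real^'n \<Rightarrow> real^'n::finite" where
  "contraction M b t x = (\<chi> i. if i \<in> M then b $ i + t * (x $ i - b $ i) else x $ i)"

text \<open>Differentiation under the integral sign. A derivative in a direction of \<open>M\<close>
  produces a factor \<open>t\<close>; carrying a weight \<open>w\<close> along keeps this family of
  integrals closed under partial derivatives.\<close>

lemma contraction_parametric_integral: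
  fixes f :: "real^'n::finite \<Rightarrow> real" and w :: "real \<Rightarrow> real"
  assumes U: "open U" "convex U" and f: "f differentiable_on U" "\<And>i. continuous_on U (pd i f)"
    and w: "continuous_on {0..1} w"
    and C: "\<And>t x. t \<in> {0..1} \<Longrightarrow> x \<in> U \<Longrightarrow> contraction M b t x \<in> U" and x: "x \<in> U"
  defines "I \<equiv> \<lambda>w f x. integral {0..1} (\<lambda>t. w t * f (contraction M b t x))"
  shows "I w f differentiable (at x)"
    and "pd i (I w f) x = I (\<lambda>t. w t * (if i \<in> M then t else 1)) (pd i f) x"
proof -
  let ?c = "\<lambda>i t. if i \<in> M then t else 1 :: real"
  have fd: "f differentiable (at y)" if "y \<in> U" for y
    using f(1) U(1) that by (simp add: differentiable_on_eq_differentiable_at)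
  have ctr: "((\<lambda>x. contraction M b t x $ a) has_derivative (\<lambda>v. ?c a t * v $ a)) (at x)" for a t x
    unfolding contraction_def by (cases "a \<in> M") (auto intro!: derivative_eq_intros
        bounded_linear_imp_has_derivative[OF bounded_linear_vec_nth])
  have ctrd: "(\<lambda>x. contraction M b t x $ a) differentiable (at x)" for a t x
    by (rule differentiableI[OF ctr])
  have pdc: "pd i (\<lambda>x. contraction M b t x $ a) x = (if a = i then ?c i t else 0)" for i a t x
    unfolding pd_eqI[OF ctr] by (simp add: axis_def)
  have cc: "continuous_on (U \<times> {0..1}) (\<lambda>(x, t). contraction M b t x)"
    unfolding contraction_def split_beta
  proof (intro continuous_on_vec_lambda)
    show "continuous_on (U \<times> {0..1}) (\<lambda>p. if i \<in> M then b $ i + snd p * (fst p $ i - b $ i) else fst p $ i)" for i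
      by (cases "i \<in> M") (auto intro!: continuous_intros)
  qed
  have cg: "continuous_on (U \<times> {0..1}) (\<lambda>(x, t). g (contraction M b t x))"
    if "continuous_on U g" for g :: "_ \<Rightarrow> real"
    using continuous_on_compose2[OF that cc] C by (fastforce simp: split_beta)
  have cg1: "continuous_on {0..1} (\<lambda>t. g (contraction M b t x))"
    if "continuous_on U g" "x \<in> U" for g :: "_ \<Rightarrow> real" and x
  proof -
    have "continuous_on {0..1} (\<lambda>t::real. (x, t))" by (intro continuous_intros)
    from continuous_on_compose2[OF cg[OF that(1)] this] show ?thesis using that(2) by auto
  qed
  define f' :: "real^'n \<Rightarrow> real \<Rightarrow> (real^'n) \<Rightarrow>\<^sub>L real" where
    "f' x t = (\<Sum>i\<in>UNIV. (w t * ?c i t * pd i f (contraction M b t x)) *\<^sub>R blinfun_inner_left (axis i 1))" for x t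
  have f': "blinfun_apply (f' x t) v = (\<Sum>i\<in>UNIV. w t * ?c i t * pd i f (contraction M b t x) * v $ i)" for x t v
    by (simp add: f'_def blinfun.sum_left blinfun.scaleR_left inner_axis)
  have fx: "((\<lambda>x. w t * f (contraction M b t x)) has_derivative blinfun_apply (f' x t)) (at x within U)"
    if "x \<in> U" "t \<in> {0..1}" for x t
  proof -
    have d: "(\<lambda>x. f (contraction M b t x)) differentiable (at x)"
      by (rule pd_compose(2)[OF ctrd fd[OF C[OF that(2,1)]]])
    have D: "((\<lambda>x. w t * f (contraction M b t x)) has_derivative
        (\<lambda>v. w t * frechet_derivative (\<lambda>x. f (contraction M b t x)) (at x) v)) (at x)"
      by (intro has_derivative_mult_right has_derivative_frechet d)
    have eq: "w t * frechet_derivative (\<lambda>x. f (contraction M b t x)) (at x) v = blinfun_apply (f' x t) v" for v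
      unfolding frechet_derivative_pd[OF d] f' sum_distrib_left
    proof (intro sum.cong refl)
      fix i
      have "pd i (\<lambda>x. f (contraction M b t x)) x = (\<Sum>a\<in>UNIV. pd a f (contraction M b t x) * (if a = i then ?c i t else 0))"
        by (simp only: pd_compose(1)[OF ctrd fd[OF C[OF that(2,1)]]] pdc)
      also have "\<dots> = pd i f (contraction M b t x) * ?c i t"
        by (simp add: if_distrib cong: if_cong)
      finally show "w t * (pd i (\<lambda>x. f (contraction M b t x)) x * v $ i) =
          w t * ?c i t * pd i f (contraction M b t x) * v $ i" by (simp only: mult_ac)
    qed
    show ?thesis
      using D unfolding eq by (rule has_derivative_at_withinI)
  qed
  have cw: "continuous_on (U \<times> {0..1}) (\<lambda>p. w (snd p))"
    by (rule continuous_on_compose2[OF w]) (auto intro!: continuous_intros)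
  have cci: "continuous_on A (\<lambda>p. ?c i (g p))" if "continuous_on A g" for A :: "'c::topological_space set" and g i
    using that by (cases "i \<in> M") (auto intro!: continuous_intros)
  have cf': "continuous_on (U \<times> cbox 0 1) (\<lambda>(x, t). f' x t)"
    unfolding f'_def split_beta cbox_interval
    by (intro continuous_intros cw cci cg[OF f(2), unfolded split_beta])
  have int: "(\<lambda>t. w t * f (contraction M b t x)) integrable_on cbox 0 1" if "x \<in> U" for x
    unfolding cbox_interval using fd U(1) that
    by (intro integrable_continuous_interval continuous_intros w cg1)
      (auto simp: continuous_on_eq_continuous_at differentiable_imp_continuous_within)
  have D: "(I w f has_derivative blinfun_apply (integral (cbox 0 1) (f' x))) (at x)"
    using leibniz_rule[of U 0 1 "\<lambda>x t. w t * f (contraction M b t x)" f' x, OF _ int cf' x U(2)] fx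
    unfolding I_def at_within_open[OF x U(1)] cbox_interval by blast
  then show "I w f differentiable (at x)" by (rule differentiableI)
  have f'i: "f' x integrable_on cbox 0 1"
  proof (rule integrable_continuous)
    have "continuous_on (cbox 0 1) (\<lambda>t::real. (x, t))" by (intro continuous_intros)
    from continuous_on_compose2[OF cf' this] show "continuous_on (cbox 0 1) (f' x)"
      using x by auto
  qed
  show "pd i (I w f) x = I (\<lambda>t. w t * ?c i t) (pd i f) x"
    unfolding pd_eqI[OF D] blinfun_apply_integral[OF f'i]
    unfolding I_def cbox_interval f' by (simp add: axis_def if_distrib cong: if_cong)
qed

lemma smooth_contraction_integral:
  fixes f :: "real^'n::finite \<Rightarrow> real" and w :: "real \<Rightarrow> real"
  assumes U: "open U" "convex U" and f: "smooth_fun_on U f" and w: "continuous_on {0..1} w"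
    and C: "\<And>t x. t \<in> {0..1} \<Longrightarrow> x \<in> U \<Longrightarrow> contraction M b t x \<in> U"
  shows "smooth_fun_on U (\<lambda>x. integral {0..1} (\<lambda>t. w t * f (contraction M b t x)))"
proof -
  have "Ck_on k (\<lambda>x. integral {0..1} (\<lambda>t. w t * f (contraction M b t x))) U" for k
    using f w
  proof (induction k arbitrary: f w)
    case 0
    have "f differentiable_on U"
      using 0(1) U(1) smooth_fun_on_differentiable by (auto simp: differentiable_on_eq_differentiable_at)
    moreover have "continuous_on U (pd i f)" for i
      using 0(1) by (intro smooth_fun_on_continuous smooth_intros)
    ultimately have "isCont (\<lambda>x. integral {0..1} (\<lambda>t. w t * f (contraction M b t x))) x" if "x \<in> U" for x
      using contraction_parametric_integral(1)[OF U _ _ 0(2) C that, of f]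
      by (intro differentiable_imp_continuous_within) auto
    then show ?case using U(1) by (simp add: continuous_on_eq_continuous_at)
  next
    case (Suc k)
    have fd: "f differentiable_on U"
      using Suc.prems(1) U(1) smooth_fun_on_differentiable by (auto simp: differentiable_on_eq_differentiable_at)
    have fc: "continuous_on U (pd i f)" for i
      using Suc.prems(1) by (intro smooth_fun_on_continuous smooth_intros)
    show ?case
    proof (rule Ck_on_Suc_I[OF U(1)])
      show "(\<lambda>x. integral {0..1} (\<lambda>t. w t * f (contraction M b t x))) differentiable (at x)" if "x \<in> U" for x
        by (rule contraction_parametric_integral(1)[OF U fd fc Suc.prems(2) C that])
      fix i
      have "continuous_on {0..1} (\<lambda>t::real. if i \<in> M then t else 1)"
        by (cases "i \<in> M") (auto intro!: continuous_intros)
      then have "Ck_on k (\<lambda>x. integral {0..1} (\<lambda>t. (w t * (if i \<in> M then t else 1)) * pd i f (contraction M b t x))) U"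
        using Suc.prems by (intro Suc.IH smooth_fun_on_pd continuous_intros)
      then show "Ck_on k (pd i (\<lambda>x. integral {0..1} (\<lambda>t. w t * f (contraction M b t x)))) U"
        by (rule Ck_on_cong[OF U(1), rotated])
          (simp only: contraction_parametric_integral(2)[OF U fd fc Suc.prems(2) C])
    qed
  qed
  then show ?thesis by (simp add: smooth_fun_on_def)
qed

text \<open>For \<open>M = UNIV\<close> this is the Poincare lemma for one-forms, for \<open>M = {m}\<close> integration with
  respect to one of the coordinates.\<close>

lemma smooth_primitive:
  fixes \<alpha> :: "'n::finite \<Rightarrow> real^'n \<Rightarrow> real"
  assumes U: "open U" "convex U" and b: "\<And>t x. t \<in> {0..1} \<Longrightarrow> x \<in> U \<Longrightarrow> contraction M b t x \<in> U"
    and sm: "\<And>i. i \<in> M \<Longrightarrow> smooth_fun_on U (\<alpha> i)"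
    and closed: "\<And>i j x. i \<in> M \<Longrightarrow> j \<in> M \<Longrightarrow> x \<in> U \<Longrightarrow> pd j (\<alpha> i) x = pd i (\<alpha> j) x"
  obtains f where "smooth_fun_on U f" "\<And>i x. i \<in> M \<Longrightarrow> x \<in> U \<Longrightarrow> pd i f x = \<alpha> i x"
proof -
  define I where "I w g x = integral {0..1} (\<lambda>t. w t * g (contraction M b t x))"
    for w :: "real \<Rightarrow> real" and g :: "real^'n \<Rightarrow> real" and x
  \<comment> \<open>The line integral of the form \<alpha> along the segment from the contracted
    point to \<open>x\<close>.\<close>
  define f where "f x = (\<Sum>i\<in>M. (x $ i - b $ i) * I (\<lambda>_. 1) (\<alpha> i) x)" for x
  have sI: "smooth_fun_on U (I w (\<alpha> i))" if "i \<in> M" "continuous_on {0..1} w" for w i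
    unfolding I_def[abs_def] by (intro smooth_contraction_integral[OF U sm[OF that(1)] that(2) b])
  have sf: "smooth_fun_on U f"
    unfolding f_def[abs_def] using sI by (intro smooth_intros U) (auto intro: smooth_intros)
  have "pd j f x = \<alpha> j x" if j: "j \<in> M" and x: "x \<in> U" for j x
  proof -
    have fd: "\<alpha> i differentiable_on U" if "i \<in> M" for i
      using sm[OF that] U(1) smooth_fun_on_differentiable by (auto simp: differentiable_on_eq_differentiable_at)
    have fc: "continuous_on U (pd j (\<alpha> i))" if "i \<in> M" for i j
      using sm[OF that] by (intro smooth_fun_on_continuous smooth_intros)
    have Id: "I (\<lambda>_. 1) (\<alpha> i) differentiable (at x)" if "i \<in> M" for i
      using smooth_fun_on_differentiable[OF sI[OF that] U(1) x] by simp
    have nd: "(\<lambda>x. x $ i - b $ i) differentiable (at x)" for i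
      by (intro differentiable_diff smooth_fun_on_differentiable[OF smooth_fun_on_nth open_UNIV]) auto
    have pn: "pd j (\<lambda>x. x $ i - b $ i) x = (if j = i then 1 else 0)" for i
      by (subst pd_diff) (auto intro: smooth_fun_on_differentiable[OF smooth_fun_on_nth open_UNIV])
    have pI: "pd j (I (\<lambda>_. 1) (\<alpha> i)) x = I (\<lambda>t. t) (pd i (\<alpha> j)) x" if "i \<in> M" for i
    proof -
      have "pd j (I (\<lambda>_. 1) (\<alpha> i)) x = I (\<lambda>t. t) (pd j (\<alpha> i)) x"
        using contraction_parametric_integral(2)[OF U fd[OF that] fc[OF that] continuous_on_const[of "{0..1}" "1::real"] b x, where i = j] j
        by (simp add: I_def[abs_def])
      also have "\<dots> = I (\<lambda>t. t) (pd i (\<alpha> j)) x"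
        unfolding I_def using closed[OF that j] b[OF _ x] by (intro integral_cong) simp
      finally show ?thesis .
    qed
    have "pd j f x = (\<Sum>i\<in>M. (x $ i - b $ i) * I (\<lambda>t. t) (pd i (\<alpha> j)) x + (if j = i then 1 else 0) * I (\<lambda>_. 1) (\<alpha> i) x)"
      unfolding f_def[abs_def]
      by (subst pd_sum) (auto intro!: nd Id sum.cong simp: pd_mult nd Id pn pI)
    also have "\<dots> = I (\<lambda>_. 1) (\<alpha> j) x + (\<Sum>i\<in>M. (x $ i - b $ i) * I (\<lambda>t. t) (pd i (\<alpha> j)) x)"
      using j by (simp add: sum.distrib if_distrib[of "\<lambda>c. c * _"] cong: if_cong)
    also have "\<dots> = \<alpha> j x"
    proof -
      let ?v = "\<chi> i. if i \<in> M then x $ i - b $ i else 0"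
      let ?y = "\<lambda>t. contraction M b t x"
      have y: "?y t = ?y 0 + t *\<^sub>R ?v" for t by (simp add: contraction_def vec_eq_iff)
      have ct: "continuous_on {0..1} ?y"
        unfolding contraction_def
      proof (intro continuous_on_vec_lambda)
        show "continuous_on {0..1} (\<lambda>t. if i \<in> M then b $ i + t * (x $ i - b $ i) else x $ i)" for i
          by (cases "i \<in> M") (auto intro!: continuous_intros)
      qed
      have cy: "continuous_on {0..1} (\<lambda>t. g (?y t))" if "continuous_on U g" for g :: "_ \<Rightarrow> real"
        using b x by (intro continuous_on_compose2[OF that ct]) auto
      \<comment> \<open>The integrand found for \<open>pd j f x\<close> is the derivative of
        \<open>t * \<alpha> j (?y t)\<close>, whose values at the end points are \<open>0\<close>
        and \<open>\<alpha> j x\<close>.\<close>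
      have "((\<lambda>t. t * \<alpha> j (?y t)) has_real_derivative
          (\<alpha> j (?y t) + (\<Sum>i\<in>M. (x $ i - b $ i) * (t * pd i (\<alpha> j) (?y t))))) (at t within {0..1})"
        if t: "t \<in> {0..1}" for t
      proof -
        have "\<alpha> j differentiable (at (?y 0 + t *\<^sub>R ?v))"
          using smooth_fun_on_differentiable[OF sm[OF j] U(1) b[OF t x]] y[of t] by simp
        from has_real_derivative_pd[OF this]
        have "((\<lambda>t. \<alpha> j (?y t)) has_real_derivative (\<Sum>i\<in>UNIV. pd i (\<alpha> j) (?y t) * ?v $ i)) (at t)"
          by (simp only: y[symmetric])
        also have "(\<Sum>i\<in>UNIV. pd i (\<alpha> j) (?y t) * ?v $ i) = (\<Sum>i\<in>M. (x $ i - b $ i) * pd i (\<alpha> j) (?y t))"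
          by (simp add: if_distrib sum.If_cases mult.commute cong: if_cong)
        finally have "((\<lambda>t. t * \<alpha> j (?y t)) has_real_derivative
          (1 * \<alpha> j (?y t) + (\<Sum>i\<in>M. (x $ i - b $ i) * pd i (\<alpha> j) (?y t)) * t)) (at t)"
          by (intro DERIV_mult DERIV_ident)
        moreover have "(\<Sum>i\<in>M. (x $ i - b $ i) * pd i (\<alpha> j) (?y t)) * t =
            (\<Sum>i\<in>M. (x $ i - b $ i) * (t * pd i (\<alpha> j) (?y t)))"
          unfolding sum_distrib_right by (intro sum.cong refl) (simp only: mult_ac)
        ultimately show ?thesis
          by (simp only: mult_1_left has_field_derivative_at_within)
      qed
      then have "((\<lambda>t. \<alpha> j (?y t) + (\<Sum>i\<in>M. (x $ i - b $ i) * (t * pd i (\<alpha> j) (?y t)))) has_integral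
          (1 * \<alpha> j (?y 1) - 0 * \<alpha> j (?y 0))) {0..1}"
        unfolding has_real_derivative_iff_has_vector_derivative
        by (rule fundamental_theorem_of_calculus[OF zero_le_one])
      moreover have "?y 1 = x" by (simp add: contraction_def vec_eq_iff)
      ultimately have "integral {0..1} (\<lambda>t. \<alpha> j (?y t) + (\<Sum>i\<in>M. (x $ i - b $ i) * (t * pd i (\<alpha> j) (?y t)))) = \<alpha> j x"
        by (simp add: integral_unique)
      moreover have "integral {0..1} (\<lambda>t. \<alpha> j (?y t) + (\<Sum>i\<in>M. (x $ i - b $ i) * (t * pd i (\<alpha> j) (?y t))))
          = I (\<lambda>_. 1) (\<alpha> j) x + (\<Sum>i\<in>M. (x $ i - b $ i) * I (\<lambda>t. t) (pd i (\<alpha> j)) x)"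
      proof -
        have i1: "(\<lambda>t. \<alpha> j (?y t)) integrable_on {0..1}"
          by (intro integrable_continuous_interval cy smooth_fun_on_continuous sm j)
        have i2: "(\<lambda>t. (x $ i - b $ i) * (t * pd i (\<alpha> j) (?y t))) integrable_on {0..1}" for i
          by (intro integrable_continuous_interval continuous_on_mult continuous_on_const
              continuous_on_id cy fc[OF j])
        show ?thesis
          by (simp add: integral_add[OF i1 integrable_sum] integral_sum i2 I_def)
      qed
      ultimately show ?thesis by simp
    qed
    finally show ?thesis .
  qed
  with sf show ?thesis by (rule that)
qed

subsection \<open>Behaviour of connections and curvature under coordinate changes\<close>

definition mpd :: "'n::finite \<Rightarrow> (real^'n \<Rightarrow> real^'m^'k) \<Rightarrow> real^'n \<Rightarrow> real^'m^'k" where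
  "mpd i M x = (\<chi> a b. pd i (\<lambda>y. M y $ a $ b) x)"

definition mdiff :: "(real^'n \<Rightarrow> real^'m^'k) \<Rightarrow> real^'n::finite \<Rightarrow> bool" where
  "mdiff M x \<longleftrightarrow> (\<forall>a b. (\<lambda>y. M y $ a $ b) differentiable (at x))"

lemma sum_rotate3:
  "(\<Sum>a\<in>A. \<Sum>b\<in>B. \<Sum>c\<in>C. f a b c) = (\<Sum>b\<in>B. \<Sum>c\<in>C. \<Sum>a\<in>A. f a b c)"
  by (rule trans[OF sum.swap], rule sum.cong[OF refl], rule sum.swap)

lemma mpd_mult:
  fixes A :: "real^'n::finite \<Rightarrow> real^'m::finite^'k::finite" and B :: "real^'n \<Rightarrow> real^'l::finite^'m"
  assumes "mdiff A x" "mdiff B x"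
  shows "mpd i (\<lambda>y. A y ** B y) x = A x ** mpd i B x + mpd i A x ** B x"
  using assms unfolding mdiff_def
  by (simp add: mpd_def matrix_matrix_mult_def vec_eq_iff pd_sum pd_mult sum.distrib)

lemma mpd_add:
  assumes "mdiff A x" "mdiff B x"
  shows "mpd i (\<lambda>y. A y + B y) x = mpd i A x + mpd i B x"
  using assms unfolding mdiff_def by (simp add: mpd_def vec_eq_iff pd_add)

lemma mpd_cong_open:
  assumes "open S" "x \<in> S" "\<And>y. y \<in> S \<Longrightarrow> A y = B y"
  shows "mpd i A x = mpd i B x"
proof -
  have "pd i (\<lambda>y. A y $ a $ b) x = pd i (\<lambda>y. B y $ a $ b) x" for a b
    by (rule pd_cong_open[OF assms(1,2)]) (simp only: assms(3))
  then show ?thesis by (simp add: mpd_def)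
qed

lemma mdiff_mult:
  fixes A :: "real^'n::finite \<Rightarrow> real^'m::finite^'k::finite" and B :: "real^'n \<Rightarrow> real^'l::finite^'m"
  assumes "mdiff A x" "mdiff B x"
  shows "mdiff (\<lambda>y. A y ** B y) x"
  using assms unfolding mdiff_def matrix_matrix_mult_def by auto

lemma matrix_distribs:
  fixes A :: "real^'m::finite^'k::finite"
  shows "A ** (B - C) = A ** B - A ** C" and "(D - E) ** A = D ** A - E ** A"
    and "A ** (B + C) = A ** B + A ** C" and "(D + E) ** A = D ** A + E ** A"
  by (simp_all add: vec_eq_iff matrix_matrix_mult_def algebra_simps sum_subtractf sum.distrib)

text \<open>Formulated for an arbitrary map in any dimension because it is applied both to
  transition maps of the surface and to their cotangent lifts with the Levi-Civita
  connections.\<close>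

definition connection_law ::
    "(real^'n) set \<Rightarrow> (real^'n \<Rightarrow> real^'n) \<Rightarrow> 'n tensor3_comp \<Rightarrow> ('n::finite) tensor3_comp \<Rightarrow> bool" where
  "connection_law S F \<Gamma> \<Gamma>' \<longleftrightarrow> (\<forall>x\<in>S. \<forall>i j a.
     (\<Sum>k\<in>UNIV. \<Gamma> x i j k * jac F x a k) = pd i (\<lambda>y. jac F y a j) x +
     (\<Sum>b\<in>UNIV. \<Sum>e\<in>UNIV. jac F x b i * jac F x e j * \<Gamma>' (F x) b e a))"

text \<open>In matrix form the transformation law reads \<open>J G\<^sub>i = \<partial>\<^sub>i J + H\<^sub>i J\<close>, where \<open>H\<close> is the pulled back
  connection, so \<open>J\<close> is a gauge transformation and intertwines the two curvatures.\<close>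

lemma riemann_transform:
  fixes F :: "real^'n::finite \<Rightarrow> real^'n"
  assumes S: "open S" and T: "open T" and F: "smooth_map_on S F" and FS: "F ` S \<subseteq> T"
    and \<Gamma>: "\<And>i j k. smooth_fun_on S (\<lambda>x. \<Gamma> x i j k)"
    and \<Gamma>': "\<And>i j k. smooth_fun_on T (\<lambda>x. \<Gamma>' x i j k)"
    and law: "connection_law S F \<Gamma> \<Gamma>'" and x: "x \<in> S"
  shows "(\<Sum>l\<in>UNIV. riemann \<Gamma> x i j k l * jac F x a l) =
    (\<Sum>b\<in>UNIV. \<Sum>c\<in>UNIV. \<Sum>d\<in>UNIV. jac F x b i * jac F x c j * jac F x d k * riemann \<Gamma>' (F x) b c d a)"
proof -
  define J where "J y = (\<chi> a k. jac F y a k)" for y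
  \<comment> \<open>With the upper index labelling rows, the curvature becomes the matrix d_i G_j -
    d_j G_i + [G_i, G_j], which is fact \<open>R\<close> below.\<close>
  define G where "G i y = (\<chi> k j. \<Gamma> y i j k)" for i y
  define G' where "G' b y = (\<chi> a e. \<Gamma>' y b e a)" for b y
  define H where "H i y = (\<Sum>b\<in>UNIV. jac F y b i *\<^sub>R G' b (F y))" for i y
  define R where "R i j = (\<chi> l k. riemann \<Gamma> x i j k l)" for i j
  define R' where "R' b c = (\<chi> a d. riemann \<Gamma>' (F x) b c d a)" for b c
  have Fx: "F x \<in> T" using FS x by auto
  have dJ: "(\<lambda>y. jac F y a k) differentiable (at y)" if "y \<in> S" for a k y
    by (rule smooth_fun_on_differentiable[OF smooth_jac[OF F] S that])
  have dF: "(\<lambda>x. F x $ a) differentiable (at y)" if "y \<in> S" for a y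
    by (rule smooth_map_on_differentiable[OF F S that])
  have dG': "(\<lambda>y. \<Gamma>' y b e a) differentiable (at (F x))" for b e a
    by (rule smooth_fun_on_differentiable[OF \<Gamma>' T Fx])
  have dG'F: "(\<lambda>y. \<Gamma>' (F y) b e a) differentiable (at x)" for b e a
    by (rule pd_compose(2)[OF dF[OF x] dG'])
  have mJ: "mdiff J x" unfolding mdiff_def J_def using dJ[OF x] by simp
  have mG: "mdiff (G i) x" for i
    unfolding mdiff_def G_def using smooth_fun_on_differentiable[OF \<Gamma> S x] by simp
  have Hent: "H i y $ a $ e = (\<Sum>b\<in>UNIV. jac F y b i * \<Gamma>' (F y) b e a)" for i y a e
    by (simp add: H_def G'_def sum_component)
  have mH: "mdiff (H i) x" for i
    unfolding mdiff_def Hent using dJ[OF x] dG'F by simp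
  have mpJ: "mdiff (mpd i J) x" for i
    unfolding mdiff_def mpd_def J_def
    using smooth_fun_on_differentiable[OF smooth_fun_on_pd[OF smooth_jac[OF F]] S x] by simp
  have L: "J y ** G i y = mpd i J y + H i y ** J y" if "y \<in> S" for i y
  proof -
    have "(\<Sum>k\<in>UNIV. jac F y a k * \<Gamma> y i j k) = pd i (\<lambda>y. jac F y a j) y +
       (\<Sum>e\<in>UNIV. (\<Sum>b\<in>UNIV. jac F y b i * \<Gamma>' (F y) b e a) * jac F y e j)" for a j
    proof -
      have "(\<Sum>b\<in>UNIV. \<Sum>e\<in>UNIV. jac F y b i * jac F y e j * \<Gamma>' (F y) b e a) =
          (\<Sum>e\<in>UNIV. (\<Sum>b\<in>UNIV. jac F y b i * \<Gamma>' (F y) b e a) * jac F y e j)"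
        unfolding sum_distrib_right by (rule trans[OF sum.swap]) (simp only: mult_ac)
      then show ?thesis
        using law[unfolded connection_law_def, rule_format, OF that, of i j a]
        by (simp add: mult.commute)
    qed
    then show ?thesis
      by (simp add: vec_eq_iff matrix_matrix_mult_def Hent) (simp add: J_def G_def mpd_def)
  qed
  have symJ: "mpd i (mpd j J) x = mpd j (mpd i J) x" for i j
    unfolding mpd_def J_def vec_eq_iff
    by (simp add: pd_commute[OF smooth_jac[OF F] S x, of i j])
  have dL: "J x ** mpd i (G j) x + mpd i J x ** G j x =
      mpd i (mpd j J) x + (H j x ** mpd i J x + mpd i (H j) x ** J x)" for i j
  proof -
    have "mpd i (\<lambda>y. J y ** G j y) x = mpd i (\<lambda>y. mpd j J y + H j y ** J y) x"
      by (rule mpd_cong_open[OF S x L])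
    then show ?thesis
      by (simp only: mpd_mult[OF mJ mG] mpd_add[OF mpJ mdiff_mult[OF mH mJ]] mpd_mult[OF mH mJ])
  qed
  have R: "R i j = mpd i (G j) x - mpd j (G i) x + G i x ** G j x - G j x ** G i x" for i j
    by (simp add: R_def riemann_def G_def mpd_def vec_eq_iff matrix_matrix_mult_def mult.commute)
  have JGG: "J x ** G i x ** G j x = mpd i J x ** G j x + H i x ** mpd j J x + H i x ** H j x ** J x" for i j
  proof -
    have "J x ** G i x ** G j x = mpd i J x ** G j x + H i x ** (J x ** G j x)"
      unfolding L[OF x, of i] by (simp only: matrix_distribs(4) matrix_mul_assoc)
    then show ?thesis by (simp only: L[OF x] matrix_distribs matrix_mul_assoc add.assoc)
  qed
  have dL': "J x ** mpd i (G j) x =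
      mpd i (mpd j J) x + (H j x ** mpd i J x + mpd i (H j) x ** J x) - mpd i J x ** G j x" for i j
    using dL[of i j] by (simp only: eq_diff_eq)
  \<comment> \<open>The second derivatives of \<open>J\<close> agree by \<open>symJ\<close>, and the
    products of a derivative of \<open>J\<close> with \<open>G\<close> or \<open>H\<close> cancel in
    pairs.\<close>
  have JR: "J x ** R i j = (mpd i (H j) x - mpd j (H i) x + H i x ** H j x - H j x ** H i x) ** J x" for i j
    unfolding R matrix_distribs matrix_mul_assoc JGG
    unfolding dL'[of i j] dL'[of j i] symJ[of i j] by (simp add: algebra_simps)
  have mpdH: "mpd i (H j) x = (\<Sum>b\<in>UNIV. pd i (\<lambda>y. jac F y b j) x *\<^sub>R G' b (F x)) +
      (\<Sum>b\<in>UNIV. \<Sum>c\<in>UNIV. (jac F x b i * jac F x c j) *\<^sub>R mpd b (G' c) (F x))" for i j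
  proof -
    have "pd i (\<lambda>y. \<Gamma>' (F y) c e a) x = (\<Sum>b\<in>UNIV. pd b (\<lambda>y. \<Gamma>' y c e a) (F x) * jac F x b i)" for c e a
      unfolding jac_def by (rule pd_compose(1)[OF dF[OF x] dG'])
    then have "pd i (\<lambda>y. \<Sum>b\<in>UNIV. jac F y b j * \<Gamma>' (F y) b e a) x =
      (\<Sum>b\<in>UNIV. pd i (\<lambda>y. jac F y b j) x * \<Gamma>' (F x) b e a) +
      (\<Sum>c\<in>UNIV. \<Sum>b\<in>UNIV. jac F x b i * jac F x c j * pd b (\<lambda>y. \<Gamma>' y c e a) (F x))" for e a
      using dJ[OF x] dG'F by (simp add: pd_sum pd_mult sum.distrib sum_distrib_left mult_ac)
    then show ?thesis
      by (subst sum.swap) (simp add: mpd_def Hent vec_eq_iff sum_component G'_def)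
  qed
  have symd: "pd i (\<lambda>y. jac F y b j) x = pd j (\<lambda>y. jac F y b i) x" for i j b
    unfolding jac_def using F unfolding smooth_map_on_def
    by (intro pd_commute[OF _ S x]) simp
  have HH: "H i x ** H j x = (\<Sum>b\<in>UNIV. \<Sum>c\<in>UNIV. (jac F x b i * jac F x c j) *\<^sub>R (G' b (F x) ** G' c (F x)))" for i j
  proof -
    have "(\<Sum>m\<in>UNIV. (\<Sum>b\<in>UNIV. jac F x b i * \<Gamma>' (F x) b m a) * (\<Sum>c\<in>UNIV. jac F x c j * \<Gamma>' (F x) c e m)) =
      (\<Sum>b\<in>UNIV. \<Sum>c\<in>UNIV. jac F x b i * jac F x c j * (\<Sum>m\<in>UNIV. \<Gamma>' (F x) b m a * \<Gamma>' (F x) c e m))" for a e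
      unfolding sum_product
      by (rule trans[OF sum_rotate3]) (simp only: sum_distrib_left mult_ac)
    then show ?thesis
      by (simp add: vec_eq_iff matrix_matrix_mult_def Hent sum_component) (simp add: G'_def)
  qed
  have R': "R' b c = mpd b (G' c) (F x) - mpd c (G' b) (F x) + G' b (F x) ** G' c (F x) - G' c (F x) ** G' b (F x)" for b c
    by (simp add: R'_def riemann_def G'_def mpd_def vec_eq_iff matrix_matrix_mult_def mult.commute)
  have sw: "(\<Sum>b\<in>UNIV. \<Sum>c\<in>UNIV. (jac F x b j * jac F x c i) *\<^sub>R Q b c) =
      (\<Sum>b\<in>UNIV. \<Sum>c\<in>UNIV. (jac F x b i * jac F x c j) *\<^sub>R Q c b)" for Q :: "'n \<Rightarrow> 'n \<Rightarrow> real^'n^'n"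
    by (subst sum.swap) (simp add: mult.commute)
  \<comment> \<open>The second derivatives of \<open>F\<close> contained in the derivative of
    \<open>H\<close> are symmetric in \<open>i\<close> and \<open>j\<close> and drop out.\<close>
  have key: "J x ** R i j = (\<Sum>b\<in>UNIV. \<Sum>c\<in>UNIV. (jac F x b i * jac F x c j) *\<^sub>R R' b c) ** J x"
    unfolding JR mpdH[of i j] mpdH[of j i] HH[of i j] HH[of j i] symd[of i _ j] sw R'
    by (simp add: algebra_simps sum.distrib sum_subtractf)
  have "(J x ** R i j) $ a $ k = (\<Sum>l\<in>UNIV. riemann \<Gamma> x i j k l * jac F x a l)"
    by (simp add: matrix_matrix_mult_def J_def R_def mult.commute)
  moreover have "((\<Sum>b\<in>UNIV. \<Sum>c\<in>UNIV. (jac F x b i * jac F x c j) *\<^sub>R R' b c) ** J x) $ a $ k =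
    (\<Sum>d\<in>UNIV. \<Sum>b\<in>UNIV. \<Sum>c\<in>UNIV. jac F x b i * jac F x c j * jac F x d k * riemann \<Gamma>' (F x) b c d a)"
    by (simp add: matrix_matrix_mult_def J_def R'_def sum_component sum_distrib_left sum_distrib_right mult_ac)
  moreover have "\<dots> = (\<Sum>b\<in>UNIV. \<Sum>c\<in>UNIV. \<Sum>d\<in>UNIV. jac F x b i * jac F x c j * jac F x d k * riemann \<Gamma>' (F x) b c d a)"
    by (rule sum_rotate3)
  ultimately show ?thesis using key by simp
qed

lemma sum_delta_mult [simp]:
  fixes f :: "'n::finite \<Rightarrow> real"
  shows "(\<Sum>a\<in>UNIV. (if a = b then 1 else 0) * f a) = f b"
    and "(\<Sum>a\<in>UNIV. (if b = a then 1 else 0) * f a) = f b"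
    and "(\<Sum>a\<in>UNIV. f a * (if a = b then 1 else 0)) = f b"
    and "(\<Sum>a\<in>UNIV. f a * (if b = a then 1 else 0)) = f b"
  by (simp_all add: if_distrib if_distribR cong: if_cong)

section \<open>Transformation of the Ricci tensor and of covariant derivatives\<close>

definition pull2 :: "('n::finite \<Rightarrow> 'n \<Rightarrow> real) \<Rightarrow> ('n \<Rightarrow> 'n \<Rightarrow> real) \<Rightarrow> 'n \<Rightarrow> 'n \<Rightarrow> real" where
  "pull2 J M i j = (\<Sum>a\<in>UNIV. \<Sum>b\<in>UNIV. J a i * J b j * M a b)"

definition pull4 :: "('n::finite \<Rightarrow> 'n \<Rightarrow> real) \<Rightarrow> ('n \<Rightarrow> 'n \<Rightarrow> 'n \<Rightarrow> 'n \<Rightarrow> real) \<Rightarrow>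
    'n \<Rightarrow> 'n \<Rightarrow> 'n \<Rightarrow> 'n \<Rightarrow> real" where
  "pull4 J W i j k l =
     (\<Sum>a\<in>UNIV. \<Sum>b\<in>UNIV. \<Sum>c\<in>UNIV. \<Sum>d\<in>UNIV. J a i * J b j * J c k * J d l * W a b c d)"

definition inverse_matrices :: "('n::finite \<Rightarrow> 'n \<Rightarrow> real) \<Rightarrow> ('n \<Rightarrow> 'n \<Rightarrow> real) \<Rightarrow> bool" where
  "inverse_matrices J K \<longleftrightarrow> (\<forall>a b. (\<Sum>i\<in>UNIV. J a i * K i b) = (if a = b then 1 else 0)) \<and>
     (\<forall>i j. (\<Sum>a\<in>UNIV. K i a * J a j) = (if i = j then 1 else 0))"

text \<open>Multiplying the law for the curvature by \<open>K\<close> frees the upper index; in the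
  trace this \<open>K\<close> meets the \<open>J\<close> of the first lower index and cancels
  it.\<close>

lemma ricci_transform:
  fixes J :: "'n::finite \<Rightarrow> 'n \<Rightarrow> real"
  assumes JK: "inverse_matrices J K"
    and R: "\<And>i j k a. (\<Sum>l\<in>UNIV. riemann \<Gamma> x i j k l * J a l) =
    (\<Sum>b\<in>UNIV. \<Sum>c\<in>UNIV. \<Sum>d\<in>UNIV. J b i * J c j * J d k * riemann \<Gamma>' y b c d a)"
  shows "ricci \<Gamma> x j k = pull2 J (ricci \<Gamma>' y) j k"
proof -
  have 1: "(\<Sum>i\<in>UNIV. J b i * K i a) = (if b = a then 1 else 0)"
    and 2: "(\<Sum>a\<in>UNIV. K i a * J a j) = (if i = j then 1 else 0)" for a b i j
    using JK by (auto simp: inverse_matrices_def)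
  have "riemann \<Gamma> x i j k i = (\<Sum>a\<in>UNIV. K i a * (\<Sum>l\<in>UNIV. riemann \<Gamma> x i j k l * J a l))" for i
  proof -
    have "(\<Sum>a\<in>UNIV. K i a * (\<Sum>l\<in>UNIV. riemann \<Gamma> x i j k l * J a l)) =
        (\<Sum>l\<in>UNIV. riemann \<Gamma> x i j k l * (\<Sum>a\<in>UNIV. K i a * J a l))"
      unfolding sum_distrib_left by (rule trans[OF sum.swap]) (simp only: mult_ac)
    then show ?thesis by (simp add: 2)
  qed
  then have "ricci \<Gamma> x j k = (\<Sum>i\<in>UNIV. \<Sum>a\<in>UNIV. K i a *
      (\<Sum>b\<in>UNIV. \<Sum>c\<in>UNIV. \<Sum>d\<in>UNIV. J b i * J c j * J d k * riemann \<Gamma>' y b c d a))"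
    by (simp only: ricci_def R)
  also have "\<dots> = (\<Sum>a\<in>UNIV. \<Sum>i\<in>UNIV. \<Sum>b\<in>UNIV. J b i * K i a *
      (\<Sum>c\<in>UNIV. \<Sum>d\<in>UNIV. J c j * J d k * riemann \<Gamma>' y b c d a))"
    unfolding sum_distrib_left by (rule trans[OF sum.swap]) (simp only: mult_ac)
  also have "\<dots> = (\<Sum>a\<in>UNIV. \<Sum>b\<in>UNIV. (\<Sum>i\<in>UNIV. J b i * K i a) *
      (\<Sum>c\<in>UNIV. \<Sum>d\<in>UNIV. J c j * J d k * riemann \<Gamma>' y b c d a))"
    unfolding sum_distrib_right by (intro sum.cong refl sum.swap)
  also have "\<dots> = (\<Sum>a\<in>UNIV. \<Sum>c\<in>UNIV. \<Sum>d\<in>UNIV. J c j * J d k * riemann \<Gamma>' y a c d a)"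
    by (simp add: 1)
  also have "\<dots> = (\<Sum>c\<in>UNIV. \<Sum>d\<in>UNIV. \<Sum>a\<in>UNIV. J c j * J d k * riemann \<Gamma>' y a c d a)"
    by (rule sum_rotate3)
  finally show ?thesis by (simp add: pull2_def ricci_def sum_distrib_left)
qed

lemma cov_deriv_02_transform:
  fixes F :: "real^'n::finite \<Rightarrow> real^'n"
  assumes S: "open S" and T: "open T" and F: "smooth_map_on S F" and FS: "F ` S \<subseteq> T"
    and \<Phi>: "\<And>i j. smooth_fun_on T (\<lambda>x. \<Phi>' x i j)"
    and pull: "\<And>y i j. y \<in> S \<Longrightarrow> \<Phi> y i j = pull2 (jac F y) (\<Phi>' (F y)) i j"
    and law: "connection_law S F \<Gamma> \<Gamma>'" and x: "x \<in> S"
  shows "cov_deriv_02 \<Gamma> \<Phi> x i j k = (\<Sum>a\<in>UNIV. \<Sum>b\<in>UNIV. \<Sum>c\<in>UNIV.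
    jac F x a i * jac F x b j * jac F x c k * cov_deriv_02 \<Gamma>' \<Phi>' (F x) a b c)"
proof -
  let ?J = "jac F x"
  have Fx: "F x \<in> T" using FS x by auto
  have dJ: "(\<lambda>y. jac F y a k) differentiable (at x)" for a k
    by (rule smooth_fun_on_differentiable[OF smooth_jac[OF F] S x])
  have dF: "(\<lambda>x. F x $ a) differentiable (at x)" for a
    by (rule smooth_map_on_differentiable[OF F S x])
  have d\<Phi>: "(\<lambda>y. \<Phi>' y a b) differentiable (at (F x))" for a b
    by (rule smooth_fun_on_differentiable[OF \<Phi> T Fx])
  have d\<Phi>F: "(\<lambda>y. \<Phi>' (F y) a b) differentiable (at x)" for a b
    by (rule pd_compose(2)[OF dF d\<Phi>])
  have p\<Phi>: "pd k (\<lambda>y. \<Phi>' (F y) a b) x = (\<Sum>c\<in>UNIV. ?J c k * pd c (\<lambda>y. \<Phi>' y a b) (F x))" for a b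
    unfolding jac_def by (simp only: pd_compose(1)[OF dF d\<Phi>] mult.commute)
  have "pd k (\<lambda>y. \<Phi> y i j) x = pd k (\<lambda>y. pull2 (jac F y) (\<Phi>' (F y)) i j) x"
    using pull by (rule pd_cong_open[OF S x])
  also have "\<dots> = (\<Sum>a\<in>UNIV. \<Sum>b\<in>UNIV. pd k (\<lambda>y. jac F y a i) x * ?J b j * \<Phi>' (F x) a b)
     + (\<Sum>a\<in>UNIV. \<Sum>b\<in>UNIV. ?J a i * pd k (\<lambda>y. jac F y b j) x * \<Phi>' (F x) a b)
     + (\<Sum>a\<in>UNIV. \<Sum>b\<in>UNIV. ?J a i * ?J b j * (\<Sum>c\<in>UNIV. ?J c k * pd c (\<lambda>y. \<Phi>' y a b) (F x)))"
    unfolding pull2_def using dJ d\<Phi>F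
    by (simp add: pd_sum pd_mult p\<Phi> sum.distrib algebra_simps)
  finally have 1: "pd k (\<lambda>y. \<Phi> y i j) x = \<dots>" .
  \<comment> \<open>Second derivatives of \<open>F\<close> are traded for the two connections: the
    terms with \<open>\<Gamma>\<close> cancel those on the left-hand side, the terms with
    \<open>\<Gamma>'\<close> complete the covariant derivative on the target.\<close>
  have law': "pd k (\<lambda>y. jac F y a i) x = (\<Sum>m\<in>UNIV. \<Gamma> x k i m * ?J a m) -
      (\<Sum>c\<in>UNIV. \<Sum>e\<in>UNIV. ?J c k * ?J e i * \<Gamma>' (F x) c e a)" for a i
    using law[unfolded connection_law_def, rule_format, OF x, of k i a] by simp
  have 2: "(\<Sum>m\<in>UNIV. \<Gamma> x k i m * \<Phi> x m j) =
      (\<Sum>a\<in>UNIV. \<Sum>b\<in>UNIV. (\<Sum>m\<in>UNIV. \<Gamma> x k i m * ?J a m) * ?J b j * \<Phi>' (F x) a b)"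
    unfolding pull[OF x] pull2_def sum_distrib_left sum_distrib_right
    by (rule trans[OF sum_rotate3]) (simp only: mult_ac)
  have 3: "(\<Sum>m\<in>UNIV. \<Gamma> x k j m * \<Phi> x i m) =
      (\<Sum>a\<in>UNIV. \<Sum>b\<in>UNIV. ?J a i * (\<Sum>m\<in>UNIV. \<Gamma> x k j m * ?J b m) * \<Phi>' (F x) a b)"
    unfolding pull[OF x] pull2_def sum_distrib_left sum_distrib_right
    by (rule trans[OF sum_rotate3]) (simp only: mult_ac)
  have 4: "(\<Sum>a\<in>UNIV. \<Sum>b\<in>UNIV. (\<Sum>c\<in>UNIV. \<Sum>e\<in>UNIV. ?J c k * ?J e i * \<Gamma>' (F x) c e a) * ?J b j * \<Phi>' (F x) a b)
      = (\<Sum>a\<in>UNIV. \<Sum>b\<in>UNIV. \<Sum>c\<in>UNIV. ?J a i * ?J b j * ?J c k * (\<Sum>m\<in>UNIV. \<Gamma>' (F x) c a m * \<Phi>' (F x) m b))"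
  proof -
    have "(\<Sum>a\<in>UNIV. \<Sum>b\<in>UNIV. (\<Sum>c\<in>UNIV. \<Sum>e\<in>UNIV. ?J c k * ?J e i * \<Gamma>' (F x) c e a) * ?J b j * \<Phi>' (F x) a b)
      = (\<Sum>m\<in>UNIV. \<Sum>b\<in>UNIV. \<Sum>c\<in>UNIV. \<Sum>a\<in>UNIV. ?J a i * ?J b j * ?J c k * (\<Gamma>' (F x) c a m * \<Phi>' (F x) m b))"
      unfolding sum_distrib_left sum_distrib_right by (simp only: mult_ac)
    also have "\<dots> = (\<Sum>b\<in>UNIV. \<Sum>c\<in>UNIV. \<Sum>a\<in>UNIV. \<Sum>m\<in>UNIV. ?J a i * ?J b j * ?J c k * (\<Gamma>' (F x) c a m * \<Phi>' (F x) m b))"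
      by (rule trans[OF sum.swap], rule sum.cong[OF refl], rule sum_rotate3)
    also have "\<dots> = (\<Sum>b\<in>UNIV. \<Sum>a\<in>UNIV. \<Sum>c\<in>UNIV. \<Sum>m\<in>UNIV. ?J a i * ?J b j * ?J c k * (\<Gamma>' (F x) c a m * \<Phi>' (F x) m b))"
      by (rule sum.cong[OF refl], rule sum.swap)
    also have "\<dots> = (\<Sum>a\<in>UNIV. \<Sum>b\<in>UNIV. \<Sum>c\<in>UNIV. \<Sum>m\<in>UNIV. ?J a i * ?J b j * ?J c k * (\<Gamma>' (F x) c a m * \<Phi>' (F x) m b))"
      by (rule sum.swap)
    finally show ?thesis by (simp only: sum_distrib_left)
  qed
  have 5: "(\<Sum>a\<in>UNIV. \<Sum>b\<in>UNIV. ?J a i * (\<Sum>c\<in>UNIV. \<Sum>e\<in>UNIV. ?J c k * ?J e j * \<Gamma>' (F x) c e b) * \<Phi>' (F x) a b)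
      = (\<Sum>a\<in>UNIV. \<Sum>b\<in>UNIV. \<Sum>c\<in>UNIV. ?J a i * ?J b j * ?J c k * (\<Sum>m\<in>UNIV. \<Gamma>' (F x) c b m * \<Phi>' (F x) a m))"
  proof (rule sum.cong[OF refl])
    fix a
    have "(\<Sum>b\<in>UNIV. ?J a i * (\<Sum>c\<in>UNIV. \<Sum>e\<in>UNIV. ?J c k * ?J e j * \<Gamma>' (F x) c e b) * \<Phi>' (F x) a b)
      = (\<Sum>m\<in>UNIV. \<Sum>c\<in>UNIV. \<Sum>b\<in>UNIV. ?J a i * ?J b j * ?J c k * (\<Gamma>' (F x) c b m * \<Phi>' (F x) a m))"
      by (simp add: sum_distrib_right sum_distrib_left mult_ac)
    also have "\<dots> = (\<Sum>c\<in>UNIV. \<Sum>b\<in>UNIV. \<Sum>m\<in>UNIV. ?J a i * ?J b j * ?J c k * (\<Gamma>' (F x) c b m * \<Phi>' (F x) a m))"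
      by (rule sum_rotate3)
    also have "\<dots> = (\<Sum>b\<in>UNIV. \<Sum>c\<in>UNIV. \<Sum>m\<in>UNIV. ?J a i * ?J b j * ?J c k * (\<Gamma>' (F x) c b m * \<Phi>' (F x) a m))"
      by (rule sum.swap)
    finally show "(\<Sum>b\<in>UNIV. ?J a i * (\<Sum>c\<in>UNIV. \<Sum>e\<in>UNIV. ?J c k * ?J e j * \<Gamma>' (F x) c e b) * \<Phi>' (F x) a b)
      = (\<Sum>b\<in>UNIV. \<Sum>c\<in>UNIV. ?J a i * ?J b j * ?J c k * (\<Sum>m\<in>UNIV. \<Gamma>' (F x) c b m * \<Phi>' (F x) a m))"
      by (simp only: sum_distrib_left)
  qed
  have 6: "(\<Sum>a\<in>UNIV. \<Sum>b\<in>UNIV. (p a - q a) * r b * s a b) = (\<Sum>a\<in>UNIV. \<Sum>b\<in>UNIV. p a * r b * s a b) -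
      (\<Sum>a\<in>UNIV. \<Sum>b\<in>UNIV. q a * r b * s a b)"
    "(\<Sum>a\<in>UNIV. \<Sum>b\<in>UNIV. r a * (p b - q b) * s a b) = (\<Sum>a\<in>UNIV. \<Sum>b\<in>UNIV. r a * p b * s a b) -
      (\<Sum>a\<in>UNIV. \<Sum>b\<in>UNIV. r a * q b * s a b)" for p q r :: "'n \<Rightarrow> real" and s
    by (simp_all add: algebra_simps sum_subtractf)
  show ?thesis
    unfolding cov_deriv_02_def 1 2 3 law' 6 4 5
    by (simp add: sum_subtractf right_diff_distrib sum_distrib_left mult_ac)
qed

subsection \<open>Walker metrics\<close>

lemma lc_symbol_swap23: "lc_symbol i k j l = - lc_symbol i j k l"
proof (cases "j = k")
  case True
  have "row (2::4) (vector [axis i 1, axis k 1, axis k 1, axis l 1] :: real^4^4) =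
        row (3::4) (vector [axis i 1, axis k 1, axis k 1, axis l 1])"
    by (simp add: row_def)
  then have "lc_symbol i k k l = 0"
    unfolding lc_symbol_def by (intro det_identical_rows[of "2::4" 3]) auto
  then show ?thesis using True by simp
next
  case False
  let ?M = "vector [axis i 1, axis j 1, axis k 1, axis l 1] :: real^4^4"
  have "(vector [axis i 1, axis k 1, axis j 1, axis l 1] :: real^4^4) =
      (\<chi> r. ?M $ Transposition.transpose 2 3 r)"
    by (simp add: vec_eq_iff forall_4 Transposition.transpose_def)
  then show ?thesis
    using det_permute_rows[of "Transposition.transpose 2 3" ?M]
    by (simp add: lc_symbol_def permutes_swap_id sign_swap_id)
qed

lemma lc_symbol_repeated:
  "lc_symbol i i k l = 0" "lc_symbol i j j l = 0" "lc_symbol i j k k = 0"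
  using lc_symbol_swap12[of i i k l] lc_symbol_swap23[of i j j l] lc_symbol_swap34[of i j k k]
  by simp_all

text \<open>Only decreasing neighbours are swapped, so rewriting sorts the four indices and
  terminates.\<close>

lemmas lc_symbol_sort =
  lc_symbol_swap12[of 2 1] lc_symbol_swap12[of 3 1] lc_symbol_swap12[of 4 1]
  lc_symbol_swap12[of 3 2] lc_symbol_swap12[of 4 2] lc_symbol_swap12[of 4 3]
  lc_symbol_swap23[of _ 2 1] lc_symbol_swap23[of _ 3 1] lc_symbol_swap23[of _ 4 1]
  lc_symbol_swap23[of _ 3 2] lc_symbol_swap23[of _ 4 2] lc_symbol_swap23[of _ 4 3]
  lc_symbol_swap34[of _ _ 2 1] lc_symbol_swap34[of _ _ 3 1] lc_symbol_swap34[of _ _ 4 1]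
  lc_symbol_swap34[of _ _ 3 2] lc_symbol_swap34[of _ _ 4 2] lc_symbol_swap34[of _ _ 4 3]

definition skew :: "real \<Rightarrow> real \<Rightarrow> real \<Rightarrow> real \<Rightarrow> real \<Rightarrow> real \<Rightarrow> real^4^4" where
  "skew p q r s t u = vector [vector [0, p, q, r], vector [- p, 0, s, t],
     vector [- q, - s, 0, u], vector [- r, - t, - u, 0]]"

lemma skew_nth [simp]:
  "skew p q r s t u $ 1 $ 1 = 0" "skew p q r s t u $ 1 $ 2 = p" "skew p q r s t u $ 1 $ 3 = q"
  "skew p q r s t u $ 1 $ 4 = r" "skew p q r s t u $ 2 $ 1 = - p" "skew p q r s t u $ 2 $ 2 = 0"
  "skew p q r s t u $ 2 $ 3 = s" "skew p q r s t u $ 2 $ 4 = t" "skew p q r s t u $ 3 $ 1 = - q"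
  "skew p q r s t u $ 3 $ 2 = - s" "skew p q r s t u $ 3 $ 3 = 0" "skew p q r s t u $ 3 $ 4 = u"
  "skew p q r s t u $ 4 $ 1 = - r" "skew p q r s t u $ 4 $ 2 = - t" "skew p q r s t u $ 4 $ 3 = - u"
  "skew p q r s t u $ 4 $ 4 = 0"
  by (simp_all add: skew_def)

lemma bivector_skew: "bivector B \<longleftrightarrow>
  B = skew (B $ 1 $ 2) (B $ 1 $ 3) (B $ 1 $ 4) (B $ 2 $ 3) (B $ 2 $ 4) (B $ 3 $ 4)"
  unfolding bivector_def vec_eq_iff forall_4 by simp argo

text \<open>Duality exchanges an index pair with its complement, which reverses the order of the six
  entries; the signs are those of the permutations, and the volume factor is \<open>1\<close> by
  \<open>abs_det_block_form\<close>.\<close>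

lemma hodge_skew_block_form:
  assumes g: "g z = block_form P 1" and P: "P 2 1 = P 1 2"
  shows "hodge s g z (skew p q r t u v) = raise2 g z (\<lambda>i j. s * skew v (- u) t r (- q) p $ i $ j)"
proof -
  have "(1/2) * (\<Sum>k\<in>UNIV. \<Sum>l\<in>UNIV. s * sqrt \<bar>det (g z)\<bar> * lc_symbol i j k l * skew p q r t u v $ k $ l) =
      s * skew v (- u) t r (- q) p $ i $ j" for i j
    using exhaust_4[of i] exhaust_4[of j]
    by (elim disjE) (simp_all add: g abs_det_block_form sum_4 lc_symbol_repeated lc_symbol_sort lc_symbol_1234)
  then show ?thesis unfolding hodge_def by simp
qed

lemma raise2_eq_0_block_form:
  assumes g: "g z = block_form P 1"
  shows "raise2 g z L = 0 \<longleftrightarrow> (\<forall>i j. L i j = 0)"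
proof
  assume "raise2 g z L = 0"
  then have "\<forall>i j. raise2 g z L $ i $ j = 0" by simp
  then show "\<forall>i j. L i j = 0"
    by (simp add: forall_4 raise2_def g matrix_inv_block_form sum_4) auto
qed (simp add: raise2_def vec_eq_iff)

text \<open>Three of the six equations imply the others. The entries \<open>p\<close>,
  \<open>v\<close> and one of \<open>q\<close>, \<open>u\<close> remain free, as they must for a
  three-dimensional space of self-dual bivectors.\<close>

lemma self_dual_block_form:
  assumes g: "g z = block_form P 1" and P: "P 2 1 = P 1 2"
  shows "hodge 1 g z (skew p q r t u v) = skew p q r t u v \<longleftrightarrow>
     2 * r = - P 2 2 * p \<and> 2 * t = P 1 1 * p \<and> q - u = - P 1 2 * p"
proof
  note defs = hodge_skew_block_form[of g z, OF g P] vec_eq_iff forall_4 raise2_def g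
    matrix_inv_block_form sum_4 P
  show "hodge 1 g z (skew p q r t u v) = skew p q r t u v" if
    "2 * r = - P 2 2 * p \<and> 2 * t = P 1 1 * p \<and> q - u = - P 1 2 * p"
  proof -
    have "r = - P 2 2 * p / 2" "t = P 1 1 * p / 2" "u = q + P 1 2 * p" using that by auto
    then show ?thesis by (simp add: defs algebra_simps)
  qed
  assume h: "hodge 1 g z (skew p q r t u v) = skew p q r t u v"
  have e: "hodge 1 g z (skew p q r t u v) $ i $ j = skew p q r t u v $ i $ j" for i j
    by (simp only: h)
  note defs = hodge_skew_block_form[of g z, OF g P] raise2_def g matrix_inv_block_form sum_4 P
  have "2 * r = - P 2 2 * p" using e[of 1 4] by (simp add: defs algebra_simps)
  moreover have "2 * t = P 1 1 * p" using e[of 2 3] by (simp add: defs algebra_simps)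
  moreover have "q - u = - P 1 2 * p" using e[of 1 3] by (simp add: defs algebra_simps)
  ultimately show "2 * r = - P 2 2 * p \<and> 2 * t = P 1 1 * p \<and> q - u = - P 1 2 * p"
    by blast
qed

text \<open>These are twice E_1 \<and> V_2 and twice E_2 \<and> V_1, where V_1, V_2 are the fibre
  directions and E_i is the null vector over the i-th base direction.\<close>

lemma anti_self_dual_block_form:
  assumes g: "g z = block_form P 1" and P: "P 2 1 = P 1 2"
  shows "hodge 1 g z (skew 0 0 2 0 0 (- P 1 1)) = - skew 0 0 2 0 0 (- P 1 1)"
    and "hodge 1 g z (skew 0 0 0 2 0 (P 2 2)) = - skew 0 0 0 2 0 (P 2 2)"
  unfolding hodge_skew_block_form[of g z, OF g P]
  by (simp_all add: vec_eq_iff forall_4 raise2_def g matrix_inv_block_form sum_4 P algebra_simps)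

lemma riemann_antisym: "riemann \<Gamma> x j i k l = - riemann \<Gamma> x i j k l"
  by (simp add: riemann_def)

lemma riemann_low_antisym: "riemann_low g x j i k l = - riemann_low g x i j k l"
  unfolding riemann_low_def riemann_antisym[of _ x j i] by (simp add: sum_negf)

section \<open>Curvature of a general Walker metric\<close>

locale walker_metric =
  fixes P :: "real^4 \<Rightarrow> 2 \<Rightarrow> 2 \<Rightarrow> real" and U :: "(real^4) set"
  assumes open_U: "open U" and smooth_P: "\<And>i j. smooth_fun_on U (\<lambda>z. P z i j)"
    and P_sym: "\<And>z. z \<in> U \<Longrightarrow> P z 2 1 = P z 1 2"
begin

definition A where "A z = P z 1 1"
definition B where "B z = P z 2 2"
definition C where "C z = P z 1 2"
definition g :: metric4 where "g z = block_form (P z) 1"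

text \<open>Christoffel symbols in closed form, so that the curvature is obtained without
  differentiating \<open>matrix_inv\<close>. A lower fibre index leaves only fibre components: this
  is the parallelism of the fibres.\<close>

definition chr :: "real^4 \<Rightarrow> real^4^4^4" where
  "chr z = (let
     r11 = vector [- (1/2) * pd 3 A z, - (1/2) * pd 4 A z,
       (1/2) * (pd 1 A z + A z * pd 3 A z + C z * pd 4 A z),
       pd 1 C z + (1/2) * (B z * pd 4 A z + C z * pd 3 A z - pd 2 A z)];
     r12 = vector [- (1/2) * pd 3 C z, - (1/2) * pd 4 C z,
       (1/2) * (pd 2 A z + A z * pd 3 C z + C z * pd 4 C z),
       (1/2) * (pd 1 B z + B z * pd 4 C z + C z * pd 3 C z)];
     r22 = vector [- (1/2) * pd 3 B z, - (1/2) * pd 4 B z,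
       pd 2 C z + (1/2) * (A z * pd 3 B z + C z * pd 4 B z - pd 1 B z),
       (1/2) * (pd 2 B z + B z * pd 4 B z + C z * pd 3 B z)];
     r13 = vector [0, 0, (1/2) * pd 3 A z, (1/2) * pd 3 C z];
     r14 = vector [0, 0, (1/2) * pd 4 A z, (1/2) * pd 4 C z];
     r23 = vector [0, 0, (1/2) * pd 3 C z, (1/2) * pd 3 B z];
     r24 = vector [0, 0, (1/2) * pd 4 C z, (1/2) * pd 4 B z]
   in vector [vector [r11, r12, r13, r14], vector [r12, r22, r23, r24],
     vector [r13, r23, 0, 0], vector [r14, r24, 0, 0]])"

lemma levi_civita_eq:
  assumes z: "z \<in> U"
  shows "levi_civita g z i j k = chr z $ i $ j $ k"
proof -
  have 1: "pd m (\<lambda>z. P z 2 1) z = pd m C z" for m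
    using P_sym by (intro pd_cong_open[OF open_U z]) (simp add: C_def)
  have 2: "(\<lambda>z. P z 1 1) = A" "(\<lambda>z. P z 2 2) = B" "(\<lambda>z. P z 1 2) = C"
    by (simp_all add: fun_eq_iff A_def B_def C_def)
  have 3: "g y = block_form (P y) 1" for y by (simp add: g_def)
  have e: "pd m (\<lambda>y. g y $ i $ j) z = (\<chi> i j. if i = 1 then (if j = 1 then pd m A z else if j = 2 then pd m C z else 0)
      else if i = 2 then (if j = 1 then pd m C z else if j = 2 then pd m B z else 0) else 0) $ i $ j" for m i j
    using exhaust_4[of i] exhaust_4[of j]
    by (elim disjE) (simp_all add: 3 block_form_def 1 2)
  show ?thesis
    using exhaust_4[of i] exhaust_4[of j] exhaust_4[of k]
    unfolding levi_civita_def 3 matrix_inv_block_form e[unfolded 3] P_sym[OF z]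
    by (elim disjE; simp add: sum_4 chr_def Let_def A_def[of z] B_def[of z] C_def[of z] algebra_simps)
qed

lemma smooth_ABC [smooth_intros]: "smooth_fun_on U A" "smooth_fun_on U B" "smooth_fun_on U C"
  using smooth_P unfolding A_def[abs_def] B_def[abs_def] C_def[abs_def] by auto

definition sc where "sc z = pd 3 (pd 3 A) z + pd 4 (pd 4 B) z + 2 * pd 3 (pd 4 C) z"

definition W12 where "W12 z =
      - 1/2 * pd 2 (pd 3 A) z + 1/2 * pd 1 (pd 4 B) z - 1/2 * pd 2 (pd 4 C) z + 1/2 * pd 1 (pd 3
      C) z - 1/4 * A z * pd 3 (pd 4 B) z - 1/4 * A z * pd 3 (pd 3 C) z + 1/4 * pd 3 (pd 4 A) z *
      B z + 1/4 * pd 3 (pd 3 A) z * C z + 1/4 * B z * pd 4 (pd 4 C) z - 1/4 * pd 4 (pd 4 B) z *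
      C z"

definition W22 where "W22 z =
      - 1/2 * pd 2 (pd 2 A) z - 1/2 * pd 1 (pd 1 B) z + pd 1 (pd 2 C) z + 1/2 * A z * pd 1 (pd 3
      B) z - 1/2 * A z * pd 2 (pd 3 C) z - 1/8 * (A z)\<^sup>2 * pd 3 (pd 3 B) z + 1/4 * pd 4 A
      z * pd 2 B z - 1/8 * pd 4 (pd 4 A) z * (B z)\<^sup>2 - 1/4 * pd 3 A z * pd 1 B z + 1/2 *
      pd 3 A z * pd 2 C z - 1/8 * pd 3 (pd 3 A) z * (C z)\<^sup>2 - 1/4 * pd 2 A z * pd 4 B z -
      1/2 * pd 2 A z * pd 3 C z + 1/2 * pd 2 (pd 4 A) z * B z + 1/2 * pd 2 (pd 3 A) z * C z +
      1/4 * pd 1 A z * pd 3 B z - 1/2 * B z * pd 1 (pd 4 C) z + 1/2 * pd 4 B z * pd 1 C z - 1/8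
      * pd 4 (pd 4 B) z * (C z)\<^sup>2 - 1/2 * pd 1 B z * pd 4 C z + 1/2 * pd 1 (pd 4 B) z * C
      z - 1/2 * C z * pd 2 (pd 4 C) z - 1/2 * C z * pd 1 (pd 3 C) z + 1/4 * (C z)\<^sup>2 * pd 3
      (pd 4 C) z + 1/4 * A z * B z * pd 3 (pd 4 C) z - 1/4 * A z * pd 4 B z * pd 3 C z + 1/4 * A
      z * pd 3 B z * pd 4 C z - 1/4 * A z * pd 3 (pd 4 B) z * C z + 1/4 * A z * C z * pd 3 (pd 3
      C) z + 1/4 * pd 4 A z * B z * pd 3 C z - 1/4 * pd 4 A z * pd 3 B z * C z - 1/4 * pd 3 A z
      * B z * pd 4 C z + 1/4 * pd 3 A z * pd 4 B z * C z - 1/4 * pd 3 (pd 4 A) z * B z * C z +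
      1/4 * B z * C z * pd 4 (pd 4 C) z"

text \<open>The functions \<open>sc\<close>, \<open>W12\<close>, \<open>W22\<close> are components of \<open>W\<^sup>+\<close> in the basis dual to the basis of bivectors consisting of
  \<open>V\<^sub>1 \<and> V\<^sub>2\<close>, \<open>E\<^sub>1 \<and> V\<^sub>1 + E\<^sub>2 \<and> V\<^sub>2\<close>, \<open>E\<^sub>1 \<and> E\<^sub>2\<close> (self-dual) and
  \<open>E\<^sub>1 \<and> V\<^sub>2\<close>, \<open>E\<^sub>1 \<and> V\<^sub>1 - E\<^sub>2 \<and> V\<^sub>2\<close>, \<open>E\<^sub>2 \<and> V\<^sub>1\<close> (anti-self-dual). Here \<open>V\<^sub>1, V\<^sub>2\<close> span the
  fibre directions and \<open>E\<^sub>i\<close> is the null vector projecting to \<open>\<partial>\<^sub>i\<close> with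
  \<open>E\<^sub>i = \<partial>\<^sub>i - P\<^sub>i\<^sub>j V\<^sub>j / 2\<close>.\<close>

definition "p0 z = skew ((A z * B z - (C z)\<^sup>2) / 4) (- C z / 2) (A z / 2) (- B z / 2) (C z / 2) 1"
definition "p1 = skew 0 (1/2) 0 0 (1/2) 0"
definition "p2 = skew 1 0 0 0 0 0"
definition "m0 z = skew (B z / 2) 0 1 0 0 0"
definition "m1 z = skew (C z / 2) (1/2) 0 0 (- (1/2)) 0"
definition "m2 z = skew (- A z / 2) 0 0 1 0 0"

context
  fixes z assumes z: "z \<in> U"
begin

lemma diff_ABC [simp]:
  "A differentiable (at z)" "B differentiable (at z)" "C differentiable (at z)"
  "pd i A differentiable (at z)" "pd i B differentiable (at z)" "pd i C differentiable (at z)"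
  by (rule smooth_fun_on_differentiable[OF _ open_U z], intro smooth_intros)+

text \<open>A normal form for mixed derivatives, smaller index outside, in which the component
  tables below are written.\<close>

lemma pd_commute_ABC:
  "f \<in> {A, B, C} \<Longrightarrow> pd 2 (pd 1 f) z = pd 1 (pd 2 f) z"
  "f \<in> {A, B, C} \<Longrightarrow> pd 3 (pd 1 f) z = pd 1 (pd 3 f) z"
  "f \<in> {A, B, C} \<Longrightarrow> pd 4 (pd 1 f) z = pd 1 (pd 4 f) z"
  "f \<in> {A, B, C} \<Longrightarrow> pd 3 (pd 2 f) z = pd 2 (pd 3 f) z"
  "f \<in> {A, B, C} \<Longrightarrow> pd 4 (pd 2 f) z = pd 2 (pd 4 f) z"
  "f \<in> {A, B, C} \<Longrightarrow> pd 4 (pd 3 f) z = pd 3 (pd 4 f) z"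
  using smooth_ABC by (auto intro: pd_commute[OF _ open_U z])

lemma riemann_eq:
  "riemann (levi_civita g) z i j k l =
     pd i (\<lambda>y. chr y $ j $ k $ l) z - pd j (\<lambda>y. chr y $ i $ k $ l) z
     + (\<Sum>m\<in>UNIV. chr z $ j $ k $ m * chr z $ i $ m $ l)
     - (\<Sum>m\<in>UNIV. chr z $ i $ k $ m * chr z $ j $ m $ l)"
  unfolding riemann_def levi_civita_eq[OF z]
  using pd_cong_open[OF open_U z levi_civita_eq] by simp

lemmas chr_simps = chr_def Let_def sum_4 pd_add pd_mult pd_diff pd_minus pd_divide_const pd_commute_ABC

lemma ricci_eq:
  "ricci (levi_civita g) z 1 1 =
      - pd 2 (pd 4 A) z - 1/2 * (pd 4 C z)\<^sup>2 + pd 1 (pd 4 C) z + 1/2 * A z * pd 3 (pd 3 A)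
      z + 1/2 * pd 4 A z * pd 4 B z - 1/2 * pd 4 A z * pd 3 C z + 1/2 * pd 4 (pd 4 A) z * B z +
      1/2 * pd 3 A z * pd 4 C z + pd 3 (pd 4 A) z * C z"
  "ricci (levi_civita g) z 1 2 =
      1/2 * pd 2 (pd 3 A) z + 1/2 * pd 1 (pd 4 B) z - 1/2 * pd 2 (pd 4 C) z - 1/2 * pd 1 (pd 3
      C) z + 1/2 * A z * pd 3 (pd 3 C) z - 1/2 * pd 4 A z * pd 3 B z + 1/2 * B z * pd 4 (pd 4 C)
      z + C z * pd 3 (pd 4 C) z + 1/2 * pd 4 C z * pd 3 C z"
  "ricci (levi_civita g) z 1 3 =
      1/2 * pd 3 (pd 3 A) z + 1/2 * pd 3 (pd 4 C) z"
  "ricci (levi_civita g) z 1 4 =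
      1/2 * pd 3 (pd 4 A) z + 1/2 * pd 4 (pd 4 C) z"
  "ricci (levi_civita g) z 2 1 =
      1/2 * pd 2 (pd 3 A) z + 1/2 * pd 1 (pd 4 B) z - 1/2 * pd 2 (pd 4 C) z - 1/2 * pd 1 (pd 3
      C) z + 1/2 * A z * pd 3 (pd 3 C) z - 1/2 * pd 4 A z * pd 3 B z + 1/2 * B z * pd 4 (pd 4 C)
      z + C z * pd 3 (pd 4 C) z + 1/2 * pd 4 C z * pd 3 C z"
  "ricci (levi_civita g) z 2 2 =
      - pd 1 (pd 3 B) z - 1/2 * (pd 3 C z)\<^sup>2 + pd 2 (pd 3 C) z + 1/2 * A z * pd 3 (pd 3 B)
      z + 1/2 * pd 3 A z * pd 3 B z + 1/2 * B z * pd 4 (pd 4 B) z + 1/2 * pd 4 B z * pd 3 C z -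
      1/2 * pd 3 B z * pd 4 C z + pd 3 (pd 4 B) z * C z"
  "ricci (levi_civita g) z 2 3 =
      1/2 * pd 3 (pd 4 B) z + 1/2 * pd 3 (pd 3 C) z"
  "ricci (levi_civita g) z 2 4 =
      1/2 * pd 4 (pd 4 B) z + 1/2 * pd 3 (pd 4 C) z"
  "ricci (levi_civita g) z 3 1 =
      1/2 * pd 3 (pd 3 A) z + 1/2 * pd 3 (pd 4 C) z"
  "ricci (levi_civita g) z 3 2 =
      1/2 * pd 3 (pd 4 B) z + 1/2 * pd 3 (pd 3 C) z"
  "ricci (levi_civita g) z 3 3 =
      0"
  "ricci (levi_civita g) z 3 4 =
      0"
  "ricci (levi_civita g) z 4 1 =
      1/2 * pd 3 (pd 4 A) z + 1/2 * pd 4 (pd 4 C) z"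
  "ricci (levi_civita g) z 4 2 =
      1/2 * pd 4 (pd 4 B) z + 1/2 * pd 3 (pd 4 C) z"
  "ricci (levi_civita g) z 4 3 =
      0"
  "ricci (levi_civita g) z 4 4 =
      0"
  by (simp_all add: ricci_def riemann_eq chr_simps algebra_simps add_divide_distrib diff_divide_distrib power2_eq_square)

lemma g_nth:
  "g z $ 1 $ 1 = A z" "g z $ 1 $ 2 = C z" "g z $ 2 $ 1 = C z" "g z $ 2 $ 2 = B z"
  "g z $ 1 $ 3 = 1" "g z $ 1 $ 4 = 0" "g z $ 2 $ 3 = 0" "g z $ 2 $ 4 = 1"
  "g z $ 3 $ 1 = 1" "g z $ 4 $ 1 = 0" "g z $ 3 $ 2 = 0" "g z $ 4 $ 2 = 1"
  "g z $ 3 $ 3 = 0" "g z $ 3 $ 4 = 0" "g z $ 4 $ 3 = 0" "g z $ 4 $ 4 = 0"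
  by (simp_all add: g_def block_form_def A_def B_def C_def P_sym[OF z])

lemma scalar_eq: "scalar_curv g z = sc z"
  unfolding scalar_curv_def g_def[of z] matrix_inv_block_form P_sym[OF z]
  by (simp add: sum_4 ricci_eq sc_def A_def[of z] B_def[of z] C_def[of z] algebra_simps)

lemma riemann_low_eq:
  "riemann_low g z 1 2 k l = skew
      (1/2 * pd 2 (pd 2 A) z + 1/2 * pd 1 (pd 1 B) z - pd 1 (pd 2 C) z + 1/4 * A z * (pd 3 C
      z)\<^sup>2 - 1/4 * pd 4 A z * pd 2 B z + 1/4 * pd 3 A z * pd 1 B z - 1/2 * pd 3 A z * pd 2
      C z + 1/4 * pd 2 A z * pd 4 B z + 1/2 * pd 2 A z * pd 3 C z - 1/4 * pd 1 A z * pd 3 B z +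
      1/4 * B z * (pd 4 C z)\<^sup>2 - 1/2 * pd 4 B z * pd 1 C z + 1/2 * pd 1 B z * pd 4 C z -
      1/4 * A z * pd 3 A z * pd 3 B z - 1/4 * pd 4 A z * B z * pd 4 B z - 1/4 * pd 4 A z * pd 3
      B z * C z - 1/4 * pd 3 A z * pd 4 B z * C z + 1/2 * C z * pd 4 C z * pd 3 C z)
      (1/2 * pd 2 (pd 3 A) z - 1/2 * pd 1 (pd 3 C) z - 1/4 * pd 4 A z * pd 3 B z + 1/4 * pd 4 C
      z * pd 3 C z)
      (1/2 * pd 2 (pd 4 A) z + 1/4 * (pd 4 C z)\<^sup>2 - 1/2 * pd 1 (pd 4 C) z - 1/4 * pd 4 A z
      * pd 4 B z + 1/4 * pd 4 A z * pd 3 C z - 1/4 * pd 3 A z * pd 4 C z)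
      (- 1/2 * pd 1 (pd 3 B) z - 1/4 * (pd 3 C z)\<^sup>2 + 1/2 * pd 2 (pd 3 C) z + 1/4 * pd 3 A
      z * pd 3 B z + 1/4 * pd 4 B z * pd 3 C z - 1/4 * pd 3 B z * pd 4 C z)
      (- 1/2 * pd 1 (pd 4 B) z + 1/2 * pd 2 (pd 4 C) z + 1/4 * pd 4 A z * pd 3 B z - 1/4 * pd 4
      C z * pd 3 C z)
      (0)
      $ k $ l"
  "riemann_low g z 1 3 k l = skew
      (1/2 * pd 2 (pd 3 A) z - 1/2 * pd 1 (pd 3 C) z - 1/4 * pd 4 A z * pd 3 B z + 1/4 * pd 4 C
      z * pd 3 C z)
      (1/2 * pd 3 (pd 3 A) z)
      (1/2 * pd 3 (pd 4 A) z)
      (1/2 * pd 3 (pd 3 C) z)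
      (1/2 * pd 3 (pd 4 C) z)
      (0)
      $ k $ l"
  "riemann_low g z 1 4 k l = skew
      (1/2 * pd 2 (pd 4 A) z + 1/4 * (pd 4 C z)\<^sup>2 - 1/2 * pd 1 (pd 4 C) z - 1/4 * pd 4 A z
      * pd 4 B z + 1/4 * pd 4 A z * pd 3 C z - 1/4 * pd 3 A z * pd 4 C z)
      (1/2 * pd 3 (pd 4 A) z)
      (1/2 * pd 4 (pd 4 A) z)
      (1/2 * pd 3 (pd 4 C) z)
      (1/2 * pd 4 (pd 4 C) z)
      (0)
      $ k $ l"
  "riemann_low g z 2 3 k l = skew
      (- 1/2 * pd 1 (pd 3 B) z - 1/4 * (pd 3 C z)\<^sup>2 + 1/2 * pd 2 (pd 3 C) z + 1/4 * pd 3 A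
      z * pd 3 B z + 1/4 * pd 4 B z * pd 3 C z - 1/4 * pd 3 B z * pd 4 C z)
      (1/2 * pd 3 (pd 3 C) z)
      (1/2 * pd 3 (pd 4 C) z)
      (1/2 * pd 3 (pd 3 B) z)
      (1/2 * pd 3 (pd 4 B) z)
      (0)
      $ k $ l"
  "riemann_low g z 2 4 k l = skew
      (- 1/2 * pd 1 (pd 4 B) z + 1/2 * pd 2 (pd 4 C) z + 1/4 * pd 4 A z * pd 3 B z - 1/4 * pd 4
      C z * pd 3 C z)
      (1/2 * pd 3 (pd 4 C) z)
      (1/2 * pd 4 (pd 4 C) z)
      (1/2 * pd 3 (pd 4 B) z)
      (1/2 * pd 4 (pd 4 B) z)
      (0)
      $ k $ l"
  "riemann_low g z 3 4 k l = skew
      (0)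
      (0)
      (0)
      (0)
      (0)
      (0)
      $ k $ l"
  using exhaust_4[of k] exhaust_4[of l]
  by (elim disjE; simp add: riemann_low_def riemann_eq chr_simps g_nth algebra_simps add_divide_distrib diff_divide_distrib power2_eq_square)+

text \<open>The absence of mixed terms in \<open>p\<close> and \<open>m\<close> is the splitting of
  the Weyl operator into W^+ and W^-. Products of \<open>p0\<close> with itself or with
  \<open>p1\<close> do not occur because the null fibres are parallel, and the coefficients of
  \<open>p0\<close>, \<open>p2\<close> and of \<open>p1\<close>, \<open>p1\<close> are tied to each
  other by trace-freeness.\<close>

lemma weyl_decomposition:
  "weyl g z i j l k = - sc z / 12 * (p0 z $ i $ j * p2 $ k $ l + p2 $ i $ j * p0 z $ k $ l)
     - sc z / 3 * p1 $ i $ j * p1 $ k $ l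
     + W12 z * (p1 $ i $ j * p2 $ k $ l + p2 $ i $ j * p1 $ k $ l) + W22 z * p2 $ i $ j * p2 $ k $ l
     + (- 1/2 * pd 4 (pd 4 A) z) * m0 z $ i $ j * m0 z $ k $ l
     + (- 1/2 * pd 3 (pd 4 A) z + 1/2 * pd 4 (pd 4 C) z) * (m0 z $ i $ j * m1 z $ k $ l + m1 z $ i $ j * m0 z $ k $ l)
     + (1/12 * pd 3 (pd 3 A) z + 1/12 * pd 4 (pd 4 B) z - 1/3 * pd 3 (pd 4 C) z) *
         (m0 z $ i $ j * m2 z $ k $ l + m2 z $ i $ j * m0 z $ k $ l)
     + (- 1/3 * pd 3 (pd 3 A) z - 1/3 * pd 4 (pd 4 B) z + 4/3 * pd 3 (pd 4 C) z) * m1 z $ i $ j * m1 z $ k $ l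
     + (1/2 * pd 3 (pd 4 B) z - 1/2 * pd 3 (pd 3 C) z) * (m1 z $ i $ j * m2 z $ k $ l + m2 z $ i $ j * m1 z $ k $ l)
     + (- 1/2 * pd 3 (pd 3 B) z) * m2 z $ i $ j * m2 z $ k $ l"
proof -
  have anti: "weyl g z j i l k = - weyl g z i j l k" for i j k l
    unfolding weyl_def riemann_low_antisym[of g z j i] by (simp add: algebra_simps)
  have diag: "weyl g z i i l k = 0" for i k l using anti[of i i l k] by simp
  note defs = p0_def p1_def p2_def m0_def m1_def m2_def
  show ?thesis
    \<comment> \<open>All 256 index choices are checked; antisymmetry first brings \<open>i\<close>,
      \<open>j\<close> into increasing order, the only case listed in the table for
      \<open>riemann_low\<close>.\<close>
    using exhaust_4[of i] exhaust_4[of j] exhaust_4[of k] exhaust_4[of l]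
    apply (elim disjE)
    apply (simp_all only: diag anti[of 2 1] anti[of 3 1] anti[of 4 1] anti[of 3 2] anti[of 4 2] anti[of 4 3])
    apply (simp_all add: defs)
    apply (simp_all add: weyl_def riemann_low_eq ricci_eq scalar_eq g_nth sc_def W12_def W22_def field_simps power2_eq_square)
    done
qed

text \<open>The sum runs over ordered index pairs, hence gives twice the usual pairing of a 2-form
  with a bivector.\<close>

definition br :: "real^4^4 \<Rightarrow> real^4^4 \<Rightarrow> real" where
  "br X Y = (\<Sum>k\<in>UNIV. \<Sum>l\<in>UNIV. X $ k $ l * Y $ k $ l)"

lemma weyl_contraction:
  "(\<Sum>k\<in>UNIV. \<Sum>l\<in>UNIV. weyl g z i j l k * Y $ k $ l) =
     - sc z / 12 * (p0 z $ i $ j * br p2 Y + p2 $ i $ j * br (p0 z) Y) - sc z / 3 * p1 $ i $ j * br p1 Y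
     + W12 z * (p1 $ i $ j * br p2 Y + p2 $ i $ j * br p1 Y) + W22 z * p2 $ i $ j * br p2 Y
     + (- 1/2 * pd 4 (pd 4 A) z) * m0 z $ i $ j * br (m0 z) Y
     + (- 1/2 * pd 3 (pd 4 A) z + 1/2 * pd 4 (pd 4 C) z) * (m0 z $ i $ j * br (m1 z) Y + m1 z $ i $ j * br (m0 z) Y)
     + (1/12 * pd 3 (pd 3 A) z + 1/12 * pd 4 (pd 4 B) z - 1/3 * pd 3 (pd 4 C) z) *
         (m0 z $ i $ j * br (m2 z) Y + m2 z $ i $ j * br (m0 z) Y)
     + (- 1/3 * pd 3 (pd 3 A) z - 1/3 * pd 4 (pd 4 B) z + 4/3 * pd 3 (pd 4 C) z) * m1 z $ i $ j * br (m1 z) Y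
     + (1/2 * pd 3 (pd 4 B) z - 1/2 * pd 3 (pd 3 C) z) * (m1 z $ i $ j * br (m2 z) Y + m2 z $ i $ j * br (m1 z) Y)
     + (- 1/2 * pd 3 (pd 3 B) z) * m2 z $ i $ j * br (m2 z) Y"
  unfolding weyl_decomposition br_def
  by (simp only: sum_distrib_left sum.distrib[symmetric] sum_subtractf[symmetric] distrib_left
      distrib_right left_diff_distrib right_diff_distrib mult.assoc)

lemma g_z: "g z = block_form (P z) 1"
  by (simp add: g_def)

lemma weyl_operator_eq_0:
  "weyl_operator g z Y = 0 \<longleftrightarrow> (\<forall>i j. (\<Sum>k\<in>UNIV. \<Sum>l\<in>UNIV. weyl g z i j l k * Y $ k $ l) = 0)"
  unfolding weyl_operator_def raise2_eq_0_block_form[of g z, OF g_z] by simp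

lemma br_skew:
  "br (p0 z) (skew p q r t u v) = 2 * ((A z * B z - (C z)\<^sup>2) / 4 * p - C z / 2 * q + A z / 2 * r
      - B z / 2 * t + C z / 2 * u + v)"
  "br p1 (skew p q r t u v) = q + u"
  "br p2 (skew p q r t u v) = 2 * p"
  "br (m0 z) (skew p q r t u v) = B z * p + 2 * r"
  "br (m1 z) (skew p q r t u v) = C z * p + q - u"
  "br (m2 z) (skew p q r t u v) = - A z * p + 2 * t"
  by (simp_all add: br_def sum_4 p0_def p1_def p2_def m0_def m1_def m2_def algebra_simps
      add_divide_distrib diff_divide_distrib)

lemma bivector_skew_entries [simp]: "bivector (skew p q r t u v)"
  unfolding bivector_def forall_4 by simp

text \<open>By \<open>br_skew\<close> these three equations say exactly that \<open>m0\<close>,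
  \<open>m1\<close> and \<open>m2\<close> annihilate the bivector.\<close>

lemma self_dual_skew:
  "hodge 1 g z (skew p q r t u v) = skew p q r t u v \<longleftrightarrow>
     2 * r = - B z * p \<and> 2 * t = A z * p \<and> q - u = - C z * p"
  using self_dual_block_form[of g z, OF g_z P_sym[OF z]] unfolding A_def B_def C_def .

text \<open>On self-dual bivectors only the terms in \<open>p0\<close>, \<open>p1\<close>,
  \<open>p2\<close> survive. Conversely three test bivectors, each read at the entry
  \<open>1\<close>, \<open>2\<close>, isolate the three scalars one after the other.\<close>

lemma W_plus_vanishes_iff:
  "W_plus_vanishes 1 g z \<longleftrightarrow> sc z = 0 \<and> W12 z = 0 \<and> W22 z = 0"
proof
  assume W: "W_plus_vanishes 1 g z"
  have 0: "(\<Sum>k\<in>UNIV. \<Sum>l\<in>UNIV. weyl g z 1 2 l k * skew p q r t u v $ k $ l) = 0"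
    if "2 * r = - B z * p \<and> 2 * t = A z * p \<and> q - u = - C z * p" for p q r t u v
  proof -
    have "hodge 1 g z (skew p q r t u v) = skew p q r t u v"
      using that by (simp only: self_dual_skew)
    then have "weyl_operator g z (skew p q r t u v) = 0"
      by (rule W[unfolded W_plus_vanishes_def, rule_format, OF bivector_skew_entries])
    then show ?thesis unfolding weyl_operator_eq_0 by blast
  qed
  \<comment> \<open>The instantiations list \<open>r\<close>, \<open>p\<close>, \<open>t\<close>,
    \<open>q\<close>, \<open>u\<close>, \<open>v\<close> in this order. The tests are V_1 \<and>
    V_2, then E_1 \<and> V_1 + E_2 \<and> V_2, then E_1 \<and> E_2 up to a multiple of the
    first.\<close>
  have sc0: "sc z = 0"
    using 0[of 0 0 0 0 0 1] unfolding weyl_contraction br_skew by (simp add: p0_def p2_def p1_def m0_def m1_def m2_def)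
  moreover have W120: "W12 z = 0"
    using 0[of 0 0 0 1 1 0] sc0 unfolding weyl_contraction br_skew by (simp add: p0_def p2_def p1_def m0_def m1_def m2_def)
  moreover have "W22 z = 0"
    using 0[of "- B z / 2" 1 "A z / 2" "- C z / 2" "C z / 2" 0] sc0 W120
    unfolding weyl_contraction br_skew by (simp add: p0_def p2_def p1_def m0_def m1_def m2_def)
  ultimately show "sc z = 0 \<and> W12 z = 0 \<and> W22 z = 0" by blast
next
  assume 0: "sc z = 0 \<and> W12 z = 0 \<and> W22 z = 0"
  show "W_plus_vanishes 1 g z"
    unfolding W_plus_vanishes_def
  proof (intro allI impI)
    fix Y assume Y: "bivector Y" "hodge 1 g z Y = Y"
    from Y(1) obtain p q r t u v where Y': "Y = skew p q r t u v"
      unfolding bivector_skew by blast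
    have "2 * r = - B z * p" "2 * t = A z * p" "q - u = - C z * p"
      using Y(2) unfolding Y' self_dual_skew by auto
    then have "br (m0 z) Y = 0" "br (m1 z) Y = 0" "br (m2 z) Y = 0"
      unfolding Y' br_skew by (simp_all add: algebra_simps)
    then show "weyl_operator g z Y = 0"
      unfolding weyl_operator_eq_0 weyl_contraction by (simp add: 0)
  qed
qed

lemma W_minus_vanishes_imp:
  assumes W: "W_minus_vanishes 1 g z"
  shows "pd 4 (pd 4 A) z = 0" and "pd 3 (pd 3 B) z = 0"
proof -
  have 0: "(\<Sum>k\<in>UNIV. \<Sum>l\<in>UNIV. weyl g z i j l k * Y $ k $ l) = 0"
    if "bivector Y" "hodge 1 g z Y = - Y" for i j Y
    using W[unfolded W_minus_vanishes_def, rule_format, OF that] unfolding weyl_operator_eq_0 by blast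
  note asd = anti_self_dual_block_form[of g z, OF g_z P_sym[OF z]]
  \<comment> \<open>This test bivector pairs nontrivially with \<open>m0\<close> alone, and at the
    entry \<open>1\<close>, \<open>4\<close> only \<open>m0\<close> is nonzero, so just the
    coefficient of \<open>m0\<close> times \<open>m0\<close> is seen.\<close>
  show "pd 4 (pd 4 A) z = 0"
    using 0[OF bivector_skew_entries asd(1), of 1 4] unfolding weyl_contraction br_skew
    by (simp add: p0_def p2_def p1_def m0_def m1_def m2_def A_def)
  show "pd 3 (pd 3 B) z = 0"
    using 0[OF bivector_skew_entries asd(2), of 2 3] unfolding weyl_contraction br_skew
    by (simp add: p0_def p2_def p1_def m0_def m1_def m2_def B_def)
qed

end

lemma smooth_levi_civita: "smooth_fun_on U (\<lambda>z. levi_civita g z i j k)"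
proof -
  have "smooth_fun_on U (\<lambda>z. chr z $ i $ j $ k)"
    using exhaust_4[of i] exhaust_4[of j] exhaust_4[of k]
    by (elim disjE; simp only: chr_def Let_def vector_4 zero_index; intro smooth_intros open_U)
  then show ?thesis
    by (rule smooth_fun_on_cong[OF open_U levi_civita_eq[symmetric], rotated])
qed

end

subsection \<open>Naturality of the Weyl tensor\<close>

lemma sum_rotate4:
  "(\<Sum>a\<in>A. \<Sum>b\<in>B. \<Sum>c\<in>C. \<Sum>d\<in>D. f a b c d) = (\<Sum>b\<in>B. \<Sum>c\<in>C. \<Sum>d\<in>D. \<Sum>a\<in>A. f a b c d)"
  by (rule trans[OF sum.swap], rule sum.cong[OF refl], rule sum_rotate3)

lemma sum_exchange22:
  "(\<Sum>a\<in>A. \<Sum>b\<in>B. \<Sum>c\<in>C. \<Sum>d\<in>D. f a b c d) = (\<Sum>c\<in>C. \<Sum>d\<in>D. \<Sum>a\<in>A. \<Sum>b\<in>B. f a b c d)"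
  by (rule trans[OF sum.cong[OF refl sum_rotate3]], rule sum_rotate3)

lemma matrix_inv_eqI:
  fixes M N :: "real^'n::finite^'n"
  assumes "invertible M" "N ** M = mat 1"
  shows "matrix_inv M = N"
proof -
  obtain K where K: "M ** K = mat 1" "K ** M = mat 1"
    using assms(1) unfolding invertible_def by blast
  then have "M ** matrix_inv M = mat 1 \<and> matrix_inv M ** M = mat 1"
    unfolding matrix_inv_def by (intro someI[of "\<lambda>A'. M ** A' = mat 1 \<and> A' ** M = mat 1" K]) simp
  then have "N = N ** (M ** matrix_inv M)" by simp
  also have "\<dots> = matrix_inv M" unfolding matrix_mul_assoc assms(2) by simp
  finally show ?thesis by simp
qed

lemma matrix_inv_mult:
  fixes M :: "real^'n::finite^'n"
  assumes "invertible M"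
  shows "M ** matrix_inv M = mat 1" "matrix_inv M ** M = mat 1"
proof -
  obtain K where K: "M ** K = mat 1" "K ** M = mat 1"
    using assms(1) unfolding invertible_def by blast
  then have "M ** matrix_inv M = mat 1 \<and> matrix_inv M ** M = mat 1"
    unfolding matrix_inv_def by (intro someI[of "\<lambda>A'. M ** A' = mat 1 \<and> A' ** M = mat 1" K]) simp
  then show "M ** matrix_inv M = mat 1" "matrix_inv M ** M = mat 1" by auto
qed

text \<open>In matrix form \<open>g\<close> is the congruence of \<open>g'\<close> by
  \<open>J\<close>, so conjugating the inverse of \<open>g\<close> by \<open>J\<close> and its
  transpose gives a left inverse of \<open>g'\<close>.\<close>

lemma inverse_metric_transform:
  fixes g g' :: "real^'n::finite^'n"
  assumes JK: "inverse_matrices J K" and inv: "invertible g'"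
    and g: "\<And>i j. g $ i $ j = pull2 J (\<lambda>a b. g' $ a $ b) i j"
  shows "(\<Sum>k\<in>UNIV. \<Sum>l\<in>UNIV. J a k * matrix_inv g $ k $ l * J b l) = matrix_inv g' $ a $ b"
    and "invertible g"
proof -
  define Jm where "Jm = (\<chi> a i. J a i)"
  define Km where "Km = (\<chi> i a. K i a)"
  have 1: "Jm ** Km = mat 1" "Km ** Jm = mat 1"
    using JK by (simp_all add: inverse_matrices_def Jm_def Km_def matrix_matrix_mult_def mat_def vec_eq_iff)
  have gm: "g = transpose Jm ** g' ** Jm"
    unfolding vec_eq_iff g pull2_def
    by (simp add: matrix_matrix_mult_def transpose_def Jm_def sum_distrib_right)
      (subst sum.swap, simp add: mult_ac)
  have "invertible Jm" "invertible (transpose Jm)"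
  proof -
    show "invertible Jm" using 1 unfolding invertible_def by blast
    have "transpose Jm ** transpose Km = mat 1" "transpose Km ** transpose Jm = mat 1"
      using 1 by (simp_all only: matrix_transpose_mul[symmetric] transpose_mat)
    then show "invertible (transpose Jm)" unfolding invertible_def by blast
  qed
  then show ig: "invertible g"
    unfolding gm using inv by (intro invertible_mult)
  have "(Jm ** matrix_inv g ** transpose Jm) ** g' = (Jm ** matrix_inv g ** transpose Jm) ** g' ** (Jm ** Km)"
    by (simp add: 1)
  also have "\<dots> = Jm ** (matrix_inv g ** g) ** Km"
    unfolding gm by (simp only: matrix_mul_assoc)
  also have "\<dots> = mat 1" by (simp add: matrix_inv_mult[OF ig] 1)
  finally have "matrix_inv g' = Jm ** matrix_inv g ** transpose Jm"
    by (intro matrix_inv_eqI inv)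
  then show "(\<Sum>k\<in>UNIV. \<Sum>l\<in>UNIV. J a k * matrix_inv g $ k $ l * J b l) = matrix_inv g' $ a $ b"
    by (simp add: matrix_matrix_mult_def transpose_def Jm_def sum_distrib_right)
      (subst sum.swap, simp)
qed

locale isometry =
  fixes S T :: "(real^4) set" and F :: "real^4 \<Rightarrow> real^4" and g g' :: metric4 and K
  assumes open_S: "open S" and open_T: "open T" and F: "smooth_map_on S F" and FS: "F ` S \<subseteq> T"
    and smooth_g': "\<And>i j. smooth_fun_on T (\<lambda>y. g' y $ i $ j)"
    and sym_g': "\<And>y i j. y \<in> T \<Longrightarrow> g' y $ i $ j = g' y $ j $ i"
    and inv_g': "\<And>y. y \<in> T \<Longrightarrow> invertible (g' y)"
    and pull_g: "\<And>y i j. y \<in> S \<Longrightarrow> g y $ i $ j = pull2 (jac F y) (\<lambda>a b. g' (F y) $ a $ b) i j"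
    and JK: "\<And>y. y \<in> S \<Longrightarrow> inverse_matrices (jac F y) (K y)"
begin

lemma levi_civita_law: "connection_law S F (levi_civita g) (levi_civita g')"
  unfolding connection_law_def
proof (intro ballI allI)
  fix x i j a assume x: "x \<in> S"
  let ?J = "jac F x" and ?G = "\<lambda>a b. g' (F x) $ a $ b"
  have Fx: "F x \<in> T" using FS x by auto
  define H where "H a i j = pd i (\<lambda>y. jac F y a j) x" for a i j
  define dg where "dg m a b = pd m (\<lambda>y. g' y $ a $ b) (F x)" for m a b
  \<comment> \<open>\<open>P\<close> collects second derivatives of \<open>F\<close>,
    \<open>Q\<close> derivatives of the metric. The Koszul combination contains six terms
    \<open>P\<close>; by symmetry four cancel and \<open>2 * P i j l\<close> remains.\<close>
  define P where "P i j l = (\<Sum>a\<in>UNIV. \<Sum>b\<in>UNIV. H a i j * ?J b l * ?G a b)" for i j l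
  define Q where "Q i j l = (\<Sum>a\<in>UNIV. \<Sum>b\<in>UNIV. \<Sum>m\<in>UNIV. ?J a j * ?J b l * (?J m i * dg m a b))" for i j l
  define Y where "Y b = 2 * (\<Sum>c\<in>UNIV. H c i j * ?G c b) +
      (\<Sum>c\<in>UNIV. \<Sum>d\<in>UNIV. ?J c i * ?J d j * (dg c d b + dg d c b - dg b c d))" for b
  have sG: "?G a b = ?G b a" for a b using sym_g'[OF Fx] .
  have dJ: "(\<lambda>y. jac F y a k) differentiable (at x)" for a k
    by (rule smooth_fun_on_differentiable[OF smooth_jac[OF F] open_S x])
  have dF: "(\<lambda>x. F x $ a) differentiable (at x)" for a
    by (rule smooth_map_on_differentiable[OF F open_S x])
  have dg': "(\<lambda>y. g' y $ a $ b) differentiable (at (F x))" for a b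
    by (rule smooth_fun_on_differentiable[OF smooth_g' open_T Fx])
  have dgF: "(\<lambda>y. g' (F y) $ a $ b) differentiable (at x)" for a b
    by (rule pd_compose(2)[OF dF dg'])
  have pg: "pd i (\<lambda>y. g' (F y) $ a $ b) x = (\<Sum>m\<in>UNIV. ?J m i * dg m a b)" for i a b
    unfolding jac_def dg_def by (simp only: pd_compose(1)[OF dF dg'] mult.commute)
  have symH: "H a i j = H a j i" for a i j
    unfolding H_def jac_def using F unfolding smooth_map_on_def
    by (intro pd_commute[OF _ open_S x]) simp
  have dgij: "pd i (\<lambda>y. g y $ j $ l) x = P i j l + P i l j + Q i j l" for i j l
  proof -
    have "pd i (\<lambda>y. g y $ j $ l) x = pd i (\<lambda>y. pull2 (jac F y) (\<lambda>a b. g' (F y) $ a $ b) j l) x"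
      using pull_g by (rule pd_cong_open[OF open_S x])
    also have "\<dots> = P i j l + (\<Sum>a\<in>UNIV. \<Sum>b\<in>UNIV. ?J a j * H b i l * ?G a b) + Q i j l"
      unfolding pull2_def P_def Q_def H_def using dJ dgF
      by (simp add: pd_sum pd_mult pg sum.distrib algebra_simps sum_distrib_left)
    also have "(\<Sum>a\<in>UNIV. \<Sum>b\<in>UNIV. ?J a j * H b i l * ?G a b) = P i l j"
      unfolding P_def by (rule trans[OF sum.swap], intro sum.cong refl) (use sG in \<open>simp add: mult_ac\<close>)
    finally show ?thesis .
  qed
  have V: "pd i (\<lambda>y. g y $ j $ l) x + pd j (\<lambda>y. g y $ i $ l) x - pd l (\<lambda>y. g y $ i $ j) x =
      (\<Sum>b\<in>UNIV. ?J b l * Y b)" for l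
  proof -
    have symP: "P i j l = P j i l" for i j l
      unfolding P_def using symH by (intro sum.cong refl) simp
    have "P i j l = (\<Sum>b\<in>UNIV. ?J b l * (\<Sum>c\<in>UNIV. H c i j * ?G c b))"
      unfolding P_def sum_distrib_left by (rule trans[OF sum.swap]) (simp only: mult_ac)
    moreover have "Q i j l = (\<Sum>b\<in>UNIV. \<Sum>c\<in>UNIV. \<Sum>d\<in>UNIV. ?J b l * (?J c i * ?J d j * dg c d b))"
      unfolding Q_def by (rule trans[OF sum_rotate3]) (simp only: mult_ac)
    moreover have "Q j i l = (\<Sum>b\<in>UNIV. \<Sum>c\<in>UNIV. \<Sum>d\<in>UNIV. ?J b l * (?J c i * ?J d j * dg d c b))"
      unfolding Q_def by (rule trans[OF sum.swap]) (simp only: mult_ac)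
    moreover have "Q l i j = (\<Sum>b\<in>UNIV. \<Sum>c\<in>UNIV. \<Sum>d\<in>UNIV. ?J b l * (?J c i * ?J d j * dg b c d))"
      unfolding Q_def by (rule trans[OF sum_rotate3[symmetric]]) (simp only: mult_ac)
    moreover have "pd i (\<lambda>y. g y $ j $ l) x + pd j (\<lambda>y. g y $ i $ l) x - pd l (\<lambda>y. g y $ i $ j) x =
        2 * P i j l + Q i j l + Q j i l - Q l i j"
      unfolding dgij using symP[of j i l] symP[of l i j] symP[of i l j] symP[of j l i] by simp
    ultimately show ?thesis
      unfolding Y_def
      by (simp add: sum.distrib sum_subtractf sum_distrib_left algebra_simps)
  qed
  have "(\<Sum>k\<in>UNIV. levi_civita g x i j k * ?J a k) =
      (\<Sum>k\<in>UNIV. \<Sum>l\<in>UNIV. \<Sum>b\<in>UNIV. (1/2) * (?J a k * matrix_inv (g x) $ k $ l * ?J b l * Y b))"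
    unfolding levi_civita_def V by (simp add: sum_distrib_left sum_distrib_right mult_ac)
  also have "\<dots> = (\<Sum>b\<in>UNIV. \<Sum>k\<in>UNIV. \<Sum>l\<in>UNIV. (1/2) * (?J a k * matrix_inv (g x) $ k $ l * ?J b l * Y b))"
    by (rule sum_rotate3[symmetric])
  also have "\<dots> = (\<Sum>b\<in>UNIV. (1/2) * ((\<Sum>k\<in>UNIV. \<Sum>l\<in>UNIV. ?J a k * matrix_inv (g x) $ k $ l * ?J b l) * Y b))"
    by (simp add: sum_distrib_left sum_distrib_right)
  also have "\<dots> = (\<Sum>b\<in>UNIV. (1/2) * (matrix_inv (g' (F x)) $ a $ b * Y b))"
    by (simp only: inverse_metric_transform(1)[OF JK[OF x] inv_g'[OF Fx] pull_g[OF x]])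
  also have "\<dots> = (\<Sum>b\<in>UNIV. \<Sum>c\<in>UNIV. matrix_inv (g' (F x)) $ a $ b * (H c i j * ?G c b)) +
      (\<Sum>b\<in>UNIV. \<Sum>c\<in>UNIV. \<Sum>d\<in>UNIV. ?J c i * ?J d j * ((1/2) * (matrix_inv (g' (F x)) $ a $ b *
        (dg c d b + dg d c b - dg b c d))))"
    unfolding Y_def by (simp add: sum.distrib[symmetric] sum_distrib_left distrib_left mult_ac)
  also have "(\<Sum>b\<in>UNIV. \<Sum>c\<in>UNIV. matrix_inv (g' (F x)) $ a $ b * (H c i j * ?G c b)) = H a i j"
  proof -
    have "(matrix_inv (g' (F x)) ** g' (F x)) $ a $ c = (if a = c then 1 else 0)" for c
      using matrix_inv_mult(2)[OF inv_g'[OF Fx]] by (simp add: mat_def)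
    then have "(\<Sum>b\<in>UNIV. matrix_inv (g' (F x)) $ a $ b * ?G c b) = (if a = c then 1 else 0)" for c
      unfolding sG[of c] by (simp add: matrix_matrix_mult_def)
    moreover have "(\<Sum>b\<in>UNIV. \<Sum>c\<in>UNIV. matrix_inv (g' (F x)) $ a $ b * (H c i j * ?G c b)) =
        (\<Sum>c\<in>UNIV. (\<Sum>b\<in>UNIV. matrix_inv (g' (F x)) $ a $ b * ?G c b) * H c i j)"
      unfolding sum_distrib_right by (rule trans[OF sum.swap]) (simp only: mult_ac)
    ultimately show ?thesis by simp
  qed
  also have "(\<Sum>b\<in>UNIV. \<Sum>c\<in>UNIV. \<Sum>d\<in>UNIV. ?J c i * ?J d j * ((1/2) * (matrix_inv (g' (F x)) $ a $ b *
        (dg c d b + dg d c b - dg b c d)))) =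
      (\<Sum>b\<in>UNIV. \<Sum>e\<in>UNIV. ?J b i * ?J e j * levi_civita g' (F x) b e a)"
    by (rule trans[OF sum_rotate3]) (simp only: levi_civita_def dg_def sum_distrib_left)
  finally show "(\<Sum>k\<in>UNIV. levi_civita g x i j k * ?J a k) = pd i (\<lambda>y. jac F y a j) x +
      (\<Sum>b\<in>UNIV. \<Sum>e\<in>UNIV. ?J b i * ?J e j * levi_civita g' (F x) b e a)"
    by (simp only: H_def)
qed

end

section \<open>Transport of the Weyl tensor and of the condition on W^+\<close>

lemma pull4_add: "pull4 J (\<lambda>a b c d. V a b c d + W a b c d) i j k l = pull4 J V i j k l + pull4 J W i j k l"
  and pull4_diff: "pull4 J (\<lambda>a b c d. V a b c d - W a b c d) i j k l = pull4 J V i j k l - pull4 J W i j k l"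
  and pull4_cmult: "pull4 J (\<lambda>a b c d. s * V a b c d) i j k l = s * pull4 J V i j k l"
  by (simp_all add: pull4_def algebra_simps sum.distrib sum_subtractf sum_distrib_left)

lemma pull2_pull2:
  "pull2 J V j k * pull2 J W i l = pull4 J (\<lambda>a b c d. V b c * W a d) i j k l"
  "pull2 J V i k * pull2 J W j l = pull4 J (\<lambda>a b c d. V a c * W b d) i j k l"
proof -
  have "pull2 J V j k * pull2 J W i l = (\<Sum>b\<in>UNIV. \<Sum>c\<in>UNIV. \<Sum>a\<in>UNIV. \<Sum>d\<in>UNIV.
      J a i * J b j * J c k * J d l * (V b c * W a d))"
    unfolding pull2_def by (simp only: sum_distrib_right, simp only: sum_distrib_left, simp only: mult_ac)
  also have "\<dots> = pull4 J (\<lambda>a b c d. V b c * W a d) i j k l"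
    unfolding pull4_def by (rule sum_rotate3[symmetric])
  finally show "pull2 J V j k * pull2 J W i l = pull4 J (\<lambda>a b c d. V b c * W a d) i j k l" .
  have "pull2 J V i k * pull2 J W j l = (\<Sum>a\<in>UNIV. \<Sum>c\<in>UNIV. \<Sum>b\<in>UNIV. \<Sum>d\<in>UNIV.
      J a i * J b j * J c k * J d l * (V a c * W b d))"
    unfolding pull2_def by (simp only: sum_distrib_right, simp only: sum_distrib_left, simp only: mult_ac)
  also have "\<dots> = pull4 J (\<lambda>a b c d. V a c * W b d) i j k l"
    unfolding pull4_def by (rule sum.cong[OF refl], rule sum.swap)
  finally show "pull2 J V i k * pull2 J W j l = pull4 J (\<lambda>a b c d. V a c * W b d) i j k l" .
qed

context isometry
begin

lemma weyl_transform:
  assumes x: "x \<in> S"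
    and s: "\<And>i j k. smooth_fun_on S (\<lambda>x. levi_civita g x i j k)"
    and s': "\<And>i j k. smooth_fun_on T (\<lambda>x. levi_civita g' x i j k)"
  shows "weyl g x i j k l = pull4 (jac F x) (weyl g' (F x)) i j k l"
proof -
  let ?J = "jac F x" and ?G = "\<lambda>a b. g' (F x) $ a $ b"
  have Fx: "F x \<in> T" using FS x by auto
  note R = riemann_transform[OF open_S open_T F FS s s' levi_civita_law x]
  have ric: "ricci (levi_civita g) x j k = pull2 ?J (ricci (levi_civita g') (F x)) j k" for j k
    by (rule ricci_transform[OF JK[OF x] R])
  have low: "riemann_low g x i j k l = pull4 ?J (riemann_low g' (F x)) i j k l"
  proof -
    let ?R = "riemann (levi_civita g) x" and ?R' = "riemann (levi_civita g') (F x)"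
    have "riemann_low g x i j k l = (\<Sum>m\<in>UNIV. \<Sum>a\<in>UNIV. \<Sum>e\<in>UNIV. ?R i j k m * ?J a m * (?J e l * ?G a e))"
      unfolding riemann_low_def pull_g[OF x] pull2_def by (simp add: sum_distrib_left mult_ac)
    also have "\<dots> = (\<Sum>a\<in>UNIV. \<Sum>e\<in>UNIV. (\<Sum>m\<in>UNIV. ?R i j k m * ?J a m) * (?J e l * ?G a e))"
      unfolding sum_distrib_right by (rule sum_rotate3)
    also have "\<dots> = (\<Sum>a\<in>UNIV. \<Sum>e\<in>UNIV. \<Sum>b\<in>UNIV. \<Sum>c\<in>UNIV. \<Sum>d\<in>UNIV.
        ?J b i * ?J c j * ?J d k * ?J e l * (?R' b c d a * ?G a e))"
      unfolding R sum_distrib_right by (simp only: mult_ac)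
    also have "\<dots> = (\<Sum>a\<in>UNIV. \<Sum>b\<in>UNIV. \<Sum>c\<in>UNIV. \<Sum>d\<in>UNIV. \<Sum>e\<in>UNIV.
        ?J b i * ?J c j * ?J d k * ?J e l * (?R' b c d a * ?G a e))"
      by (rule sum.cong[OF refl], rule sum_rotate4)
    also have "\<dots> = (\<Sum>b\<in>UNIV. \<Sum>c\<in>UNIV. \<Sum>d\<in>UNIV. \<Sum>a\<in>UNIV. \<Sum>e\<in>UNIV.
        ?J b i * ?J c j * ?J d k * ?J e l * (?R' b c d a * ?G a e))"
      by (rule sum_rotate4)
    also have "\<dots> = (\<Sum>b\<in>UNIV. \<Sum>c\<in>UNIV. \<Sum>d\<in>UNIV. \<Sum>e\<in>UNIV. \<Sum>a\<in>UNIV.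
        ?J b i * ?J c j * ?J d k * ?J e l * (?R' b c d a * ?G a e))"
      by (rule sum.cong[OF refl], rule sum.cong[OF refl], rule sum.cong[OF refl], rule sum.swap)
    finally show ?thesis unfolding pull4_def riemann_low_def by (simp only: sum_distrib_left)
  qed
  have sc: "scalar_curv g x = scalar_curv g' (F x)"
  proof -
    have "scalar_curv g x = (\<Sum>j\<in>UNIV. \<Sum>k\<in>UNIV. \<Sum>c\<in>UNIV. \<Sum>d\<in>UNIV.
        ?J c j * matrix_inv (g x) $ j $ k * ?J d k * ricci (levi_civita g') (F x) c d)"
      unfolding scalar_curv_def ric pull2_def by (simp add: sum_distrib_left mult_ac)
    also have "\<dots> = (\<Sum>c\<in>UNIV. \<Sum>d\<in>UNIV. (\<Sum>j\<in>UNIV. \<Sum>k\<in>UNIV.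
        ?J c j * matrix_inv (g x) $ j $ k * ?J d k) * ricci (levi_civita g') (F x) c d)"
      unfolding sum_distrib_right by (rule sum_exchange22)
    also have "\<dots> = scalar_curv g' (F x)"
      unfolding scalar_curv_def
      by (simp only: inverse_metric_transform(1)[OF JK[OF x] inv_g'[OF Fx] pull_g[OF x]])
    finally show ?thesis .
  qed
  have W': "weyl g' (F x) = (\<lambda>a b c d. riemann_low g' (F x) a b c d
     - (1/2) * (ricci (levi_civita g') (F x) b c * ?G a d + ?G b c * ricci (levi_civita g') (F x) a d
              - ricci (levi_civita g') (F x) a c * ?G b d - ?G a c * ricci (levi_civita g') (F x) b d)
     + scalar_curv g' (F x) / 6 * (?G b c * ?G a d - ?G a c * ?G b d))"
    by (simp add: fun_eq_iff weyl_def mult.commute)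
  show ?thesis
    unfolding W' pull4_add pull4_diff pull4_cmult pull2_pull2[symmetric]
    unfolding weyl_def low ric sc pull_g[OF x] by (simp add: mult.commute)
qed

text \<open>The push-forward of a self-dual bivector must again be self-dual. By \<open>vert\<close>
  the map preserves the fibres, which fix the orientation; the linear description in
  \<open>self_dual_block_form\<close> then replaces a general naturality statement for the Hodge
  operator.\<close>

lemma W_plus_transform:
  assumes x: "x \<in> S"
    and s: "\<And>i j k. smooth_fun_on S (\<lambda>x. levi_civita g x i j k)"
    and s': "\<And>i j k. smooth_fun_on T (\<lambda>x. levi_civita g' x i j k)"
    and P: "g x = block_form P 1" "P 2 1 = P 1 2" and P': "g' (F x) = block_form P' 1" "P' 2 1 = P' 1 2"
    and vert: "\<And>a i. a \<in> {1, 2} \<Longrightarrow> i \<in> {3, 4} \<Longrightarrow> jac F x a i = 0"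
    and W: "W_plus_vanishes 1 g' (F x)"
  shows "W_plus_vanishes 1 g x"
  unfolding W_plus_vanishes_def
proof (intro allI impI)
  fix B assume bv: "bivector B" and sd: "hodge 1 g x B = B"
  let ?J = "jac F x"
  define B' where "B' = (\<chi> a b. \<Sum>k\<in>UNIV. \<Sum>l\<in>UNIV. ?J a k * ?J b l * B $ k $ l)"
  obtain p q r t u v where B: "B = skew p q r t u v"
    using bv unfolding bivector_skew by blast
  have sd1: "2 * r = - P 2 2 * p" "2 * t = P 1 1 * p" "q - u = - P 1 2 * p"
    using sd unfolding B self_dual_block_form[of g x, OF P] by auto
  have bv': "bivector B'"
    unfolding bivector_def
  proof (intro allI)
    fix a b
    have anti: "B $ l $ k = - B $ k $ l" for k l
      using bv unfolding bivector_def by blast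
    have "?J a k * ?J b l * B $ k $ l = - (?J b l * ?J a k * B $ l $ k)" for k l
      unfolding anti[of l k] by simp
    then have "(\<Sum>l\<in>UNIV. \<Sum>k\<in>UNIV. ?J a k * ?J b l * B $ k $ l) =
        (\<Sum>l\<in>UNIV. \<Sum>k\<in>UNIV. - (?J b l * ?J a k * B $ l $ k))"
      by (simp only:)
    then have "(\<Sum>k\<in>UNIV. \<Sum>l\<in>UNIV. ?J a k * ?J b l * B $ k $ l) =
        (\<Sum>l\<in>UNIV. \<Sum>k\<in>UNIV. - (?J b l * ?J a k * B $ l $ k))"
      by (rule trans[OF sum.swap])
    then show "B' $ a $ b = - B' $ b $ a" by (simp add: B'_def sum_negf)
  qed
  have gJ: "g x $ i $ j = pull2 ?J (\<lambda>a b. block_form P' 1 $ a $ b) i j" for i j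
    using pull_g[OF x, of i j] by (simp only: P'(1))
  have v0: "?J 1 3 = 0" "?J 1 4 = 0" "?J 2 3 = 0" "?J 2 4 = 0" using vert by auto
  have e: "P 1 1 = pull2 ?J (\<lambda>a b. block_form P' 1 $ a $ b) 1 1" "P 1 2 = pull2 ?J (\<lambda>a b. block_form P' 1 $ a $ b) 1 2"
    "P 2 2 = pull2 ?J (\<lambda>a b. block_form P' 1 $ a $ b) 2 2"
    "1 = pull2 ?J (\<lambda>a b. block_form P' 1 $ a $ b) 1 3" "0 = pull2 ?J (\<lambda>a b. block_form P' 1 $ a $ b) 1 4"
    "0 = pull2 ?J (\<lambda>a b. block_form P' 1 $ a $ b) 2 3" "1 = pull2 ?J (\<lambda>a b. block_form P' 1 $ a $ b) 2 4"
    unfolding gJ[symmetric] P(1) by (simp_all add: block_form_def)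
  note e' = e[unfolded pull2_def sum_4 block_form_def vector_4 v0 P'(2), simplified]
  have D: "?J 1 1 * ?J 3 3 + ?J 2 1 * ?J 4 3 = 1" "?J 1 1 * ?J 3 4 + ?J 2 1 * ?J 4 4 = 0"
    "?J 1 2 * ?J 3 3 + ?J 2 2 * ?J 4 3 = 0" "?J 1 2 * ?J 3 4 + ?J 2 2 * ?J 4 4 = 1"
    using e'(4-7) by (simp_all add: algebra_simps)
  note b' = B'_def B sum_4 v0
  have "B' = skew (B' $ 1 $ 2) (B' $ 1 $ 3) (B' $ 1 $ 4) (B' $ 2 $ 3) (B' $ 2 $ 4) (B' $ 3 $ 4)"
    using bv' unfolding bivector_skew .
  moreover have "2 * B' $ 1 $ 4 = - P' 2 2 * B' $ 1 $ 2 \<and> 2 * B' $ 2 $ 3 = P' 1 1 * B' $ 1 $ 2 \<and>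
      B' $ 1 $ 3 - B' $ 2 $ 4 = - P' 1 2 * B' $ 1 $ 2"
  proof -
    \<comment> \<open>Blocks of the Jacobian: \<open>A\<close> along the base, \<open>D\<close>
      along the fibres, \<open>N\<close> the fibre components of base directions.\<close>
    define A11 A12 A21 A22 where A: "A11 = ?J 1 1" "A12 = ?J 1 2" "A21 = ?J 2 1" "A22 = ?J 2 2"
    define N11 N12 N21 N22 where N: "N11 = ?J 3 1" "N12 = ?J 3 2" "N21 = ?J 4 1" "N22 = ?J 4 2"
    define D11 D12 D21 D22 where DD: "D11 = ?J 3 3" "D12 = ?J 3 4" "D21 = ?J 4 3" "D22 = ?J 4 4"
    define \<delta> where "\<delta> = A11 * A22 - A12 * A21"
    have D': "A11 * D11 + A21 * D21 = 1" "A11 * D12 + A21 * D22 = 0"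
      "A12 * D11 + A22 * D21 = 0" "A12 * D12 + A22 * D22 = 1"
      using D by (simp_all only: A DD)
    \<comment> \<open>\<open>D\<close> is the inverse transpose of \<open>A\<close>. Multiplication
      by \<open>\<delta>\<close> replaces it by cofactors, and the three equations become polynomial
      identities.\<close>
    have d: "\<delta> \<noteq> 0" using D' unfolding \<delta>_def by algebra
    have De: "\<delta> * D11 = A22" "\<delta> * D12 = - A21" "\<delta> * D21 = - A12" "\<delta> * D22 = A11"
      using D' unfolding \<delta>_def by algebra+
    have Pe: "P 1 1 = A11 * A11 * P' 1 1 + 2 * A11 * A21 * P' 1 2 + A21 * A21 * P' 2 2 + 2 * A11 * N11 + 2 * A21 * N21"
      "P 1 2 = A11 * A12 * P' 1 1 + (A11 * A22 + A12 * A21) * P' 1 2 + A21 * A22 * P' 2 2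
         + A11 * N12 + A12 * N11 + A21 * N22 + A22 * N21"
      "P 2 2 = A12 * A12 * P' 1 1 + 2 * A12 * A22 * P' 1 2 + A22 * A22 * P' 2 2 + 2 * A12 * N12 + 2 * A22 * N22"
      using e'(1-3) unfolding A N by (simp_all add: algebra_simps)
    have s: "r = - P 2 2 * p / 2" "t = P 1 1 * p / 2" "q = u - P 1 2 * p" using sd1 by auto
    have B12: "B' $ 1 $ 2 = \<delta> * p"
      unfolding \<delta>_def A by (simp add: b' algebra_simps)
    have B14: "B' $ 1 $ 4 = p * (A11 * N22 - A12 * N21) + D21 * (A11 * q + A12 * t) + D22 * (A11 * r + A12 * u)"
      unfolding A N DD by (simp add: b' algebra_simps)
    have B23: "B' $ 2 $ 3 = p * (A21 * N12 - A22 * N11) + D11 * (A21 * q + A22 * t) + D12 * (A21 * r + A22 * u)"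
      unfolding A N DD by (simp add: b' algebra_simps)
    have B13: "B' $ 1 $ 3 = p * (A11 * N12 - A12 * N11) + D11 * (A11 * q + A12 * t) + D12 * (A11 * r + A12 * u)"
      unfolding A N DD by (simp add: b' algebra_simps)
    have B24: "B' $ 2 $ 4 = p * (A21 * N22 - A22 * N21) + D21 * (A21 * q + A22 * t) + D22 * (A21 * r + A22 * u)"
      unfolding A N DD by (simp add: b' algebra_simps)
    have "\<delta> * (2 * B' $ 1 $ 4) = 2 * (\<delta> * p * (A11 * N22 - A12 * N21) + (\<delta> * D21) * (A11 * q + A12 * t) + (\<delta> * D22) * (A11 * r + A12 * u))"
      unfolding B14 by (simp add: algebra_simps)
    also have "\<dots> = \<delta> * (- P' 2 2 * B' $ 1 $ 2)"
      unfolding De B12 s Pe unfolding \<delta>_def by (simp add: field_simps)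
    finally have 1: "2 * B' $ 1 $ 4 = - P' 2 2 * B' $ 1 $ 2" using d by (simp only: mult_cancel_left) simp
    have "\<delta> * (2 * B' $ 2 $ 3) = 2 * (\<delta> * p * (A21 * N12 - A22 * N11) + (\<delta> * D11) * (A21 * q + A22 * t) + (\<delta> * D12) * (A21 * r + A22 * u))"
      unfolding B23 by (simp add: algebra_simps)
    also have "\<dots> = \<delta> * (P' 1 1 * B' $ 1 $ 2)"
      unfolding De B12 s Pe unfolding \<delta>_def by (simp add: field_simps)
    finally have 2: "2 * B' $ 2 $ 3 = P' 1 1 * B' $ 1 $ 2" using d by (simp only: mult_cancel_left) simp
    have "\<delta> * (B' $ 1 $ 3 - B' $ 2 $ 4) = \<delta> * p * (A11 * N12 - A12 * N11 - A21 * N22 + A22 * N21)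
        + (\<delta> * D11) * (A11 * q + A12 * t) + (\<delta> * D12) * (A11 * r + A12 * u)
        - (\<delta> * D21) * (A21 * q + A22 * t) - (\<delta> * D22) * (A21 * r + A22 * u)"
      unfolding B13 B24 by (simp add: algebra_simps)
    also have "\<dots> = \<delta> * (- P' 1 2 * B' $ 1 $ 2)"
      unfolding De B12 s Pe unfolding \<delta>_def by (simp add: field_simps)
    finally have 3: "B' $ 1 $ 3 - B' $ 2 $ 4 = - P' 1 2 * B' $ 1 $ 2" using d by (simp only: mult_cancel_left) simp
    show ?thesis using 1 2 3 by blast
  qed
  ultimately have sd': "hodge 1 g' (F x) B' = B'"
    using self_dual_block_form[of g' "F x", OF P'] by metis
  have op0: "weyl_operator h y Y = 0 \<longleftrightarrow> (\<forall>i j. (\<Sum>k\<in>UNIV. \<Sum>l\<in>UNIV. weyl h y i j l k * Y $ k $ l) = 0)"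
    if "h y = block_form M 1" for h y Y M
    unfolding weyl_operator_def raise2_eq_0_block_form[of h y, OF that] by simp
  have 0: "(\<Sum>k\<in>UNIV. \<Sum>l\<in>UNIV. weyl g' (F x) a b l k * B' $ k $ l) = 0" for a b
    using W bv' sd' op0[of g' "F x", OF P'(1)] unfolding W_plus_vanishes_def by blast
  have "(\<Sum>k\<in>UNIV. \<Sum>l\<in>UNIV. weyl g x i j l k * B $ k $ l) = 0" for i j
  proof -
    have "(\<Sum>k\<in>UNIV. \<Sum>l\<in>UNIV. weyl g x i j l k * B $ k $ l) =
      (\<Sum>k\<in>UNIV. \<Sum>l\<in>UNIV. \<Sum>a\<in>UNIV. \<Sum>b\<in>UNIV. \<Sum>c\<in>UNIV. \<Sum>d\<in>UNIV.
        ?J a i * ?J b j * (weyl g' (F x) a b c d * (?J d k * ?J c l * B $ k $ l)))"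
      unfolding weyl_transform[OF x s s'] pull4_def by (simp add: sum_distrib_right sum_distrib_left mult_ac)
    also have "\<dots> = (\<Sum>a\<in>UNIV. \<Sum>b\<in>UNIV. \<Sum>k\<in>UNIV. \<Sum>l\<in>UNIV. \<Sum>c\<in>UNIV. \<Sum>d\<in>UNIV.
        ?J a i * ?J b j * (weyl g' (F x) a b c d * (?J d k * ?J c l * B $ k $ l)))"
      by (rule sum_exchange22)
    also have "\<dots> = (\<Sum>a\<in>UNIV. \<Sum>b\<in>UNIV. \<Sum>c\<in>UNIV. \<Sum>d\<in>UNIV. \<Sum>k\<in>UNIV. \<Sum>l\<in>UNIV.
        ?J a i * ?J b j * (weyl g' (F x) a b c d * (?J d k * ?J c l * B $ k $ l)))"
      by (rule sum.cong[OF refl], rule sum.cong[OF refl], rule sum_exchange22)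
    also have "\<dots> = (\<Sum>a\<in>UNIV. \<Sum>b\<in>UNIV. \<Sum>d\<in>UNIV. \<Sum>c\<in>UNIV. \<Sum>k\<in>UNIV. \<Sum>l\<in>UNIV.
        ?J a i * ?J b j * (weyl g' (F x) a b c d * (?J d k * ?J c l * B $ k $ l)))"
      by (rule sum.cong[OF refl], rule sum.cong[OF refl], rule sum.swap)
    also have "\<dots> = (\<Sum>a\<in>UNIV. \<Sum>b\<in>UNIV. ?J a i * ?J b j *
        (\<Sum>d\<in>UNIV. \<Sum>c\<in>UNIV. weyl g' (F x) a b c d * B' $ d $ c))"
      unfolding B'_def by (simp add: sum_distrib_left)
    also have "\<dots> = 0" unfolding 0 by simp
    finally show ?thesis .
  qed
  then show "weyl_operator g x B = 0" unfolding op0[of g x, OF P(1)] by blast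
qed

end

subsection \<open>Cotangent lifts of coordinate changes\<close>

lemma inverse_matrices_jac:
  fixes F G :: "real^'n::finite \<Rightarrow> real^'n"
  assumes S: "open S" and T: "open T" and F: "smooth_map_on S F" and G: "smooth_map_on T G"
    and FS: "F ` S \<subseteq> T" and GT: "G ` T \<subseteq> S"
    and GF: "\<And>x. x \<in> S \<Longrightarrow> G (F x) = x" and FG: "\<And>y. y \<in> T \<Longrightarrow> F (G y) = y" and x: "x \<in> S"
  shows "inverse_matrices (jac F x) (jac G (F x))"
proof -
  have y: "F x \<in> T" using FS x by auto
  have *: "(\<Sum>i\<in>UNIV. jac f y a i * jac h x i b) = (if a = b then 1 else 0)"
    if "open U" "x \<in> U" "\<And>z. z \<in> U \<Longrightarrow> f (h z) = z" "h x = y"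
      "\<And>i. (\<lambda>z. h z $ i) differentiable (at x)" "\<And>i. (\<lambda>z. f z $ i) differentiable (at y)"
    for f h :: "real^'n \<Rightarrow> real^'n" and x y U a b
  proof -
    have "(\<Sum>i\<in>UNIV. jac f y a i * jac h x i b) = pd b (\<lambda>z. f (h z) $ a) x"
      unfolding jac_def that(4)[symmetric]
      by (rule pd_compose(1)[OF that(5) that(6)[folded that(4)], symmetric])
    also have "\<dots> = pd b (\<lambda>z. z $ a) x"
      by (rule pd_cong_open[OF that(1,2)]) (simp only: that(3))
    finally show ?thesis by auto
  qed
  note dF = smooth_map_on_differentiable[OF F S x] and dG = smooth_map_on_differentiable[OF G T y]
  show ?thesis
    unfolding inverse_matrices_def
    using *[OF T y FG GF[OF x] dG dF] *[OF S x GF refl dF dG] by simp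
qed

lemma base_nth: "base z $ 1 = z $ 1" "base z $ 2 = z $ 2"
  and fibre_nth: "fibre z $ 1 = z $ 3" "fibre z $ 2 = z $ 4"
  by (simp_all add: base_def fibre_def)

lemma smooth_fibre [smooth_intros]: "smooth_fun_on U (\<lambda>z. fibre z $ k)"
  using exhaust_2[of k] by (auto simp: fibre_nth smooth_fun_on_nth)

lemma smooth_base: "smooth_map_on U base"
  unfolding smooth_map_on_def forall_2 base_nth by (simp add: smooth_fun_on_nth)

lemma open_base_vimage: "open S \<Longrightarrow> open (base -` S)"
  by (rule open_vimage[OF _ smooth_map_on_continuous[OF smooth_base]])

lemma smooth_fun_on_base:
  assumes "open S" "smooth_fun_on S f"
  shows "smooth_fun_on (base -` S) (\<lambda>z. f (base z))"
  by (rule smooth_fun_on_compose[OF open_base_vimage[OF assms(1)] assms(1) _ smooth_base assms(2)]) auto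

lemma pd_base:
  assumes "f differentiable (at (base z))"
  shows "pd i (\<lambda>z. f (base z)) z =
    (if i = 1 then pd 1 f (base z) else if i = 2 then pd 2 f (base z) else 0)"
    and "(\<lambda>z. f (base z)) differentiable (at z)"
proof -
  have d: "(\<lambda>z. base z $ a) differentiable (at z)" for a
    using smooth_map_on_differentiable[OF smooth_base open_UNIV, of z a] by simp
  have "pd i (\<lambda>z. base z $ a) z = (if (a = 1 \<and> i = 1) \<or> (a = 2 \<and> i = 2) then 1 else 0)" for a
    using exhaust_2[of a] by (auto simp: base_nth)
  then show "pd i (\<lambda>z. f (base z)) z =
    (if i = 1 then pd 1 f (base z) else if i = 2 then pd 2 f (base z) else 0)"
    unfolding pd_compose(1)[OF d assms] sum_2 using exhaust_4[of i] by auto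
  show "(\<lambda>z. f (base z)) differentiable (at z)"
    by (rule pd_compose(2)[OF d assms])
qed

text \<open>The base components of the one-form \<open>iota_11 T\<close>; their products form the
  quadratic part of the metric.\<close>

definition momentum :: "2 tensor2_comp \<Rightarrow> real^4 \<Rightarrow> 2 \<Rightarrow> real" where
  "momentum T z i = (\<Sum>k\<in>UNIV. fibre z $ k * T (base z) i k)"

definition walker_part :: "2 tensor3_comp \<Rightarrow> 2 tensor2_comp \<Rightarrow> 2 tensor2_comp \<Rightarrow> real^4 \<Rightarrow> 2 \<Rightarrow> 2 \<Rightarrow> real" where
  "walker_part \<Gamma> \<Phi> T z i j = momentum T z i * momentum T z j
     - 2 * (\<Sum>k\<in>UNIV. fibre z $ k * \<Gamma> (base z) i j k) + \<Phi> (base z) i j"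

lemma deformed_extension_block_form:
  "deformed_extension \<Gamma> \<Phi> T z = block_form (walker_part \<Gamma> \<Phi> T z) 1"
  unfolding deformed_extension_coordinates block_form_def walker_part_def momentum_def
  by (simp add: vec_eq_iff forall_4 sum_2 algebra_simps)

lemma invertible_block_form: "invertible (block_form P 1)"
  using abs_det_block_form[of P] by (intro invertible_det_nz[THEN iffD2]) auto

definition smooth_data ::
    "(real^2) set \<Rightarrow> 2 tensor3_comp \<Rightarrow> 2 tensor2_comp \<Rightarrow> 2 tensor2_comp \<Rightarrow> bool" where
  "smooth_data S \<Gamma> \<Phi> T \<longleftrightarrow> open S \<and> (\<forall>i j k. smooth_fun_on S (\<lambda>x. \<Gamma> x i j k)) \<and>
     (\<forall>i j. smooth_fun_on S (\<lambda>x. \<Phi> x i j)) \<and> (\<forall>i j. smooth_fun_on S (\<lambda>x. T x i j)) \<and>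
     (\<forall>x\<in>S. \<forall>i j k. \<Gamma> x i j k = \<Gamma> x j i k) \<and> (\<forall>x\<in>S. \<forall>i j. \<Phi> x i j = \<Phi> x j i)"

lemma walker_part_sym:
  "smooth_data S \<Gamma> \<Phi> T \<Longrightarrow> base z \<in> S \<Longrightarrow> walker_part \<Gamma> \<Phi> T z i j = walker_part \<Gamma> \<Phi> T z j i"
  unfolding smooth_data_def walker_part_def by (metis (no_types, lifting) mult.commute sum.cong)

lemma walker_metric_deformed_extension:
  assumes "smooth_data S \<Gamma> \<Phi> T"
  shows "walker_metric (walker_part \<Gamma> \<Phi> T) (base -` S)"
    and "walker_metric.g (walker_part \<Gamma> \<Phi> T) = deformed_extension \<Gamma> \<Phi> T"
proof -
  have S: "open S" "open (base -` S)"
    using assms open_base_vimage unfolding smooth_data_def by auto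
  show W: "walker_metric (walker_part \<Gamma> \<Phi> T) (base -` S)"
  proof
    show "walker_part \<Gamma> \<Phi> T z 2 1 = walker_part \<Gamma> \<Phi> T z 1 2" if "z \<in> base -` S" for z
      using walker_part_sym[OF assms] that by simp
    show "smooth_fun_on (base -` S) (\<lambda>z. walker_part \<Gamma> \<Phi> T z i j)" for i j
      unfolding walker_part_def momentum_def using assms unfolding smooth_data_def
      by (intro smooth_intros S(2) smooth_fun_on_base[OF S(1)]) blast+
  qed (rule S)
  show "walker_metric.g (walker_part \<Gamma> \<Phi> T) = deformed_extension \<Gamma> \<Phi> T"
    unfolding fun_eq_iff walker_metric.g_def[OF W] deformed_extension_block_form by simp
qed

text \<open>The cotangent lift of \<open>F\<close>: covectors are transported by pulling back along
  the inverse map \<open>G\<close>, whose Jacobian therefore acts on the fibre coordinates.\<close>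

definition lift :: "(real^2 \<Rightarrow> real^2) \<Rightarrow> (real^2 \<Rightarrow> real^2) \<Rightarrow> real^4 \<Rightarrow> real^4" where
  "lift F G z = vector [F (base z) $ 1, F (base z) $ 2,
     \<Sum>k\<in>UNIV. fibre z $ k * jac G (F (base z)) k 1, \<Sum>k\<in>UNIV. fibre z $ k * jac G (F (base z)) k 2]"

lemma base_lift [simp]: "base (lift F G z) = F (base z)"
  and fibre_lift: "fibre (lift F G z) $ a = (\<Sum>k\<in>UNIV. fibre z $ k * jac G (F (base z)) k a)"
  using exhaust_2[of a] by (auto simp: base_def fibre_def lift_def vec_eq_iff forall_2)

lemma smooth_lift:
  assumes S: "open S" and T: "open T" and F: "smooth_map_on S F" and G: "smooth_map_on T G"
    and FS: "F ` S \<subseteq> T"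
  shows "smooth_map_on (base -` S) (lift F G)"
proof -
  note Sb = open_base_vimage[OF S]
  have 1: "smooth_fun_on (base -` S) (\<lambda>z. F (base z) $ a)" for a
    using F by (intro smooth_fun_on_base[OF S]) (simp add: smooth_map_on_def)
  have "smooth_fun_on (base -` S) (\<lambda>z. jac G (F (base z)) k a)" for k a
    by (intro smooth_fun_on_base[OF S, of "\<lambda>x. jac G (F x) k a"]
        smooth_fun_on_compose[OF S T FS F] smooth_jac G)
  then have 2: "smooth_fun_on (base -` S) (\<lambda>z. \<Sum>k\<in>UNIV. fibre z $ k * jac G (F (base z)) k a)" for a
    by (intro smooth_intros Sb)
  show ?thesis
    unfolding smooth_map_on_def forall_4 lift_def vector_4 using 1 2 by blast
qed

locale coordinate_change =
  fixes S T :: "(real^2) set" and F G :: "real^2 \<Rightarrow> real^2"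
    and \<Gamma> \<Gamma>' :: "2 tensor3_comp" and \<Phi> \<Phi>' U U' :: "2 tensor2_comp"
  assumes open_S: "open S" and open_T: "open T" and F: "smooth_map_on S F" and G: "smooth_map_on T G"
    and FS: "F ` S \<subseteq> T" and GT: "G ` T \<subseteq> S"
    and GF: "\<And>x. x \<in> S \<Longrightarrow> G (F x) = x" and FG: "\<And>y. y \<in> T \<Longrightarrow> F (G y) = y"
    and data: "smooth_data S \<Gamma> \<Phi> U" and data': "smooth_data T \<Gamma>' \<Phi>' U'"
    and law: "connection_law S F \<Gamma> \<Gamma>'"
    and pull_\<Phi>: "\<And>x i j. x \<in> S \<Longrightarrow> \<Phi> x i j = pull2 (jac F x) (\<Phi>' (F x)) i j"
    and law_U: "\<And>x i a. x \<in> S \<Longrightarrow>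
      (\<Sum>k\<in>UNIV. U x i k * jac F x a k) = (\<Sum>b\<in>UNIV. jac F x b i * U' (F x) b a)"
begin

context
  fixes z assumes z: "base z \<in> S"
begin

abbreviation "J \<equiv> jac F (base z)"
abbreviation "K \<equiv> jac G (F (base z))"
abbreviation "p' \<equiv> (\<lambda>a. fibre (lift F G z) $ a)"
abbreviation "H \<equiv> (\<lambda>a i j. pd i (\<lambda>y. jac F y a j) (base z))"
abbreviation "N \<equiv> (\<lambda>a i. \<Sum>k\<in>UNIV. fibre z $ k * pd i (\<lambda>x. jac G (F x) k a) (base z))"

lemma inverse_JK: "inverse_matrices J K"
  by (rule inverse_matrices_jac[OF open_S open_T F G FS GT GF FG z])

lemma KJ: "(\<Sum>a\<in>UNIV. K i a * J a j) = (if i = j then 1 else 0)"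
  and JK: "(\<Sum>i\<in>UNIV. J a i * K i b) = (if a = b then 1 else 0)"
  using inverse_JK unfolding inverse_matrices_def by auto

lemma fibre_J: "fibre z $ j = (\<Sum>a\<in>UNIV. p' a * J a j)"
proof -
  have "(\<Sum>a\<in>UNIV. p' a * J a j) = (\<Sum>k\<in>UNIV. fibre z $ k * (\<Sum>a\<in>UNIV. K k a * J a j))"
    unfolding fibre_lift sum_distrib_left sum_distrib_right
    by (rule trans[OF sum.swap]) (simp only: mult_ac)
  then show ?thesis unfolding KJ by simp
qed

lemma smooth_GF: "smooth_fun_on S (\<lambda>x. jac G (F x) k a)"
  by (rule smooth_fun_on_compose[OF open_S open_T FS F smooth_jac[OF G]])

text \<open>Obtained by differentiating \<open>K J = 1\<close>: the base derivatives of the lifted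
  fibre coordinates are governed by the second derivatives of \<open>F\<close>.\<close>

lemma N_J: "(\<Sum>a\<in>UNIV. N a i * J a j) = - (\<Sum>a\<in>UNIV. p' a * H a i j)"
proof -
  have dK: "(\<lambda>x. jac G (F x) k a) differentiable (at (base z))" for k a
    by (rule smooth_fun_on_differentiable[OF smooth_GF open_S z])
  have dJ: "(\<lambda>x. jac F x a j) differentiable (at (base z))" for a j
    by (rule smooth_fun_on_differentiable[OF smooth_jac[OF F] open_S z])
  have 0: "(\<Sum>a\<in>UNIV. pd i (\<lambda>x. jac G (F x) k a) (base z) * J a j + K k a * H a i j) = 0" for k
  proof -
    have "pd i (\<lambda>x. \<Sum>a\<in>UNIV. jac G (F x) k a * jac F x a j) (base z) =
        pd i (\<lambda>x. if k = j then 1 else 0) (base z)"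
    proof (rule pd_cong_open[OF open_S z])
      fix y assume y: "y \<in> S"
      show "(\<Sum>a\<in>UNIV. jac G (F y) k a * jac F y a j) = (if k = j then 1 else 0)"
        using inverse_matrices_jac[OF open_S open_T F G FS GT GF FG y]
        unfolding inverse_matrices_def by blast
    qed
    then show ?thesis using dK dJ by (simp add: pd_sum pd_mult add.commute)
  qed
  have "(\<Sum>a\<in>UNIV. N a i * J a j) + (\<Sum>a\<in>UNIV. p' a * H a i j) =
      (\<Sum>k\<in>UNIV. fibre z $ k * (\<Sum>a\<in>UNIV. pd i (\<lambda>x. jac G (F x) k a) (base z) * J a j + K k a * H a i j))"
    unfolding fibre_lift sum_distrib_left sum_distrib_right
    by (subst (1 2) sum.swap) (simp only: sum.distrib[symmetric] distrib_left mult_ac)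
  then show ?thesis unfolding 0 by simp
qed

lemma momentum_lift: "momentum U z i = (\<Sum>a\<in>UNIV. J a i * momentum U' (lift F G z) a)"
proof -
  have "momentum U z i = (\<Sum>a\<in>UNIV. p' a * (\<Sum>k\<in>UNIV. U (base z) i k * J a k))"
    unfolding momentum_def fibre_J sum_distrib_left sum_distrib_right
    by (rule trans[OF sum.swap]) (simp only: mult_ac)
  also have "\<dots> = (\<Sum>a\<in>UNIV. J a i * momentum U' (lift F G z) a)"
    unfolding law_U[OF z] momentum_def sum_distrib_left base_lift
    by (rule trans[OF sum.swap]) (simp only: mult_ac)
  finally show ?thesis .
qed

text \<open>The inhomogeneous term of the connection law enters with factor -2 and is, by
  \<open>N_J\<close>, the sum of the two terms with \<open>N\<close>. These are the cross terms that
  the canonical pairing of base and fibre produces under the lift, so connection and pairing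
  compensate each other.\<close>

lemma walker_part_lift:
  "walker_part \<Gamma> \<Phi> U z i j = (\<Sum>a\<in>UNIV. \<Sum>b\<in>UNIV. J a i * J b j * walker_part \<Gamma>' \<Phi>' U' (lift F G z) a b)
     + (\<Sum>a\<in>UNIV. J a i * N a j) + (\<Sum>a\<in>UNIV. N a i * J a j)"
proof -
  have H_sym: "H a i j = H a j i" for a
    unfolding jac_def using F unfolding smooth_map_on_def by (intro pd_commute[OF _ open_S z]) simp
  have 1: "(\<Sum>a\<in>UNIV. J a i * N a j) = - (\<Sum>a\<in>UNIV. p' a * H a i j)"
    using N_J[of j i] by (simp only: mult.commute H_sym)
  have "(\<Sum>k\<in>UNIV. fibre z $ k * \<Gamma> (base z) i j k) = (\<Sum>a\<in>UNIV. p' a * (\<Sum>k\<in>UNIV. \<Gamma> (base z) i j k * J a k))"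
    unfolding fibre_J sum_distrib_left sum_distrib_right
    by (rule trans[OF sum.swap]) (simp only: mult_ac)
  also have "\<dots> = (\<Sum>a\<in>UNIV. p' a * H a i j) +
      (\<Sum>e\<in>UNIV. \<Sum>a\<in>UNIV. \<Sum>b\<in>UNIV. J a i * J b j * (p' e * \<Gamma>' (F (base z)) a b e))"
    unfolding law[unfolded connection_law_def, rule_format, OF z] distrib_left sum.distrib
      sum_distrib_left by (simp only: mult_ac)
  also have "(\<Sum>e\<in>UNIV. \<Sum>a\<in>UNIV. \<Sum>b\<in>UNIV. J a i * J b j * (p' e * \<Gamma>' (F (base z)) a b e)) =
      (\<Sum>a\<in>UNIV. \<Sum>b\<in>UNIV. J a i * J b j * (\<Sum>e\<in>UNIV. p' e * \<Gamma>' (F (base z)) a b e))"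
    unfolding sum_distrib_left by (rule sum_rotate3)
  finally have 2: "(\<Sum>k\<in>UNIV. fibre z $ k * \<Gamma> (base z) i j k) = (\<Sum>a\<in>UNIV. p' a * H a i j) +
      (\<Sum>a\<in>UNIV. \<Sum>b\<in>UNIV. J a i * J b j * (\<Sum>e\<in>UNIV. p' e * \<Gamma>' (F (base z)) a b e))" .
  have 3: "momentum U z i * momentum U z j = (\<Sum>a\<in>UNIV. \<Sum>b\<in>UNIV. J a i * J b j *
      (momentum U' (lift F G z) a * momentum U' (lift F G z) b))"
    unfolding momentum_lift sum_product by (simp only: mult_ac)
  show ?thesis
    unfolding walker_part_def[of \<Gamma>] 2 3 1 N_J pull_\<Phi>[OF z] pull2_def walker_part_def base_lift
    by (simp add: algebra_simps sum.distrib sum_subtractf sum_distrib_left)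
qed

lemma jac_lift:
  "a \<in> {1, 2} \<Longrightarrow> i \<in> {3, 4} \<Longrightarrow> jac (lift F G) z a i = 0"
  "jac (lift F G) z 1 1 = J 1 1" "jac (lift F G) z 1 2 = J 1 2"
  "jac (lift F G) z 2 1 = J 2 1" "jac (lift F G) z 2 2 = J 2 2"
  "jac (lift F G) z 3 1 = N 1 1" "jac (lift F G) z 3 2 = N 1 2"
  "jac (lift F G) z 4 1 = N 2 1" "jac (lift F G) z 4 2 = N 2 2"
  "jac (lift F G) z 3 3 = K 1 1" "jac (lift F G) z 3 4 = K 2 1"
  "jac (lift F G) z 4 3 = K 1 2" "jac (lift F G) z 4 4 = K 2 2"
proof -
  have dF: "(\<lambda>x. F x $ a) differentiable (at (base z))" for a
    by (rule smooth_map_on_differentiable[OF F open_S z])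
  have dK: "(\<lambda>x. jac G (F x) k a) differentiable (at (base z))" for k a
    by (rule smooth_fun_on_differentiable[OF smooth_GF open_S z])
  have df: "(\<lambda>z. fibre z $ k) differentiable (at z)" for k
    by (rule smooth_fun_on_differentiable[OF smooth_fibre open_UNIV]) simp
  have pf: "pd i (\<lambda>z. fibre z $ 1) z = (if i = 3 then 1 else 0)"
    "pd i (\<lambda>z. fibre z $ 2) z = (if i = 4 then 1 else 0)" for i
    by (simp_all add: fibre_nth)
  have 1: "jac (lift F G) z 1 i = (if i = 1 then J 1 1 else if i = 2 then J 1 2 else 0)"
    "jac (lift F G) z 2 i = (if i = 1 then J 2 1 else if i = 2 then J 2 2 else 0)" for i
    unfolding jac_def lift_def vector_4 pd_base(1)[OF dF] by simp_all
  have 2: "pd i (\<lambda>z. \<Sum>k\<in>UNIV. fibre z $ k * jac G (F (base z)) k a) z =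
      (if i = 1 then N a 1 else if i = 2 then N a 2 else if i = 3 then K 1 a else K 2 a)" for i a
    using exhaust_4[of i]
    by (subst pd_sum) (auto intro!: differentiable_mult df pd_base(2)[OF dK]
        simp: sum_2 pd_mult[OF df pd_base(2)[OF dK]] pd_base(1)[OF dK] pf)
  have 3: "jac (lift F G) z 3 i = (if i = 1 then N 1 1 else if i = 2 then N 1 2 else if i = 3 then K 1 1 else K 2 1)"
    "jac (lift F G) z 4 i = (if i = 1 then N 2 1 else if i = 2 then N 2 2 else if i = 3 then K 1 2 else K 2 2)" for i
    unfolding jac_def[of "lift F G"] lift_def vector_4 2 by (rule refl)+
  show "a \<in> {1, 2} \<Longrightarrow> i \<in> {3, 4} \<Longrightarrow> jac (lift F G) z a i = 0"
    by (auto simp: 1)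
  show "jac (lift F G) z 1 1 = J 1 1" "jac (lift F G) z 1 2 = J 1 2"
  "jac (lift F G) z 2 1 = J 2 1" "jac (lift F G) z 2 2 = J 2 2"
  "jac (lift F G) z 3 1 = N 1 1" "jac (lift F G) z 3 2 = N 1 2"
  "jac (lift F G) z 4 1 = N 2 1" "jac (lift F G) z 4 2 = N 2 2"
  "jac (lift F G) z 3 3 = K 1 1" "jac (lift F G) z 3 4 = K 2 1"
  "jac (lift F G) z 4 3 = K 1 2" "jac (lift F G) z 4 4 = K 2 2"
    by (simp_all add: 1 3)
qed

lemma deformed_extension_lift:
  "deformed_extension \<Gamma> \<Phi> U z $ i $ j =
     pull2 (jac (lift F G) z) (\<lambda>a b. deformed_extension \<Gamma>' \<Phi>' U' (lift F G z) $ a $ b) i j"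
proof -
  have v0: "jac (lift F G) z 1 3 = 0" "jac (lift F G) z 1 4 = 0" "jac (lift F G) z 2 3 = 0" "jac (lift F G) z 2 4 = 0"
    by (simp_all add: jac_lift(1))
  have K: "J 1 1 * K 1 1 + J 2 1 * K 1 2 = 1" "J 1 1 * K 2 1 + J 2 1 * K 2 2 = 0"
    "J 1 2 * K 1 1 + J 2 2 * K 1 2 = 0" "J 1 2 * K 2 1 + J 2 2 * K 2 2 = 1"
    using KJ[of 1 1] KJ[of 2 1] KJ[of 1 2] KJ[of 2 2] by (simp_all add: sum_2 mult.commute)
  define Q where "Q = walker_part \<Gamma>' \<Phi>' U' (lift F G z)"
  note w = walker_part_lift[folded Q_def, unfolded sum_2]
  show ?thesis
    unfolding deformed_extension_block_form Q_def[symmetric] pull2_def sum_4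
    using exhaust_4[of i] exhaust_4[of j] K
    apply (elim disjE)
    apply (simp_all add: block_form_def v0 jac_lift(2-) w sum_2)
    apply (simp_all add: algebra_simps)
    done
qed

end

text \<open>The lift of the inverse map inverts the lift, so its Jacobian is the pointwise inverse
  that the locale asks for.\<close>

lemma isometry_lift:
  "isometry (base -` S) (base -` T) (lift F G) (deformed_extension \<Gamma> \<Phi> U) (deformed_extension \<Gamma>' \<Phi>' U')
     (\<lambda>z. jac (lift G F) (lift F G z))"
proof
  note Sb = open_base_vimage[OF open_S] and Tb = open_base_vimage[OF open_T]
  show "open (base -` S)" "open (base -` T)" by (rule Sb Tb)+
  show "smooth_map_on (base -` S) (lift F G)" by (rule smooth_lift[OF open_S open_T F G FS])
  show LS: "lift F G ` (base -` S) \<subseteq> base -` T" using FS by auto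
  interpret w: walker_metric "walker_part \<Gamma>' \<Phi>' U'" "base -` T"
    by (rule walker_metric_deformed_extension[OF data'])
  show "smooth_fun_on (base -` T) (\<lambda>y. deformed_extension \<Gamma>' \<Phi>' U' y $ i $ j)" for i j
    unfolding deformed_extension_block_form block_form_def
    using exhaust_4[of i] exhaust_4[of j] by (elim disjE; simp add: w.smooth_P smooth_fun_on_const)
  show "deformed_extension \<Gamma>' \<Phi>' U' y $ i $ j = deformed_extension \<Gamma>' \<Phi>' U' y $ j $ i"
    if "y \<in> base -` T" for y i j
    unfolding deformed_extension_block_form block_form_def
    using exhaust_4[of i] exhaust_4[of j] w.P_sym[OF that] by (elim disjE; simp)
  show "invertible (deformed_extension \<Gamma>' \<Phi>' U' y)" for y
    unfolding deformed_extension_block_form by (rule invertible_block_form)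
  show "deformed_extension \<Gamma> \<Phi> U y $ i $ j =
      pull2 (jac (lift F G) y) (\<lambda>a b. deformed_extension \<Gamma>' \<Phi>' U' (lift F G y) $ a $ b) i j"
    if "y \<in> base -` S" for y i j
    using that by (intro deformed_extension_lift) simp
  have inv: "lift G' F' (lift F' G' z) = z"
    if "\<And>x. x \<in> S' \<Longrightarrow> G' (F' x) = x" "\<And>x. x \<in> S' \<Longrightarrow> inverse_matrices (jac F' x) (jac G' (F' x))" "base z \<in> S'"
    for F' G' z and S' :: "(real^2) set"
  proof -
    have e: "(\<Sum>a\<in>UNIV. jac G' (F' (base z)) i a * jac F' (base z) a j) = (if i = j then 1 else 0)" for i j
      using that(2)[OF that(3)] unfolding inverse_matrices_def by blast
    have "fibre (lift G' F' (lift F' G' z)) $ j =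
        (\<Sum>k\<in>UNIV. fibre z $ k * (\<Sum>a\<in>UNIV. jac G' (F' (base z)) k a * jac F' (base z) a j))" for j
      unfolding fibre_lift base_lift that(1)[OF that(3)] sum_distrib_left sum_distrib_right
      by (rule trans[OF sum.swap]) (simp only: mult_ac)
    then have "fibre (lift G' F' (lift F' G' z)) $ j = fibre z $ j" for j unfolding e by simp
    moreover have "base (lift G' F' (lift F' G' z)) $ j = base z $ j" for j
      using that by simp
    ultimately show ?thesis
      unfolding vec_eq_iff forall_4 using base_nth fibre_nth by metis
  qed
  note iF = inverse_matrices_jac[OF open_S open_T F G FS GT GF FG]
    and iG = inverse_matrices_jac[OF open_T open_S G F GT FS FG GF]
  show "inverse_matrices (jac (lift F G) y) (jac (lift G F) (lift F G y))" if "y \<in> base -` S" for y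
  proof (rule inverse_matrices_jac[OF Sb Tb smooth_lift[OF open_S open_T F G FS] smooth_lift[OF open_T open_S G F GT] LS _ _ _ that])
    show "lift G F ` (base -` T) \<subseteq> base -` S" using GT by auto
    show "lift G F (lift F G x) = x" if "x \<in> base -` S" for x
      using that by (intro inv[OF GF iF]) auto
    show "lift F G (lift G F y) = y" if "y \<in> base -` T" for y
      using that by (intro inv[OF FG iG]) auto
  qed
qed

theorem W_plus_lift:
  assumes z: "base z \<in> S" and W: "W_plus_vanishes 1 (deformed_extension \<Gamma>' \<Phi>' U') (lift F G z)"
  shows "W_plus_vanishes 1 (deformed_extension \<Gamma> \<Phi> U) z"
proof (rule isometry.W_plus_transform[OF isometry_lift _ _ _
      deformed_extension_block_form _ deformed_extension_block_form _ _ W])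
  note w = walker_metric_deformed_extension[OF data] and w' = walker_metric_deformed_extension[OF data']
  show "z \<in> base -` S" using z by simp
  show "smooth_fun_on (base -` S) (\<lambda>x. levi_civita (deformed_extension \<Gamma> \<Phi> U) x i j k)" for i j k
    using walker_metric.smooth_levi_civita[OF w(1)] unfolding w(2) .
  show "smooth_fun_on (base -` T) (\<lambda>x. levi_civita (deformed_extension \<Gamma>' \<Phi>' U') x i j k)" for i j k
    using walker_metric.smooth_levi_civita[OF w'(1)] unfolding w'(2) .
  show "walker_part \<Gamma> \<Phi> U z 2 1 = walker_part \<Gamma> \<Phi> U z 1 2"
    by (rule walker_part_sym[OF data z])
  show "walker_part \<Gamma>' \<Phi>' U' (lift F G z) 2 1 = walker_part \<Gamma>' \<Phi>' U' (lift F G z) 1 2"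
    using FS z by (intro walker_part_sym[OF data']) auto
  show "jac (lift F G) z a i = 0" if "a \<in> {1, 2}" "i \<in> {3, 4}" for a i
    by (rule jac_lift(1)[OF z that])
qed

end

subsection \<open>Charts\<close>

lemma smooth_map_on_cong:
  assumes "open S" "\<And>x. x \<in> S \<Longrightarrow> F x = F' x" "smooth_map_on S F"
  shows "smooth_map_on S F'"
  unfolding smooth_map_on_def
proof
  fix a
  show "smooth_fun_on S (\<lambda>x. F' x $ a)"
    by (rule smooth_fun_on_cong[of S "\<lambda>x. F x $ a"])
      (use assms in \<open>simp_all add: smooth_map_on_def\<close>)
qed

lemma homeomorphic_map_top_of_set:
  assumes "homeomorphism U V F G"
  shows "homeomorphic_map (top_of_set U) (top_of_set V) F"
proof -
  have "homeomorphic_maps (top_of_set U) (top_of_set V) F G"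
    using assms unfolding homeomorphism_def homeomorphic_maps_def
    by (auto simp: continuous_map_in_subtopology)
  then show ?thesis using homeomorphic_map_maps by blast
qed

locale affine_surface_locale =
  fixes X :: "'a topology" and A :: "'a chart set" and \<Gamma> :: "'a chart \<Rightarrow> 2 tensor3_comp"
  assumes surface: "affine_surface X A \<Gamma>"
begin

lemma chart_of: "c \<in> A \<Longrightarrow> chart_of X c"
  and compatible: "c \<in> A \<Longrightarrow> d \<in> A \<Longrightarrow> compatible c d"
  and maximal: "chart_of X c \<Longrightarrow> (\<And>d. d \<in> A \<Longrightarrow> compatible c d) \<Longrightarrow> c \<in> A"
  and charts_cover: "(\<Union>c\<in>A. fst c) = topspace X"
  using surface unfolding affine_surface_def smooth_surface_def by blast+

lemma chart_domain: "c \<in> A \<Longrightarrow> openin X (fst c)"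
  and open_chart_image: "c \<in> A \<Longrightarrow> open (chart_image c)"
  and chart_homeo: "c \<in> A \<Longrightarrow> homeomorphic_map (subtopology X (fst c)) (top_of_set (chart_image c)) (snd c)"
  using chart_of unfolding chart_of_def by blast+

lemma topspace_chart: "c \<in> A \<Longrightarrow> topspace (subtopology X (fst c)) = fst c"
  using openin_subset[OF chart_domain, of c] by (simp add: Int_absorb1)

lemma inj_chart: "c \<in> A \<Longrightarrow> inj_on (snd c) (fst c)"
  using homeomorphic_imp_injective_map[OF chart_homeo, of c] by (simp only: topspace_chart)

lemma inv_chart: "c \<in> A \<Longrightarrow> p \<in> fst c \<Longrightarrow> inv_into (fst c) (snd c) (snd c p) = p"
  by (rule inv_into_f_f[OF inj_chart])

lemma transition_chart: "c \<in> A \<Longrightarrow> p \<in> fst c \<Longrightarrow> transition c d (snd c p) = snd d p"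
  by (simp add: transition_def inv_chart)

lemma chart_imageE:
  assumes "x \<in> chart_image c" obtains p where "p \<in> fst c" "x = snd c p"
  using assms unfolding chart_image_def by auto

lemma chart_imageI: "p \<in> fst c \<Longrightarrow> snd c p \<in> chart_image c"
  by (simp add: chart_image_def)

lemma overlapI: "p \<in> fst c \<Longrightarrow> p \<in> fst d \<Longrightarrow> snd c p \<in> overlap c d"
  by (simp add: overlap_def)

lemma overlapE:
  assumes "x \<in> overlap c d" obtains p where "p \<in> fst c" "p \<in> fst d" "x = snd c p"
  using assms unfolding overlap_def by auto

lemma overlap_subset: "overlap c d \<subseteq> chart_image c"
  by (auto simp: overlap_def chart_image_def)

lemma open_chart_of_openin:
  assumes c: "c \<in> A" and W: "openin X W" "W \<subseteq> fst c"
  shows "open (snd c ` W)"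
proof -
  have "openin (subtopology X (fst c)) W"
    using W by (auto simp: openin_subtopology)
  then have "openin (top_of_set (chart_image c)) (snd c ` W)"
    using homeomorphic_imp_open_map[OF chart_homeo[OF c]] unfolding open_map_def by blast
  then show ?thesis
    using openin_open_trans open_chart_image[OF c] by blast
qed

lemma openin_chart_vimage:
  assumes c: "c \<in> A" and U: "open U"
  shows "openin X {p \<in> fst c. snd c p \<in> U}"
proof -
  have "continuous_map (subtopology X (fst c)) (top_of_set (chart_image c)) (snd c)"
    using homeomorphic_imp_continuous_map[OF chart_homeo[OF c]] .
  then have "continuous_map (subtopology X (fst c)) euclidean (snd c)"
    by (simp add: continuous_map_in_subtopology)
  then have "openin (subtopology X (fst c)) {p \<in> topspace (subtopology X (fst c)). snd c p \<in> U}"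
    using U by (intro openin_continuous_map_preimage) auto
  then show ?thesis
    unfolding topspace_chart[OF c] using openin_trans_full chart_domain[OF c] by blast
qed

lemma open_overlap:
  assumes c: "c \<in> A" and d: "d \<in> A"
  shows "open (overlap c d)"
  unfolding overlap_def
  by (rule open_chart_of_openin[OF c]) (auto intro: openin_Int chart_domain c d)

lemma smooth_transition: "c \<in> A \<Longrightarrow> d \<in> A \<Longrightarrow> smooth_map_on (overlap c d) (transition c d)"
  using compatible unfolding compatible_def by blast

lemma transition_image:
  assumes c: "c \<in> A"
  shows "transition c d ` overlap c d \<subseteq> overlap d c"
  using c by (auto elim!: overlapE simp: transition_chart intro: overlapI)

lemma transition_transition:
  assumes "c \<in> A" "d \<in> A" "x \<in> overlap c d"
  shows "transition d c (transition c d x) = x"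
  using assms by (auto elim!: overlapE simp: transition_chart)

lemma jacobian_eq: "jacobian c d x a i = jac (transition c d) x a i"
  by (simp add: jacobian_def jac_def)

lemma inverse_jacobian:
  assumes "c \<in> A" "d \<in> A" "x \<in> overlap c d"
  shows "inverse_matrices (jac (transition c d) x) (jac (transition d c) (transition c d x))"
  by (rule inverse_matrices_jac[OF open_overlap[OF assms(1,2)] open_overlap[OF assms(2,1)]
        smooth_transition[OF assms(1,2)] smooth_transition[OF assms(2,1)] transition_image[OF assms(1)]
        transition_image[OF assms(2)] transition_transition[OF assms(1,2)] transition_transition[OF assms(2,1)] assms(3)])

lemma smooth_\<Gamma>: "c \<in> A \<Longrightarrow> smooth_fun_on (chart_image c) (\<lambda>x. \<Gamma> c x i j k)"
  and \<Gamma>_sym: "c \<in> A \<Longrightarrow> x \<in> chart_image c \<Longrightarrow> \<Gamma> c x i j k = \<Gamma> c x j i k"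
  using surface unfolding affine_surface_def affine_connection_def torsion_free_def by blast+

lemma connection_law_transition:
  assumes "c \<in> A" "d \<in> A"
  shows "connection_law (overlap c d) (transition c d) (\<Gamma> c) (\<Gamma> d)"
  using surface assms unfolding affine_surface_def affine_connection_def connection_law_def jacobian_eq
  by blast

lemma riemann_transition:
  assumes c: "c \<in> A" and d: "d \<in> A" and x: "x \<in> overlap c d"
  shows "(\<Sum>l\<in>UNIV. riemann (\<Gamma> c) x i j k l * jac (transition c d) x a l) =
    (\<Sum>b\<in>UNIV. \<Sum>e\<in>UNIV. \<Sum>f\<in>UNIV. jac (transition c d) x b i * jac (transition c d) x e j *
       jac (transition c d) x f k * riemann (\<Gamma> d) (transition c d x) b e f a)"
  by (rule riemann_transform[OF open_overlap[OF c d] open_overlap[OF d c] smooth_transition[OF c d]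
        transition_image[OF c] smooth_fun_on_subset[OF smooth_\<Gamma>[OF c] overlap_subset]
        smooth_fun_on_subset[OF smooth_\<Gamma>[OF d] overlap_subset] connection_law_transition[OF c d] x])

text \<open>Vanishing of the curvature at a point does not depend on the chart; this makes
  \<open>nonflat_locus\<close> an intrinsic set.\<close>

lemma riemann_zero_transition:
  assumes c: "c \<in> A" and d: "d \<in> A" and x: "x \<in> overlap c d"
    and 0: "\<And>i j k l. riemann (\<Gamma> d) (transition c d x) i j k l = 0"
  shows "riemann (\<Gamma> c) x i j k l = 0"
proof -
  let ?J = "jac (transition c d) x" and ?K = "jac (transition d c) (transition c d x)"
  have "riemann (\<Gamma> c) x i j k l = (\<Sum>m\<in>UNIV. riemann (\<Gamma> c) x i j k m * (\<Sum>a\<in>UNIV. ?K l a * ?J a m))"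
    using inverse_jacobian[OF c d x] unfolding inverse_matrices_def by simp
  also have "\<dots> = (\<Sum>a\<in>UNIV. ?K l a * (\<Sum>m\<in>UNIV. riemann (\<Gamma> c) x i j k m * ?J a m))"
    unfolding sum_distrib_left by (rule trans[OF sum.swap]) (simp only: mult_ac)
  also have "\<dots> = 0" unfolding riemann_transition[OF c d x] 0 by simp
  finally show ?thesis .
qed

lemma ricci_transition:
  assumes c: "c \<in> A" and d: "d \<in> A" and x: "x \<in> overlap c d"
  shows "ricci (\<Gamma> c) x j k = pull2 (jac (transition c d) x) (ricci (\<Gamma> d) (transition c d x)) j k"
  by (rule ricci_transform[OF inverse_jacobian[OF c d x] riemann_transition[OF c d x]])

lemma smooth_riemann:
  assumes c: "c \<in> A"
  shows "smooth_fun_on (chart_image c) (\<lambda>x. riemann (\<Gamma> c) x i j k l)"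
  unfolding riemann_def by (intro smooth_intros open_chart_image c smooth_\<Gamma>)

lemma smooth_ricci:
  assumes c: "c \<in> A"
  shows "smooth_fun_on (chart_image c) (\<lambda>x. ricci (\<Gamma> c) x i j)"
  unfolding ricci_def by (intro smooth_intros open_chart_image c smooth_riemann)

lemma cov_deriv_02_transition:
  assumes c: "c \<in> A" and d: "d \<in> A" and x: "x \<in> overlap c d"
    and \<Phi>: "\<And>i j. smooth_fun_on (chart_image d) (\<lambda>x. \<Phi>' x i j)"
    and pull: "\<And>y i j. y \<in> overlap c d \<Longrightarrow> \<Phi> y i j = pull2 (jac (transition c d) y) (\<Phi>' (transition c d y)) i j"
  shows "cov_deriv_02 (\<Gamma> c) \<Phi> x i j k = (\<Sum>a\<in>UNIV. \<Sum>b\<in>UNIV. \<Sum>e\<in>UNIV.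
    jac (transition c d) x a i * jac (transition c d) x b j * jac (transition c d) x e k *
    cov_deriv_02 (\<Gamma> d) \<Phi>' (transition c d x) a b e)"
  by (rule cov_deriv_02_transform[OF open_overlap[OF c d] open_overlap[OF d c] smooth_transition[OF c d]
        transition_image[OF c] smooth_fun_on_subset[OF \<Phi> overlap_subset] pull connection_law_transition[OF c d] x])

lemma atlas_on_subset: "atlas_on A S \<subseteq> A"
  by (auto simp: atlas_on_def)

lemma symmetric_02_transition:
  assumes "symmetric_02_tensor A' \<Phi>" "c \<in> A'" "d \<in> A'" "x \<in> overlap c d"
  shows "\<Phi> c x i j = pull2 (jac (transition c d) x) (\<Phi> d (transition c d x)) i j"
  using assms unfolding symmetric_02_tensor_def pull2_def jacobian_eq by blast

lemma tensor_11_transition: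
  assumes "tensor_11 A' T" "c \<in> A'" "d \<in> A'" "x \<in> overlap c d"
  shows "(\<Sum>k\<in>UNIV. T c x i k * jac (transition c d) x a k) =
    (\<Sum>b\<in>UNIV. jac (transition c d) x b i * T d (transition c d x) b a)"
  using assms unfolding tensor_11_def jacobian_eq by blast

lemma smooth_data_chart:
  assumes c: "c \<in> A" "c \<in> A'" and \<Phi>: "symmetric_02_tensor A' \<Phi>" and T: "tensor_11 A T"
    and S: "open S" "S \<subseteq> chart_image c"
  shows "smooth_data S (\<Gamma> c) (\<Phi> c) (T c)"
  unfolding smooth_data_def
proof (intro conjI allI ballI)
  show "smooth_fun_on S (\<lambda>x. \<Gamma> c x i j k)" for i j k
    by (rule smooth_fun_on_subset[OF smooth_\<Gamma>[OF c(1)] S(2)])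
  show "smooth_fun_on S (\<lambda>x. \<Phi> c x i j)" for i j
    using \<Phi> c(2) unfolding symmetric_02_tensor_def by (intro smooth_fun_on_subset[OF _ S(2)]) blast
  show "smooth_fun_on S (\<lambda>x. T c x i j)" for i j
    using T c(1) unfolding tensor_11_def by (intro smooth_fun_on_subset[OF _ S(2)]) blast
  show "\<Gamma> c x i j k = \<Gamma> c x j i k" if "x \<in> S" for x i j k
    using \<Gamma>_sym[OF c(1)] S(2) that by blast
  show "\<Phi> c x i j = \<Phi> c x j i" if "x \<in> S" for x i j
    using \<Phi> c(2) S(2) that unfolding symmetric_02_tensor_def by blast
qed (rule S)

lemma coordinate_change_transition:
  assumes c: "c \<in> A" "c \<in> A'" and d: "d \<in> A" "d \<in> A'"
    and \<Phi>: "symmetric_02_tensor A' \<Phi>" and T: "tensor_11 A T"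
  shows "coordinate_change (overlap c d) (overlap d c) (transition c d) (transition d c)
    (\<Gamma> c) (\<Gamma> d) (\<Phi> c) (\<Phi> d) (T c) (T d)"
proof
  note cd = c(1) d(1) and dc = d(1) c(1)
  show "open (overlap c d)" "open (overlap d c)" by (intro open_overlap cd dc)+
  show "smooth_map_on (overlap c d) (transition c d)" "smooth_map_on (overlap d c) (transition d c)"
    by (intro smooth_transition cd dc)+
  show "transition c d ` overlap c d \<subseteq> overlap d c" "transition d c ` overlap d c \<subseteq> overlap c d"
    by (intro transition_image c d)+
  show "smooth_data (overlap c d) (\<Gamma> c) (\<Phi> c) (T c)" "smooth_data (overlap d c) (\<Gamma> d) (\<Phi> d) (T d)"
    by (intro smooth_data_chart[OF c \<Phi> T open_overlap[OF cd] overlap_subset]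
        smooth_data_chart[OF d \<Phi> T open_overlap[OF dc] overlap_subset])+
qed (use transition_transition c d connection_law_transition symmetric_02_transition[OF \<Phi>]
      tensor_11_transition[OF T] in auto)

text \<open>By maximality of the atlas it suffices to check compatibility with its members, and
  there the transition maps are old ones composed with \<open>F\<close> or \<open>G\<close>.\<close>

lemma new_chart:
  assumes c: "c \<in> A" and U: "open U" "U \<subseteq> chart_image c" and V: "open V"
    and hom: "homeomorphism U V F G" and F: "smooth_map_on U F" and G: "smooth_map_on V G"
  defines "c' \<equiv> ({p \<in> fst c. snd c p \<in> U}, F \<circ> snd c)"
  shows "c' \<in> A" and "chart_image c' = V" and "overlap c c' = U"
    and "\<And>x. x \<in> U \<Longrightarrow> transition c c' x = F x"
proof -
  let ?W = "{p \<in> fst c. snd c p \<in> U}"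
  have FG: "F ` U = V" "G ` V = U" "\<And>x. x \<in> U \<Longrightarrow> G (F x) = x" "\<And>y. y \<in> V \<Longrightarrow> F (G y) = y"
    using hom unfolding homeomorphism_def by auto
  have W: "openin X ?W" by (rule openin_chart_vimage[OF c U(1)])
  have uW: "snd c ` ?W = U" using U(2) by (auto simp: chart_image_def)
  show img: "chart_image c' = V"
    unfolding chart_image_def c'_def fst_conv snd_conv image_comp[symmetric] uW FG(1) ..
  have h1: "homeomorphic_map (subtopology X ?W) (top_of_set U) (snd c)"
  proof -
    have "homeomorphic_map (subtopology (subtopology X (fst c)) ?W) (subtopology (top_of_set (chart_image c)) U) (snd c)"
      by (rule homeomorphic_map_subtopologies_alt[OF chart_homeo[OF c]]) (auto simp: topspace_chart[OF c])
    moreover have "fst c \<inter> ?W = ?W" "chart_image c \<inter> U = U" using U(2) by auto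
    ultimately show ?thesis by (simp add: subtopology_subtopology)
  qed
  have "homeomorphic_map (subtopology X ?W) (top_of_set V) (F \<circ> snd c)"
    by (rule homeomorphic_map_compose[OF h1 homeomorphic_map_top_of_set[OF hom]])
  then have chart: "chart_of X c'"
    unfolding chart_of_def using W V img by (simp add: c'_def)
  have inj: "inj_on (F \<circ> snd c) ?W"
  proof (rule comp_inj_on)
    show "inj_on (snd c) ?W" using inj_chart[OF c] by (rule inj_on_subset) auto
    show "inj_on F (snd c ` ?W)" unfolding uW using FG(3) by (metis inj_onI)
  qed
  have inv': "inv_into ?W (F \<circ> snd c) (F (snd c p)) = p" if "p \<in> ?W" for p
    using inv_into_f_f[OF inj that] by simp
  show "overlap c c' = U"
    unfolding overlap_def c'_def using uW by (simp add: Int_def conj_commute cong: conj_cong)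
  show "transition c c' x = F x" if "x \<in> U" for x
    using that U(2) by (auto elim!: chart_imageE dest!: subsetD simp: transition_chart[OF c] c'_def)
  have ov: "overlap c' d = G -` overlap c d \<inter> V" "overlap d c' = transition d c -` U \<inter> overlap d c" if d: "d \<in> A" for d
  proof -
    show "overlap c' d = G -` overlap c d \<inter> V"
    proof (intro equalityI subsetI)
      fix y assume "y \<in> overlap c' d"
      then obtain p where p: "p \<in> fst c" "snd c p \<in> U" "p \<in> fst d" "y = F (snd c p)"
        unfolding overlap_def c'_def by auto
      then show "y \<in> G -` overlap c d \<inter> V"
        using FG(1,3) by (auto intro: overlapI)
    next
      fix y assume y: "y \<in> G -` overlap c d \<inter> V"
      then obtain p where p: "p \<in> fst c" "p \<in> fst d" "G y = snd c p" by (auto elim: overlapE)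
      then have "snd c p \<in> U" "y = F (snd c p)" using y FG(2,4) by force+
      then show "y \<in> overlap c' d" using p unfolding overlap_def c'_def by auto
    qed
    show "overlap d c' = transition d c -` U \<inter> overlap d c"
      unfolding overlap_def c'_def by (auto simp: transition_chart[OF d])
  qed
  have cont: "continuous_on V G" "continuous_on U F"
    using hom unfolding homeomorphism_def by auto
  have "compatible c' d" if d: "d \<in> A" for d
    unfolding compatible_def
  proof
    have o1: "open (overlap c' d)"
      unfolding ov(1)[OF d] using continuous_open_preimage[OF cont(1) V open_overlap[OF c d]]
      by (simp add: Int_commute)
    have "smooth_map_on (overlap c' d) (\<lambda>y. transition c d (G y))"
    proof (rule smooth_map_on_compose[OF o1 open_overlap[OF c d] _ _ smooth_transition[OF c d]])
      show "G ` overlap c' d \<subseteq> overlap c d" unfolding ov(1)[OF d] by auto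
      show "smooth_map_on (overlap c' d) G"
        by (rule smooth_map_on_subset[OF G]) (auto simp: ov(1)[OF d])
    qed
    then show "smooth_map_on (overlap c' d) (transition c' d)"
    proof (rule smooth_map_on_cong[OF o1, rotated])
      fix y assume "y \<in> overlap c' d"
      then obtain p where p: "p \<in> fst c" "snd c p \<in> U" "p \<in> fst d" "y = F (snd c p)"
        unfolding overlap_def c'_def by auto
      then have "transition c' d y = snd d p"
        using inv'[of p] by (simp add: transition_def c'_def)
      then show "transition c d (G y) = transition c' d y"
        using p FG(3) by (simp add: transition_chart[OF c])
    qed
    have o2: "open (overlap d c')"
      unfolding ov(2)[OF d]
      using continuous_open_preimage[OF smooth_map_on_continuous[OF smooth_transition[OF d c]] open_overlap[OF d c] U(1)]
      by (simp add: Int_commute)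
    have "smooth_map_on (overlap d c') (\<lambda>y. F (transition d c y))"
    proof (rule smooth_map_on_compose[OF o2 U(1) _ _ F])
      show "transition d c ` overlap d c' \<subseteq> U" unfolding ov(2)[OF d] by auto
      show "smooth_map_on (overlap d c') (transition d c)"
        by (rule smooth_map_on_subset[OF smooth_transition[OF d c]]) (auto simp: ov(2)[OF d])
    qed
    then show "smooth_map_on (overlap d c') (transition d c')"
      by (rule smooth_map_on_cong[OF o2, rotated]) (simp add: transition_def c'_def)
  qed
  with chart show "c' \<in> A" by (rule maximal)
qed

text \<open>Functions with nonzero Jacobian determinant at a point are coordinates near it. Every
  new chart below is obtained in this way.\<close>

lemma chart_composition:
  assumes c: "c \<in> A" and Q: "open Q" "Q \<subseteq> chart_image c" and F: "smooth_map_on Q F"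
    and p: "p \<in> fst c" "snd c p \<in> Q" and det: "jac_det F (snd c p) \<noteq> 0"
  obtains c' where "c' \<in> A" "p \<in> fst c'" "fst c' \<subseteq> fst c" "overlap c c' \<subseteq> Q"
    "snd c ` fst c' = overlap c c'" "\<And>q. q \<in> fst c' \<Longrightarrow> snd c' q = F (snd c q)"
    "\<And>x a i. x \<in> overlap c c' \<Longrightarrow> jac (transition c c') x a i = jac F x a i"
    "\<And>x. x \<in> overlap c c' \<Longrightarrow> transition c c' x = F x"
proof -
  obtain U V G where UV: "open U" "U \<subseteq> Q" "snd c p \<in> U" "open V" "homeomorphism U V F G" "smooth_map_on V G"
    by (rule local_diffeomorphism[OF Q(1) F p(2) det])
  have Uc: "U \<subseteq> chart_image c" using UV(2) Q(2) by auto
  note n = new_chart[OF c UV(1) Uc UV(4,5) smooth_map_on_subset[OF F UV(2)] UV(6)]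
  show ?thesis
  proof (rule that[OF n(1)])
    let ?c' = "({p \<in> fst c. snd c p \<in> U}, F \<circ> snd c)"
    show "jac (transition c ?c') x a i = jac F x a i" if "x \<in> overlap c ?c'" for x a i
      unfolding jac_def using that unfolding n(3)
      by (intro pd_cong_open[OF UV(1)]) (simp_all add: n(4))
    show "snd c ` fst ?c' = overlap c ?c'" unfolding n(3) using Uc by (auto simp: chart_image_def)
  qed (use p UV n in auto)
qed

end

subsection \<open>Parallel nilpotent tensor fields\<close>

lemma Ck_on_exp:
  assumes S: "open S" and f: "Ck_on k f S"
  shows "Ck_on k (\<lambda>x. exp (f x)) S"
  using f
proof (induction k)
  case 0
  then show ?case unfolding Ck_on.simps by (rule continuous_on_exp)
next
  case (Suc k)
  have d: "f differentiable (at x)" if "x \<in> S" for x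
    by (rule Ck_on_differentiable[OF Suc.prems S that])
  have D: "((\<lambda>x. exp (f x)) has_derivative (\<lambda>h. exp (f x) * frechet_derivative f (at x) h)) (at x)" if "x \<in> S" for x
    using has_derivative_exp[OF has_derivative_frechet[OF d[OF that]]] by (simp add: mult.commute)
  show ?case
  proof (rule Ck_on_Suc_I[OF S])
    show "(\<lambda>x. exp (f x)) differentiable (at x)" if "x \<in> S" for x
      using D[OF that] by (rule differentiableI)
    fix i
    have "Ck_on k (\<lambda>x. exp (f x) * pd i f x) S"
    proof (rule Ck_on_mult[OF S])
      show "Ck_on k (\<lambda>x. exp (f x)) S" by (rule Suc.IH[OF Ck_on_pred[OF Suc.prems]])
      show "Ck_on k (pd i f) S" using Suc.prems by simp
    qed
    then show "Ck_on k (pd i (\<lambda>x. exp (f x))) S"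
      by (rule Ck_on_cong[OF S, rotated]) (simp only: pd_eqI[OF D] pd_def[of i f])
  qed
qed

lemma smooth_fun_on_exp [smooth_intros]:
  "open S \<Longrightarrow> smooth_fun_on S f \<Longrightarrow> smooth_fun_on S (\<lambda>x. exp (f x))"
  by (simp add: smooth_fun_on_def Ck_on_exp)

lemma pd_exp:
  assumes "f differentiable (at x)"
  shows "pd i (\<lambda>x. exp (f x)) x = exp (f x) * pd i f x"
  by (rule trans[OF pd_eqI[OF has_derivative_exp[OF has_derivative_frechet[OF assms]]]])
    (simp add: pd_def)

text \<open>A ball of the maximum norm: moving any subset of the coordinates towards the centre
  visibly stays inside, as \<open>smooth_primitive\<close> requires.\<close>

definition cube :: "real^2 \<Rightarrow> real \<Rightarrow> (real^2) set" where
  "cube a e = box (\<chi> i. a $ i - e) (\<chi> i. a $ i + e)"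

lemma cube_iff: "x \<in> cube a e \<longleftrightarrow> (\<forall>i. \<bar>x $ i - a $ i\<bar> < e)"
  by (auto simp: cube_def mem_box_cart abs_less_iff algebra_simps)

lemma cube_basic: "open (cube a e)" "convex (cube a e)" "e > 0 \<Longrightarrow> a \<in> cube a e"
  by (auto simp: cube_def convex_box cube_iff[unfolded cube_def])

lemma contraction_cube: "t \<in> {0..1} \<Longrightarrow> x \<in> cube a e \<Longrightarrow> contraction M a t x \<in> cube a e"
  unfolding cube_iff contraction_def
proof
  fix i assume t: "t \<in> {0..1}" and x: "\<forall>i. \<bar>x $ i - a $ i\<bar> < e"
  have "\<bar>t * (x $ i - a $ i)\<bar> \<le> 1 * \<bar>x $ i - a $ i\<bar>"
    unfolding abs_mult using t by (intro mult_right_mono) auto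
  then show "\<bar>(\<chi> i. if i \<in> M then a $ i + t * (x $ i - a $ i) else x $ i) $ i - a $ i\<bar> < e"
    using x[rule_format, of i] by auto
qed

lemma cube_subset:
  assumes "open U" "a \<in> U"
  obtains e where "e > 0" "cube a e \<subseteq> U"
proof -
  obtain r where r: "r > 0" "ball a r \<subseteq> U" using assms open_contains_ball by blast
  have "cube a (r / 2) \<subseteq> ball a r"
  proof
    fix x assume x: "x \<in> cube a (r / 2)"
    have "norm (x - a) \<le> \<bar>x $ 1 - a $ 1\<bar> + \<bar>x $ 2 - a $ 2\<bar>"
      using norm_le_l1_cart[of "x - a"] by (simp add: sum_2)
    also have "\<dots> < r" using x[unfolded cube_iff, rule_format, of 1] x[unfolded cube_iff, rule_format, of 2] by linarith
    finally show "x \<in> ball a r" by (simp add: dist_norm norm_minus_commute)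
  qed
  then show ?thesis using r by (intro that[of "r / 2"]) auto
qed

lemma pull2_eq_0:
  assumes JK: "inverse_matrices J K" and 0: "\<And>i j. pull2 J M i j = 0"
  shows "M a b = 0"
proof -
  have 1: "(\<Sum>i\<in>UNIV. J c i * K i a) = (if c = a then 1 else 0)" for c a
    using JK unfolding inverse_matrices_def by blast
  have "M a b = (\<Sum>c\<in>UNIV. \<Sum>d\<in>UNIV. (\<Sum>i\<in>UNIV. J c i * K i a) * (\<Sum>j\<in>UNIV. J d j * K j b) * M c d)"
    unfolding 1 mult.assoc sum_distrib_left[symmetric] by simp
  also have "\<dots> = (\<Sum>c\<in>UNIV. \<Sum>d\<in>UNIV. \<Sum>i\<in>UNIV. \<Sum>j\<in>UNIV. K i a * K j b * (J c i * J d j * M c d))"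
    by (simp only: sum_product, simp only: sum_distrib_right, simp only: mult_ac)
  also have "\<dots> = (\<Sum>i\<in>UNIV. \<Sum>j\<in>UNIV. K i a * K j b * pull2 J M i j)"
    unfolding pull2_def sum_distrib_left by (rule sum_exchange22)
  finally show ?thesis unfolding 0 by simp
qed

text \<open>In contrast to \<open>adapted_chart\<close> the remaining Christoffel symbol may vanish
  identically, so such charts are available at flat points as well.\<close>

definition normal_chart ::
    "('a chart \<Rightarrow> 2 tensor3_comp) \<Rightarrow> ('a chart \<Rightarrow> 2 tensor2_comp) \<Rightarrow> 'a chart \<Rightarrow> bool" where
  "normal_chart \<Gamma> T c \<longleftrightarrow> (\<forall>x\<in>chart_image c.
     (\<forall>i j k. (i, j, k) \<noteq> (1, 1, 2) \<longrightarrow> \<Gamma> c x i j k = 0) \<and>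
     T c x 1 1 = 0 \<and> T c x 1 2 = 1 \<and> T c x 2 1 = 0 \<and> T c x 2 2 = 0)"

locale parallel_surface = affine_surface_locale X A \<Gamma>
  for X :: "'a topology" and A :: "'a chart set" and \<Gamma> :: "'a chart \<Rightarrow> 2 tensor3_comp" +
  fixes T :: "'a chart \<Rightarrow> 2 tensor2_comp"
  assumes tensor: "tensor_11 A T" and parallel: "parallel_11 A \<Gamma> T" and nilpotent: "nilpotent_11 A T"
    and nonzero: "nonzero_11 X A T"
begin

lemma smooth_T: "c \<in> A \<Longrightarrow> smooth_fun_on (chart_image c) (\<lambda>x. T c x i k)"
  using tensor unfolding tensor_11_def by blast

lemma pd_T:
  assumes "c \<in> A" "x \<in> chart_image c"
  shows "pd j (\<lambda>y. T c y i k) x =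
    (\<Sum>m\<in>UNIV. \<Gamma> c x j i m * T c x m k) - (\<Sum>m\<in>UNIV. \<Gamma> c x j m k * T c x i m)"
proof -
  have "cov_deriv_11 (\<Gamma> c) (T c) x i k j = 0"
    using parallel assms unfolding parallel_11_def by blast
  then show ?thesis unfolding cov_deriv_11_def by simp
qed

text \<open>A nilpotent 2 by 2 matrix has trace and determinant zero.\<close>

lemma T_algebra:
  assumes "c \<in> A" "x \<in> chart_image c"
  shows "T c x 2 2 = - T c x 1 1" "T c x 1 1 * T c x 1 1 = - (T c x 1 2 * T c x 2 1)"
proof -
  have n: "(\<Sum>k\<in>UNIV. T c x i k * T c x k l) = 0" for i l
    using nilpotent assms unfolding nilpotent_11_def by blast
  note eqs = n[of 1 1, unfolded sum_2] n[of 1 2, unfolded sum_2] n[of 2 1, unfolded sum_2] n[of 2 2, unfolded sum_2]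
  show e: "T c x 1 1 * T c x 1 1 = - (T c x 1 2 * T c x 2 1)"
    using eqs(1) by simp
  have "(T c x 1 1 + T c x 2 2) * T c x 1 2 = 0" "(T c x 1 1 + T c x 2 2) * T c x 2 1 = 0"
    using eqs(2,3) by (simp_all add: algebra_simps)
  then consider "T c x 1 1 + T c x 2 2 = 0" | "T c x 1 2 = 0" by auto
  then show "T c x 2 2 = - T c x 1 1"
    using eqs e by cases auto
qed

lemma T_zero_transition:
  assumes c: "c \<in> A" and d: "d \<in> A" and x: "x \<in> overlap c d"
    and 0: "\<And>i k. T d (transition c d x) i k = 0"
  shows "T c x i k = 0"
proof -
  let ?J = "jac (transition c d) x" and ?K = "jac (transition d c) (transition c d x)"
  have "T c x i k = (\<Sum>m\<in>UNIV. T c x i m * (\<Sum>a\<in>UNIV. ?K k a * ?J a m))"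
    using inverse_jacobian[OF c d x] unfolding inverse_matrices_def by simp
  also have "\<dots> = (\<Sum>a\<in>UNIV. ?K k a * (\<Sum>m\<in>UNIV. T c x i m * ?J a m))"
    unfolding sum_distrib_left by (rule trans[OF sum.swap]) (simp only: mult_ac)
  also have "\<dots> = 0" unfolding tensor_11_transition[OF tensor c d x] 0 by simp
  finally show ?thesis .
qed

text \<open>Along a segment the components of a parallel tensor field solve a linear system of ordinary
  differential equations.\<close>

lemma T_zero_ball:
  assumes c: "c \<in> A" and e: "cball x0 e \<subseteq> chart_image c" and 0: "\<And>i k. T c x0 i k = 0"
    and x: "x \<in> cball x0 e"
  shows "T c x i k = 0"
proof -
  let ?v = "x - x0" and ?y = "\<lambda>t. x0 + t *\<^sub>R (x - x0)"
  have y: "?y t \<in> cball x0 e" if "0 \<le> t" "t \<le> 1" for t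
  proof -
    have "norm (t *\<^sub>R (x - x0)) \<le> 1 * norm (x - x0)"
      unfolding norm_scaleR using that by (intro mult_right_mono) auto
    then show ?thesis using x by (simp add: dist_norm norm_minus_commute)
  qed
  have y': "?y t \<in> chart_image c" if "0 \<le> t" "t \<le> 1" for t using y[OF that] e by auto
  have "\<exists>M. \<forall>z\<in>cball x0 e. \<bar>\<Gamma> c z i j k\<bar> \<le> M" for i j k
  proof -
    have "continuous_on (cball x0 e) (\<lambda>z. \<bar>\<Gamma> c z i j k\<bar>)"
      by (intro continuous_intros smooth_fun_on_continuous smooth_fun_on_subset[OF smooth_\<Gamma>[OF c] e])
    then have "bounded ((\<lambda>z. \<bar>\<Gamma> c z i j k\<bar>) ` cball x0 e)"
      by (intro compact_imp_bounded compact_continuous_image) auto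
    then show ?thesis unfolding bounded_iff by auto
  qed
  then obtain B where B: "\<And>i j k z. z \<in> cball x0 e \<Longrightarrow> \<bar>\<Gamma> c z i j k\<bar> \<le> B i j k" by metis
  define M where "M = (\<Sum>i\<in>UNIV. \<Sum>j\<in>UNIV. \<Sum>k\<in>UNIV. \<bar>B i j k\<bar>)"
  have M: "\<bar>\<Gamma> c z i j k\<bar> \<le> M" if "z \<in> cball x0 e" for z i j k
  proof -
    have "\<bar>\<Gamma> c z i j k\<bar> \<le> \<bar>B i j k\<bar>" using B[OF that, of i j k] by simp
    also have "\<dots> \<le> M"
      using exhaust_2[of i] exhaust_2[of j] exhaust_2[of k] unfolding M_def sum_2 by auto
    finally show ?thesis .
  qed
  have M0: "M \<ge> 0" unfolding M_def by (intro sum_nonneg) simp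
  \<comment> \<open>\<open>s\<close> is convenient for estimates, \<open>h\<close> is
    differentiable; they are compared by \<open>s t * s t \<le> 4 * h t\<close>, with
    \<open>4\<close> the number of components.\<close>
  define s where "s t = (\<Sum>i\<in>UNIV. \<Sum>k\<in>UNIV. \<bar>T c (?y t) i k\<bar>)" for t
  define h where "h t = (\<Sum>i\<in>UNIV. \<Sum>k\<in>UNIV. T c (?y t) i k * T c (?y t) i k)" for t
  define w where "w = \<bar>?v $ 1\<bar> + \<bar>?v $ 2\<bar>"
  define h' where "h' t = (\<Sum>i\<in>UNIV. \<Sum>k\<in>UNIV. 2 * T c (?y t) i k * (\<Sum>j\<in>UNIV. pd j (\<lambda>z. T c z i k) (?y t) * ?v $ j))" for t
  have s0: "\<bar>T c (?y t) i k\<bar> \<le> s t" for t i k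
    using exhaust_2[of i] exhaust_2[of k] unfolding s_def sum_2 by auto
  have sn: "s t \<ge> 0" for t unfolding s_def by (intro sum_nonneg) simp
  have sh: "s t * s t \<le> 4 * h t" for t
  proof -
    have *: "(a + b + (d + f)) * (a + b + (d + f)) \<le> 4 * (a * a + b * b + (d * d + f * f))" for a b d f :: real
    proof -
      have "4 * (a * a + b * b + (d * d + f * f)) - (a + b + (d + f)) * (a + b + (d + f)) =
        (a - b)\<^sup>2 + (a - d)\<^sup>2 + (a - f)\<^sup>2 + (b - d)\<^sup>2 + (b - f)\<^sup>2 + (d - f)\<^sup>2"
        by (simp add: power2_eq_square algebra_simps)
      also have "\<dots> \<ge> 0" by simp
      finally show ?thesis by simp
    qed
    show ?thesis unfolding s_def h_def sum_2 using *[of "\<bar>T c (?y t) 1 1\<bar>" "\<bar>T c (?y t) 1 2\<bar>" "\<bar>T c (?y t) 2 1\<bar>" "\<bar>T c (?y t) 2 2\<bar>"]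
      by simp
  qed
  have hD: "(h has_real_derivative h' t) (at t)" if "0 \<le> t" "t \<le> 1" for t
  proof -
    have d: "((\<lambda>t. T c (?y t) i k) has_real_derivative (\<Sum>j\<in>UNIV. pd j (\<lambda>z. T c z i k) (?y t) * ?v $ j)) (at t)" for i k
      by (rule has_real_derivative_pd[OF smooth_fun_on_differentiable[OF smooth_T[OF c] open_chart_image[OF c] y'[OF that]]])
    have dd: "((\<lambda>t. T c (?y t) i k * T c (?y t) i k) has_real_derivative
        2 * T c (?y t) i k * (\<Sum>j\<in>UNIV. pd j (\<lambda>z. T c z i k) (?y t) * ?v $ j)) (at t)" for i k
      using DERIV_mult[OF d d, of i k i k] by (simp add: algebra_simps)
    show ?thesis unfolding h_def[abs_def] h'_def by (rule DERIV_sum, rule DERIV_sum, rule dd)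
  qed
  \<comment> \<open>The derivative of a component has four terms bounded by \<open>M * s t\<close>;
    the factor 2 from squaring, the four components and the comparison of \<open>s\<close> with
    \<open>h\<close> give 4 x 2 x 4 x 4 = 128.\<close>
  have h'_le: "h' t \<le> (128 * M * w) * h t" if t: "0 \<le> t" "t \<le> 1" for t
  proof -
    have T': "\<bar>pd j (\<lambda>z. T c z i k) (?y t)\<bar> \<le> 4 * M * s t" for j i k
    proof -
      have g: "\<bar>\<Gamma> c (?y t) a b d * T c (?y t) i k\<bar> \<le> M * s t" for a b d i k
        unfolding abs_mult using M[OF y[OF t]] s0 M0 by (intro mult_mono) auto
      show ?thesis unfolding pd_T[OF c y'[OF t]] sum_2
        using g[of j i 1 1 k] g[of j i 2 2 k] g[of j 1 k i 1] g[of j 2 k i 2] by linarith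
    qed
    have v: "\<bar>\<Sum>j\<in>UNIV. pd j (\<lambda>z. T c z i k) (?y t) * ?v $ j\<bar> \<le> 4 * M * s t * w" for i k
    proof -
      have "\<bar>pd j (\<lambda>z. T c z i k) (?y t) * ?v $ j\<bar> \<le> 4 * M * s t * \<bar>?v $ j\<bar>" for j
        unfolding abs_mult using T' by (intro mult_right_mono) auto
      from this[of 1] this[of 2] show ?thesis unfolding sum_2 w_def distrib_left by linarith
    qed
    have le: "2 * T c (?y t) i k * (\<Sum>j\<in>UNIV. pd j (\<lambda>z. T c z i k) (?y t) * ?v $ j) \<le> 2 * s t * (4 * M * s t * w)" for i k
    proof -
      have "\<bar>2 * T c (?y t) i k * (\<Sum>j\<in>UNIV. pd j (\<lambda>z. T c z i k) (?y t) * ?v $ j)\<bar> \<le> 2 * s t * (4 * M * s t * w)"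
        unfolding abs_mult using s0 v sn by (intro mult_mono) auto
      then show ?thesis by linarith
    qed
    have "h' t \<le> (\<Sum>i\<in>(UNIV::2 set). \<Sum>k\<in>(UNIV::2 set). 2 * s t * (4 * M * s t * w))"
      unfolding h'_def by (rule sum_mono, rule sum_mono, rule le)
    also have "\<dots> = 32 * M * w * (s t * s t)" by (simp add: sum_2)
    also have "\<dots> \<le> 32 * M * w * (4 * h t)"
      using sh M0 by (intro mult_left_mono) (auto simp: w_def)
    finally show ?thesis by simp
  qed
  \<comment> \<open>Gronwall's argument: multiplied by the decaying exponential with this rate,
    \<open>h\<close> is nonincreasing and starts at \<open>0\<close>.\<close>
  define k0 where "k0 = 128 * M * w"
  have "\<exists>y. ((\<lambda>t. exp (- k0 * t) * h t) has_real_derivative y) (at t) \<and> y \<le> 0" if t: "0 \<le> t" "t \<le> 1" for t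
  proof (intro exI conjI)
    show "((\<lambda>t. exp (- k0 * t) * h t) has_real_derivative
        (exp (- k0 * t) * (- k0)) * h t + h' t * exp (- k0 * t)) (at t)"
      by (intro DERIV_mult hD[OF t]) (auto intro!: derivative_eq_intros)
    have "exp (- k0 * t) * (h' t - k0 * h t) \<le> 0"
      using h'_le[OF t] unfolding k0_def by (intro mult_nonneg_nonpos) auto
    then show "(exp (- k0 * t) * (- k0)) * h t + h' t * exp (- k0 * t) \<le> 0"
      by (simp add: algebra_simps)
  qed
  then have "exp (- k0 * 1) * h 1 \<le> exp (- k0 * 0) * h 0"
    by (intro DERIV_nonpos_imp_nonincreasing[of 0 1 "\<lambda>t. exp (- k0 * t) * h t"]) auto
  also have "h 0 = 0" by (simp add: h_def 0)
  finally have "h 1 \<le> 0" by (simp add: mult_le_0_iff)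
  then have "s 1 * s 1 \<le> 0" using sh[of 1] by linarith
  then have "s 1 = 0" using mult_le_0_iff[of "s 1" "s 1"] sn[of 1] by linarith
  then show ?thesis using s0[of 1 i k] by simp
qed

text \<open>The zeros of \<open>T\<close> form an open set by \<open>T_zero_ball\<close>, the other
  points do so by continuity; a connected component lies in one of the two, and
  \<open>nonzero\<close> decides which.\<close>

lemma T_nonzero:
  assumes c: "c \<in> A" and x: "x \<in> chart_image c"
  obtains i k where "T c x i k \<noteq> 0"
proof -
  define Z where "Z = {p. \<exists>c\<in>A. p \<in> fst c \<and> (\<forall>i k. T c (snd c p) i k = 0)}"
  define N where "N = {p. \<exists>c\<in>A. p \<in> fst c \<and> (\<exists>i k. T c (snd c p) i k \<noteq> 0)}"
  have disj: "Z \<inter> N = {}"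
  proof (rule ccontr)
    assume "Z \<inter> N \<noteq> {}"
    then obtain p a b i k where p: "a \<in> A" "p \<in> fst a" "\<And>i k. T a (snd a p) i k = 0" "b \<in> A" "p \<in> fst b"
      "T b (snd b p) i k \<noteq> 0"
      unfolding Z_def N_def by blast
    show False
      using T_zero_transition[OF p(4,1) overlapI[OF p(5,2)], of i k] p(3,6)
      unfolding transition_chart[OF p(4,5)] by blast
  qed
  have Z: "openin X Z"
  proof (subst openin_subopen, intro ballI)
    fix p assume "p \<in> Z"
    then obtain a where a: "a \<in> A" "p \<in> fst a" "\<And>i k. T a (snd a p) i k = 0"
      unfolding Z_def by blast
    obtain e where e: "e > 0" "cball (snd a p) e \<subseteq> chart_image a"
      using open_chart_image[OF a(1)] chart_imageI[OF a(2)] open_contains_cball by blast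
    have "openin X {q \<in> fst a. snd a q \<in> ball (snd a p) e}"
      by (rule openin_chart_vimage[OF a(1) open_ball])
    moreover have "{q \<in> fst a. snd a q \<in> ball (snd a p) e} \<subseteq> Z"
    proof
      fix q assume q: "q \<in> {q \<in> fst a. snd a q \<in> ball (snd a p) e}"
      then have "T a (snd a q) i k = 0" for i k
        using T_zero_ball[OF a(1) e(2) a(3), of "snd a q"] by simp
      with a(1) q show "q \<in> Z" unfolding Z_def by blast
    qed
    ultimately show "\<exists>W. openin X W \<and> p \<in> W \<and> W \<subseteq> Z" using a(2) e(1) by fastforce
  qed
  have N: "openin X N"
  proof (subst openin_subopen, intro ballI)
    fix p assume "p \<in> N"
    then obtain a i k where a: "a \<in> A" "p \<in> fst a" "T a (snd a p) i k \<noteq> 0"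
      unfolding N_def by blast
    let ?O = "chart_image a \<inter> (\<lambda>x. T a x i k) -` (- {0})"
    have "open ?O"
      by (intro continuous_open_preimage open_chart_image a(1) smooth_fun_on_continuous smooth_T open_Compl closed_singleton)
    then have "openin X {q \<in> fst a. snd a q \<in> ?O}" by (rule openin_chart_vimage[OF a(1)])
    moreover have "{q \<in> fst a. snd a q \<in> ?O} \<subseteq> N" using a(1) unfolding N_def by auto
    moreover have "p \<in> {q \<in> fst a. snd a q \<in> ?O}" using a chart_imageI[OF a(2)] by auto
    ultimately show "\<exists>W. openin X W \<and> p \<in> W \<and> W \<subseteq> N" by blast
  qed
  obtain p where p: "p \<in> fst c" "x = snd c p" using x by (rule chart_imageE)
  have pX: "p \<in> topspace X" using p(1) charts_cover c by blast
  let ?C = "connected_component_of_set X p"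
  have "?C \<in> connected_components_of X" using pX unfolding connected_components_of_def by blast
  then obtain a q i k where q: "a \<in> A" "q \<in> fst a" "q \<in> ?C" "T a (snd a q) i k \<noteq> 0"
    using nonzero unfolding nonzero_11_def by blast
  have C: "connectedin X ?C" by (rule connectedin_connected_component_of)
  have cov: "?C \<subseteq> Z \<union> N"
  proof
    fix r assume "r \<in> ?C"
    then have "r \<in> topspace X" using connectedin_subset_topspace[OF C] by blast
    then obtain b where "b \<in> A" "r \<in> fst b" using charts_cover by blast
    then show "r \<in> Z \<union> N" unfolding Z_def N_def by blast
  qed
  have "q \<in> N" using q unfolding N_def by blast
  then have "Z \<inter> ?C = {}"
    using C Z N cov disj q(3) unfolding connectedin by blast
  moreover have "p \<in> ?C" using pX by (simp add: connected_component_of_refl)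
  ultimately have "p \<notin> Z" by blast
  then show ?thesis using c p that unfolding Z_def by blast
qed

text \<open>The integrability condition of \<open>DT = 0\<close>: second derivatives of the
  components of \<open>T\<close> commute.\<close>

lemma riemann_commute:
  assumes c: "c \<in> A" and x: "x \<in> chart_image c"
  shows "(\<Sum>a\<in>UNIV. riemann (\<Gamma> c) x 1 2 k a * T c x a l) = (\<Sum>a\<in>UNIV. T c x k a * riemann (\<Gamma> c) x 1 2 a l)"
proof -
  have dT: "(\<lambda>y. T c y i k) differentiable (at x)" for i k
    by (rule smooth_fun_on_differentiable[OF smooth_T[OF c] open_chart_image[OF c] x])
  have dG: "(\<lambda>y. \<Gamma> c y i j k) differentiable (at x)" for i j k
    by (rule smooth_fun_on_differentiable[OF smooth_\<Gamma>[OF c] open_chart_image[OF c] x])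
  have pp: "pd i (pd j (\<lambda>y. T c y k l)) x =
    pd i (\<lambda>y. (\<Sum>m\<in>UNIV. \<Gamma> c y j k m * T c y m l) - (\<Sum>m\<in>UNIV. \<Gamma> c y j m l * T c y k m)) x" for i j
    by (rule pd_cong_open[OF open_chart_image[OF c] x pd_T[OF c]])
  have "pd 1 (pd 2 (\<lambda>y. T c y k l)) x = pd 2 (pd 1 (\<lambda>y. T c y k l)) x"
    by (rule pd_commute[OF smooth_T[OF c] open_chart_image[OF c] x])
  then show ?thesis
    unfolding pp sum_2 riemann_def
    by (simp add: pd_add pd_diff pd_mult dT dG pd_T[OF c x] sum_2 algebra_simps)
qed

end

subsection \<open>Adapted coordinates\<close>

context parallel_surface
begin

lemma T_offdiagonal:
  assumes c: "c \<in> A" and x: "x \<in> chart_image c"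
  obtains m n where "m \<noteq> n" "T c x m n \<noteq> 0"
proof -
  obtain i k where ik: "T c x i k \<noteq> 0" by (rule T_nonzero[OF c x])
  have "T c x 1 2 \<noteq> 0 \<or> T c x 2 1 \<noteq> 0"
  proof (rule ccontr)
    assume "\<not> ?thesis"
    then show False
      using ik T_algebra[OF c x] exhaust_2[of i] exhaust_2[of k] by auto
  qed
  then show ?thesis using that[of 1 2] that[of 2 1] by auto
qed

text \<open>Write \<open>T = \<theta> \<otimes> V\<close> with \<open>V\<^sup>n = 1\<close>, that is \<open>\<theta>\<^sub>i = T\<^sub>i\<^sup>n\<close>. Then \<open>DV = \<lambda> \<otimes> V\<close>, \<open>D\<theta> = - \<lambda> \<otimes> \<theta>\<close>, and
  \<open>d\<lambda>\<close> is half the trace of the curvature, so a symmetric Ricci tensor provides \<open>f\<close> with \<open>df = \<lambda>\<close>;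
  then \<open>e\<^sup>f \<theta>\<close> is parallel and hence closed.\<close>

lemma parallel_first_integral:
  assumes c: "c \<in> A" and x0: "x0 \<in> Q0" and Q0: "open Q0" "Q0 \<subseteq> chart_image c"
    and mn: "m \<noteq> n" "T c x0 m n \<noteq> 0"
    and trace: "\<And>x. x \<in> Q0 \<Longrightarrow> (\<Sum>k\<in>UNIV. riemann (\<Gamma> c) x 1 2 k k) = 0"
  obtains Q f u where "open Q" "x0 \<in> Q" "Q \<subseteq> Q0" "smooth_fun_on Q f" "smooth_fun_on Q u"
    "\<And>x. x \<in> Q \<Longrightarrow> T c x m n \<noteq> 0"
    "\<And>x i. x \<in> Q \<Longrightarrow> pd i u x = exp (f x) * T c x i n"
    "\<And>x i j. x \<in> Q \<Longrightarrow> pd i (pd j u) x = (\<Sum>a\<in>UNIV. \<Gamma> c x i j a * pd a u x)"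
proof -
  have sum_mn: "(\<Sum>k\<in>UNIV. h k) = h n + h m" for h :: "2 \<Rightarrow> real"
    using mn(1) exhaust_2[of m] exhaust_2[of n] by (auto simp: sum_2)
  let ?O = "Q0 \<inter> (\<lambda>x. T c x m n) -` (- {0})"
  have "open ?O"
    by (intro continuous_open_preimage Q0(1) smooth_fun_on_continuous open_Compl closed_singleton
        smooth_fun_on_subset[OF smooth_T[OF c] Q0(2)])
  then obtain e where e: "e > 0" "cube x0 e \<subseteq> ?O"
    using x0 mn(2) by (elim cube_subset) auto
  let ?Q = "cube x0 e"
  have Q: "x \<in> Q0" "x \<in> chart_image c" "T c x m n \<noteq> 0" if "x \<in> ?Q" for x
    using e(2) that Q0(2) by auto
  note oQ = cube_basic(1)[of x0 e] and cQ = cube_basic(2)[of x0 e]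
  have sT: "smooth_fun_on ?Q (\<lambda>x. T c x i k)" for i k
    by (rule smooth_fun_on_subset[OF smooth_T[OF c]]) (use Q(2) in blast)
  have sG: "smooth_fun_on ?Q (\<lambda>x. \<Gamma> c x i j k)" for i j k
    by (rule smooth_fun_on_subset[OF smooth_\<Gamma>[OF c]]) (use Q(2) in blast)
  \<comment> \<open>\<open>v\<close> is the component V^m, and \<open>L\<close> is \<lambda>, read
    off from the component \<open>n\<close> of DV = \<lambda> \<otimes> V; the fact
    \<open>pv\<close> is the component \<open>m\<close> of the same equation.\<close>
  define v where "v x = T c x m m * inverse (T c x m n)" for x
  define L where "L j x = \<Gamma> c x j n n + \<Gamma> c x j m n * v x" for j x
  have sv: "smooth_fun_on ?Q v"
    unfolding v_def[abs_def] by (intro smooth_intros oQ sT) (rule Q(3))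
  have sL: "smooth_fun_on ?Q (L j)" for j
    unfolding L_def[abs_def] by (intro smooth_intros oQ sG sv)
  have dT: "(\<lambda>y. T c y i k) differentiable (at x)" if "x \<in> ?Q" for i k x
    by (rule smooth_fun_on_differentiable[OF sT oQ that])
  have dG: "(\<lambda>y. \<Gamma> c y i j k) differentiable (at x)" if "x \<in> ?Q" for i j k x
    by (rule smooth_fun_on_differentiable[OF sG oQ that])
  have dv: "v differentiable (at x)" if "x \<in> ?Q" for x
    by (rule smooth_fun_on_differentiable[OF sv oQ that])
  have alg: "T c x n n = - T c x m m" "T c x m m * T c x m m = - (T c x m n * T c x n m)" if "x \<in> ?Q" for x
    using T_algebra[OF c Q(2)[OF that]] mn(1) exhaust_2[of m] exhaust_2[of n] by auto
  have Tv: "T c x m m = v x * T c x m n" "T c x n n = - v x * T c x m n"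
    "T c x n m = - (v x * v x) * T c x m n" if "x \<in> ?Q" for x
    using alg[OF that] Q(3)[OF that] by (auto simp: v_def field_simps)
  have pv: "pd i v x = L i x * v x - \<Gamma> c x i n m - \<Gamma> c x i m m * v x" if x: "x \<in> ?Q" for i x
  proof -
    let ?t = "T c x m n"
    have 1: "pd i (\<lambda>y. T c y m m) x = \<Gamma> c x i m n * T c x n m - \<Gamma> c x i n m * ?t"
      "pd i (\<lambda>y. T c y m n) x = \<Gamma> c x i m n * T c x n n + \<Gamma> c x i m m * ?t - \<Gamma> c x i n n * ?t - \<Gamma> c x i m n * T c x m m"
      unfolding pd_T[OF c Q(2)[OF x]] sum_mn by simp_all
    have "pd i (\<lambda>y. T c y m m * inverse (T c y m n)) x =
        T c x m m * - (inverse ?t * inverse ?t * pd i (\<lambda>y. T c y m n) x) + pd i (\<lambda>y. T c y m m) x * inverse ?t"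
      by (subst pd_mult[OF dT[OF x]]) (simp_all add: pd_inverse dT[OF x] Q(3)[OF x])
    then have "pd i v x = - v x * (pd i (\<lambda>y. T c y m n) x * inverse ?t) + pd i (\<lambda>y. T c y m m) x * inverse ?t"
      unfolding v_def[abs_def] by simp
    also have "pd i (\<lambda>y. T c y m n) x * inverse ?t = - 2 * \<Gamma> c x i m n * v x + \<Gamma> c x i m m - \<Gamma> c x i n n"
      unfolding 1 Tv[OF x] using Q(3)[OF x] by (simp add: field_simps)
    also have "pd i (\<lambda>y. T c y m m) x * inverse ?t = - \<Gamma> c x i m n * (v x * v x) - \<Gamma> c x i n m"
      unfolding 1 Tv[OF x] using Q(3)[OF x] by (simp add: field_simps)
    finally show ?thesis unfolding L_def by (simp add: algebra_simps)
  qed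
  have closed: "pd 2 (L 1) x = pd 1 (L 2) x" if x: "x \<in> ?Q" for x
  proof -
    let ?r = "riemann (\<Gamma> c) x 1 2"
    have pL: "pd i (L j) x = pd i (\<lambda>y. \<Gamma> c y j n n) x + \<Gamma> c x j m n * pd i v x + pd i (\<lambda>y. \<Gamma> c y j m n) x * v x" for i j
      unfolding L_def[abs_def] by (simp add: pd_add pd_mult dG[OF x] dv[OF x])
    \<comment> \<open>On the left stands the eigenvalue of the curvature on V. An endomorphism
      commuting with \<open>T\<close> is a multiple of the identity plus a multiple of
      \<open>T\<close>, so its trace is twice this eigenvalue.\<close>
    have "?r n n + v x * ?r m n = pd 1 (L 2) x - pd 2 (L 1) x"
      unfolding pL pv[OF x] riemann_def sum_mn L_def by (simp add: algebra_simps)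
    moreover have "?r m n * T c x n n + ?r m m * T c x m n = T c x m n * ?r n n + T c x m m * ?r m n"
      using riemann_commute[OF c Q(2)[OF x], of m n] unfolding sum_mn .
    then have "T c x m n * (?r m m - ?r n n - 2 * v x * ?r m n) = 0"
      unfolding Tv[OF x] by (simp add: algebra_simps)
    then have "?r m m - ?r n n - 2 * v x * ?r m n = 0" using Q(3)[OF x] by simp
    moreover have "?r n n + ?r m m = 0" using trace[OF Q(1)[OF x]] unfolding sum_mn .
    ultimately show ?thesis by algebra
  qed
  obtain f where f: "smooth_fun_on ?Q f" "\<And>i x. x \<in> ?Q \<Longrightarrow> pd i f x = L i x"
  proof (rule smooth_primitive[OF oQ cQ contraction_cube sL, of UNIV])
    show "pd j (L i) x = pd i (L j) x" if "x \<in> ?Q" for i j x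
      using closed[OF that] exhaust_2[of i] exhaust_2[of j] by auto
  qed auto
  have df: "f differentiable (at x)" if "x \<in> ?Q" for x
    by (rule smooth_fun_on_differentiable[OF f(1) oQ that])
  have dE: "(\<lambda>y. exp (f y)) differentiable (at x)" if "x \<in> ?Q" for x
    by (rule smooth_fun_on_differentiable[OF smooth_fun_on_exp[OF oQ f(1)] oQ that])
  define t where "t i x = exp (f x) * T c x i n" for i x
  have st: "smooth_fun_on ?Q (t i)" for i
    unfolding t_def[abs_def] by (intro smooth_intros oQ f(1) sT)
  have pt: "pd i (t j) x = (\<Sum>a\<in>UNIV. \<Gamma> c x i j a * t a x)" if x: "x \<in> ?Q" for i j x
  proof -
    have "pd i (t j) x = exp (f x) * (pd i (\<lambda>y. T c y j n) x + L i x * T c x j n)"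
      unfolding t_def[abs_def] pd_mult[OF dE[OF x] dT[OF x]] pd_exp[OF df[OF x]] f(2)[OF x]
      by (simp add: algebra_simps)
    also have "pd i (\<lambda>y. T c y j n) x + L i x * T c x j n = \<Gamma> c x i j n * T c x n n + \<Gamma> c x i j m * T c x m n"
    proof -
      have "T c x j m = T c x j n * v x"
        using Tv[OF x] exhaust_2[of j] exhaust_2[of m] exhaust_2[of n] mn(1) by auto
      then show ?thesis
        unfolding pd_T[OF c Q(2)[OF x]] sum_mn L_def by (simp add: algebra_simps)
    qed
    finally show ?thesis unfolding sum_mn t_def by (simp add: algebra_simps)
  qed
  obtain u where u: "smooth_fun_on ?Q u" "\<And>i x. x \<in> ?Q \<Longrightarrow> pd i u x = t i x"
  proof (rule smooth_primitive[OF oQ cQ contraction_cube st, of UNIV])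
    show "pd j (t i) x = pd i (t j) x" if "x \<in> ?Q" for i j x
      unfolding pt[OF that] using \<Gamma>_sym[OF c Q(2)[OF that], of i j] by simp
  qed auto
  show ?thesis
  proof (rule that[OF oQ cube_basic(3)[OF e(1)] _ f(1) u(1) Q(3)])
    show "?Q \<subseteq> Q0" using Q(1) by blast
    show "pd i u x = exp (f x) * T c x i n" if "x \<in> ?Q" for x i
      using u(2)[OF that] by (simp add: t_def)
    show "pd i (pd j u) x = (\<Sum>a\<in>UNIV. \<Gamma> c x i j a * pd a u x)" if x: "x \<in> ?Q" for x i j
    proof -
      have "pd i (pd j u) x = pd i (t j) x"
        by (rule pd_cong_open[OF oQ x u(2)])
      then show ?thesis unfolding pt[OF x] by (simp add: u(2)[OF x])
    qed
  qed
qed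

lemma smooth_pair:
  "smooth_fun_on Q u \<Longrightarrow> smooth_fun_on Q w \<Longrightarrow> smooth_map_on Q (\<lambda>x. vector [u x, w x] :: real^2)"
  unfolding smooth_map_on_def forall_2 by simp

text \<open>The hypothesis \<open>0\<close> says that the covariant Hessian of the first coordinate
  of \<open>d\<close> vanishes. In the chart \<open>d\<close> this Hessian has the components -
  \<Gamma> with upper index \<open>1\<close>.\<close>

lemma vanishing_transition:
  assumes c: "c \<in> A" and d: "d \<in> A" and x: "x \<in> overlap c d"
    and 0: "\<And>i j. (\<Sum>k\<in>UNIV. \<Gamma> c x i j k * jac (transition c d) x 1 k) =
      pd i (\<lambda>y. jac (transition c d) y 1 j) x"
  shows "\<Gamma> d (transition c d x) i j 1 = 0"
proof (rule pull2_eq_0[OF inverse_jacobian[OF c d x], of "\<lambda>i j. \<Gamma> d (transition c d x) i j 1"])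
  show "pull2 (jac (transition c d) x) (\<lambda>i j. \<Gamma> d (transition c d x) i j 1) i j = 0" for i j
    using connection_law_transition[OF c d, unfolded connection_law_def, rule_format, OF x, of i j 1]
    unfolding 0 pull2_def by simp
qed

text \<open>The parallel form becomes the differential of the first coordinate, and
  \<open>x $ n\<close> completes it: the Jacobian determinant is, up to sign, the derivative of
  \<open>u\<close> in direction \<open>m\<close>.\<close>

lemma foliated_chart:
  assumes c: "c \<in> A" and p: "p \<in> fst c" and Q0: "open Q0" "Q0 \<subseteq> chart_image c" "snd c p \<in> Q0"
    and trace: "\<And>x. x \<in> Q0 \<Longrightarrow> (\<Sum>k\<in>UNIV. riemann (\<Gamma> c) x 1 2 k k) = 0"
  obtains d where "d \<in> A" "p \<in> fst d" "fst d \<subseteq> fst c" "snd c ` fst d \<subseteq> Q0"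
    "\<And>y i j. y \<in> chart_image d \<Longrightarrow> \<Gamma> d y i j 1 = 0"
    "\<And>y. y \<in> chart_image d \<Longrightarrow> T d y 1 1 = 0 \<and> T d y 1 2 \<noteq> 0 \<and> T d y 2 1 = 0 \<and> T d y 2 2 = 0"
proof -
  obtain m n where mn: "m \<noteq> n" "T c (snd c p) m n \<noteq> 0"
    by (rule T_offdiagonal[OF c chart_imageI[OF p]])
  obtain Q f u where Q: "open Q" "snd c p \<in> Q" "Q \<subseteq> Q0" and f: "smooth_fun_on Q f" and u: "smooth_fun_on Q u"
    and Tmn: "\<And>x. x \<in> Q \<Longrightarrow> T c x m n \<noteq> 0"
    and pu: "\<And>x i. x \<in> Q \<Longrightarrow> pd i u x = exp (f x) * T c x i n"
    and ppu: "\<And>x i j. x \<in> Q \<Longrightarrow> pd i (pd j u) x = (\<Sum>a\<in>UNIV. \<Gamma> c x i j a * pd a u x)"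
  proof (rule parallel_first_integral[OF c Q0(3,1,2) mn trace])
    fix Q f u
    assume h: "open Q" "snd c p \<in> Q" "Q \<subseteq> Q0" "smooth_fun_on Q f" "smooth_fun_on Q u"
      "\<And>x. x \<in> Q \<Longrightarrow> T c x m n \<noteq> 0" "\<And>x i. x \<in> Q \<Longrightarrow> pd i u x = exp (f x) * T c x i n"
      "\<And>x i j. x \<in> Q \<Longrightarrow> pd i (pd j u) x = (\<Sum>a\<in>UNIV. \<Gamma> c x i j a * pd a u x)"
    show thesis by (rule that[of Q f u, OF h])
  qed
  define F where "F x = (vector [u x, x $ n] :: real^2)" for x
  have F: "smooth_map_on Q F"
    unfolding F_def[abs_def] by (intro smooth_pair u smooth_fun_on_nth)
  have jF: "jac F x 1 i = pd i u x" "jac F x 2 i = (if i = n then 1 else 0)" for x i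
    by (simp_all add: jac_def F_def)
  have Qc: "Q \<subseteq> chart_image c" using Q(3) Q0(2) by blast
  have det: "jac_det F (snd c p) \<noteq> 0"
    using mn exhaust_2[of m] exhaust_2[of n] by (auto simp: jac_det_def jF pu[OF Q(2)])
  obtain d where d: "d \<in> A" "p \<in> fst d" "fst d \<subseteq> fst c" "overlap c d \<subseteq> Q" "snd c ` fst d = overlap c d"
    and "\<And>q. q \<in> fst d \<Longrightarrow> snd d q = F (snd c q)"
    and jd: "\<And>x a i. x \<in> overlap c d \<Longrightarrow> jac (transition c d) x a i = jac F x a i"
    and "\<And>x. x \<in> overlap c d \<Longrightarrow> transition c d x = F x"
    by (rule chart_composition[OF c Q(1) Qc F p Q(2) det]) (rule that, simp_all)
  have pt: "\<exists>x\<in>overlap c d. y = transition c d x" if "y \<in> chart_image d" for y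
    using that d(3) by (auto elim!: chart_imageE intro!: bexI overlapI simp: transition_chart[OF c])
  have T0: "T d y 1 1 = 0 \<and> T d y 1 2 \<noteq> 0 \<and> T d y 2 1 = 0 \<and> T d y 2 2 = 0" if y: "y \<in> chart_image d" for y
  proof -
    obtain x where x: "x \<in> overlap c d" "y = transition c d x" using pt[OF y] by blast
    have xQ: "x \<in> Q" using x(1) d(4) by blast
    have xc: "x \<in> chart_image c" using x(1) overlap_subset by blast
    have J: "jac (transition c d) x 1 i = exp (f x) * T c x i n" "jac (transition c d) x 2 i = (if i = n then 1 else 0)" for i
      using jd[OF x(1)] by (simp_all add: jF pu[OF xQ])
    have eq: "(\<Sum>k\<in>UNIV. T c x i k * jac (transition c d) x a k) =
        exp (f x) * T c x i n * T d y 1 a + (if i = n then 1 else 0) * T d y 2 a" for i a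
      using tensor_11_transition[OF tensor c d(1) x(1), of i a] unfolding sum_2[of "\<lambda>b. jac _ _ b _ * _ b"] J x(2)[symmetric]
      by (simp add: sum_2 J)
    have sum_mn: "(\<Sum>k\<in>UNIV. h k) = h n + h m" for h :: "2 \<Rightarrow> real"
      using mn(1) exhaust_2[of m] exhaust_2[of n] by (auto simp: sum_2)
    have alg: "T c x n n = - T c x m m" "T c x m m * T c x m m = - (T c x m n * T c x n m)"
      using T_algebra[OF c xc] mn(1) exhaust_2[of m] exhaust_2[of n] by auto
    \<comment> \<open>This is \<theta>(V) = 0, which expresses nilpotency.\<close>
    have L1: "(\<Sum>k\<in>UNIV. T c x i k * jac (transition c d) x 1 k) = 0" for i
      using alg exhaust_2[of i] exhaust_2[of m] exhaust_2[of n] mn(1) unfolding sum_mn J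
      by (auto simp: algebra_simps)
    have L2: "(\<Sum>k\<in>UNIV. T c x i k * jac (transition c d) x 2 k) = T c x i n" for i
      unfolding sum_mn J using mn(1) by simp
    have nz: "exp (f x) * T c x m n \<noteq> 0" using Tmn[OF xQ] by simp
    have "T d y 1 1 = 0" using eq[of m 1] nz mn(1) unfolding L1 by simp
    moreover have "T d y 2 1 = 0" using eq[of n 1] \<open>T d y 1 1 = 0\<close> unfolding L1 by simp
    moreover have T12: "exp (f x) * T d y 1 2 = 1" using eq[of m 2] Tmn[OF xQ] mn(1) unfolding L2 by simp
    moreover have "T d y 2 2 = 0"
    proof -
      have "T c x n n = (exp (f x) * T d y 1 2) * T c x n n + T d y 2 2"
        using eq[of n 2] unfolding L2 by (simp add: mult_ac)
      then show ?thesis unfolding T12 by simp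
    qed
    ultimately show ?thesis by auto
  qed
  have G0: "\<Gamma> d y i j 1 = 0" if y: "y \<in> chart_image d" for y i j
  proof -
    obtain x where x: "x \<in> overlap c d" "y = transition c d x" using pt[OF y] by blast
    have xQ: "x \<in> Q" using x(1) d(4) by blast
    show ?thesis
      unfolding x(2)
    proof (rule vanishing_transition[OF c d(1) x(1)])
      fix i j
      have "pd i (\<lambda>y. jac (transition c d) y 1 j) x = pd i (pd j u) x"
        by (rule pd_cong_open[OF open_overlap[OF c d(1)] x(1)]) (simp add: jd jF)
      then show "(\<Sum>k\<in>UNIV. \<Gamma> c x i j k * jac (transition c d) x 1 k) = pd i (\<lambda>y. jac (transition c d) y 1 j) x"
        unfolding ppu[OF xQ] by (simp add: jd[OF x(1)] jF)
    qed
  qed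
  show ?thesis
    by (rule that[OF d(1-3) _ G0 T0]) (use d Q(3) in auto)
qed

text \<open>The first coordinate is kept. Reparametrising the leaves by a primitive of
  \<open>inverse (T a y 1 2)\<close> in the second variable makes the remaining component of
  \<open>T\<close> equal to \<open>1\<close>; then \<open>DT = 0\<close> removes the Christoffel
  symbols that are still unwanted.\<close>

lemma normal_chart_exists:
  assumes c: "c \<in> A" and p: "p \<in> fst c" and Q0: "open Q0" "Q0 \<subseteq> chart_image c" "snd c p \<in> Q0"
    and trace: "\<And>x. x \<in> Q0 \<Longrightarrow> (\<Sum>k\<in>UNIV. riemann (\<Gamma> c) x 1 2 k k) = 0"
  obtains d where "d \<in> A" "p \<in> fst d" "fst d \<subseteq> fst c" "snd c ` fst d \<subseteq> Q0" "normal_chart \<Gamma> T d"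
proof -
  obtain a where a: "a \<in> A" "p \<in> fst a" "fst a \<subseteq> fst c" "snd c ` fst a \<subseteq> Q0"
    and G0: "\<And>y i j. y \<in> chart_image a \<Longrightarrow> \<Gamma> a y i j 1 = 0"
    and T0: "\<And>y. y \<in> chart_image a \<Longrightarrow> T a y 1 1 = 0 \<and> T a y 1 2 \<noteq> 0 \<and> T a y 2 1 = 0 \<and> T a y 2 2 = 0"
    by (rule foliated_chart[OF c p Q0 trace], assumption) (rule that, simp_all)
  let ?y0 = "snd a p"
  obtain e where e: "e > 0" "cube ?y0 e \<subseteq> chart_image a"
    by (rule cube_subset[OF open_chart_image[OF a(1)] chart_imageI[OF a(2)]])
  let ?Q = "cube ?y0 e"
  note oQ = cube_basic(1)[of ?y0 e] and cQ = cube_basic(2)[of ?y0 e]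
  have Q: "x \<in> chart_image a" if "x \<in> ?Q" for x using e(2) that by blast
  have w0: "T a y 1 2 \<noteq> 0" if "y \<in> ?Q" for y using T0[OF Q[OF that]] by blast
  have sw: "smooth_fun_on ?Q (\<lambda>y. inverse (T a y 1 2))"
    by (intro smooth_intros oQ smooth_fun_on_subset[OF smooth_T[OF a(1)] e(2)] w0)
  obtain v where v: "smooth_fun_on ?Q v" "\<And>x. x \<in> ?Q \<Longrightarrow> pd 2 v x = inverse (T a x 1 2)"
  proof (rule smooth_primitive[OF oQ cQ contraction_cube, of "{2}" "\<lambda>_ y. inverse (T a y 1 2)"])
    fix f assume "smooth_fun_on ?Q f" "\<And>i x. i \<in> {2::2} \<Longrightarrow> x \<in> ?Q \<Longrightarrow> pd i f x = inverse (T a x 1 2)"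
    then show thesis by (intro that) auto
  qed (use sw in auto)
  define F where "F x = (vector [x $ 1, v x] :: real^2)" for x
  have F: "smooth_map_on ?Q F"
    unfolding F_def[abs_def] by (intro smooth_pair v smooth_fun_on_nth)
  have jF: "jac F x 1 i = (if i = 1 then 1 else 0)" "jac F x 2 i = pd i v x" for x i
    by (simp_all add: jac_def F_def)
  have y0: "?y0 \<in> ?Q" by (rule cube_basic(3)[OF e(1)])
  have det: "jac_det F ?y0 \<noteq> 0"
    using w0[OF y0] by (simp add: jac_det_def jF v(2)[OF y0])
  obtain d where d: "d \<in> A" "p \<in> fst d" "fst d \<subseteq> fst a" "overlap a d \<subseteq> ?Q" "snd a ` fst d = overlap a d"
    and "\<And>q. q \<in> fst d \<Longrightarrow> snd d q = F (snd a q)"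
    and jd: "\<And>x b i. x \<in> overlap a d \<Longrightarrow> jac (transition a d) x b i = jac F x b i"
    and "\<And>x. x \<in> overlap a d \<Longrightarrow> transition a d x = F x"
    by (rule chart_composition[OF a(1) oQ e(2) F a(2) y0 det]) (rule that, simp_all)
  have pt: "\<exists>x\<in>overlap a d. y = transition a d x" if "y \<in> chart_image d" for y
    using that d(3) by (auto elim!: chart_imageE intro!: bexI overlapI simp: transition_chart[OF a(1)])
  have Td: "T d y 1 1 = 0 \<and> T d y 1 2 = 1 \<and> T d y 2 1 = 0 \<and> T d y 2 2 = 0" if y: "y \<in> chart_image d" for y
  proof -
    obtain x where x: "x \<in> overlap a d" "y = transition a d x" using pt[OF y] by blast
    have xQ: "x \<in> ?Q" using x(1) d(4) by blast
    have J: "jac (transition a d) x 1 i = (if i = 1 then 1 else 0)" "jac (transition a d) x 2 i = pd i v x" for i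
      using jd[OF x(1)] by (simp_all add: jF)
    have eq: "T a x i 1 * jac (transition a d) x b 1 + T a x i 2 * jac (transition a d) x b 2 =
        jac (transition a d) x 1 i * T d y 1 b + jac (transition a d) x 2 i * T d y 2 b" for i b
      using tensor_11_transition[OF tensor a(1) d(1) x(1), of i b] unfolding sum_2 x(2)[symmetric] .
    note t0 = T0[OF Q[OF xQ]]
    have "T d y 2 b = 0" for b
      using eq[of 2 b] t0 unfolding J v(2)[OF xQ] by simp
    moreover have "T d y 1 1 = 0" using eq[of 1 1] t0 \<open>\<And>b. T d y 2 b = 0\<close> unfolding J by simp
    moreover have "T d y 1 2 = 1"
      using eq[of 1 2] t0 \<open>\<And>b. T d y 2 b = 0\<close> unfolding J v(2)[OF xQ] by simp
    ultimately show ?thesis by blast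
  qed
  have G1: "\<Gamma> d y i j 1 = 0" if y: "y \<in> chart_image d" for y i j
  proof -
    obtain x where x: "x \<in> overlap a d" "y = transition a d x" using pt[OF y] by blast
    have xa: "x \<in> chart_image a" using x(1) overlap_subset by blast
    show ?thesis
      unfolding x(2)
    proof (rule vanishing_transition[OF a(1) d(1) x(1)])
      fix i j
      have "pd i (\<lambda>y. jac (transition a d) y 1 j) x = pd i (\<lambda>y. if j = 1 then 1 else 0) x"
        by (rule pd_cong_open[OF open_overlap[OF a(1) d(1)] x(1)]) (simp add: jd jF)
      then show "(\<Sum>k\<in>UNIV. \<Gamma> a x i j k * jac (transition a d) x 1 k) = pd i (\<lambda>y. jac (transition a d) y 1 j) x"
        by (simp add: jd[OF x(1)] jF sum_2 G0[OF xa])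
    qed
  qed
  \<comment> \<open>The component \<open>1\<close>, \<open>2\<close> of \<open>DT = 0\<close> for
    constant \<open>T\<close>; the symbol with indices \<open>j\<close>, \<open>1\<close>,
    \<open>1\<close> is already zero.\<close>
  have G2: "\<Gamma> d y j 2 2 = 0" if y: "y \<in> chart_image d" for y j
  proof -
    have "pd j (\<lambda>y. T d y 1 2) y = pd j (\<lambda>y. 1) y"
      by (rule pd_cong_open[OF open_chart_image[OF d(1)] y]) (simp add: Td)
    then show ?thesis
      using pd_T[OF d(1) y, of j 1 2] Td[OF y] G1[OF y] by (simp add: sum_2)
  qed
  have "normal_chart \<Gamma> T d"
    unfolding normal_chart_def
  proof (intro ballI conjI allI impI)
    fix y and i j k :: 2 assume y: "y \<in> chart_image d"
    show "T d y 1 1 = 0" "T d y 1 2 = 1" "T d y 2 1 = 0" "T d y 2 2 = 0" using Td[OF y] by auto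
    assume "(i, j, k) \<noteq> (1, 1, 2)"
    then show "\<Gamma> d y i j k = 0"
      using G1[OF y] G2[OF y] \<Gamma>_sym[OF d(1) y, of 2 1 2] exhaust_2[of i] exhaust_2[of j] exhaust_2[of k]
      by auto
  qed
  moreover have "fst d \<subseteq> fst c" "snd c ` fst d \<subseteq> Q0"
    using d(3) a(3,4) by (blast intro: order_trans image_mono)+
  ultimately show ?thesis using d(1,2) by (intro that[of d])
qed

end

subsection \<open>The Weyl tensor of the deformed Riemannian extension\<close>

lemma rank_outer_product:
  fixes v :: "2 \<Rightarrow> real"
  assumes "r \<noteq> 0" "v k \<noteq> 0"
  shows "rank (\<chi> i j. r * v i * v j :: real^2^2) = 1"
proof -
  let ?A = "\<chi> i j. r * v i * v j :: real^2^2" and ?w = "\<chi> i. v i :: real^2"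
  have w: "?w \<noteq> 0" using assms(2) by (auto simp: vec_eq_iff)
  have A: "?A *v x = (r * (\<Sum>j\<in>UNIV. v j * x $ j)) *\<^sub>R ?w" for x
    by (simp add: vec_eq_iff matrix_vector_mult_def sum_distrib_left sum_distrib_right mult_ac)
  have "range (\<lambda>x. ?A *v x) = span {?w}"
    unfolding span_singleton
  proof (intro equalityI subsetI)
    fix y assume "y \<in> range (\<lambda>t. t *\<^sub>R ?w)"
    then obtain t where t: "y = t *\<^sub>R ?w" by auto
    have "(\<Sum>j\<in>UNIV. v j * (axis k (t / (r * v k)) :: real^2) $ j) = t / r"
      using assms by (simp add: axis_def if_distrib cong: if_cong)
    then have "?A *v axis k (t / (r * v k)) = y" unfolding A t using assms by simp
    then show "y \<in> range (\<lambda>x. ?A *v x)" by (metis rangeI)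
  qed (auto simp: A)
  then have "rank ?A = dim (span {?w})" by (simp add: rank_dim_range)
  also have "\<dots> = 1" using w by (simp add: dim_span dim_singleton)
  finally show ?thesis .
qed

lemma rank_zero_matrix: "rank (\<chi> i j. 0 :: real^2^2) = 0"
proof -
  have "(\<chi> i j. 0) = (0 :: real^2^2)" by (simp add: vec_eq_iff)
  then show ?thesis by simp
qed

definition push :: "(2 \<Rightarrow> 2 \<Rightarrow> real) \<Rightarrow> real^2 \<Rightarrow> real^2" where
  "push J v = (\<chi> a. \<Sum>i\<in>UNIV. J a i * v $ i)"

lemma eval_push:
  "eval1 (\<lambda>k. \<Sum>e\<in>UNIV. J e k * w e) v = eval1 w (push J v)"
  "eval2 (pull2 J M) v v' = eval2 M (push J v) (push J v')"
  "eval3 (\<lambda>i j k. \<Sum>a\<in>UNIV. \<Sum>b\<in>UNIV. \<Sum>e\<in>UNIV. J a i * J b j * J e k * P a b e) v v' v'' =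
     eval3 P (push J v) (push J v') (push J v'')"
  by (simp_all add: eval1_def eval2_def eval3_def pull2_def push_def sum_2 algebra_simps)

lemma momentum_eq: "momentum T z i = fibre z $ 1 * T (base z) i 1 + fibre z $ 2 * T (base z) i 2"
  by (simp add: momentum_def sum_2)

context
  fixes S \<Gamma> \<Phi> T assumes data: "smooth_data S \<Gamma> \<Phi> T"
begin

lemma open_data: "open S" and smooth_\<Gamma>_data: "smooth_fun_on S (\<lambda>x. \<Gamma> x i j k)"
  and smooth_\<Phi>_data: "smooth_fun_on S (\<lambda>x. \<Phi> x i j)" and smooth_T_data: "smooth_fun_on S (\<lambda>x. T x i j)"
  and \<Gamma>_sym_data: "x \<in> S \<Longrightarrow> \<Gamma> x i j k = \<Gamma> x j i k"
  using data unfolding smooth_data_def by blast+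

lemma differentiable_data:
  assumes "x \<in> S"
  shows "(\<lambda>x. \<Gamma> x i j k) differentiable (at x)" "(\<lambda>x. \<Phi> x i j) differentiable (at x)"
    "(\<lambda>x. T x i j) differentiable (at x)"
  by (rule smooth_fun_on_differentiable[OF _ open_data assms], rule smooth_\<Gamma>_data smooth_\<Phi>_data smooth_T_data)+

lemma differentiable_lifted_data:
  assumes "base z \<in> S"
  shows "(\<lambda>z. \<Gamma> (base z) i j k) differentiable (at z)" "(\<lambda>z. \<Phi> (base z) i j) differentiable (at z)"
    "(\<lambda>z. T (base z) i j) differentiable (at z)" "(\<lambda>z. fibre z $ l) differentiable (at z)"
  using pd_base(2)[OF differentiable_data(1)[OF assms]] pd_base(2)[OF differentiable_data(2)[OF assms]]
    pd_base(2)[OF differentiable_data(3)[OF assms]]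
    smooth_fun_on_differentiable[OF smooth_fibre open_UNIV] by auto

lemma pd_fibre_nth: "pd i (\<lambda>z. fibre z $ 1) z = (if i = 3 then 1 else 0)"
  "pd i (\<lambda>z. fibre z $ 2) z = (if i = 4 then 1 else 0)"
  by (simp_all add: fibre_nth)

lemma pd_lifted_data:
  assumes "base z \<in> S"
  shows "pd l (\<lambda>z. \<Gamma> (base z) i j k) z = (if l = 1 then pd 1 (\<lambda>x. \<Gamma> x i j k) (base z) else
      if l = 2 then pd 2 (\<lambda>x. \<Gamma> x i j k) (base z) else 0)"
    "pd l (\<lambda>z. \<Phi> (base z) i j) z = (if l = 1 then pd 1 (\<lambda>x. \<Phi> x i j) (base z) else
      if l = 2 then pd 2 (\<lambda>x. \<Phi> x i j) (base z) else 0)"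
    "pd l (\<lambda>z. T (base z) i j) z = (if l = 1 then pd 1 (\<lambda>x. T x i j) (base z) else
      if l = 2 then pd 2 (\<lambda>x. T x i j) (base z) else 0)"
  using pd_base(1)[OF differentiable_data(1)[OF assms]] pd_base(1)[OF differentiable_data(2)[OF assms]]
    pd_base(1)[OF differentiable_data(3)[OF assms]] by auto

lemmas pd_data = pd_add pd_diff pd_mult pd_fibre_nth pd_lifted_data differentiable_lifted_data

lemma pd_walker_part:
  assumes z: "base z \<in> S"
  shows "pd 3 (\<lambda>z. walker_part \<Gamma> \<Phi> T z i j) z =
      T (base z) i 1 * momentum T z j + momentum T z i * T (base z) j 1 - 2 * \<Gamma> (base z) i j 1"
    and "pd 4 (\<lambda>z. walker_part \<Gamma> \<Phi> T z i j) z =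
      T (base z) i 2 * momentum T z j + momentum T z i * T (base z) j 2 - 2 * \<Gamma> (base z) i j 2"
  unfolding walker_part_def momentum_eq sum_2 using z by (simp_all add: pd_data algebra_simps)

lemma pd_pd_walker_part:
  assumes z: "base z \<in> S"
  shows "pd l (pd 3 (\<lambda>z. walker_part \<Gamma> \<Phi> T z i j)) z = pd l (\<lambda>z.
      T (base z) i 1 * momentum T z j + momentum T z i * T (base z) j 1 - 2 * \<Gamma> (base z) i j 1) z"
    and "pd l (pd 4 (\<lambda>z. walker_part \<Gamma> \<Phi> T z i j)) z = pd l (\<lambda>z.
      T (base z) i 2 * momentum T z j + momentum T z i * T (base z) j 2 - 2 * \<Gamma> (base z) i j 2) z"
  by (rule pd_cong_open[OF open_base_vimage[OF open_data]]; use z pd_walker_part in simp)+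

text \<open>Second fibre derivatives see only \<open>T\<close>, since the metric is quadratic along
  the fibres. In a mixed derivative the contribution of \<open>T\<close> still contains a fibre
  coordinate, hence dies on the zero section.\<close>

lemma second_pd_walker_part:
  assumes z: "base z \<in> S"
  shows "pd 3 (pd 3 (\<lambda>z. walker_part \<Gamma> \<Phi> T z i j)) z = 2 * T (base z) i 1 * T (base z) j 1"
    and "pd 3 (pd 4 (\<lambda>z. walker_part \<Gamma> \<Phi> T z i j)) z = T (base z) i 1 * T (base z) j 2 + T (base z) i 2 * T (base z) j 1"
    and "pd 4 (pd 4 (\<lambda>z. walker_part \<Gamma> \<Phi> T z i j)) z = 2 * T (base z) i 2 * T (base z) j 2"
    and "fibre z = 0 \<Longrightarrow> pd 1 (pd 3 (\<lambda>z. walker_part \<Gamma> \<Phi> T z i j)) z = - 2 * pd 1 (\<lambda>x. \<Gamma> x i j 1) (base z)"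
    and "fibre z = 0 \<Longrightarrow> pd 2 (pd 3 (\<lambda>z. walker_part \<Gamma> \<Phi> T z i j)) z = - 2 * pd 2 (\<lambda>x. \<Gamma> x i j 1) (base z)"
    and "fibre z = 0 \<Longrightarrow> pd 1 (pd 4 (\<lambda>z. walker_part \<Gamma> \<Phi> T z i j)) z = - 2 * pd 1 (\<lambda>x. \<Gamma> x i j 2) (base z)"
    and "fibre z = 0 \<Longrightarrow> pd 2 (pd 4 (\<lambda>z. walker_part \<Gamma> \<Phi> T z i j)) z = - 2 * pd 2 (\<lambda>x. \<Gamma> x i j 2) (base z)"
  unfolding pd_pd_walker_part[OF z] momentum_eq using z by (simp_all add: pd_data algebra_simps)

lemma walker_ABC:
  "walker_metric.A (walker_part \<Gamma> \<Phi> T) = (\<lambda>z. walker_part \<Gamma> \<Phi> T z 1 1)"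
  "walker_metric.B (walker_part \<Gamma> \<Phi> T) = (\<lambda>z. walker_part \<Gamma> \<Phi> T z 2 2)"
  "walker_metric.C (walker_part \<Gamma> \<Phi> T) = (\<lambda>z. walker_part \<Gamma> \<Phi> T z 1 2)"
  using walker_metric.A_def walker_metric.B_def walker_metric.C_def walker_metric_deformed_extension(1)[OF data]
  by (simp_all add: fun_eq_iff)

lemma W_plus_vanishes_data:
  assumes z: "base z \<in> S"
  shows "W_plus_vanishes 1 (deformed_extension \<Gamma> \<Phi> T) z \<longleftrightarrow>
    walker_metric.sc (walker_part \<Gamma> \<Phi> T) z = 0 \<and> walker_metric.W12 (walker_part \<Gamma> \<Phi> T) z = 0 \<and>
    walker_metric.W22 (walker_part \<Gamma> \<Phi> T) z = 0"
  using walker_metric.W_plus_vanishes_iff[OF walker_metric_deformed_extension(1)[OF data], of z] z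
  unfolding walker_metric_deformed_extension(2)[OF data] by simp

lemma not_W_minus_vanishes:
  assumes z: "base z \<in> S" and T0: "T (base z) 1 2 \<noteq> 0 \<or> T (base z) 2 1 \<noteq> 0"
  shows "\<not> W_minus_vanishes 1 (deformed_extension \<Gamma> \<Phi> T) z"
proof
  assume W: "W_minus_vanishes 1 (deformed_extension \<Gamma> \<Phi> T) z"
  note w = walker_metric.W_minus_vanishes_imp[OF walker_metric_deformed_extension(1)[OF data], of z,
      unfolded walker_metric_deformed_extension(2)[OF data] walker_ABC second_pd_walker_part[OF z]]
  show False using w(1)[OF _ W] w(2)[OF _ W] z T0 by simp
qed

lemma trace_riemann:
  assumes x: "x \<in> S"
  shows "(\<Sum>k\<in>UNIV. riemann \<Gamma> x 1 2 k k) =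
    pd 1 (\<lambda>x. \<Gamma> x 1 2 1) x + pd 1 (\<lambda>x. \<Gamma> x 2 2 2) x - pd 2 (\<lambda>x. \<Gamma> x 1 1 1) x - pd 2 (\<lambda>x. \<Gamma> x 1 2 2) x"
proof -
  have "pd l (\<lambda>x. \<Gamma> x 2 1 k) x = pd l (\<lambda>x. \<Gamma> x 1 2 k) x" for l k
    by (rule pd_cong_open[OF open_data x]) (rule \<Gamma>_sym_data)
  then show ?thesis by (simp add: riemann_def sum_2 algebra_simps)
qed

text \<open>On the zero section \<open>W12\<close> is minus this trace: the products of
  \<open>\<Phi>\<close> with components of \<open>T\<close> cancel because \<open>T\<close> is
  trace-free.\<close>

lemma W_plus_vanishes_imp_trace:
  assumes z: "base z \<in> S" and f: "fibre z = 0" and W: "W_plus_vanishes 1 (deformed_extension \<Gamma> \<Phi> T) z"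
    and T0: "T (base z) 2 2 = - T (base z) 1 1"
  shows "(\<Sum>k\<in>UNIV. riemann \<Gamma> (base z) 1 2 k k) = 0"
proof -
  have "walker_metric.W12 (walker_part \<Gamma> \<Phi> T) z = 0"
    using W W_plus_vanishes_data[OF z] by blast
  then have "(\<Sum>k\<in>UNIV. riemann \<Gamma> (base z) 1 2 k k) = 0"
    unfolding walker_metric.W12_def[OF walker_metric_deformed_extension(1)[OF data]] walker_ABC
      second_pd_walker_part(1-3)[OF z] second_pd_walker_part(4-7)[OF z f] trace_riemann[OF z] T0
    by (simp add: algebra_simps)
  then show ?thesis .
qed

end

subsection \<open>Computations in adapted coordinates\<close>

lemma pd_pd_base:
  fixes f :: "real^2 \<Rightarrow> real"
  assumes S: "open S" and f: "smooth_fun_on S f" and z: "base z \<in> S"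
  shows "pd i (pd 1 (\<lambda>z. f (base z))) z = (if i = 1 then pd 1 (pd 1 f) (base z) else
      if i = 2 then pd 2 (pd 1 f) (base z) else 0)"
    and "pd i (pd 2 (\<lambda>z. f (base z))) z = (if i = 1 then pd 1 (pd 2 f) (base z) else
      if i = 2 then pd 2 (pd 2 f) (base z) else 0)"
    and "pd i (pd 3 (\<lambda>z. f (base z))) z = 0" "pd i (pd 4 (\<lambda>z. f (base z))) z = 0"
proof -
  note U = open_base_vimage[OF S]
  have zU: "z \<in> base -` S" using z by simp
  have d: "f differentiable (at (base y))" if "y \<in> base -` S" for y
    using smooth_fun_on_differentiable[OF f S] that by simp
  have d': "pd j f differentiable (at (base z))" for j
    by (rule smooth_fun_on_differentiable[OF smooth_fun_on_pd[OF f] S z])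
  have 1: "pd i (pd j (\<lambda>z. f (base z))) z = pd i (\<lambda>y. if j = 1 then pd 1 f (base y) else
      if j = 2 then pd 2 f (base y) else 0) z" for i j
    by (rule pd_cong_open[OF U zU pd_base(1)[OF d]])
  show "pd i (pd 1 (\<lambda>z. f (base z))) z = (if i = 1 then pd 1 (pd 1 f) (base z) else
      if i = 2 then pd 2 (pd 1 f) (base z) else 0)"
    "pd i (pd 2 (\<lambda>z. f (base z))) z = (if i = 1 then pd 1 (pd 2 f) (base z) else
      if i = 2 then pd 2 (pd 2 f) (base z) else 0)"
    "pd i (pd 3 (\<lambda>z. f (base z))) z = 0" "pd i (pd 4 (\<lambda>z. f (base z))) z = 0"
    unfolding 1 using pd_base(1)[OF d'] by simp_all
qed

lemma pd_pd_cong_open: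
  assumes U: "open U" and x: "x \<in> U" and eq: "\<And>y. y \<in> U \<Longrightarrow> f y = g y"
  shows "pd i (pd j f) x = pd i (pd j g) x"
  by (rule pd_cong_open[OF U x], rule pd_cong_open[OF U _ eq])

locale normal_data =
  fixes S :: "(real^2) set" and \<Gamma> :: "2 tensor3_comp" and T :: "2 tensor2_comp"
  assumes open_S: "open S" and \<Gamma>_0: "\<And>x i j k. x \<in> S \<Longrightarrow> (i, j, k) \<noteq> (1, 1, 2) \<Longrightarrow> \<Gamma> x i j k = 0"
    and T_0: "\<And>x. x \<in> S \<Longrightarrow> T x 1 1 = 0" "\<And>x. x \<in> S \<Longrightarrow> T x 1 2 = 1" "\<And>x. x \<in> S \<Longrightarrow> T x 2 1 = 0"
      "\<And>x. x \<in> S \<Longrightarrow> T x 2 2 = 0"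
begin

abbreviation "b \<equiv> (\<lambda>x. \<Gamma> x 1 1 2)"

lemma \<Gamma>_simps:
  assumes "x \<in> S"
  shows "\<Gamma> x 1 1 1 = 0" "\<Gamma> x 1 2 k = 0" "\<Gamma> x 2 j k = 0"
  by (rule \<Gamma>_0[OF assms]; simp)+

lemma pd_\<Gamma>: "x \<in> S \<Longrightarrow> (i, j, k) \<noteq> (1, 1, 2) \<Longrightarrow> pd l (\<lambda>x. \<Gamma> x i j k) x = 0"
proof -
  assume h: "x \<in> S" "(i, j, k) \<noteq> (1, 1, 2)"
  have "pd l (\<lambda>x. \<Gamma> x i j k) x = pd l (\<lambda>x. 0) x"
    by (rule pd_cong_open[OF open_S h(1)]) (rule \<Gamma>_0[OF _ h(2)])
  then show ?thesis by simp
qed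

lemma pd_\<Gamma>_simps:
  assumes "x \<in> S"
  shows "pd l (\<lambda>x. \<Gamma> x 1 1 1) x = 0" "pd l (\<lambda>x. \<Gamma> x 1 2 k) x = 0" "pd l (\<lambda>x. \<Gamma> x 2 j k) x = 0"
  by (rule pd_\<Gamma>[OF assms]; simp)+

lemma riemann_normal:
  assumes "x \<in> S"
  shows "riemann \<Gamma> x i j k l = (if k = 1 \<and> l = 2 then
    (if i = 2 \<and> j = 1 then pd 2 b x else if i = 1 \<and> j = 2 then - pd 2 b x else 0) else 0)"
  using exhaust_2[of i] exhaust_2[of j] exhaust_2[of k] exhaust_2[of l]
  by (elim disjE; simp add: riemann_def sum_2 \<Gamma>_simps[OF assms] pd_\<Gamma>_simps[OF assms])

lemma ricci_normal:
  assumes "x \<in> S"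
  shows "ricci \<Gamma> x i j = (if i = 1 \<and> j = 1 then pd 2 b x else 0)"
  using exhaust_2[of i] exhaust_2[of j]
  by (elim disjE; simp add: ricci_def sum_2 riemann_normal[OF assms])

lemma cov_deriv_02_normal:
  assumes "x \<in> S"
  shows "cov_deriv_02 \<Gamma> \<Psi> x i j k = pd k (\<lambda>y. \<Psi> y i j) x - (if k = 1 \<and> i = 1 then b x * \<Psi> x 2 j else 0)
    - (if k = 1 \<and> j = 1 then b x * \<Psi> x i 2 else 0)"
  using exhaust_2[of i] exhaust_2[of j] exhaust_2[of k]
  by (elim disjE; simp add: cov_deriv_02_def sum_2 \<Gamma>_simps[OF assms])

lemma cov_deriv_ricci_normal:
  assumes x: "x \<in> S"
  shows "cov_deriv_02 \<Gamma> (ricci \<Gamma>) x i j k = (if i = 1 \<and> j = 1 then pd k (pd 2 b) x else 0)"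
proof -
  have "pd k (\<lambda>y. ricci \<Gamma> y i j) x = pd k (\<lambda>y. if i = 1 \<and> j = 1 then pd 2 b y else 0) x"
    by (rule pd_cong_open[OF open_S x ricci_normal])
  then show ?thesis
    unfolding cov_deriv_02_normal[OF x] ricci_normal[OF x] by auto
qed

text \<open>The right-hand side of the second equation in adapted coordinates. The last term
  collects two connection corrections: \<open>- b\<close> from D^2 \<Phi>(2,2;1,1) and
  \<open>2 * b\<close> from - 2 D^2 \<Phi>(1,2;2,1).\<close>

definition "equation_defect \<Phi> x = (1/2) * (\<Phi> x 2 2 * \<Phi> x 2 2) + 2 * (\<Phi> x 2 2 * pd 2 b x)
  + pd 2 (pd 2 (\<lambda>x. \<Phi> x 1 1)) x + pd 1 (pd 1 (\<lambda>x. \<Phi> x 2 2)) x - 2 * pd 1 (pd 2 (\<lambda>x. \<Phi> x 1 2)) x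
  + b x * pd 2 (\<lambda>x. \<Phi> x 2 2) x"

lemma apply_T: "x \<in> S \<Longrightarrow> apply_11 T x X = axis 2 (X $ 1)"
  by (simp add: apply_11_def vec_eq_iff forall_2 sum_2 T_0 axis_def)

lemma second_equation_normal:
  assumes x: "x \<in> S"
  shows "(let d1 = axis 1 1; Td1 = apply_11 T x d1; D2\<Phi> = eval4 (cov_deriv2_02 \<Gamma> \<Phi> x)
     in 0 = (1/2) * (eval2 (\<Phi> x) Td1 Td1 * eval2 (\<Phi> x) Td1 Td1)
          + 2 * (eval2 (\<Phi> x) Td1 Td1 * eval2 (ricci \<Gamma> x) d1 d1)
          + D2\<Phi> d1 d1 Td1 Td1 + D2\<Phi> Td1 Td1 d1 d1 - 2 * D2\<Phi> d1 Td1 Td1 d1)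
    \<longleftrightarrow> equation_defect \<Phi> x = 0"
proof -
  have D: "pd l (\<lambda>y. cov_deriv_02 \<Gamma> \<Phi> y i j k) x = pd l (pd k (\<lambda>y. \<Phi> y i j)) x"
    if "k = 2 \<or> (i = 2 \<and> j = 2)" for i j k l
    by (rule pd_cong_open[OF open_S x]) (use that in \<open>auto simp: cov_deriv_02_normal\<close>)
  have e: "cov_deriv2_02 \<Gamma> \<Phi> x 1 1 2 2 = pd 2 (pd 2 (\<lambda>x. \<Phi> x 1 1)) x"
    "cov_deriv2_02 \<Gamma> \<Phi> x 2 2 1 1 = pd 1 (pd 1 (\<lambda>x. \<Phi> x 2 2)) x - b x * pd 2 (\<lambda>x. \<Phi> x 2 2) x"
    "cov_deriv2_02 \<Gamma> \<Phi> x 1 2 2 1 = pd 1 (pd 2 (\<lambda>x. \<Phi> x 1 2)) x - b x * pd 2 (\<lambda>x. \<Phi> x 2 2) x"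
    unfolding cov_deriv2_02_def cov_deriv_03_def
    by (simp_all add: D sum_2 \<Gamma>_simps[OF x] cov_deriv_02_normal[OF x])
  show ?thesis
    unfolding apply_T[OF x] Let_def eval2_def eval4_def sum_2 equation_defect_def
    by (simp add: axis_def e ricci_normal[OF x]) argo
qed

text \<open>The image of \<open>T\<close> is spanned by the second coordinate direction, so both
  sides are a single coefficient times the product of the first components of \<open>X\<close>,
  \<open>Y\<close>, \<open>Z\<close>.\<close>

lemma first_equation_normal:
  assumes x: "x \<in> S"
  shows "(\<forall>X Y Z. eval3 (cov_deriv_02 \<Gamma> \<Phi> x) (apply_11 T x X) (apply_11 T x Y) (apply_11 T x Z) =
     - 2 * (eval1 w (apply_11 T x Z) * eval2 (ricci \<Gamma> x) X Y))
    \<longleftrightarrow> pd 2 (\<lambda>x. \<Phi> x 2 2) x = - 2 * w 2 * pd 2 b x"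
proof -
  have e: "eval3 (cov_deriv_02 \<Gamma> \<Phi> x) (apply_11 T x X) (apply_11 T x Y) (apply_11 T x Z) =
      pd 2 (\<lambda>x. \<Phi> x 2 2) x * (X $ 1 * Y $ 1 * Z $ 1)" for X Y Z
    unfolding apply_T[OF x] eval3_def sum_2 by (simp add: axis_def cov_deriv_02_normal[OF x])
  have r: "- 2 * (eval1 w (apply_11 T x Z) * eval2 (ricci \<Gamma> x) X Y) =
      (- 2 * w 2 * pd 2 b x) * (X $ 1 * Y $ 1 * Z $ 1)" for X Y Z
    unfolding apply_T[OF x] eval1_def eval2_def sum_2 by (simp add: axis_def ricci_normal[OF x])
  have "(axis 1 1 :: real^2) $ 1 = 1" by simp
  then show ?thesis unfolding e r by (metis mult_1_right)
qed

context
  fixes \<Phi> assumes data: "smooth_data S \<Gamma> \<Phi> T"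
begin

text \<open>Here \<open>B\<close> and \<open>C\<close> are constant along the fibres and
  \<open>A\<close> is a quadratic polynomial in the last fibre coordinate. Undifferentiated,
  \<open>A\<close> is multiplied only by fibre derivatives of \<open>B\<close> and \<open>C\<close>,
  so no quadratic term survives in \<open>W22\<close>.\<close>

lemma W_normal:
  assumes z: "base z \<in> S"
  shows "walker_metric.sc (walker_part \<Gamma> \<Phi> T) z = 0"
    and "walker_metric.W12 (walker_part \<Gamma> \<Phi> T) z = 0"
    and "walker_metric.W22 (walker_part \<Gamma> \<Phi> T) z =
      fibre z $ 2 * (pd 2 (pd 2 b) (base z) + (1/2) * pd 2 (\<lambda>x. \<Phi> x 2 2) (base z)) - (1/2) * equation_defect \<Phi> (base z)"
proof -
  let ?x = "base z" and ?U = "base -` S"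
  have U: "open ?U" by (rule open_base_vimage[OF open_S])
  have zU: "z \<in> ?U" using z by simp
  define A where "A = (\<lambda>z. walker_part \<Gamma> \<Phi> T z 1 1)"
  define B where "B = (\<lambda>z. walker_part \<Gamma> \<Phi> T z 2 2)"
  define C where "C = (\<lambda>z. walker_part \<Gamma> \<Phi> T z 1 2)"
  have vals: "A y = fibre y $ 2 * fibre y $ 2 - 2 * (fibre y $ 2 * b (base y)) + \<Phi> (base y) 1 1"
    "B y = \<Phi> (base y) 2 2" "C y = \<Phi> (base y) 1 2" if "y \<in> ?U" for y
    using that by (simp_all add: A_def B_def C_def walker_part_def momentum_def sum_2 T_0 \<Gamma>_simps)
  have sb: "smooth_fun_on S b" and s\<Phi>: "smooth_fun_on S (\<lambda>x. \<Phi> x i j)" for i j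
    using data unfolding smooth_data_def by blast+
  have db: "b differentiable (at (base y))" "pd i b differentiable (at (base y))" if "y \<in> ?U" for y i
    using that smooth_fun_on_differentiable[OF sb open_S]
      smooth_fun_on_differentiable[OF smooth_fun_on_pd[OF sb] open_S] by auto
  have d\<Phi>: "(\<lambda>x. \<Phi> x i j) differentiable (at (base y))" "pd k (\<lambda>x. \<Phi> x i j) differentiable (at (base y))"
    if "y \<in> ?U" for y i j k
    using that smooth_fun_on_differentiable[OF s\<Phi> open_S]
      smooth_fun_on_differentiable[OF smooth_fun_on_pd[OF s\<Phi>] open_S] by auto
  have df: "(\<lambda>z. fibre z $ l) differentiable (at y)" for l and y :: "real^4"
    by (rule smooth_fun_on_differentiable[OF smooth_fibre open_UNIV]) simp
  have pf: "pd i (\<lambda>z. fibre z $ 2) y = (if i = 4 then 1 else 0)" for i and y :: "real^4"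
    by (simp add: fibre_nth)
  have BC: "pd i B y = (if i = 1 then pd 1 (\<lambda>x. \<Phi> x 2 2) (base y) else if i = 2 then pd 2 (\<lambda>x. \<Phi> x 2 2) (base y) else 0)"
    "pd i C y = (if i = 1 then pd 1 (\<lambda>x. \<Phi> x 1 2) (base y) else if i = 2 then pd 2 (\<lambda>x. \<Phi> x 1 2) (base y) else 0)"
    if y: "y \<in> ?U" for i y
    using pd_cong_open[OF U y vals(2), where i = i] pd_cong_open[OF U y vals(3), where i = i]
    by (simp_all add: pd_base(1)[OF d\<Phi>(1)[OF y]])
  have BC2: "pd i (pd j B) z = pd i (pd j (\<lambda>y. \<Phi> (base y) 2 2)) z"
    "pd i (pd j C) z = pd i (pd j (\<lambda>y. \<Phi> (base y) 1 2)) z" for i j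
    by (rule pd_pd_cong_open[OF U zU vals(2)], assumption, rule pd_pd_cong_open[OF U zU vals(3)])
  have A1: "pd i A y = (if i = 1 then - 2 * (fibre y $ 2 * pd 1 b (base y)) + pd 1 (\<lambda>x. \<Phi> x 1 1) (base y)
      else if i = 2 then - 2 * (fibre y $ 2 * pd 2 b (base y)) + pd 2 (\<lambda>x. \<Phi> x 1 1) (base y)
      else if i = 3 then 0 else 2 * fibre y $ 2 - 2 * b (base y))" if y: "y \<in> ?U" for i y
  proof -
    have "pd i A y = pd i (\<lambda>y. fibre y $ 2 * fibre y $ 2 - 2 * (fibre y $ 2 * b (base y)) + \<Phi> (base y) 1 1) y"
      by (rule pd_cong_open[OF U y vals(1)])
    then show ?thesis
      using exhaust_4[of i]
      by (auto simp: pd_add pd_diff pd_mult df pf pd_base[OF db(1)[OF y]] pd_base[OF d\<Phi>(1)[OF y]])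
  qed
  have A2: "pd i (pd 2 A) z = pd i (\<lambda>y. - 2 * (fibre y $ 2 * pd 2 b (base y)) + pd 2 (\<lambda>x. \<Phi> x 1 1) (base y)) z"
    "pd i (pd 3 A) z = pd i (\<lambda>y. 0) z" "pd i (pd 4 A) z = pd i (\<lambda>y. 2 * fibre y $ 2 - 2 * b (base y)) z" for i
    by (rule pd_cong_open[OF U zU]; simp add: A1)+
  have A2': "pd 2 (pd 2 A) z = - 2 * (fibre z $ 2 * pd 2 (pd 2 b) ?x) + pd 2 (pd 2 (\<lambda>x. \<Phi> x 1 1)) ?x"
    "pd i (pd 3 A) z = 0" "pd 4 (pd 4 A) z = 2" "pd 3 (pd 4 A) z = 0" "pd 2 (pd 4 A) z = - 2 * pd 2 b ?x" for i
    unfolding A2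
    by (simp_all add: pd_add pd_diff pd_mult pd_minus df pf pd_base[OF db(1)[OF zU]] pd_base[OF db(2)[OF zU]]
        pd_base[OF d\<Phi>(2)[OF zU]])
  note W = walker_metric_deformed_extension(1)[OF data]
  note fs = walker_ABC[OF data, folded A_def B_def C_def] and p2 = pd_pd_base[OF open_S s\<Phi> z]
  show "walker_metric.sc (walker_part \<Gamma> \<Phi> T) z = 0"
    unfolding walker_metric.sc_def[OF W] fs BC2 A2' by (simp add: p2)
  show "walker_metric.W12 (walker_part \<Gamma> \<Phi> T) z = 0"
    unfolding walker_metric.W12_def[OF W] fs BC2 A2' by (simp add: p2)
  show "walker_metric.W22 (walker_part \<Gamma> \<Phi> T) z =
      fibre z $ 2 * (pd 2 (pd 2 b) (base z) + (1/2) * pd 2 (\<lambda>x. \<Phi> x 2 2) (base z)) - (1/2) * equation_defect \<Phi> (base z)"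
    unfolding walker_metric.W22_def[OF W] fs BC2 A2' A1[OF zU] BC[OF zU] vals[OF zU] equation_defect_def
    by (simp add: p2 algebra_simps power2_eq_square)
qed

lemma W_plus_normal:
  assumes x: "x \<in> S"
  shows "(\<forall>z. base z = x \<longrightarrow> W_plus_vanishes 1 (deformed_extension \<Gamma> \<Phi> T) z) \<longleftrightarrow>
    pd 2 (\<lambda>x. \<Phi> x 2 2) x = - 2 * pd 2 (pd 2 b) x \<and> equation_defect \<Phi> x = 0"
proof -
  define \<alpha> where "\<alpha> = pd 2 (pd 2 b) x + (1/2) * pd 2 (\<lambda>x. \<Phi> x 2 2) x"
  have iff: "W_plus_vanishes 1 (deformed_extension \<Gamma> \<Phi> T) z \<longleftrightarrow> fibre z $ 2 * \<alpha> - (1/2) * equation_defect \<Phi> x = 0"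
    if "base z = x" for z
    using W_plus_vanishes_data[OF data, of z] W_normal[of z] x unfolding that \<alpha>_def by simp
  have "(\<forall>z. base z = x \<longrightarrow> W_plus_vanishes 1 (deformed_extension \<Gamma> \<Phi> T) z) \<longleftrightarrow> \<alpha> = 0 \<and> equation_defect \<Phi> x = 0"
  proof
    assume W: "\<forall>z. base z = x \<longrightarrow> W_plus_vanishes 1 (deformed_extension \<Gamma> \<Phi> T) z"
    let ?z = "\<lambda>q. vector [x $ 1, x $ 2, 0, q] :: real^4"
    have z: "base (?z q) = x" "fibre (?z q) $ 2 = q" for q
      by (simp_all add: base_def fibre_def vec_eq_iff forall_2)
    have "q * \<alpha> - (1/2) * equation_defect \<Phi> x = 0" for q
      using W iff[OF z(1)[of q]] z by simp
    \<comment> \<open>An affine function of the fibre coordinate is determined by its values at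
      \<open>0\<close> and \<open>1\<close>.\<close>
    from this[of 0] this[of 1] show "\<alpha> = 0 \<and> equation_defect \<Phi> x = 0" by simp
  qed (use iff in auto)
  also have "\<alpha> = 0 \<longleftrightarrow> pd 2 (\<lambda>x. \<Phi> x 2 2) x = - 2 * pd 2 (pd 2 b) x"
    unfolding \<alpha>_def by auto
  finally show ?thesis .
qed

end

end

subsection \<open>Recurrence\<close>

lemma W_vanishes_deformed_extension [simp]:
  "W_plus_vanishes (fibre_orientation (deformed_extension \<Gamma> \<Phi> T) z) g z \<longleftrightarrow> W_plus_vanishes 1 g z"
  "W_minus_vanishes (fibre_orientation (deformed_extension \<Gamma> \<Phi> T) z) g z \<longleftrightarrow> W_minus_vanishes 1 g z"
  by (simp_all add: fibre_orientation_deformed_extension)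

text \<open>In dimension two antisymmetry leaves a single summand in each of these Ricci components.
  Symmetry of the Ricci tensor is thereby the trace condition from which coordinates are
  built.\<close>

lemma trace_riemann_ricci:
  "(\<Sum>k\<in>UNIV. riemann \<Gamma> x 1 2 k k) = ricci \<Gamma> x 2 1 - ricci \<Gamma> x (1::2) 2"
  using riemann_antisym[of \<Gamma> x 1 1 1 2] riemann_antisym[of \<Gamma> x 2 1 2 2] riemann_antisym[of \<Gamma> x 1 1 2 1]
    riemann_antisym[of \<Gamma> x 2 2 1 2]
  by (simp add: ricci_def sum_2)

context parallel_surface
begin

lemma cov_deriv_ricci_transition:
  assumes c: "c \<in> A" and d: "d \<in> A" and x: "x \<in> overlap c d"
  shows "cov_deriv_02 (\<Gamma> c) (ricci (\<Gamma> c)) x i j k = (\<Sum>a\<in>UNIV. \<Sum>b\<in>UNIV. \<Sum>e\<in>UNIV.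
    jac (transition c d) x a i * jac (transition c d) x b j * jac (transition c d) x e k *
    cov_deriv_02 (\<Gamma> d) (ricci (\<Gamma> d)) (transition c d x) a b e)"
proof (rule cov_deriv_02_transition[OF c d x])
  show "smooth_fun_on (chart_image d) (\<lambda>x. ricci (\<Gamma> d) x i j)" for i j
    by (rule smooth_ricci[OF d])
  show "ricci (\<Gamma> c) y i j = pull2 (jac (transition c d) y) (ricci (\<Gamma> d) (transition c d y)) i j"
    if "y \<in> overlap c d" for y i j
    by (rule ricci_transition[OF c d that])
qed

lemma normal_data_chart:
  assumes d: "d \<in> A" and n: "normal_chart \<Gamma> T d"
  shows "normal_data (chart_image d) (\<Gamma> d) (T d)"
  using n open_chart_image[OF d] unfolding normal_chart_def by unfold_locales auto

text \<open>Everything is read off in a normal chart around the point: \<open>v\<close> is the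
  differential of its first coordinate, \<open>r\<close> the only Ricci component there, and
  \<open>w\<close> the logarithmic differential of that component.\<close>

lemma ricci_at_nonflat_point:
  assumes c: "c \<in> A" and x: "x \<in> chart_image c"
    and trace: "\<And>x. x \<in> chart_image c \<Longrightarrow> (\<Sum>k\<in>UNIV. riemann (\<Gamma> c) x 1 2 k k) = 0"
    and nonflat: "riemann (\<Gamma> c) x i0 j0 k0 l0 \<noteq> 0"
  obtains r v w k where "r \<noteq> 0" "v k \<noteq> (0::real)" "\<And>i j. ricci (\<Gamma> c) x i j = r * v i * v j"
    "\<And>i j k. cov_deriv_02 (\<Gamma> c) (ricci (\<Gamma> c)) x i j k = w k * ricci (\<Gamma> c) x i j"
proof -
  obtain p where p: "p \<in> fst c" "x = snd c p" using x by (rule chart_imageE)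
  obtain d where d: "d \<in> A" "p \<in> fst d" "normal_chart \<Gamma> T d"
  proof (rule normal_chart_exists[OF c p(1) open_chart_image[OF c] subset_refl])
    show "snd c p \<in> chart_image c" using x p by simp
    show "(\<Sum>k\<in>UNIV. riemann (\<Gamma> c) x 1 2 k k) = 0" if "x \<in> chart_image c" for x
      by (rule trace[OF that])
  qed (rule that)
  interpret n: normal_data "chart_image d" "\<Gamma> d" "T d"
    by (rule normal_data_chart[OF d(1,3)])
  have ov: "x \<in> overlap c d" unfolding p(2) by (rule overlapI[OF p(1) d(2)])
  let ?y = "transition c d x" and ?J = "jac (transition c d) x"
  have y: "?y \<in> chart_image d"
    unfolding p(2) transition_chart[OF c p(1)] by (rule chart_imageI[OF d(2)])
  define r where "r = pd 2 (\<lambda>x. \<Gamma> d x 1 1 2) ?y"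
  have r0: "r \<noteq> 0"
  proof
    assume "r = 0"
    then have "riemann (\<Gamma> d) ?y i j k l = 0" for i j k l
      unfolding n.riemann_normal[OF y] r_def by simp
    then show False using riemann_zero_transition[OF c d(1) ov] nonflat by blast
  qed
  have ric: "ricci (\<Gamma> c) x i j = r * ?J 1 i * ?J 1 j" for i j
    unfolding ricci_transition[OF c d(1) ov] pull2_def sum_2 n.ricci_normal[OF y] r_def
    by (simp add: mult_ac)
  define q where "q e = pd e (pd 2 (\<lambda>x. \<Gamma> d x 1 1 2)) ?y" for e
  define w where "w k = (\<Sum>e\<in>UNIV. ?J e k * q e) / r" for k
  have w: "w k * r = (\<Sum>e\<in>UNIV. ?J e k * q e)" for k unfolding w_def using r0 by simp
  have rec: "cov_deriv_02 (\<Gamma> c) (ricci (\<Gamma> c)) x i j k = w k * ricci (\<Gamma> c) x i j" for i j k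
  proof -
    have "cov_deriv_02 (\<Gamma> c) (ricci (\<Gamma> c)) x i j k = (\<Sum>a\<in>UNIV. \<Sum>b\<in>UNIV. \<Sum>e\<in>UNIV.
        ?J a i * ?J b j * ?J e k * (if a = 1 \<and> b = 1 then q e else 0))"
      unfolding cov_deriv_ricci_transition[OF c d(1) ov] n.cov_deriv_ricci_normal[OF y] q_def ..
    also have "\<dots> = (w k * r) * (?J 1 i * ?J 1 j)"
      unfolding w by (simp add: sum_2 algebra_simps)
    finally show ?thesis unfolding ric by (simp only: mult.assoc)
  qed
  have "\<exists>k. ?J 1 k \<noteq> 0"
  proof (rule ccontr)
    assume "\<not> ?thesis"
    then have 0: "?J 1 k = 0" for k by blast
    have "(\<Sum>i\<in>UNIV. ?J 1 i * jac (transition d c) ?y i 1) = 1"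
      using inverse_jacobian[OF c d(1) ov] unfolding inverse_matrices_def by simp
    then show False unfolding 0 by simp
  qed
  then obtain k where k: "?J 1 k \<noteq> 0" by blast
  show ?thesis by (rule that[where v = "?J 1", OF r0 k ric rec])
qed

text \<open>The recurrence equation is solved by contracting both sides with the Ricci components.
  The sums themselves depend on the chart, but the solution is unique where the Ricci tensor is
  nonzero, which yields the transformation law.\<close>

definition recurrence_one_form :: "'a chart \<Rightarrow> 2 form_comp" where
  "recurrence_one_form c x k =
     (\<Sum>i\<in>UNIV. \<Sum>j\<in>UNIV. cov_deriv_02 (\<Gamma> c) (ricci (\<Gamma> c)) x i j k * ricci (\<Gamma> c) x i j) /
     (\<Sum>i\<in>UNIV. \<Sum>j\<in>UNIV. ricci (\<Gamma> c) x i j * ricci (\<Gamma> c) x i j)"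

lemma recurrence_one_form_eqI:
  assumes "ricci (\<Gamma> c) x a b \<noteq> 0"
    and "\<And>i j. cov_deriv_02 (\<Gamma> c) (ricci (\<Gamma> c)) x i j k = w * ricci (\<Gamma> c) x i j"
  shows "(\<Sum>i\<in>UNIV. \<Sum>j\<in>UNIV. ricci (\<Gamma> c) x i j * ricci (\<Gamma> c) x i j) \<noteq> 0"
    and "recurrence_one_form c x k = w"
proof -
  have "(\<Sum>i\<in>UNIV. \<Sum>j\<in>UNIV. ricci (\<Gamma> c) x i j * ricci (\<Gamma> c) x i j) \<ge> ricci (\<Gamma> c) x a b * ricci (\<Gamma> c) x a b"
    using exhaust_2[of a] exhaust_2[of b] by (auto simp: sum_2)
  moreover have "ricci (\<Gamma> c) x a b * ricci (\<Gamma> c) x a b > 0" using assms(1) by (simp add: zero_less_mult_iff) linarith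
  ultimately show s: "(\<Sum>i\<in>UNIV. \<Sum>j\<in>UNIV. ricci (\<Gamma> c) x i j * ricci (\<Gamma> c) x i j) \<noteq> 0" by linarith
  have "(\<Sum>i\<in>UNIV. \<Sum>j\<in>UNIV. w * ricci (\<Gamma> c) x i j * ricci (\<Gamma> c) x i j) =
      w * (\<Sum>i\<in>UNIV. \<Sum>j\<in>UNIV. ricci (\<Gamma> c) x i j * ricci (\<Gamma> c) x i j)"
    by (simp add: sum_distrib_left mult.assoc)
  then show "recurrence_one_form c x k = w"
    unfolding recurrence_one_form_def assms(2) using s by simp
qed

lemma nonflat_chart:
  assumes c: "c \<in> atlas_on A (nonflat_locus A \<Gamma>)" and x: "x \<in> chart_image c"
  shows "\<exists>i j k l. riemann (\<Gamma> c) x i j k l \<noteq> 0"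
proof -
  have cA: "c \<in> A" "fst c \<subseteq> nonflat_locus A \<Gamma>" using c unfolding atlas_on_def by auto
  obtain p where p: "p \<in> fst c" "x = snd c p" using x by (rule chart_imageE)
  then obtain d i j k l where d: "d \<in> A" "p \<in> fst d" "riemann (\<Gamma> d) (snd d p) i j k l \<noteq> 0"
    using cA(2) unfolding nonflat_locus_def by blast
  show ?thesis
  proof (rule ccontr)
    assume "\<not> ?thesis"
    then have "riemann (\<Gamma> c) (transition d c (snd d p)) i j k l = 0" for i j k l
      unfolding transition_chart[OF d(1,2)] p(2)[symmetric] by blast
    then show False
      using riemann_zero_transition[OF d(1) cA(1) overlapI[OF d(2) p(1)]] d(3) by blast
  qed
qed

lemma recurrent_nonflat_locus:
  assumes trace: "\<And>c x. c \<in> A \<Longrightarrow> x \<in> chart_image c \<Longrightarrow> (\<Sum>k\<in>UNIV. riemann (\<Gamma> c) x 1 2 k k) = 0"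
  defines "N \<equiv> atlas_on A (nonflat_locus A \<Gamma>)"
  shows "recurrent N \<Gamma>" and "symmetric_ricci N \<Gamma>" and "rank_one_ricci N \<Gamma>"
proof -
  have NA: "c \<in> A" if "c \<in> N" for c using that unfolding N_def atlas_on_def by auto
  have ric: "\<exists>r v w k. r \<noteq> 0 \<and> v k \<noteq> (0::real) \<and> (\<forall>i j. ricci (\<Gamma> c) x i j = r * v i * v j) \<and>
    (\<forall>i j k. cov_deriv_02 (\<Gamma> c) (ricci (\<Gamma> c)) x i j k = w k * ricci (\<Gamma> c) x i j)"
    if c: "c \<in> N" and x: "x \<in> chart_image c" for c x
  proof -
    obtain i j k l where nf: "riemann (\<Gamma> c) x i j k l \<noteq> 0"
      using nonflat_chart[OF c[unfolded N_def] x] by blast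
    show ?thesis
    proof (rule ricci_at_nonflat_point[OF NA[OF c] x trace[OF NA[OF c]] nf])
      fix r v w k
      assume h: "r \<noteq> 0" "v k \<noteq> (0::real)" "\<And>i j. ricci (\<Gamma> c) x i j = r * v i * v j"
        "\<And>i j k. cov_deriv_02 (\<Gamma> c) (ricci (\<Gamma> c)) x i j k = w k * ricci (\<Gamma> c) x i j"
      show ?thesis
        by (rule exI[of _ r], rule exI[of _ v], rule exI[of _ w], rule exI[of _ k])
          (intro conjI allI h)
    qed
  qed
  show "symmetric_ricci N \<Gamma>"
    unfolding symmetric_ricci_def
  proof (intro ballI allI)
    fix c x and i j :: 2 assume "c \<in> N" "x \<in> chart_image c"
    then obtain r v where "\<forall>i j. ricci (\<Gamma> c) x i j = r * v i * (v j :: real)" using ric[of c x] by blast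
    then show "ricci (\<Gamma> c) x i j = ricci (\<Gamma> c) x j i" by (simp add: mult_ac)
  qed
  show "rank_one_ricci N \<Gamma>"
    unfolding rank_one_ricci_def
  proof (intro ballI)
    fix c x assume c: "c \<in> N" "x \<in> chart_image c"
    obtain r v w k where h: "r \<noteq> 0" "v k \<noteq> (0::real)" "\<forall>i j. ricci (\<Gamma> c) x i j = r * v i * v j"
      using ric[OF c] by blast
    show "rank (\<chi> i j. ricci (\<Gamma> c) x i j) = 1"
      using rank_outer_product[of r v k, OF h(1,2)] h(3) by simp
  qed
  have nz: "\<exists>a b. ricci (\<Gamma> c) x a b \<noteq> 0" if c: "c \<in> N" "x \<in> chart_image c" for c x
  proof -
    obtain r v w k where h: "r \<noteq> 0" "v k \<noteq> (0::real)" "\<forall>i j. ricci (\<Gamma> c) x i j = r * v i * v j"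
      using ric[OF c] by blast
    then show ?thesis by (intro exI[of _ k]) simp
  qed
  have rec: "cov_deriv_02 (\<Gamma> c) (ricci (\<Gamma> c)) x i j k = recurrence_one_form c x k * ricci (\<Gamma> c) x i j"
    "(\<Sum>i\<in>UNIV. \<Sum>j\<in>UNIV. ricci (\<Gamma> c) x i j * ricci (\<Gamma> c) x i j) \<noteq> 0"
    if c: "c \<in> N" "x \<in> chart_image c" for c x i j k
  proof -
    obtain w where w: "\<forall>i j k. cov_deriv_02 (\<Gamma> c) (ricci (\<Gamma> c)) x i j k = w k * ricci (\<Gamma> c) x i j"
      using ric[OF c] by blast
    obtain a b where ab: "ricci (\<Gamma> c) x a b \<noteq> 0" using nz[OF c] by blast
    note e = recurrence_one_form_eqI[OF ab, of k "w k"]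
    show "cov_deriv_02 (\<Gamma> c) (ricci (\<Gamma> c)) x i j k = recurrence_one_form c x k * ricci (\<Gamma> c) x i j"
      using e w by simp
    show "(\<Sum>i\<in>UNIV. \<Sum>j\<in>UNIV. ricci (\<Gamma> c) x i j * ricci (\<Gamma> c) x i j) \<noteq> 0"
      using e w by simp
  qed
  have "one_form N recurrence_one_form"
    unfolding one_form_def
  proof (intro conjI ballI allI)
    fix c and k :: 2 assume c: "c \<in> N"
    note cA = NA[OF c]
    show "smooth_fun_on (chart_image c) (\<lambda>x. recurrence_one_form c x k)"
      unfolding recurrence_one_form_def cov_deriv_02_def
      by (intro smooth_intros open_chart_image cA smooth_ricci smooth_\<Gamma>) (rule rec(2)[OF c])
  next
    fix c d x and k :: 2 assume c: "c \<in> N" and d: "d \<in> N" and x: "x \<in> overlap c d"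
    let ?J = "jac (transition c d) x" and ?y = "transition c d x"
    note cA = NA[OF c] and dA = NA[OF d]
    have xc: "x \<in> chart_image c" using x overlap_subset by blast
    have yd: "?y \<in> chart_image d" using transition_image[OF cA] x overlap_subset by blast
    obtain a b where ab: "ricci (\<Gamma> c) x a b \<noteq> 0" using nz[OF c xc] by blast
    show "recurrence_one_form c x k = (\<Sum>a\<in>UNIV. jacobian c d x a k * recurrence_one_form d ?y a)"
      unfolding jacobian_eq
    proof (rule recurrence_one_form_eqI(2)[OF ab])
      fix i j
      show "cov_deriv_02 (\<Gamma> c) (ricci (\<Gamma> c)) x i j k =
          (\<Sum>a\<in>UNIV. ?J a k * recurrence_one_form d ?y a) * ricci (\<Gamma> c) x i j"
        unfolding cov_deriv_ricci_transition[OF cA dA x]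
          rec(1)[OF d yd] ricci_transition[OF cA dA x] pull2_def
        by (simp add: sum_2 algebra_simps)
    qed
  qed
  then show "recurrent N \<Gamma>"
    unfolding recurrent_def recurrence_form_def using rec(1) by blast
qed

text \<open>The identity is taken as coordinate change, so that a chart is merely shrunk into
  \<open>S\<close>.\<close>

lemma restrict_chart:
  assumes S: "openin X S" and p: "p \<in> S"
  obtains c where "c \<in> atlas_on A S" "p \<in> fst c"
proof -
  have "p \<in> topspace X" using S p openin_subset by blast
  then obtain a where a: "a \<in> A" "p \<in> fst a" using charts_cover by blast
  let ?Q = "snd a ` (fst a \<inter> S)"
  have Q: "open ?Q" "?Q \<subseteq> chart_image a" "snd a p \<in> ?Q"
    using open_chart_of_openin[OF a(1), of "fst a \<inter> S"] chart_domain[OF a(1)] S p a(2)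
    by (auto simp: chart_image_def)
  have id: "smooth_map_on ?Q (\<lambda>x. x)" unfolding smooth_map_on_def by (simp add: smooth_fun_on_nth)
  have det: "jac_det (\<lambda>x. x) (snd a p) \<noteq> 0" by (simp add: jac_det_def jac_def)
  obtain c where c: "c \<in> A" "p \<in> fst c" "fst c \<subseteq> fst a" "overlap a c \<subseteq> ?Q" "snd a ` fst c = overlap a c"
  proof (rule chart_composition[OF a(1) Q(1,2) id a(2) Q(3) det])
    fix c assume "c \<in> A" "p \<in> fst c" "fst c \<subseteq> fst a" "overlap a c \<subseteq> ?Q" "snd a ` fst c = overlap a c"
    then show thesis by (rule that)
  qed
  have "fst c \<subseteq> S"
  proof
    fix q assume q: "q \<in> fst c"
    then obtain q' where q': "q' \<in> fst a \<inter> S" "snd a q = snd a q'" using c(4,5) by blast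
    then have "q = q'" using inj_chart[OF a(1)] c(3) q by (auto dest: inj_onD)
    then show "q \<in> S" using q' by blast
  qed
  with c show ?thesis by (intro that[of c]) (auto simp: atlas_on_def)
qed

section \<open>From local computations to statements on the surface\<close>

lemma not_self_dual:
  assumes ne: "topspace X \<noteq> {}" and \<Phi>: "symmetric_02_tensor A \<Phi>"
  shows "\<not> self_dual A (\<lambda>c. deformed_extension (\<Gamma> c) (\<Phi> c) (T c))"
proof
  assume sd: "self_dual A (\<lambda>c. deformed_extension (\<Gamma> c) (\<Phi> c) (T c))"
  obtain c p where c: "c \<in> A" "p \<in> fst c" using ne charts_cover by blast
  let ?x = "snd c p"
  let ?z = "vector [?x $ 1, ?x $ 2, 0, 0] :: real^4"
  have x: "?x \<in> chart_image c" by (rule chart_imageI[OF c(2)])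
  have z: "base ?z = ?x" by (simp add: base_def vec_eq_iff forall_2)
  note data = smooth_data_chart[OF c(1,1) \<Phi> tensor open_chart_image[OF c(1)] subset_refl]
  obtain m n where mn: "m \<noteq> n" "T c ?x m n \<noteq> 0" by (rule T_offdiagonal[OF c(1) x])
  then have "T c ?x 1 2 \<noteq> 0 \<or> T c ?x 2 1 \<noteq> 0" using exhaust_2[of m] exhaust_2[of n] by auto
  then have "\<not> W_minus_vanishes 1 (deformed_extension (\<Gamma> c) (\<Phi> c) (T c)) ?z"
    using not_W_minus_vanishes[OF data, of ?z] x unfolding z by blast
  moreover have "W_minus_vanishes 1 (deformed_extension (\<Gamma> c) (\<Phi> c) (T c)) ?z"
    using sd[unfolded self_dual_def W_vanishes_deformed_extension, rule_format, OF c(1), of ?z] x unfolding z by simp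
  ultimately show False by blast
qed

lemma anti_self_dual_imp_trace:
  assumes asd: "anti_self_dual A (\<lambda>c. deformed_extension (\<Gamma> c) (\<Phi> c) (T c))" and \<Phi>: "symmetric_02_tensor A \<Phi>"
    and c: "c \<in> A" and x: "x \<in> chart_image c"
  shows "(\<Sum>k\<in>UNIV. riemann (\<Gamma> c) x 1 2 k k) = 0"
proof -
  let ?z = "vector [x $ 1, x $ 2, 0, 0] :: real^4"
  have z: "base ?z = x" "fibre ?z = 0" by (simp_all add: base_def fibre_def vec_eq_iff forall_2)
  note data = smooth_data_chart[OF c c \<Phi> tensor open_chart_image[OF c] subset_refl]
  have "W_plus_vanishes 1 (deformed_extension (\<Gamma> c) (\<Phi> c) (T c)) ?z"
    using asd[unfolded anti_self_dual_def W_vanishes_deformed_extension, rule_format, OF c, of ?z] x unfolding z(1) by simp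
  from W_plus_vanishes_imp_trace[OF data _ z(2) this] show ?thesis
    using x T_algebra(1)[OF c x] unfolding z(1) by blast
qed

lemma adapted_imp_normal:
  assumes "adapted_chart \<Gamma> T c"
  shows "normal_chart \<Gamma> T c"
  unfolding normal_chart_def
proof (intro ballI conjI)
  fix x assume x: "x \<in> chart_image c"
  have G: "\<forall>i j k. (i, j, k) \<noteq> (1, 1, 2) \<longrightarrow> \<Gamma> c x i j k = 0"
    and T: "apply_11 (T c) x (axis 1 1) = axis 2 1" "apply_11 (T c) x (axis 2 1) = 0"
    using assms x unfolding adapted_chart_def by blast+
  show "\<forall>i j k. (i, j, k) \<noteq> (1, 1, 2) \<longrightarrow> \<Gamma> c x i j k = 0" by (rule G)
  show "T c x 1 1 = 0" "T c x 1 2 = 1" "T c x 2 1 = 0" "T c x 2 2 = 0"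
    using T by (simp_all add: apply_11_def vec_eq_iff forall_2 sum_2 axis_def)
qed

text \<open>Symmetry of the Ricci tensor provides a normal chart; rank one provides a point where
  its Christoffel symbol is nonzero, since otherwise the Ricci tensor would vanish there.\<close>

lemma adapted_chart_exists:
  assumes S: "openin X S" and sym: "symmetric_ricci (atlas_on A S) \<Gamma>"
    and rank: "rank_one_ricci (atlas_on A S) \<Gamma>" and p: "p \<in> S"
  obtains d where "d \<in> atlas_on A S" "p \<in> fst d" "adapted_chart \<Gamma> T d"
proof -
  obtain c where c: "c \<in> atlas_on A S" "p \<in> fst c" by (rule restrict_chart[OF S p])
  then have cA: "c \<in> A" "fst c \<subseteq> S" unfolding atlas_on_def by auto
  have trace: "(\<Sum>k\<in>UNIV. riemann (\<Gamma> c) x 1 2 k k) = 0" if x: "x \<in> chart_image c" for x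
    unfolding trace_riemann_ricci using sym c(1) x unfolding symmetric_ricci_def by simp
  obtain d where d: "d \<in> A" "p \<in> fst d" "fst d \<subseteq> fst c" "normal_chart \<Gamma> T d"
  proof (rule normal_chart_exists[OF cA(1) c(2) open_chart_image[OF cA(1)] subset_refl chart_imageI[OF c(2)]])
    show "(\<Sum>k\<in>UNIV. riemann (\<Gamma> c) x 1 2 k k) = 0" if "x \<in> chart_image c" for x
      by (rule trace[OF that])
  qed (rule that)
  have dS: "d \<in> atlas_on A S" using d cA(2) unfolding atlas_on_def by auto
  interpret n: normal_data "chart_image d" "\<Gamma> d" "T d"
    by (rule normal_data_chart[OF d(1,4)])
  have y: "snd d p \<in> chart_image d" by (rule chart_imageI[OF d(2)])
  have "\<exists>x\<in>chart_image d. \<Gamma> d x 1 1 2 \<noteq> 0"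
  proof (rule ccontr)
    assume "\<not> ?thesis"
    then have "pd 2 (\<lambda>x. \<Gamma> d x 1 1 2) (snd d p) = pd 2 (\<lambda>x. 0) (snd d p)"
      by (intro pd_cong_open[OF n.open_S y]) blast
    then have "ricci (\<Gamma> d) (snd d p) i j = 0" for i j
      unfolding n.ricci_normal[OF y] by simp
    then have "rank (\<chi> i j. ricci (\<Gamma> d) (snd d p) i j) = 0" by (simp add: rank_zero_matrix)
    then show False using rank dS y unfolding rank_one_ricci_def by force
  qed
  then have "adapted_chart \<Gamma> T d"
    unfolding adapted_chart_def using n.\<Gamma>_0 n.apply_T by (auto simp: axis_def vec_eq_iff)
  with dS d(2) show ?thesis by (rule that)
qed

text \<open>Over each base point covered by a chart of \<open>C\<close> the equivalence is local. To
  reach the other charts, the first equation is carried over as an identity of tensors,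
  anti-self-duality by the cotangent lift of the transition map.\<close>

lemma anti_self_dual_iff:
  assumes rec: "recurrence_form (atlas_on A S) \<Gamma> \<omega>" and \<Phi>: "symmetric_02_tensor (atlas_on A S) \<Phi>"
    and C: "C \<subseteq> {c \<in> atlas_on A S. adapted_chart \<Gamma> T c}" and cover: "(\<Union>c\<in>C. fst c) = S"
  shows "anti_self_dual (atlas_on A S) (\<lambda>c. deformed_extension (\<Gamma> c) (\<Phi> c) (T c)) \<longleftrightarrow>
    first_equation (atlas_on A S) \<Gamma> T \<omega> \<Phi> \<and> (\<forall>c\<in>C. second_equation \<Gamma> T \<Phi> c)"
proof -
  let ?g = "\<lambda>c. deformed_extension (\<Gamma> c) (\<Phi> c) (T c)"
  let ?FE = "\<lambda>c x. \<forall>X Y Z. eval3 (cov_deriv_02 (\<Gamma> c) (\<Phi> c) x)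
      (apply_11 (T c) x X) (apply_11 (T c) x Y) (apply_11 (T c) x Z) =
     - 2 * (eval1 (\<omega> c x) (apply_11 (T c) x Z) * eval2 (ricci (\<Gamma> c) x) X Y)"
  have CA: "c \<in> atlas_on A S" "c \<in> A" "normal_chart \<Gamma> T c" if "c \<in> C" for c
    using C that adapted_imp_normal[of c] unfolding atlas_on_def by blast+
  have local: "(\<forall>z. base z = x \<longrightarrow> W_plus_vanishes 1 (?g c) z) \<longleftrightarrow>
      ?FE c x \<and> normal_data.equation_defect (\<Gamma> c) (\<Phi> c) x = 0"
    if c: "c \<in> C" and x: "x \<in> chart_image c" for c x
  proof -
    interpret n: normal_data "chart_image c" "\<Gamma> c" "T c"
      by (rule normal_data_chart[OF CA(2,3)[OF c]])
    note data = smooth_data_chart[OF CA(2,1)[OF c] \<Phi> tensor n.open_S subset_refl]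
    have "cov_deriv_02 (\<Gamma> c) (ricci (\<Gamma> c)) x 1 1 2 = \<omega> c x 2 * ricci (\<Gamma> c) x 1 1"
      using rec CA(1)[OF c] x unfolding recurrence_form_def by blast
    \<comment> \<open>Recurrence replaces the second derivative in \<open>W_plus_normal\<close> by
      the product with the recurrence form that appears in the first equation.\<close>
    then have "pd 2 (pd 2 (\<lambda>x. \<Gamma> c x 1 1 2)) x = \<omega> c x 2 * pd 2 (\<lambda>x. \<Gamma> c x 1 1 2) x"
      unfolding n.cov_deriv_ricci_normal[OF x] n.ricci_normal[OF x] by simp
    then show ?thesis
      unfolding n.W_plus_normal[OF data x] n.first_equation_normal[OF x] by (simp add: mult.assoc)
  qed
  have second: "second_equation \<Gamma> T \<Phi> c \<longleftrightarrow> (\<forall>x\<in>chart_image c. normal_data.equation_defect (\<Gamma> c) (\<Phi> c) x = 0)"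
    if c: "c \<in> C" for c
  proof -
    interpret n: normal_data "chart_image c" "\<Gamma> c" "T c"
      by (rule normal_data_chart[OF CA(2,3)[OF c]])
    show ?thesis unfolding second_equation_def using n.second_equation_normal by blast
  qed
  have asd: "anti_self_dual (atlas_on A S) ?g \<longleftrightarrow>
      (\<forall>c\<in>atlas_on A S. \<forall>z. base z \<in> chart_image c \<longrightarrow> W_plus_vanishes 1 (?g c) z)"
    unfolding anti_self_dual_def by simp
  have cov: "\<exists>d\<in>C. x \<in> overlap c d" if c: "c \<in> atlas_on A S" and x: "x \<in> chart_image c" for c x
  proof -
    obtain p where p: "p \<in> fst c" "x = snd c p" using x by (rule chart_imageE)
    have "fst c \<subseteq> S" using c unfolding atlas_on_def by simp
    then have "p \<in> (\<Union>c\<in>C. fst c)" unfolding cover using p(1) by (rule subsetD)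
    then obtain d where d: "d \<in> C" "p \<in> fst d" by (rule UN_E)
    show ?thesis unfolding p(2) by (rule bexI[of _ d]) (rule overlapI[OF p(1) d(2)], rule d(1))
  qed
  have FE_transition: "?FE c x" if c: "c \<in> atlas_on A S" and d: "d \<in> atlas_on A S" and x: "x \<in> overlap c d"
    and FE: "?FE d (transition c d x)" for c d x
  proof -
    let ?J = "jac (transition c d) x" and ?y = "transition c d x"
    have A: "c \<in> A" "d \<in> A" using c d atlas_on_subset by blast+
    have s: "smooth_fun_on (chart_image d) (\<lambda>x. \<Phi> d x i j)" for i j
      using \<Phi> d unfolding symmetric_02_tensor_def by blast
    have tr: "\<Phi> c y i j = pull2 (jac (transition c d) y) (\<Phi> d (transition c d y)) i j" if "y \<in> overlap c d" for y i j
      by (rule symmetric_02_transition[OF \<Phi> c d that])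
    have D: "cov_deriv_02 (\<Gamma> c) (\<Phi> c) x = (\<lambda>i j k. \<Sum>a\<in>UNIV. \<Sum>b\<in>UNIV. \<Sum>e\<in>UNIV.
        ?J a i * ?J b j * ?J e k * cov_deriv_02 (\<Gamma> d) (\<Phi> d) ?y a b e)"
      by (rule ext, rule ext, rule ext, rule cov_deriv_02_transition[OF A x], rule s, rule tr)
    have R: "ricci (\<Gamma> c) x = pull2 ?J (ricci (\<Gamma> d) ?y)"
      by (intro ext ricci_transition[OF A x])
    have W: "\<omega> c x = (\<lambda>k. \<Sum>e\<in>UNIV. ?J e k * \<omega> d ?y e)"
      using rec c d x unfolding recurrence_form_def one_form_def jacobian_eq by blast
    have P: "push ?J (apply_11 (T c) x v) = apply_11 (T d) ?y (push ?J v)" for v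
    proof -
      have "push ?J (apply_11 (T c) x v) $ a = (\<Sum>i\<in>UNIV. v $ i * (\<Sum>k\<in>UNIV. T c x i k * ?J a k))" for a
        by (simp add: push_def apply_11_def sum_2 algebra_simps)
      also have "\<dots> a = apply_11 (T d) ?y (push ?J v) $ a" for a
        unfolding tensor_11_transition[OF tensor A x] by (simp add: push_def apply_11_def sum_2 algebra_simps)
      finally show ?thesis by (simp add: vec_eq_iff)
    qed
    show ?thesis unfolding D R W eval_push P using FE by blast
  qed
  show ?thesis
  proof
    assume a: "anti_self_dual (atlas_on A S) ?g"
    have loc: "?FE d y \<and> normal_data.equation_defect (\<Gamma> d) (\<Phi> d) y = 0" if d: "d \<in> C" and y: "y \<in> chart_image d" for d y
      using a[unfolded asd, rule_format, OF CA(1)[OF d]] y local[OF d y] by blast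
    have "?FE c x" if c: "c \<in> atlas_on A S" and x: "x \<in> chart_image c" for c x
    proof -
      obtain d where d: "d \<in> C" "x \<in> overlap c d" using cov[OF c x] by blast
      have cA: "c \<in> A" using c atlas_on_subset by blast
      have "transition c d x \<in> chart_image d" using transition_image[OF cA] d(2) overlap_subset by blast
      then show ?thesis using FE_transition[OF c CA(1)[OF d(1)] d(2)] loc[OF d(1)] by blast
    qed
    then show "first_equation (atlas_on A S) \<Gamma> T \<omega> \<Phi> \<and> (\<forall>c\<in>C. second_equation \<Gamma> T \<Phi> c)"
      unfolding first_equation_def using second loc by blast
  next
    assume e: "first_equation (atlas_on A S) \<Gamma> T \<omega> \<Phi> \<and> (\<forall>c\<in>C. second_equation \<Gamma> T \<Phi> c)"
    show "anti_self_dual (atlas_on A S) ?g"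
      unfolding asd
    proof (intro ballI allI impI)
      fix c z assume c: "c \<in> atlas_on A S" and z: "base z \<in> chart_image c"
      obtain d where d: "d \<in> C" "base z \<in> overlap c d" using cov[OF c z] by blast
      have A: "c \<in> A" "d \<in> A" using c CA(2)[OF d(1)] atlas_on_subset by blast+
      have y: "transition c d (base z) \<in> chart_image d"
        using transition_image[OF A(1)] d(2) overlap_subset by blast
      have "?FE d (transition c d (base z))"
        using e CA(1)[OF d(1)] y unfolding first_equation_def by blast
      moreover have "normal_data.equation_defect (\<Gamma> d) (\<Phi> d) (transition c d (base z)) = 0"
        using e second[OF d(1)] d(1) y by blast
      ultimately have "\<forall>z'. base z' = transition c d (base z) \<longrightarrow> W_plus_vanishes 1 (?g d) z'"
        using local[OF d(1) y] by blast
      then have "W_plus_vanishes 1 (?g d) (lift (transition c d) (transition d c) z)" by simp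
      then show "W_plus_vanishes 1 (?g c) z"
        by (rule coordinate_change.W_plus_lift[OF coordinate_change_transition[OF A(1) c A(2) CA(1)[OF d(1)] \<Phi> tensor] d(2)])
    qed
  qed
qed

end

theorem theorem5p1:
  fixes X :: "'a topology" and A :: "'a chart set"
    and \<Gamma> :: "'a chart \<Rightarrow> 2 tensor3_comp" and T :: "'a chart \<Rightarrow> 2 tensor2_comp"
  assumes surface: "affine_surface X A \<Gamma>" and nonempty: "topspace X \<noteq> {}"
    and T: "tensor_11 A T" "parallel_11 A \<Gamma> T" "nilpotent_11 A T" "nonzero_11 X A T"
  shows
    "(\<forall>\<Phi>. symmetric_02_tensor A \<Phi> \<longrightarrow>
        \<not> self_dual A (\<lambda>c. deformed_extension (\<Gamma> c) (\<Phi> c) (T c))) \<and>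
     (\<forall>\<Phi>. symmetric_02_tensor A \<Phi> \<longrightarrow>
        anti_self_dual A (\<lambda>c. deformed_extension (\<Gamma> c) (\<Phi> c) (T c)) \<longrightarrow>
        flat A \<Gamma> \<or>
        (let N = atlas_on A (nonflat_locus A \<Gamma>)
         in recurrent N \<Gamma> \<and> symmetric_ricci N \<Gamma> \<and> rank_one_ricci N \<Gamma>)) \<and>
     (\<forall>S. openin X S \<longrightarrow> recurrent (atlas_on A S) \<Gamma> \<longrightarrow>
        symmetric_ricci (atlas_on A S) \<Gamma> \<longrightarrow> rank_one_ricci (atlas_on A S) \<Gamma> \<longrightarrow>
        (\<forall>p\<in>S. \<exists>c\<in>atlas_on A S. p \<in> fst c \<and> adapted_chart \<Gamma> T c) \<and>
        (\<forall>\<omega> \<Phi> C. recurrence_form (atlas_on A S) \<Gamma> \<omega> \<longrightarrow>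
           symmetric_02_tensor (atlas_on A S) \<Phi> \<longrightarrow>
           C \<subseteq> {c \<in> atlas_on A S. adapted_chart \<Gamma> T c} \<longrightarrow> (\<Union>c\<in>C. fst c) = S \<longrightarrow>
           (anti_self_dual (atlas_on A S) (\<lambda>c. deformed_extension (\<Gamma> c) (\<Phi> c) (T c)) \<longleftrightarrow>
              first_equation (atlas_on A S) \<Gamma> T \<omega> \<Phi> \<and> (\<forall>c\<in>C. second_equation \<Gamma> T \<Phi> c))))"
proof -
  interpret parallel_surface X A \<Gamma> T
    using surface T by unfold_locales
  show ?thesis
  proof (intro conjI allI impI)
    fix \<Phi> assume "symmetric_02_tensor A \<Phi>"
    then show "\<not> self_dual A (\<lambda>c. deformed_extension (\<Gamma> c) (\<Phi> c) (T c))"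
      by (rule not_self_dual[OF nonempty])
  next
    fix \<Phi> assume \<Phi>: "symmetric_02_tensor A \<Phi>"
      and asd: "anti_self_dual A (\<lambda>c. deformed_extension (\<Gamma> c) (\<Phi> c) (T c))"
    note recurrent_nonflat_locus[OF anti_self_dual_imp_trace[OF asd \<Phi>]]
    then show "flat A \<Gamma> \<or> (let N = atlas_on A (nonflat_locus A \<Gamma>)
        in recurrent N \<Gamma> \<and> symmetric_ricci N \<Gamma> \<and> rank_one_ricci N \<Gamma>)"
      by (simp add: Let_def)
  next
    fix S
    assume S: "openin X S" "symmetric_ricci (atlas_on A S) \<Gamma>" "rank_one_ricci (atlas_on A S) \<Gamma>"
    show "\<forall>p\<in>S. \<exists>c\<in>atlas_on A S. p \<in> fst c \<and> adapted_chart \<Gamma> T c"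
    proof
      fix p assume "p \<in> S"
      then obtain c where "c \<in> atlas_on A S" "p \<in> fst c" "adapted_chart \<Gamma> T c"
        by (rule adapted_chart_exists[OF S])
      then show "\<exists>c\<in>atlas_on A S. p \<in> fst c \<and> adapted_chart \<Gamma> T c" by blast
    qed
  next
    fix S \<omega> \<Phi> C
    assume "recurrence_form (atlas_on A S) \<Gamma> \<omega>" "symmetric_02_tensor (atlas_on A S) \<Phi>"
      "C \<subseteq> {c \<in> atlas_on A S. adapted_chart \<Gamma> T c}" "(\<Union>c\<in>C. fst c) = S"
    then show "anti_self_dual (atlas_on A S) (\<lambda>c. deformed_extension (\<Gamma> c) (\<Phi> c) (T c)) \<longleftrightarrow>
        first_equation (atlas_on A S) \<Gamma> T \<omega> \<Phi> \<and> (\<forall>c\<in>C. second_equation \<Gamma> T \<Phi> c)"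
      by (rule anti_self_dual_iff)
  qed
qed

end
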